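(* Let $\Gamma$ be a graph with vertex set $[n]$, $n\ge 2$, let $\widehat{\Gamma}$ be its cone, and let $\mathcal{G}$ (resp. $\widehat{\mathcal{G}}$) be the set of layers of the toric arrangement of $\Gamma$ (resp. of subspaces in the intersection lattice of the hyperplane arrangement of $\widehat{\Gamma}$) whose associated partition has exactly one non-singleton block. Then the toric wonderful model $\mathcal{Y}^T(\Gamma,\mathcal{G})$ and the projective hyperplane wonderful model $\mathcal{Y}^H(\widehat{\Gamma},\widehat{\mathcal{G}})$ are isomorphic as algebraic varieties over $\mathbb{C}$.
   Context: Graphs are finite, simple, undirected, without loops, with at least two vertices; they need not be connected. Write $[n]=\{1,\dots,n\}$. Given a graph $\Gamma=(\mathcal{V},\mathcal{E})$ with $\mathcal{V}=[n]$, its cone $\widehat{\Gamma}$ is the graph with vertices $\{0,1,\dots,n\}$ and edges $\mathcal{E}\cup\{(0,j)\mid j\in[n]\}$. In what follows $v=(1,\dots,1)$, of suitable length. Partitions. For a graph $\Gamma$ on a vertex set $W$, let $\Pi(\Gamma)$ be the set of set partitions of $W$ each of whose blocks induces a connected subgraph of $\Gamma$. Toric model $\mathcal{Y}^T(\Gamma,\mathcal{G})$. Let $T=(\mathbb{C}^* )^n/(\mathbb{C}^*v)$. The toric arrangement $\mathcal{A}^T(\Gamma)$ is the set of subtori $\mathcal{K}_{ij}=\{(t_1,\dots,t_n)\in(\mathbb{C}^* )^n\mid t_it_j^{-1}=1\}/(\mathbb{C}^*v)$ for $(i,j)\in\mathcal{E}$. Its poset of layers $\mathcal{C}(\mathcal{A}^T(\Gamma))$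 is the set of connected components of intersections of elements of $\mathcal{A}^T(\Gamma)$, including $T$ as the empty intersection. Its elements correspond bijectively to the partitions $\pi\in\Pi(\Gamma)$, where $\pi$ corresponds to the layer $\{t\mid t_i=t_j \text{ whenever } i,j \text{ lie in the same block of }\pi\}/(\mathbb{C}^*v)$. Let $\mathcal{G}$ be the set of layers whose partition has exactly one non-singleton block. Let $X_\Delta$ be the smooth projective toric variety with torus $T$ whose fan $\Delta$ in $\mathbb{R}^n/\mathbb{R}v$ (with lattice $\mathbb{Z}^n/\mathbb{Z}v$, the cocharacter lattice of $T$) is the fan of Weyl chambers of type $A_{n-1}$, i.e. its maximal cones are $\{[x]\mid x_{\sigma(1)}\le x_{\sigma(2)}\le\dots\le x_{\sigma(n)}\}$ for $\sigma\in S_n$. For $G\in\mathcal{G}$ let $\overline{G}$ be its closure in $X_\Delta$. The model $\mathcal{Y}^T(\Gamma,\mathcal{G})$ is the closure of the image of the locally closed embedding $$X_\Delta\setminus\bigcup_{G\in\mathcal{G}}\overline{G}\longrightarrow\prod_{G\in\mathcal{G}}\mathrm{Bl}_{\overline{G}}X_\Delta,$$ where $\mathrm{Bl}_{\overline{G}}X_\Delta$ is the blowup of $X_\Delta$ along $\overline{G}$ (if $\mathcal{G}=\emptyset$, the model is $X_\Delta$ itself). Hyperplane model $\mathcal{Y}^H(\widehat{\Gamma},\widehat{\mathcal{G}})$. Let $V=\mathbb{C}^{n+1}/(\mathbb{C}v)$, with coordinates on $\mathbb{C}^{n+1}$ indexed by $0,1,\dots,n$. The hyperplane arrangement $\mathcal{A}^H(\widehat{\Gamma})$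 is the set of hyperplanes $H_{ij}=\{x\in\mathbb{C}^{n+1}\mid x_i=x_j\}/(\mathbb{C}v)$ for $(i,j)$ an edge of $\widehat{\Gamma}$. Its lattice $L(\mathcal{A}^H(\widehat{\Gamma}))$ is the set of all intersections of these hyperplanes (including $V$ as the empty intersection); its elements correspond bijectively to the partitions $\pi\in\Pi(\widehat{\Gamma})$ of $\{0,1,\dots,n\}$, where $\pi$ corresponds to $\{x\mid x_i=x_j\text{ whenever }i,j\text{ lie in the same block of }\pi\}/(\mathbb{C}v)$. Let $\widehat{\mathcal{G}}$ be the set of subspaces whose partition has exactly one non-singleton block. The model $\mathcal{Y}^H(\widehat{\Gamma},\widehat{\mathcal{G}})$ is the closure of the image of the locally closed embedding $$\mathbb{P}(V)\setminus\bigcup_{(i,j)}\mathbb{P}(H_{ij})\longrightarrow\mathbb{P}(V)\times\prod_{G\in\widehat{\mathcal{G}}}\mathbb{P}(V/G),$$ where the union is over the edges $(i,j)$ of $\widehat{\Gamma}$. *)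

theory Defs
  imports "HOL-Analysis.Analysis" "HOL-Library.Disjoint_Sets" "HOL-Combinatorics.Permutations"
    "Graph_Theory.Graph_Theory"
begin

section \<open>Varieties over the complex numbers as spaces with functions\<close>

text \<open>
  A (classical) variety over the complex numbers is represented by its Zariski topology together
  with its sheaf of regular functions, viewed as a sheaf of complex valued functions:
  \<open>regular X W f\<close> says that the restriction of \<open>f\<close> to the open set \<open>W\<close> is regular. Here \<open>f\<close> is a
  total HOL function and only its values on \<open>W\<close> matter. Reduced varieties over \<open>\<complex>\<close> form a full
  subcategory of such spaces, so that the isomorphisms below are the isomorphisms of varieties.
\<close>

record 'a fspace =
  zariski :: "'a topology"
  regular :: "'a set \<Rightarrow> ('a \<Rightarrow> complex) \<Rightarrow> bool"

abbreviation points :: "'a fspace \<Rightarrow> 'a set" where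
  "points X \<equiv> topspace (zariski X)"

definition morphism :: "'a fspace \<Rightarrow> 'b fspace \<Rightarrow> ('a \<Rightarrow> 'b) \<Rightarrow> bool" where
  "morphism X Y f \<longleftrightarrow>
     continuous_map (zariski X) (zariski Y) f \<and>
     (\<forall>W g. openin (zariski Y) W \<and> regular Y W g \<longrightarrow> regular X {x \<in> points X. f x \<in> W} (g \<circ> f))"

definition isomorphic_varieties :: "'a fspace \<Rightarrow> 'b fspace \<Rightarrow> bool" where
  "isomorphic_varieties X Y \<longleftrightarrow>
     (\<exists>f g. morphism X Y f \<and> morphism Y X g \<and>
        (\<forall>x\<in>points X. g (f x) = x) \<and> (\<forall>y\<in>points Y. f (g y) = y))"

inductive_set function_algebra :: "('a \<Rightarrow> complex) set \<Rightarrow> ('a \<Rightarrow> complex) set"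
  for F :: "('a \<Rightarrow> complex) set" where
  const: "(\<lambda>_. c) \<in> function_algebra F"
| gen: "f \<in> F \<Longrightarrow> f \<in> function_algebra F"
| add: "f \<in> function_algebra F \<Longrightarrow> g \<in> function_algebra F \<Longrightarrow> (\<lambda>x. f x + g x) \<in> function_algebra F"
| mult: "f \<in> function_algebra F \<Longrightarrow> g \<in> function_algebra F \<Longrightarrow> (\<lambda>x. f x * g x) \<in> function_algebra F"

text \<open>
  The space glued from charts \<open>(U, F)\<close>, where \<open>F\<close> generates an algebra of functions on \<open>U\<close> (for an
  affine chart, its coordinate ring): the principal open subsets of the charts generate the
  topology, and regular functions are locally quotients of elements of the chart algebras.
\<close>

definition fspace_of_charts :: "('a set \<times> ('a \<Rightarrow> complex) set) set \<Rightarrow> 'a fspace" where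
  "fspace_of_charts C = \<lparr>
     zariski = topology_generated_by
       {{x \<in> U. b x \<noteq> 0} | U F b. (U, F) \<in> C \<and> b \<in> function_algebra F},
     regular = (\<lambda>W g. \<forall>x\<in>W. \<exists>(U, F)\<in>C. \<exists>a\<in>function_algebra F. \<exists>b\<in>function_algebra F.
       x \<in> U \<and> b x \<noteq> 0 \<and> (\<forall>y\<in>U \<inter> W. b y \<noteq> 0 \<longrightarrow> g y = a y / b y)) \<rparr>"

text \<open>For \<open>S\<close> closed, this is the reduced closed subvariety with underlying set \<open>S\<close>.\<close>

definition subvariety :: "'a fspace \<Rightarrow> 'a set \<Rightarrow> 'a fspace" where
  "subvariety X S = \<lparr>
     zariski = subtopology (zariski X) S,
     regular = (\<lambda>W g. \<forall>x\<in>W. \<exists>V h. openin (zariski X) V \<and> x \<in> V \<and> regular X V h \<and>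
       (\<forall>y\<in>V \<inter> W. g y = h y)) \<rparr>"

text \<open>
  The product of varieties. Its topology is finer than the product of the Zariski topologies: the
  functions on a box are generated by the pullbacks of the regular functions on its sides.
\<close>

definition variety_product :: "'i set \<Rightarrow> ('i \<Rightarrow> 'a fspace) \<Rightarrow> ('i \<Rightarrow> 'a) fspace" where
  "variety_product I X = fspace_of_charts
     {(Pi\<^sub>E I W, {\<lambda>p. g (p i) | i g. i \<in> I \<and> regular (X i) (W i) g}) | W.
       \<forall>i\<in>I. openin (zariski (X i)) (W i)}"

definition transport :: "('a \<Rightarrow> 'b) \<Rightarrow> 'a fspace \<Rightarrow> 'b fspace" where
  "transport h X = \<lparr>
     zariski = pullback_topology (h ` points X) (inv_into (points X) h) (zariski X),
     regular = (\<lambda>W g. regular X {x \<in> points X. h x \<in> W} (g \<circ> h)) \<rparr>"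


section \<open>Blowups\<close>

definition ideal_sections :: "'a fspace \<Rightarrow> 'a set \<Rightarrow> 'a set \<Rightarrow> ('a \<Rightarrow> complex) set" where
  "ideal_sections X Z W = {f. regular X W f \<and> (\<forall>z\<in>W \<inter> Z. f z = 0)}"

definition ideal_at :: "'a fspace \<Rightarrow> 'a set \<Rightarrow> 'a \<Rightarrow> ('a \<Rightarrow> complex) set" where
  "ideal_at X Z x = {f. \<exists>W. openin (zariski X) W \<and> x \<in> W \<and> f \<in> ideal_sections X Z W}"

definition scalar_class :: "('b \<Rightarrow> complex) \<Rightarrow> ('b \<Rightarrow> complex) set" where
  "scalar_class \<phi> = {\<lambda>f. c * \<phi> f | c. c \<noteq> 0}"

text \<open>
  The blowup of \<open>X\<close> along a closed set \<open>Z\<close> is the closure of the graph of the map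
  \<open>x \<mapsto> [f\<^sub>0 x : \<dots> : f\<^sub>k x]\<close> on the complement of \<open>Z\<close>, where \<open>f\<^sub>0, \<dots>, f\<^sub>k\<close> are local generators of
  the ideal sheaf of \<open>Z\<close>. To avoid choosing generators, all local sections of the ideal sheaf are
  used as homogeneous coordinates: a point of the blowup over \<open>x\<close> is a nonzero function \<open>\<phi>\<close> on
  these sections, up to scaling, such that every equation on an open \<open>W \<ni> x\<close> which is homogeneous
  in finitely many sections over \<open>W\<close>, with regular coefficients, and which holds on the graph over
  \<open>W - Z\<close>, also holds at \<open>(x, \<phi>)\<close>. In particular \<open>\<phi>\<close> is linear over the local ring at \<open>x\<close> and
  depends on germs only, hence it is determined by its values on local generators.
\<close>

definition blowup_fibre :: "'a fspace \<Rightarrow> 'a set \<Rightarrow> 'a \<Rightarrow> (('a \<Rightarrow> complex) \<Rightarrow> complex) set" where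
  "blowup_fibre X Z x = {\<phi>.
     (\<exists>f\<in>ideal_at X Z x. \<phi> f \<noteq> 0) \<and>
     (\<forall>f. f \<notin> ideal_at X Z x \<longrightarrow> \<phi> f = 0) \<and>
     (\<forall>W N d (a :: nat \<Rightarrow> 'a \<Rightarrow> complex) (f :: nat \<Rightarrow> nat \<Rightarrow> 'a \<Rightarrow> complex).
        openin (zariski X) W \<and> x \<in> W \<and>
        (\<forall>j<N. regular X W (a j)) \<and>
        (\<forall>j<N. \<forall>i<d. f j i \<in> ideal_sections X Z W) \<and>
        (\<forall>y\<in>W - Z. (\<Sum>j<N. a j y * (\<Prod>i<d. f j i y)) = 0)
        \<longrightarrow> (\<Sum>j<N. a j x * (\<Prod>i<d. \<phi> (f j i))) = 0)}"

type_synonym 'a blowup_point = "'a \<times> (('a \<Rightarrow> complex) \<Rightarrow> complex) set"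

text \<open>
  The charts are the open sets \<open>f \<noteq> 0\<close> for a section \<open>f\<close> of the ideal sheaf over an open set \<open>W\<close>,
  with the regular functions on \<open>W\<close> and the quotients \<open>h / f\<close> of sections as generators.
\<close>

definition blowup :: "'a fspace \<Rightarrow> 'a set \<Rightarrow> 'a blowup_point fspace" where
  "blowup X Z = fspace_of_charts
     {({(x, scalar_class \<phi>) | x \<phi>. x \<in> W \<and> \<phi> \<in> blowup_fibre X Z x \<and> \<phi> f \<noteq> 0},
       {\<lambda>p. a (fst p) | a. regular X W a} \<union>
       {\<lambda>p. (let \<phi> = (SOME \<phi>. \<phi> \<in> snd p) in \<phi> h / \<phi> f) | h. h \<in> ideal_sections X Z W})
      | W f. openin (zariski X) W \<and> f \<in> ideal_sections X Z W}"

text \<open>The inverse of the blowdown map over the complement of the centre.\<close>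

definition blowup_lift :: "'a fspace \<Rightarrow> 'a set \<Rightarrow> 'a \<Rightarrow> 'a blowup_point" where
  "blowup_lift X Z x = (x, scalar_class (\<lambda>f. if f \<in> ideal_at X Z x then f x else 0))"


section \<open>Graphs and partitions\<close>

definition graph_cone :: "nat pair_pre_digraph \<Rightarrow> nat pair_pre_digraph" where
  "graph_cone \<Gamma> = \<lparr> pverts = insert 0 (pverts \<Gamma>),
     parcs = parcs \<Gamma> \<union> {0} \<times> pverts \<Gamma> \<union> pverts \<Gamma> \<times> {0} \<rparr>"

definition connected_partitions :: "nat pair_pre_digraph \<Rightarrow> nat set set set" where
  "connected_partitions \<Gamma> = {\<pi>. partition_on (pverts \<Gamma>) \<pi> \<and>
     (\<forall>B\<in>\<pi>. Digraph_Component.connected (with_proj \<Gamma> \<restriction> B))}"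

definition one_nonsingleton_block :: "'v set set \<Rightarrow> bool" where
  "one_nonsingleton_block \<pi> \<longleftrightarrow> (\<exists>!B. B \<in> \<pi> \<and> \<not> is_singleton B)"

definition constant_on_blocks :: "'v set set \<Rightarrow> ('v \<Rightarrow> 'b) \<Rightarrow> bool" where
  "constant_on_blocks \<pi> x \<longleftrightarrow> (\<forall>B\<in>\<pi>. \<forall>i\<in>B. \<forall>j\<in>B. x i = x j)"


section \<open>The toric variety of a fan\<close>

text \<open>
  Tuples indexed by \<open>{1..n}\<close> are functions on \<open>nat\<close> that vanish outside of \<open>{1..n}\<close>. The lattice of
  the fan is \<open>\<int>\<^sup>n / \<int>v\<close>, so its dual lattice consists of the integer vectors with coordinate sum
  \<open>0\<close>. A cone in \<open>\<real>\<^sup>n / \<real>v\<close> is represented by its preimage in \<open>\<real>\<^sup>n\<close>; in particular the zero cone is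
  represented by the line \<open>\<real>v\<close>.
\<close>

definition character_lattice :: "nat \<Rightarrow> (nat \<Rightarrow> int) set" where
  "character_lattice n = {m. (\<forall>i. i \<notin> {1..n} \<longrightarrow> m i = 0) \<and> (\<Sum>i=1..n. m i) = 0}"

definition dual_cone :: "nat \<Rightarrow> (nat \<Rightarrow> real) set \<Rightarrow> (nat \<Rightarrow> real) set" where
  "dual_cone n \<sigma> = {u. (\<forall>i. i \<notin> {1..n} \<longrightarrow> u i = 0) \<and> (\<Sum>i=1..n. u i) = 0 \<and>
     (\<forall>x\<in>\<sigma>. 0 \<le> (\<Sum>i=1..n. u i * x i))}"

definition dual_monoid :: "nat \<Rightarrow> (nat \<Rightarrow> real) set \<Rightarrow> (nat \<Rightarrow> int) set" where
  "dual_monoid n \<sigma> = {m \<in> character_lattice n. (\<lambda>i. real_of_int (m i)) \<in> dual_cone n \<sigma>}"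

text \<open>
  The points of the affine toric variety of \<open>\<sigma>\<close> are the monoid homomorphisms from the dual monoid
  to the multiplicative monoid of \<open>\<complex>\<close>; the value \<open>0\<close> outside of the monoid is a normalisation.
\<close>

definition affine_toric :: "nat \<Rightarrow> (nat \<Rightarrow> real) set \<Rightarrow> ((nat \<Rightarrow> int) \<Rightarrow> complex) set" where
  "affine_toric n \<sigma> = {\<phi>. \<phi> (\<lambda>_. 0) = 1 \<and>
     (\<forall>m\<in>dual_monoid n \<sigma>. \<forall>m'\<in>dual_monoid n \<sigma>. \<phi> (\<lambda>i. m i + m' i) = \<phi> m * \<phi> m') \<and>
     (\<forall>m. m \<notin> dual_monoid n \<sigma> \<longrightarrow> \<phi> m = 0)}"

type_synonym toric_point = "((nat \<Rightarrow> real) set \<times> ((nat \<Rightarrow> int) \<Rightarrow> complex)) set"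

text \<open>
  A point of the toric variety is the class of all its representatives in the affine charts: points
  of the charts of \<open>\<sigma>\<close> and \<open>\<sigma>'\<close> are glued if they come from one point of the chart of \<open>\<sigma> \<inter> \<sigma>'\<close>.
\<close>

definition toric_class ::
  "nat \<Rightarrow> (nat \<Rightarrow> real) set set \<Rightarrow> (nat \<Rightarrow> real) set \<Rightarrow> ((nat \<Rightarrow> int) \<Rightarrow> complex) \<Rightarrow> toric_point" where
  "toric_class n \<Delta> \<sigma> \<phi> = {(\<sigma>', \<phi>'). \<sigma>' \<in> \<Delta> \<and> \<phi>' \<in> affine_toric n \<sigma>' \<and>
     (\<exists>\<psi>\<in>affine_toric n (\<sigma> \<inter> \<sigma>').
        (\<forall>m\<in>dual_monoid n \<sigma>. \<psi> m = \<phi> m) \<and> (\<forall>m\<in>dual_monoid n \<sigma>'. \<psi> m = \<phi>' m))}"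

definition toric_variety :: "nat \<Rightarrow> (nat \<Rightarrow> real) set set \<Rightarrow> toric_point fspace" where
  "toric_variety n \<Delta> = fspace_of_charts
     {(toric_class n \<Delta> \<sigma> ` affine_toric n \<sigma>,
       {\<lambda>p. (THE \<phi>. (\<sigma>, \<phi>) \<in> p) m | m. m \<in> dual_monoid n \<sigma>}) | \<sigma>. \<sigma> \<in> \<Delta>}"

definition weyl_chambers :: "nat \<Rightarrow> (nat \<Rightarrow> real) set set" where
  "weyl_chambers n = {{x. (\<forall>i. i \<notin> {1..n} \<longrightarrow> x i = 0) \<and> (\<forall>k. 1 \<le> k \<and> k < n \<longrightarrow> x (s k) \<le> x (s (Suc k)))}
     | s. s permutes {1..n}}"

text \<open>The faces of a cone \<open>\<sigma>\<close> are the sets \<open>\<sigma> \<inter> u\<^sup>\<bottom>\<close> with \<open>u\<close> in the dual cone.\<close>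

definition weyl_fan :: "nat \<Rightarrow> (nat \<Rightarrow> real) set set" where
  "weyl_fan n = {{x \<in> \<sigma>. (\<Sum>i=1..n. u i * x i) = 0} | \<sigma> u. \<sigma> \<in> weyl_chambers n \<and> u \<in> dual_cone n \<sigma>}"

definition weyl_toric_variety :: "nat \<Rightarrow> toric_point fspace" where
  "weyl_toric_variety n = toric_variety n (weyl_fan n)"


section \<open>The toric arrangement and its model\<close>

definition torus_cover :: "nat \<Rightarrow> (nat \<Rightarrow> complex) set" where
  "torus_cover n = {t. \<forall>i. t i \<noteq> 0 \<longleftrightarrow> i \<in> {1..n}}"

text \<open>The class of a tuple in \<open>T = (\<complex>\<^sup>*)\<^sup>n / \<complex>\<^sup>*v\<close> is \<^const>\<open>scalar_class\<close>.\<close>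

definition torus_character :: "nat \<Rightarrow> (nat \<Rightarrow> int) \<Rightarrow> (nat \<Rightarrow> complex) set \<Rightarrow> complex" where
  "torus_character n m p = (let t = (SOME t. t \<in> p) in \<Prod>i=1..n. t i powi m i)"

definition torus :: "nat \<Rightarrow> (nat \<Rightarrow> complex) set fspace" where
  "torus n = fspace_of_charts
     {(scalar_class ` torus_cover n, torus_character n ` character_lattice n)}"

definition toric_arrangement :: "nat \<Rightarrow> nat pair_pre_digraph \<Rightarrow> (nat \<Rightarrow> complex) set set set" where
  "toric_arrangement n \<Gamma> = {scalar_class ` {t \<in> torus_cover n. t i = t j} | i j. (i, j) \<in> parcs \<Gamma>}"

definition toric_layers :: "nat \<Rightarrow> nat pair_pre_digraph \<Rightarrow> (nat \<Rightarrow> complex) set set set" where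
  "toric_layers n \<Gamma> = (\<Union>S\<in>Pow (toric_arrangement n \<Gamma>).
     connected_components_of (subtopology (zariski (torus n)) (points (torus n) \<inter> \<Inter>S)))"

definition partition_layer :: "nat \<Rightarrow> nat set set \<Rightarrow> (nat \<Rightarrow> complex) set set" where
  "partition_layer n \<pi> = scalar_class ` {t \<in> torus_cover n. constant_on_blocks \<pi> t}"

definition toric_building_set :: "nat \<Rightarrow> nat pair_pre_digraph \<Rightarrow> (nat \<Rightarrow> complex) set set set" where
  "toric_building_set n \<Gamma> = {G \<in> toric_layers n \<Gamma>.
     \<exists>\<pi>\<in>connected_partitions \<Gamma>. one_nonsingleton_block \<pi> \<and> G = partition_layer n \<pi>}"

text \<open>The torus is embedded in the toric variety as the chart of the zero cone.\<close>

definition torus_embedding :: "nat \<Rightarrow> (nat \<Rightarrow> complex) set \<Rightarrow> toric_point" where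
  "torus_embedding n p = toric_class n (weyl_fan n) {x. \<exists>c. x = (\<lambda>i. if i \<in> {1..n} then c else 0)}
     (\<lambda>m. if m \<in> character_lattice n then torus_character n m p else 0)"

definition layer_closure :: "nat \<Rightarrow> (nat \<Rightarrow> complex) set set \<Rightarrow> toric_point set" where
  "layer_closure n G = zariski (weyl_toric_variety n) closure_of (torus_embedding n ` G)"

text \<open>
  The model lies in a product of blowups, or is the toric variety itself if the building set is
  empty; the sum type only serves to have both cases in one type.
\<close>

definition toric_model :: "nat \<Rightarrow> nat pair_pre_digraph \<Rightarrow>
    (toric_point + ((nat \<Rightarrow> complex) set set \<Rightarrow> toric_point blowup_point)) fspace" where
  "toric_model n \<Gamma> =
     (let X = weyl_toric_variety n; \<G> = toric_building_set n \<Gamma>;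
          P = variety_product \<G> (\<lambda>G. blowup X (layer_closure n G));
          embed = (\<lambda>x. \<lambda>G\<in>\<G>. blowup_lift X (layer_closure n G) x)
      in if \<G> = {} then transport Inl X
         else transport Inr (subvariety P
           (zariski P closure_of (embed ` (points X - (\<Union>G\<in>\<G>. layer_closure n G))))))"


section \<open>The hyperplane arrangement and its model\<close>

text \<open>
  Tuples indexed by \<open>{0..n}\<close> are functions that vanish outside of \<open>{0..n}\<close>, and subspaces \<open>G\<close> of
  \<open>V = \<complex>\<^sup>n\<^sup>+\<^sup>1 / \<complex>v\<close> are represented by their preimages in \<open>\<complex>\<^sup>n\<^sup>+\<^sup>1\<close>, which contain \<open>\<complex>v\<close>; so \<open>V / G\<close> is
  the quotient of \<open>\<complex>\<^sup>n\<^sup>+\<^sup>1\<close> by the preimage of \<open>G\<close>. A point of \<open>\<P>(\<complex>\<^sup>n\<^sup>+\<^sup>1 / U)\<close>, that is a line in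
  \<open>\<complex>\<^sup>n\<^sup>+\<^sup>1 / U\<close>, is likewise represented by its preimage \<open>U + \<complex>x\<close>, where \<open>x \<notin> U\<close>.
\<close>

definition coordinate_space :: "nat \<Rightarrow> (nat \<Rightarrow> complex) set" where
  "coordinate_space n = {x. \<forall>i. i \<notin> {0..n} \<longrightarrow> x i = 0}"

definition diagonal_line :: "nat \<Rightarrow> (nat \<Rightarrow> complex) set" where
  "diagonal_line n = {x. \<exists>c. x = (\<lambda>i. if i \<in> {0..n} then c else 0)}"

definition line_class :: "(nat \<Rightarrow> complex) set \<Rightarrow> (nat \<Rightarrow> complex) \<Rightarrow> (nat \<Rightarrow> complex) set" where
  "line_class U x = {\<lambda>i. u i + c * x i | u c. u \<in> U}"

definition linear_form :: "nat \<Rightarrow> (nat \<Rightarrow> complex) \<Rightarrow> (nat \<Rightarrow> complex) \<Rightarrow> complex" where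
  "linear_form n l x = (\<Sum>i=0..n. l i * x i)"

definition annihilator :: "nat \<Rightarrow> (nat \<Rightarrow> complex) set \<Rightarrow> (nat \<Rightarrow> complex) set" where
  "annihilator n U = {l \<in> coordinate_space n. \<forall>u\<in>U. linear_form n l u = 0}"

definition projective_quotient :: "nat \<Rightarrow> (nat \<Rightarrow> complex) set \<Rightarrow> (nat \<Rightarrow> complex) set fspace" where
  "projective_quotient n U = fspace_of_charts
     {({line_class U x | x. x \<in> coordinate_space n \<and> linear_form n l x \<noteq> 0},
       {\<lambda>p. (let x = (SOME x. x \<in> p \<and> linear_form n l x \<noteq> 0) in linear_form n k x / linear_form n l x)
         | k. k \<in> annihilator n U}) | l. l \<in> annihilator n U}"

definition hyperplane_arrangement :: "nat \<Rightarrow> nat pair_pre_digraph \<Rightarrow> (nat \<Rightarrow> complex) set set" where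
  "hyperplane_arrangement n \<Gamma> = {{x \<in> coordinate_space n. x i = x j} | i j. (i, j) \<in> parcs \<Gamma>}"

definition intersection_lattice :: "nat \<Rightarrow> nat pair_pre_digraph \<Rightarrow> (nat \<Rightarrow> complex) set set" where
  "intersection_lattice n \<Gamma> = {coordinate_space n \<inter> \<Inter>S | S. S \<subseteq> hyperplane_arrangement n \<Gamma>}"

definition partition_subspace :: "nat \<Rightarrow> nat set set \<Rightarrow> (nat \<Rightarrow> complex) set" where
  "partition_subspace n \<pi> = {x \<in> coordinate_space n. constant_on_blocks \<pi> x}"

definition hyperplane_building_set :: "nat \<Rightarrow> nat pair_pre_digraph \<Rightarrow> (nat \<Rightarrow> complex) set set" where
  "hyperplane_building_set n \<Gamma> = {G \<in> intersection_lattice n \<Gamma>.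
     \<exists>\<pi>\<in>connected_partitions \<Gamma>. one_nonsingleton_block \<pi> \<and> G = partition_subspace n \<pi>}"

definition projectivization :: "nat \<Rightarrow> (nat \<Rightarrow> complex) set \<Rightarrow> (nat \<Rightarrow> complex) set set" where
  "projectivization n H = line_class (diagonal_line n) ` (H - diagonal_line n)"

definition subspace_sum :: "(nat \<Rightarrow> complex) set \<Rightarrow> (nat \<Rightarrow> complex) set \<Rightarrow> (nat \<Rightarrow> complex) set" where
  "subspace_sum p G = {\<lambda>i. x i + u i | x u. x \<in> p \<and> u \<in> G}"

text \<open>
  Here \<open>\<Gamma>\<close> is a graph on \<open>{0..n}\<close>. The index \<open>None\<close> stands for the factor \<open>\<P>(V)\<close> and \<open>Some G\<close> for
  \<open>\<P>(V / G)\<close>; the projection \<open>\<P>(V) - \<P>(G) \<rightarrow> \<P>(V / G)\<close> sends the line \<open>p\<close> to \<open>p + G\<close>.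
\<close>

definition hyperplane_model ::
  "nat \<Rightarrow> nat pair_pre_digraph \<Rightarrow> ((nat \<Rightarrow> complex) set option \<Rightarrow> (nat \<Rightarrow> complex) set) fspace" where
  "hyperplane_model n \<Gamma> =
     (let PV = projective_quotient n (diagonal_line n); \<G> = hyperplane_building_set n \<Gamma>;
          I = insert None (Some ` \<G>);
          P = variety_product I
            (\<lambda>k. case k of None \<Rightarrow> PV | Some G \<Rightarrow> projective_quotient n G);
          embed = (\<lambda>p. \<lambda>k\<in>I. case k of None \<Rightarrow> p | Some G \<Rightarrow> subspace_sum p G)
      in subvariety P (zariski P closure_of
           (embed ` (points PV - (\<Union>H\<in>hyperplane_arrangement n \<Gamma>. projectivization n H)))))"

end

theory Submission
  imports Defs "HOL-Complex_Analysis.Conformal_Mappings"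
begin

text \<open>
  The complement of the cone arrangement in \<open>\<P>(V)\<close> and that of the toric arrangement in \<open>T\<close> are the
  same variety \<open>D\<close> of classes of tuples \<open>(0, t\<^sub>1, \<dots>, t\<^sub>n)\<close>, and both
  models contain it as a dense subset. Both are terminal among the spaces that contain \<open>D\<close> as a dense subset and in which, for every connected block
  \<open>B\<close> of the cone, some difference \<open>t\<^sub>i - t\<^sub>j\<close> with \<open>i, j \<in> B\<close> locally divides all the others. For the
  hyperplane model this is the universal property of the projective spaces \<open>\<P>(V / G)\<close>. For the toric
  model, the blocks \<open>{0, i, j}\<close> say that one of \<open>t\<^sub>i / t\<^sub>j\<close> and \<open>t\<^sub>j / t\<^sub>i\<close> is regular, which is what is
  needed for a map to the toric variety of the Weyl chambers, and the blocks without \<open>0\<close> give the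
  lifts to the blowups, because the ideal of the closure of a layer is generated near
  a point by the functions \<open>t\<^sub>k / t\<^sub>b - 1\<close> for a suitable \<open>b \<in> B\<close>.
\<close>

section \<open>Spaces glued from charts\<close>

text \<open>A regular function is determined by its values on a dense set. So every local condition
  is phrased as the extendability of an explicit expression on \<open>D\<close>, without function
  fields or irreducibility. Maps into a model are built from such extensions, and two maps that
  agree on \<open>D\<close> agree everywhere because their coordinates extend the same expressions.
  Terminality then yields mutually inverse morphisms without comparing charts.

  The delicate side is the blowup: it is encoded by all sections vanishing on the closure of a
  layer, so true generators of that ideal are required, also at boundary points of the toric
  variety. Where all t_k with k in B tend to the boundary at the same rate, replacing them by t_b
  acts on regular functions; a function minus its image lies in the ideal of the equations, and the
  image is zero if the function vanishes on the layer. Elsewhere one equation is a unit.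

  HOL cannot quantify over types inside a formula, so terminality is a polymorphic existence
  statement, instantiated at the type of the other model, together with uniqueness for
  endomorphisms.\<close>

definition local_fraction :: "'a set \<Rightarrow> ('a \<Rightarrow> complex) set \<Rightarrow> 'a \<Rightarrow> ('a \<Rightarrow> complex) \<Rightarrow> bool" where
  "local_fraction U F x g \<longleftrightarrow> (\<exists>a\<in>function_algebra F. \<exists>b\<in>function_algebra F.
     b x \<noteq> 0 \<and> (\<forall>y\<in>U. b y \<noteq> 0 \<longrightarrow> g y = a y / b y))"

lemma local_fractionI:
  assumes "a \<in> function_algebra F" "b \<in> function_algebra F" "b x \<noteq> 0"
    "\<And>y. y \<in> U \<Longrightarrow> b y \<noteq> 0 \<Longrightarrow> g y = a y / b y"
  shows "local_fraction U F x g"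
  using assms unfolding local_fraction_def by blast

lemma local_fraction_algebra:
  assumes "g \<in> function_algebra F" shows "local_fraction U F x g"
  by (rule local_fractionI[OF assms function_algebra.const[of 1]]) auto

lemma local_fraction_add:
  assumes "local_fraction U F x g" "local_fraction U F x h"
  shows "local_fraction U F x (\<lambda>y. g y + h y)"
proof -
  obtain a b where 1: "a \<in> function_algebra F" "b \<in> function_algebra F" "b x \<noteq> 0"
    "\<And>y. y \<in> U \<Longrightarrow> b y \<noteq> 0 \<Longrightarrow> g y = a y / b y" using assms(1) unfolding local_fraction_def by blast
  obtain a' b' where 2: "a' \<in> function_algebra F" "b' \<in> function_algebra F" "b' x \<noteq> 0"
    "\<And>y. y \<in> U \<Longrightarrow> b' y \<noteq> 0 \<Longrightarrow> h y = a' y / b' y" using assms(2) unfolding local_fraction_def by blast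
  show ?thesis
  proof (rule local_fractionI)
    show "(\<lambda>y. a y * b' y + a' y * b y) \<in> function_algebra F"
      by (intro function_algebra.add function_algebra.mult 1 2)
    show "(\<lambda>y. b y * b' y) \<in> function_algebra F" by (intro function_algebra.mult 1 2)
  qed (use 1 2 in \<open>auto simp: field_simps\<close>)
qed

lemma local_fraction_mult:
  assumes "local_fraction U F x g" "local_fraction U F x h"
  shows "local_fraction U F x (\<lambda>y. g y * h y)"
proof -
  obtain a b where 1: "a \<in> function_algebra F" "b \<in> function_algebra F" "b x \<noteq> 0"
    "\<And>y. y \<in> U \<Longrightarrow> b y \<noteq> 0 \<Longrightarrow> g y = a y / b y" using assms(1) unfolding local_fraction_def by blast
  obtain a' b' where 2: "a' \<in> function_algebra F" "b' \<in> function_algebra F" "b' x \<noteq> 0"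
    "\<And>y. y \<in> U \<Longrightarrow> b' y \<noteq> 0 \<Longrightarrow> h y = a' y / b' y" using assms(2) unfolding local_fraction_def by blast
  show ?thesis
  proof (rule local_fractionI)
    show "(\<lambda>y. a y * a' y) \<in> function_algebra F" by (intro function_algebra.mult 1 2)
    show "(\<lambda>y. b y * b' y) \<in> function_algebra F" by (intro function_algebra.mult 1 2)
  qed (use 1 2 in auto)
qed

text \<open>Some principal open neighbourhood of \<open>x\<close> in the chart \<open>(V, G)\<close> lies in \<open>U\<close>, and the functions in
  \<open>F\<close> are regular on it. In a directed atlas a regular function is thus a single quotient on a
  principal neighbourhood, inside one chart.\<close>

definition dominated :: "'a set \<Rightarrow> ('a \<Rightarrow> complex) set \<Rightarrow> 'a set \<Rightarrow> ('a \<Rightarrow> complex) set \<Rightarrow> 'a \<Rightarrow> bool" where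
  "dominated U F V G x \<longleftrightarrow> x \<in> V \<and>
     (\<exists>b\<in>function_algebra G. b x \<noteq> 0 \<and> (\<forall>y\<in>V. b y \<noteq> 0 \<longrightarrow> y \<in> U)) \<and>
     (\<forall>g\<in>F. local_fraction V G x g)"

definition directed_atlas :: "('a set \<times> ('a \<Rightarrow> complex) set) set \<Rightarrow> bool" where
  "directed_atlas C \<longleftrightarrow> (\<forall>U F U' F' x. (U, F) \<in> C \<and> (U', F') \<in> C \<and> x \<in> U \<and> x \<in> U' \<longrightarrow>
     (\<exists>V G. (V, G) \<in> C \<and> dominated U F V G x \<and> dominated U' F' V G x))"

lemma dominated_algebra:
  assumes "dominated U F V G x" "g \<in> function_algebra F"
  shows "local_fraction V G x g"
  using assms(2)
proof induction
  case (const c)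
  show ?case by (rule local_fraction_algebra) (rule function_algebra.const)
next
  case (gen f)
  then show ?case using assms(1) unfolding dominated_def by blast
qed (auto intro: local_fraction_add local_fraction_mult)

text \<open>One principal open set witnesses both that \<open>W\<close> is a neighbourhood of
  \<open>x\<close> and that \<open>g\<close> is a quotient there, so a change of chart has to be
  done only once for the two facts.\<close>

definition chart_rep :: "'a set \<Rightarrow> ('a \<Rightarrow> complex) set \<Rightarrow> 'a set \<Rightarrow> ('a \<Rightarrow> complex) \<Rightarrow> 'a \<Rightarrow> bool" where
  "chart_rep U F W g x \<longleftrightarrow> x \<in> U \<and> (\<exists>a\<in>function_algebra F. \<exists>b\<in>function_algebra F. b x \<noteq> 0 \<and>
     (\<forall>y\<in>U. b y \<noteq> 0 \<longrightarrow> y \<in> W \<and> g y = a y / b y))"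

lemma chart_rep_dominated:
  assumes "chart_rep U F W g x" "dominated U F V G x"
  shows "chart_rep V G W g x"
proof -
  obtain a b where ab: "a \<in> function_algebra F" "b \<in> function_algebra F" "b x \<noteq> 0"
    "\<And>y. y \<in> U \<Longrightarrow> b y \<noteq> 0 \<Longrightarrow> y \<in> W \<and> g y = a y / b y" "x \<in> U"
    using assms(1) unfolding chart_rep_def by blast
  obtain c where c: "c \<in> function_algebra G" "c x \<noteq> 0" "\<And>y. y \<in> V \<Longrightarrow> c y \<noteq> 0 \<Longrightarrow> y \<in> U" "x \<in> V"
    using assms(2) unfolding dominated_def by blast
  obtain p q where pq: "p \<in> function_algebra G" "q \<in> function_algebra G" "q x \<noteq> 0"
    "\<And>y. y \<in> V \<Longrightarrow> q y \<noteq> 0 \<Longrightarrow> a y = p y / q y"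
    using dominated_algebra[OF assms(2) ab(1)] unfolding local_fraction_def by blast
  obtain r s where rs: "r \<in> function_algebra G" "s \<in> function_algebra G" "s x \<noteq> 0"
    "\<And>y. y \<in> V \<Longrightarrow> s y \<noteq> 0 \<Longrightarrow> b y = r y / s y"
    using dominated_algebra[OF assms(2) ab(2)] unfolding local_fraction_def by blast
  have rx: "r x \<noteq> 0" using rs(3) rs(4)[of x] c(4) ab(3) by auto
  \<comment> \<open>Formally a / b = p s / (q r). The extra factor c s above and below makes
    nonvanishing of the new denominator imply that \<open>y\<close> lies in \<open>U\<close> and
    that both quotient formulas are valid at \<open>y\<close>.\<close>
  have "(\<lambda>y. (c y * p y) * (s y * s y)) \<in> function_algebra G"
    by (intro function_algebra.mult c pq rs)
  moreover have "(\<lambda>y. (c y * q y) * (r y * s y)) \<in> function_algebra G"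
    by (intro function_algebra.mult c pq rs)
  moreover have "(c x * q x) * (r x * s x) \<noteq> 0" using c pq rs rx by auto
  moreover have "y \<in> W \<and> g y = (c y * p y) * (s y * s y) / ((c y * q y) * (r y * s y))"
    if "y \<in> V" "(c y * q y) * (r y * s y) \<noteq> 0" for y
  proof -
    have nz: "c y \<noteq> 0" "q y \<noteq> 0" "r y \<noteq> 0" "s y \<noteq> 0" using that by auto
    have yU: "y \<in> U" using c(3) that(1) nz by auto
    have e: "a y = p y / q y" "b y = r y / s y" using pq(4) rs(4) that(1) nz by auto
    then have "b y \<noteq> 0" using nz by auto
    with ab(4)[OF yU] e nz show ?thesis by (auto simp: field_simps)
  qed
  ultimately show ?thesis using c(4) unfolding chart_rep_def
    by (intro conjI bexI[of _ "\<lambda>y. (c y * p y) * (s y * s y)"] bexI[of _ "\<lambda>y. (c y * q y) * (r y * s y)"] ballI impI) auto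
qed

lemma chart_repI:
  assumes "a \<in> function_algebra F" "b \<in> function_algebra F" "b x \<noteq> 0" "x \<in> U"
    "\<And>y. y \<in> U \<Longrightarrow> b y \<noteq> 0 \<Longrightarrow> y \<in> W" "\<And>y. y \<in> U \<Longrightarrow> b y \<noteq> 0 \<Longrightarrow> g y = a y / b y"
  shows "chart_rep U F W g x"
  unfolding chart_rep_def using assms by blast

text \<open>For the zero function \<open>chart_rep\<close> just says that \<open>S\<close> contains
  a principal neighbourhood of \<open>x\<close>; in this form neighbourhoods pass to a dominating
  chart through \<open>chart_rep_dominated\<close>.\<close>

lemma chart_rep_zero:
  assumes "b \<in> function_algebra F" "x \<in> U" "b x \<noteq> 0" "\<And>y. y \<in> U \<Longrightarrow> b y \<noteq> 0 \<Longrightarrow> y \<in> S"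
  shows "chart_rep U F S (\<lambda>_. 0) x"
  unfolding chart_rep_def
  using assms function_algebra.const[of 0 F] by (intro conjI bexI[of _ "\<lambda>_. 0"] bexI[of _ b]) auto



lemma chart_rep_add:
  assumes "chart_rep U F W g x" "chart_rep U F W h x"
  shows "chart_rep U F W (\<lambda>y. g y + h y) x"
proof -
  obtain a b where 1: "a \<in> function_algebra F" "b \<in> function_algebra F" "b x \<noteq> 0" "x \<in> U"
    "\<And>y. y \<in> U \<Longrightarrow> b y \<noteq> 0 \<Longrightarrow> y \<in> W \<and> g y = a y / b y" using assms(1) unfolding chart_rep_def by blast
  obtain a' b' where 2: "a' \<in> function_algebra F" "b' \<in> function_algebra F" "b' x \<noteq> 0"
    "\<And>y. y \<in> U \<Longrightarrow> b' y \<noteq> 0 \<Longrightarrow> y \<in> W \<and> h y = a' y / b' y" using assms(2) unfolding chart_rep_def by blast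
  have "(\<lambda>y. a y * b' y + a' y * b y) \<in> function_algebra F"
       "(\<lambda>y. b y * b' y) \<in> function_algebra F" by (intro function_algebra.add function_algebra.mult 1 2)+
  moreover have "\<forall>y\<in>U. b y * b' y \<noteq> 0 \<longrightarrow> y \<in> W \<and> g y + h y = (a y * b' y + a' y * b y) / (b y * b' y)"
    using 1(5) 2(4) by (auto simp: field_simps)
  ultimately show ?thesis using 1(3,4) 2(3) unfolding chart_rep_def
    by (intro conjI bexI[of _ "\<lambda>y. a y * b' y + a' y * b y"] bexI[of _ "\<lambda>y. b y * b' y"]) auto
qed

lemma chart_rep_mult:
  assumes "chart_rep U F W g x" "chart_rep U F W h x"
  shows "chart_rep U F W (\<lambda>y. g y * h y) x"
proof -
  obtain a b where 1: "a \<in> function_algebra F" "b \<in> function_algebra F" "b x \<noteq> 0" "x \<in> U"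
    "\<And>y. y \<in> U \<Longrightarrow> b y \<noteq> 0 \<Longrightarrow> y \<in> W \<and> g y = a y / b y" using assms(1) unfolding chart_rep_def by blast
  obtain a' b' where 2: "a' \<in> function_algebra F" "b' \<in> function_algebra F" "b' x \<noteq> 0"
    "\<And>y. y \<in> U \<Longrightarrow> b' y \<noteq> 0 \<Longrightarrow> y \<in> W \<and> h y = a' y / b' y" using assms(2) unfolding chart_rep_def by blast
  have "(\<lambda>y. a y * a' y) \<in> function_algebra F"
       "(\<lambda>y. b y * b' y) \<in> function_algebra F" by (intro function_algebra.mult 1 2)+
  moreover have "\<forall>y\<in>U. b y * b' y \<noteq> 0 \<longrightarrow> y \<in> W \<and> g y * h y = (a y * a' y) / (b y * b' y)"
    using 1(5) 2(4) by auto
  ultimately show ?thesis using 1(3,4) 2(3) unfolding chart_rep_def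
    by (intro conjI bexI[of _ "\<lambda>y. a y * a' y"] bexI[of _ "\<lambda>y. b y * b' y"]) auto
qed

lemma chart_rep_inverse:
  assumes "chart_rep U F W g x" "g x \<noteq> 0"
  shows "chart_rep U F {y \<in> W. g y \<noteq> 0} (\<lambda>y. inverse (g y)) x"
proof -
  obtain a b where 1: "a \<in> function_algebra F" "b \<in> function_algebra F" "b x \<noteq> 0" "x \<in> U"
    "\<And>y. y \<in> U \<Longrightarrow> b y \<noteq> 0 \<Longrightarrow> y \<in> W \<and> g y = a y / b y" using assms(1) unfolding chart_rep_def by blast
  \<comment> \<open>Taking \<open>b * b\<close> over \<open>a * b\<close>, and not \<open>b\<close>
    over \<open>a\<close>, makes the new denominator vanish wherever \<open>b\<close> does, where
    the formula for \<open>g\<close> is unknown.\<close>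
  have "(\<lambda>y. b y * b y) \<in> function_algebra F" "(\<lambda>y. a y * b y) \<in> function_algebra F"
    by (intro function_algebra.mult 1)+
  moreover have "a x * b x \<noteq> 0" using 1(5)[OF 1(4)] 1(3) assms(2) by auto
  moreover have "\<forall>y\<in>U. a y * b y \<noteq> 0 \<longrightarrow> y \<in> {y \<in> W. g y \<noteq> 0} \<and> inverse (g y) = (b y * b y) / (a y * b y)"
    using 1(5) by force
  ultimately show ?thesis using 1(4) unfolding chart_rep_def
    by (intro conjI bexI[of _ "\<lambda>y. b y * b y"] bexI[of _ "\<lambda>y. a y * b y"]) auto
qed

section \<open>Topology and regular functions of a directed atlas\<close>

lemma openin_charts:
  "openin (zariski (fspace_of_charts C)) S \<longleftrightarrow>
   generate_topology_on {{x \<in> U. b x \<noteq> 0} | U F b. (U, F) \<in> C \<and> b \<in> function_algebra F} S"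
  unfolding fspace_of_charts_def by (simp add: openin_topology_generated_by_iff)

lemma openin_chart_principal:
  assumes "(U, F) \<in> C" "b \<in> function_algebra F"
  shows "openin (zariski (fspace_of_charts C)) {x \<in> U. b x \<noteq> 0}"
  unfolding openin_charts by (rule generate_topology_on.Basis) (use assms in blast)

lemma openin_chart:
  assumes "(U, F) \<in> C"
  shows "openin (zariski (fspace_of_charts C)) U"
  using openin_chart_principal[OF assms function_algebra.const[of 1]] by simp

lemma points_charts: "points (fspace_of_charts C) = \<Union>(fst ` C)"
proof
  show "\<Union>(fst ` C) \<subseteq> points (fspace_of_charts C)"
  proof
    fix x assume "x \<in> \<Union>(fst ` C)"
    then obtain U F where "(U, F) \<in> C" "x \<in> U" by auto
    then show "x \<in> points (fspace_of_charts C)" using openin_subset[OF openin_chart] by blast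
  qed
  show "points (fspace_of_charts C) \<subseteq> \<Union>(fst ` C)"
  proof
    fix x assume "x \<in> points (fspace_of_charts C)"
    then obtain U F where "(U, F) \<in> C" "x \<in> U" unfolding fspace_of_charts_def by auto
    then show "x \<in> \<Union>(fst ` C)" by force
  qed
qed

text \<open>The principal open sets are declared only as a subbase. Directedness makes them a base:
  around a point of an intersection both sets are rewritten in a common dominating chart, where the
  product of the two denominators cuts out a smaller principal set.\<close>

lemma chart_base:
  assumes "directed_atlas C" "openin (zariski (fspace_of_charts C)) S" "x \<in> S"
  shows "\<exists>U F b. (U, F) \<in> C \<and> b \<in> function_algebra F \<and> x \<in> U \<and> b x \<noteq> 0 \<and> (\<forall>y\<in>U. b y \<noteq> 0 \<longrightarrow> y \<in> S)"
  using assms(2)[unfolded openin_charts] assms(3)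
proof (induction rule: generate_topology_on.induct)
  case (Int S T)
  then obtain U F b U' F' b' where 1: "(U, F) \<in> C" "b \<in> function_algebra F" "x \<in> U" "b x \<noteq> 0"
      "\<And>y. y \<in> U \<Longrightarrow> b y \<noteq> 0 \<Longrightarrow> y \<in> S"
    and 2: "(U', F') \<in> C" "b' \<in> function_algebra F'" "x \<in> U'" "b' x \<noteq> 0"
      "\<And>y. y \<in> U' \<Longrightarrow> b' y \<noteq> 0 \<Longrightarrow> y \<in> T" by blast
  obtain V G where V: "(V, G) \<in> C" "dominated U F V G x" "dominated U' F' V G x"
    using assms(1) 1 2 unfolding directed_atlas_def by blast
  have "chart_rep U F S (\<lambda>_. 0) x" "chart_rep U' F' T (\<lambda>_. 0) x"
    using chart_rep_zero[OF 1(2,3,4)] 1(5) chart_rep_zero[OF 2(2,3,4)] 2(5) by auto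
  note r = chart_rep_dominated[OF this(1) V(2)] chart_rep_dominated[OF this(2) V(3)]
  from r obtain c c' where "c \<in> function_algebra G" "c x \<noteq> 0" "\<And>y. y \<in> V \<Longrightarrow> c y \<noteq> 0 \<Longrightarrow> y \<in> S"
     "c' \<in> function_algebra G" "c' x \<noteq> 0" "\<And>y. y \<in> V \<Longrightarrow> c' y \<noteq> 0 \<Longrightarrow> y \<in> T" "x \<in> V"
    unfolding chart_rep_def by blast
  then show ?case using V(1) function_algebra.mult[of c G c']
    by (intro exI[of _ V] exI[of _ G] exI[of _ "\<lambda>y. c y * c' y"]) auto
next
  case (UN K)
  from UN.prems obtain S where S: "S \<in> K" "x \<in> S" by blast
  from UN.IH[OF this] show ?case using S(1) by (metis UnionI)
next
  case Empty
  then show ?case by simp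
next
  case (Basis S)
  then obtain U F b where "S = {x \<in> U. b x \<noteq> 0}" "(U, F) \<in> C" "b \<in> function_algebra F" by blast
  with Basis.prems show ?case by (intro exI[of _ U] exI[of _ F] exI[of _ b]) auto
qed

lemma bex_pair: "(\<exists>(U, F)\<in>C. P U F) \<longleftrightarrow> (\<exists>U F. (U, F) \<in> C \<and> P U F)" by auto

lemma regular_charts_iff:
  "regular (fspace_of_charts C) W g \<longleftrightarrow> (\<forall>x\<in>W. \<exists>U F. (U, F) \<in> C \<and> (\<exists>a\<in>function_algebra F. \<exists>b\<in>function_algebra F.
       x \<in> U \<and> b x \<noteq> 0 \<and> (\<forall>y\<in>U \<inter> W. b y \<noteq> 0 \<longrightarrow> g y = a y / b y)))"
  unfolding fspace_of_charts_def fspace.simps bex_pair by (rule refl)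

text \<open>The definition of \<open>regular\<close> asks for the quotient formula on
  \<open>U \<inter> W\<close> only. As \<open>W\<close> is open, a principal neighbourhood inside
  \<open>W\<close> can be found in a dominating chart, and the formula holds on all of it.\<close>

lemma regular_charts:
  assumes "directed_atlas C" "openin (zariski (fspace_of_charts C)) W"
  shows "regular (fspace_of_charts C) W g \<longleftrightarrow> (\<forall>x\<in>W. \<exists>U F. (U, F) \<in> C \<and> chart_rep U F W g x)"
proof
  assume r: "\<forall>x\<in>W. \<exists>U F. (U, F) \<in> C \<and> chart_rep U F W g x"
  show "regular (fspace_of_charts C) W g"
    unfolding regular_charts_iff
  proof (intro ballI, goal_cases)
    case (1 x)
    with r obtain U F where "(U, F) \<in> C" "chart_rep U F W g x" by blast
    then show ?case
      unfolding chart_rep_def by blast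
  qed
next
  assume r: "regular (fspace_of_charts C) W g"
  show "\<forall>x\<in>W. \<exists>U F. (U, F) \<in> C \<and> chart_rep U F W g x"
  proof
    fix x assume x: "x \<in> W"
    from r x obtain U F a b where 1: "(U, F) \<in> C" "a \<in> function_algebra F" "b \<in> function_algebra F"
      "x \<in> U" "b x \<noteq> 0" "\<And>y. y \<in> U \<Longrightarrow> y \<in> W \<Longrightarrow> b y \<noteq> 0 \<Longrightarrow> g y = a y / b y"
      unfolding regular_charts_iff by blast
    have "openin (zariski (fspace_of_charts C)) ({y\<in>U. b y \<noteq> 0} \<inter> W)"
      using openin_chart_principal[OF 1(1,3)] assms(2) by blast
    then obtain U' F' b' where 2: "(U', F') \<in> C" "b' \<in> function_algebra F'" "x \<in> U'" "b' x \<noteq> 0"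
      "\<And>y. y \<in> U' \<Longrightarrow> b' y \<noteq> 0 \<Longrightarrow> y \<in> U \<and> b y \<noteq> 0 \<and> y \<in> W"
      using chart_base[OF assms(1), of "{y\<in>U. b y \<noteq> 0} \<inter> W" x] 1 x by auto
    obtain V G where V: "(V, G) \<in> C" "dominated U F V G x" "dominated U' F' V G x"
      using assms(1) 1(1,4) 2(1,3) unfolding directed_atlas_def by blast
    \<comment> \<open>Three facts move to the dominating chart: \<open>W\<close> is a neighbourhood,
      the quotient formula holds, and the old denominator is nonzero. The factors \<open>c\<close>
      and \<open>c'\<close> merge their domains.\<close>
    have "chart_rep U' F' (U \<inter> W) (\<lambda>_. 0) x"
      using chart_rep_zero[OF 2(2,3,4)] 2(5) by auto
    from chart_rep_dominated[OF this V(3)] obtain c where c: "c \<in> function_algebra G" "c x \<noteq> 0" "\<And>y. y \<in> V \<Longrightarrow> c y \<noteq> 0 \<Longrightarrow> y \<in> W" "x \<in> V"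
      unfolding chart_rep_def by blast
    have "chart_rep U F U (\<lambda>y. a y / b y) x"
      unfolding chart_rep_def using 1(2-5) by (intro conjI bexI[of _ a] bexI[of _ b]) auto
    from chart_rep_dominated[OF this V(2)] obtain a1 b1 where ab: "a1 \<in> function_algebra G" "b1 \<in> function_algebra G" "b1 x \<noteq> 0"
      "\<And>y. y \<in> V \<Longrightarrow> b1 y \<noteq> 0 \<Longrightarrow> y \<in> U \<and> a y / b y = a1 y / b1 y" unfolding chart_rep_def by blast
    have "chart_rep U F {y\<in>U. b y \<noteq> 0} (\<lambda>y. 0) x"
      using chart_rep_zero[OF 1(3,4,5)] by auto
    from chart_rep_dominated[OF this V(2)] obtain c' where c': "c' \<in> function_algebra G" "c' x \<noteq> 0" "\<And>y. y \<in> V \<Longrightarrow> c' y \<noteq> 0 \<Longrightarrow> y \<in> U \<and> b y \<noteq> 0"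
      unfolding chart_rep_def by blast
    have "chart_rep V G W g x"
    proof (rule chart_repI[of "\<lambda>y. (c y * c' y) * a1 y" _ "\<lambda>y. (c y * c' y) * b1 y"])
      fix y assume y: "y \<in> V" "(c y * c' y) * b1 y \<noteq> 0"
      then have nz: "c y \<noteq> 0" "c' y \<noteq> 0" "b1 y \<noteq> 0" by auto
      show "y \<in> W" using c(3) y nz by auto
      have "g y = a y / b y" using 1(6) c(3) c'(3) y nz by blast
      also have "\<dots> = a1 y / b1 y" using ab(4) y nz by auto
      finally show "g y = (c y * c' y) * a1 y / ((c y * c' y) * b1 y)" using nz by simp
    qed (use c c' ab in \<open>auto intro!: function_algebra.mult\<close>)
    then show "\<exists>U F. (U, F) \<in> C \<and> chart_rep U F W g x" using V(1) by blast
  qed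
qed

text \<open>The properties of a variety on which everything later rests: a sheaf of rings of
  functions in which nonvanishing is an open condition with regular inverse. The last clause covers
  restriction as well as gluing, since \<open>V\<close> may be larger than \<open>W\<close>.\<close>

definition sheafy :: "'a fspace \<Rightarrow> bool" where
  "sheafy X \<longleftrightarrow>
    (\<forall>W c. openin (zariski X) W \<longrightarrow> regular X W (\<lambda>_. c)) \<and>
    (\<forall>W f g. openin (zariski X) W \<and> regular X W f \<and> regular X W g \<longrightarrow> regular X W (\<lambda>x. f x + g x)) \<and>
    (\<forall>W f g. openin (zariski X) W \<and> regular X W f \<and> regular X W g \<longrightarrow> regular X W (\<lambda>x. f x * g x)) \<and>
    (\<forall>W f. openin (zariski X) W \<and> regular X W f \<longrightarrow> openin (zariski X) {x \<in> W. f x \<noteq> 0} \<and>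
       regular X {x \<in> W. f x \<noteq> 0} (\<lambda>x. inverse (f x))) \<and>
    (\<forall>W f. openin (zariski X) W \<and> (\<forall>x\<in>W. \<exists>V g. openin (zariski X) V \<and> x \<in> V \<and> regular X V g \<and>
       (\<forall>y\<in>V \<inter> W. f y = g y)) \<longrightarrow> regular X W f)"

lemma sheafy_const: "sheafy X \<Longrightarrow> openin (zariski X) W \<Longrightarrow> regular X W (\<lambda>_. c)"
  and sheafy_add: "sheafy X \<Longrightarrow> openin (zariski X) W \<Longrightarrow> regular X W f \<Longrightarrow> regular X W g \<Longrightarrow> regular X W (\<lambda>x. f x + g x)"
  and sheafy_mult: "sheafy X \<Longrightarrow> openin (zariski X) W \<Longrightarrow> regular X W f \<Longrightarrow> regular X W g \<Longrightarrow> regular X W (\<lambda>x. f x * g x)"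
  and sheafy_open: "sheafy X \<Longrightarrow> openin (zariski X) W \<Longrightarrow> regular X W f \<Longrightarrow> openin (zariski X) {x \<in> W. f x \<noteq> 0}"
  and sheafy_inverse: "sheafy X \<Longrightarrow> openin (zariski X) W \<Longrightarrow> regular X W f \<Longrightarrow> regular X {x \<in> W. f x \<noteq> 0} (\<lambda>x. inverse (f x))"
proof -
  note d = iffD1[OF sheafy_def]
  show "sheafy X \<Longrightarrow> openin (zariski X) W \<Longrightarrow> regular X W (\<lambda>_. c)"
    by (rule d[THEN conjunct1, rule_format]; assumption)
  show "sheafy X \<Longrightarrow> openin (zariski X) W \<Longrightarrow> regular X W f \<Longrightarrow> regular X W g \<Longrightarrow> regular X W (\<lambda>x. f x + g x)"
    by (rule d[THEN conjunct2, THEN conjunct1, rule_format]; (assumption | (intro conjI; assumption)))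
  show "sheafy X \<Longrightarrow> openin (zariski X) W \<Longrightarrow> regular X W f \<Longrightarrow> regular X W g \<Longrightarrow> regular X W (\<lambda>x. f x * g x)"
    by (rule d[THEN conjunct2, THEN conjunct2, THEN conjunct1, rule_format]; (assumption | (intro conjI; assumption)))
  show "sheafy X \<Longrightarrow> openin (zariski X) W \<Longrightarrow> regular X W f \<Longrightarrow> openin (zariski X) {x \<in> W. f x \<noteq> 0}"
    by (rule d[THEN conjunct2, THEN conjunct2, THEN conjunct2, THEN conjunct1, rule_format, THEN conjunct1]; (assumption | (intro conjI; assumption)))
  show "sheafy X \<Longrightarrow> openin (zariski X) W \<Longrightarrow> regular X W f \<Longrightarrow> regular X {x \<in> W. f x \<noteq> 0} (\<lambda>x. inverse (f x))"
    by (rule d[THEN conjunct2, THEN conjunct2, THEN conjunct2, THEN conjunct1, rule_format, THEN conjunct2]; (assumption | (intro conjI; assumption)))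
qed

lemma sheafy_local: "sheafy X \<Longrightarrow> openin (zariski X) W \<Longrightarrow>
    (\<And>x. x \<in> W \<Longrightarrow> \<exists>V g. openin (zariski X) V \<and> x \<in> V \<and> regular X V g \<and> (\<forall>y\<in>V \<inter> W. f y = g y)) \<Longrightarrow> regular X W f"
  by (rule iffD1[OF sheafy_def, THEN conjunct2, THEN conjunct2, THEN conjunct2, THEN conjunct2, THEN spec, THEN spec, THEN mp];
      (assumption | (intro conjI ballI; assumption)))

lemma sheafy_restrict: "sheafy X \<Longrightarrow> openin (zariski X) W \<Longrightarrow> openin (zariski X) V \<Longrightarrow> V \<subseteq> W \<Longrightarrow> regular X W f \<Longrightarrow>
    (\<And>x. x \<in> V \<Longrightarrow> f x = g x) \<Longrightarrow> regular X V g"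
  by (rule sheafy_local) (auto intro!: exI[of _ W] exI[of _ f])

lemma sheafy_minus: "sheafy X \<Longrightarrow> openin (zariski X) W \<Longrightarrow> regular X W f \<Longrightarrow> regular X W g \<Longrightarrow> regular X W (\<lambda>x. f x - g x)"
  using sheafy_add[of X W f "\<lambda>x. -1 * g x"] sheafy_mult[of X W "\<lambda>_. -1" g] sheafy_const[of X W "-1"] by simp

lemma sheafy_charts:
  assumes C: "directed_atlas C"
  shows "sheafy (fspace_of_charts C)"
proof -
  let ?X = "fspace_of_charts C"
  \<comment> \<open>Directedness puts both functions into one chart, where their representations can
    be added and multiplied.\<close>
  have two: "\<exists>U F. (U, F) \<in> C \<and> chart_rep U F W f x \<and> chart_rep U F W g x"
    if "openin (zariski ?X) W" "regular ?X W f" "regular ?X W g" "x \<in> W" for W f g x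
  proof -
    from that(2,4) regular_charts[OF C that(1), of f] obtain U F where u: "(U, F) \<in> C" "chart_rep U F W f x"
      by blast
    from that(3,4) regular_charts[OF C that(1), of g] obtain U' F' where "(U', F') \<in> C" "chart_rep U' F' W g x"
      by blast
    note 1 = u this
    then obtain V G where "(V, G) \<in> C" "dominated U F V G x" "dominated U' F' V G x"
      using C unfolding directed_atlas_def chart_rep_def by blast
    then show ?thesis using chart_rep_dominated[OF 1(2)] chart_rep_dominated[OF 1(4)] by blast
  qed
  have rep: "regular ?X W f \<longleftrightarrow> (\<forall>x\<in>W. \<exists>U F. (U, F) \<in> C \<and> chart_rep U F W f x)" if "openin (zariski ?X) W" for W f
    using regular_charts[OF C that] .
  have const: "regular ?X W (\<lambda>_. c)" if W: "openin (zariski ?X) W" for W c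
    unfolding rep[OF W]
  proof
    fix x assume "x \<in> W"
    then obtain U F b where 1: "(U, F) \<in> C" "b \<in> function_algebra F" "x \<in> U" "b x \<noteq> 0" "\<forall>y\<in>U. b y \<noteq> 0 \<longrightarrow> y \<in> W"
      using chart_base[OF C W] by blast
    have "chart_rep U F W (\<lambda>_. c) x" unfolding chart_rep_def
      using 1 function_algebra.mult[OF function_algebra.const[of c F] 1(2)]
      by (intro conjI bexI[of _ "\<lambda>y. c * b y"] bexI[of _ b]) auto
    then show "\<exists>U F. (U, F) \<in> C \<and> chart_rep U F W (\<lambda>_. c) x" using 1(1) by blast
  qed
  have opn: "openin (zariski ?X) {x \<in> W. f x \<noteq> 0}" if W: "openin (zariski ?X) W" and f: "regular ?X W f" for W f
  proof (subst openin_subopen, intro ballI)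
    fix x assume x: "x \<in> {x \<in> W. f x \<noteq> 0}"
    then obtain U F where 1: "(U, F) \<in> C" "chart_rep U F W f x" using f rep[OF W, of f] by blast
    have "chart_rep U F {y \<in> W. f y \<noteq> 0} (\<lambda>y. inverse (f y)) x"
      using chart_rep_inverse[OF 1(2)] x by blast
    then obtain b where "b \<in> function_algebra F" "x \<in> U" "b x \<noteq> 0" "\<forall>y\<in>U. b y \<noteq> 0 \<longrightarrow> y \<in> {y \<in> W. f y \<noteq> 0}"
      unfolding chart_rep_def by blast
    then show "\<exists>T. openin (zariski ?X) T \<and> x \<in> T \<and> T \<subseteq> {x \<in> W. f x \<noteq> 0}"
      using openin_chart_principal[OF 1(1)] by (intro exI[of _ "{x\<in>U. b x \<noteq> 0}"]) auto
  qed
  show ?thesis unfolding sheafy_def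
  proof (intro conjI allI impI; (elim conjE)?)
    fix W c assume W: "openin (zariski ?X) W" then show "regular ?X W (\<lambda>_. c)" by (rule const)
  next
    fix W f g assume W: "openin (zariski ?X) W" and fg: "regular ?X W f" "regular ?X W g"
    show "regular ?X W (\<lambda>x. f x + g x)" unfolding rep[OF W]
      using two[OF W fg] chart_rep_add[of _ _ W f _ g] by meson
    show "regular ?X W (\<lambda>x. f x * g x)" unfolding rep[OF W]
      using two[OF W fg] chart_rep_mult[of _ _ W f _ g] by meson
  next
    fix W f assume W: "openin (zariski ?X) W" and f: "regular ?X W f"
    show "openin (zariski ?X) {x \<in> W. f x \<noteq> 0}" by (rule opn[OF W f])
    show "regular ?X {x \<in> W. f x \<noteq> 0} (\<lambda>x. inverse (f x))"
      unfolding rep[OF opn[OF W f]]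
    proof (intro ballI, goal_cases)
      case (1 x)
      then obtain U F where "(U, F) \<in> C" "chart_rep U F W f x" using f rep[OF W, of f] by blast
      then show ?case using chart_rep_inverse[of U F W f x] 1 by blast
    qed
  next
    fix W f assume W: "openin (zariski ?X) W" and loc: "\<forall>x\<in>W. \<exists>V g. openin (zariski ?X) V \<and> x \<in> V \<and> regular ?X V g \<and>
       (\<forall>y\<in>V \<inter> W. f y = g y)"
    show "regular ?X W f" unfolding rep[OF W]
    proof
      fix x assume x: "x \<in> W"
      then obtain V g where V: "openin (zariski ?X) V" "x \<in> V" "regular ?X V g" "\<forall>y\<in>V \<inter> W. f y = g y"
        using loc by blast
      obtain U F where 1: "(U, F) \<in> C" "chart_rep U F V g x" using V rep[OF V(1), of g] by blast
      obtain U' F' where 2: "(U', F') \<in> C" "chart_rep U' F' W (\<lambda>_. 1) x" using const[OF W, of 1] rep[OF W, of "\<lambda>_. 1"] x by blast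
      obtain A G where 3: "(A, G) \<in> C" "dominated U F A G x" "dominated U' F' A G x"
        using C 1 2 unfolding directed_atlas_def chart_rep_def by blast
      note r = chart_rep_dominated[OF 1(2) 3(2)] chart_rep_dominated[OF 2(2) 3(3)]
      obtain a b where ab: "a \<in> function_algebra G" "b \<in> function_algebra G" "b x \<noteq> 0" "x \<in> A"
        "\<And>y. y \<in> A \<Longrightarrow> b y \<noteq> 0 \<Longrightarrow> y \<in> V \<and> g y = a y / b y" using r(1) unfolding chart_rep_def by blast
      obtain b' where b': "b' \<in> function_algebra G" "b' x \<noteq> 0" "\<And>y. y \<in> A \<Longrightarrow> b' y \<noteq> 0 \<Longrightarrow> y \<in> W"
        using r(2) unfolding chart_rep_def by blast
      have "chart_rep A G W f x" unfolding chart_rep_def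
        using ab b' V(4) function_algebra.mult[OF ab(1) b'(1)] function_algebra.mult[OF ab(2) b'(1)]
        by (intro conjI bexI[of _ "\<lambda>y. a y * b' y"] bexI[of _ "\<lambda>y. b y * b' y"]) auto
      then show "\<exists>U F. (U, F) \<in> C \<and> chart_rep U F W f x" using 3(1) by blast
    qed
  qed
qed

lemma regular_chart_generator:
  assumes "(U, F) \<in> C" "g \<in> F"
  shows "regular (fspace_of_charts C) U g"
proof -
  show ?thesis unfolding regular_charts_iff
    using assms(1) function_algebra.const[of 1 F] function_algebra.gen[OF assms(2)]
    by (intro ballI exI[of _ U] exI[of _ F] conjI bexI[of _ g] bexI[of _ "\<lambda>_. 1"]) auto
qed

section \<open>Morphisms of spaces with functions\<close>

lemma morphism_continuous: "morphism X Y f \<Longrightarrow> continuous_map (zariski X) (zariski Y) f"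
  by (simp add: morphism_def)

lemma morphism_points: "morphism X Y f \<Longrightarrow> x \<in> points X \<Longrightarrow> f x \<in> points Y"
  using continuous_map_image_subset_topspace[OF morphism_continuous] by blast

lemma morphism_open: "morphism X Y f \<Longrightarrow> openin (zariski Y) W \<Longrightarrow> openin (zariski X) {x \<in> points X. f x \<in> W}"
  by (rule openin_continuous_map_preimage[OF morphism_continuous])

lemma morphism_regular: "morphism X Y f \<Longrightarrow> openin (zariski Y) W \<Longrightarrow> regular Y W g \<Longrightarrow>
   regular X {x \<in> points X. f x \<in> W} (\<lambda>x. g (f x))"
  using iffD1[OF morphism_def, THEN conjunct2, rule_format, OF _ conjI, of X Y f W g] by (simp add: comp_def)

lemma morphismI:
  assumes "continuous_map (zariski X) (zariski Y) f"
    "\<And>W g. openin (zariski Y) W \<Longrightarrow> regular Y W g \<Longrightarrow> regular X {x \<in> points X. f x \<in> W} (\<lambda>x. g (f x))"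
  shows "morphism X Y f"
  unfolding morphism_def comp_def by (intro conjI allI impI; (elim conjE)?; (rule assms; assumption)?)

lemma morphism_compose:
  assumes f: "morphism X Y f" and g: "morphism Y Z g"
  shows "morphism X Z (g \<circ> f)"
proof (rule morphismI)
  show "continuous_map (zariski X) (zariski Z) (g \<circ> f)"
    by (rule continuous_map_compose[OF morphism_continuous[OF f] morphism_continuous[OF g]])
  fix W h assume W: "openin (zariski Z) W" "regular Z W h"
  have "regular X {x \<in> points X. f x \<in> {y \<in> points Y. g y \<in> W}} (\<lambda>x. h (g (f x)))"
    using morphism_regular[OF f morphism_open[OF g W(1)] morphism_regular[OF g W]] .
  moreover have "{x \<in> points X. f x \<in> {y \<in> points Y. g y \<in> W}} = {x \<in> points X. (g \<circ> f) x \<in> W}"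
    using morphism_points[OF f] by auto
  ultimately show "regular X {x \<in> points X. (g \<circ> f) x \<in> W} (\<lambda>x. h ((g \<circ> f) x))" by (simp add: comp_def)
qed

lemma morphism_id: "morphism X X (\<lambda>x. x)"
proof -
  have "{x \<in> points X. x \<in> W} = W" if "openin (zariski X) W" for W
    using openin_subset[OF that] by auto
  then show ?thesis unfolding morphism_def by (auto simp: comp_def)
qed

lemma regular_divide_local:
  assumes X: "sheafy X" and W: "openin (zariski X) W" and a: "regular X W a" and b: "regular X W b"
  shows "regular X {x \<in> W. b x \<noteq> 0} (\<lambda>x. a x / b x)"
proof -
  have o: "openin (zariski X) {x \<in> W. b x \<noteq> 0}" using sheafy_open[OF X W b] .
  have "regular X {x \<in> W. b x \<noteq> 0} (\<lambda>x. a x * inverse (b x))"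
    by (rule sheafy_mult[OF X o sheafy_restrict[OF X W o _ a] sheafy_inverse[OF X W b]]) auto
  then show ?thesis by (simp add: field_class.field_divide_inverse)
qed

text \<open>Generators suffice as a test: their pullbacks generate an algebra of regular functions,
  the nonvanishing loci of these are open, and local quotients pull back to local quotients.\<close>

lemma morphism_into_charts:
  assumes X: "sheafy X"
    and pts: "\<And>x. x \<in> points X \<Longrightarrow> f x \<in> points (fspace_of_charts C)"
    and opn: "\<And>U F. (U, F) \<in> C \<Longrightarrow> openin (zariski X) {x \<in> points X. f x \<in> U}"
    and reg: "\<And>U F g. (U, F) \<in> C \<Longrightarrow> g \<in> F \<Longrightarrow> regular X {x \<in> points X. f x \<in> U} (\<lambda>x. g (f x))"
  shows "morphism X (fspace_of_charts C) f"
proof -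
  have alg: "regular X {x \<in> points X. f x \<in> U} (\<lambda>x. g (f x))" if UF: "(U, F) \<in> C" and "g \<in> function_algebra F" for U F g
    using that(2)
  proof induction
    case (const c) show ?case by (rule sheafy_const[OF X opn[OF UF]])
  next
    case (gen f) then show ?case using reg[OF UF] by blast
  next
    case (add f g) then show ?case using sheafy_add[OF X opn[OF UF]] by blast
  next
    case (mult f g) then show ?case using sheafy_mult[OF X opn[OF UF]] by blast
  qed
  have cont: "continuous_map (zariski X) (zariski (fspace_of_charts C)) f"
    unfolding fspace_of_charts_def fspace.simps
  proof (rule continuous_on_generated_topo)
    fix S assume "S \<in> {{x \<in> U. b x \<noteq> 0} |U F b. (U, F) \<in> C \<and> b \<in> function_algebra F}"
    then obtain U F b where S: "S = {x \<in> U. b x \<noteq> 0}" "(U, F) \<in> C" "b \<in> function_algebra F" by blast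
    have "f -` S \<inter> points X = {x \<in> {x \<in> points X. f x \<in> U}. b (f x) \<noteq> 0}" using S by auto
    then show "openin (zariski X) (f -` S \<inter> points X)"
      using sheafy_open[OF X opn[OF S(2)] alg[OF S(2,3)]] by simp
  next
    show "f ` points X \<subseteq> \<Union> {{x \<in> U. b x \<noteq> 0} |U F b. (U, F) \<in> C \<and> b \<in> function_algebra F}"
      using pts unfolding fspace_of_charts_def by auto
  qed
  show ?thesis
  proof (rule morphismI[OF cont])
    fix W g assume W: "openin (zariski (fspace_of_charts C)) W" "regular (fspace_of_charts C) W g"
    let ?V = "{x \<in> points X. f x \<in> W}"
    have V: "openin (zariski X) ?V" by (rule openin_continuous_map_preimage[OF cont W(1)])
    show "regular X ?V (\<lambda>x. g (f x))"
    proof (rule sheafy_local[OF X V])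
      fix x assume x: "x \<in> ?V"
      from W(2) x obtain U F a b where 1: "(U, F) \<in> C" "a \<in> function_algebra F" "b \<in> function_algebra F"
        "f x \<in> U" "b (f x) \<noteq> 0" "\<And>y. y \<in> U \<Longrightarrow> y \<in> W \<Longrightarrow> b y \<noteq> 0 \<Longrightarrow> g y = a y / b y"
        unfolding regular_charts_iff by blast
      note r = alg[OF 1(1,2)] alg[OF 1(1,3)]
      show "\<exists>V ga. openin (zariski X) V \<and> x \<in> V \<and> regular X V ga \<and> (\<forall>y\<in>V \<inter> ?V. g (f y) = ga y)"
        using sheafy_open[OF X opn[OF 1(1)] r(2)] regular_divide_local[OF X opn[OF 1(1)] r] x 1(4-6)
        by (intro exI[of _ "{x \<in> {x \<in> points X. f x \<in> U}. b (f x) \<noteq> 0}"] exI[of _ "\<lambda>x. a (f x) / b (f x)"]) auto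
    qed
  qed
qed

section \<open>Reduced subvarieties\<close>

lemma points_subvariety: "points (subvariety X S) = points X \<inter> S"
  unfolding subvariety_def by simp

lemma openin_subvariety: "openin (zariski (subvariety X S)) U \<longleftrightarrow> (\<exists>T. openin (zariski X) T \<and> U = T \<inter> S)"
  unfolding subvariety_def by (simp add: openin_subtopology)

lemma regular_subvariety: "regular (subvariety X S) W g \<longleftrightarrow> (\<forall>x\<in>W. \<exists>V h. openin (zariski X) V \<and> x \<in> V \<and> regular X V h \<and>
       (\<forall>y\<in>V \<inter> W. g y = h y))"
  unfolding subvariety_def by simp

lemma regular_subvarietyD: "regular (subvariety X S) W g \<Longrightarrow> x \<in> W \<Longrightarrow>
    \<exists>V h. openin (zariski X) V \<and> x \<in> V \<and> regular X V h \<and> (\<forall>y\<in>V \<inter> W. g y = h y)"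
  unfolding regular_subvariety by (rule bspec)

lemma sheafy_subvariety:
  assumes X: "sheafy X" shows "sheafy (subvariety X S)"
proof -
  let ?Y = "subvariety X S"
  have two: "\<exists>V h k. openin (zariski X) V \<and> x \<in> V \<and> regular X V h \<and> regular X V k \<and>
       (\<forall>y\<in>V \<inter> W. f y = h y \<and> g y = k y)" if "regular ?Y W f" "regular ?Y W g" "x \<in> W" for W f g x
  proof -
    note d = regular_subvarietyD[OF that(1,3)] regular_subvarietyD[OF that(2,3)]
    obtain V h where 1: "openin (zariski X) V" "x \<in> V" "regular X V h" "\<forall>y\<in>V \<inter> W. f y = h y"
      using d(1) by blast
    obtain V' k where 2: "openin (zariski X) V'" "x \<in> V'" "regular X V' k" "\<forall>y\<in>V' \<inter> W. g y = k y"
      using d(2) by blast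
    have o: "openin (zariski X) (V \<inter> V')" using 1 2 by blast
    show ?thesis
      using 1 2 o sheafy_restrict[OF X 1(1) o _ 1(3)] sheafy_restrict[OF X 2(1) o _ 2(3)]
      by (intro exI[of _ "V \<inter> V'"] exI[of _ h] exI[of _ k]) auto
  qed
  have opn: "openin (zariski ?Y) {x \<in> W. f x \<noteq> 0}" if W: "openin (zariski ?Y) W" and f: "regular ?Y W f" for W f
  proof (subst openin_subopen, intro ballI)
    fix x assume x: "x \<in> {x \<in> W. f x \<noteq> 0}"
    obtain T where T: "openin (zariski X) T" "W = T \<inter> S" using W unfolding openin_subvariety by blast
    obtain V h where 1: "openin (zariski X) V" "x \<in> V" "regular X V h" "\<forall>y\<in>V \<inter> W. f y = h y"
      using regular_subvarietyD[OF f, of x] x by blast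
    have "openin (zariski X) (T \<inter> {x\<in>V. h x \<noteq> 0})" using T sheafy_open[OF X 1(1,3)] by blast
    then show "\<exists>A. openin (zariski ?Y) A \<and> x \<in> A \<and> A \<subseteq> {x \<in> W. f x \<noteq> 0}"
      unfolding openin_subvariety
      using x 1 T by (intro exI[of _ "(T \<inter> {x\<in>V. h x \<noteq> 0}) \<inter> S"]) auto
  qed
  show ?thesis unfolding sheafy_def
  proof (intro conjI allI impI; (elim conjE)?)
    fix W c assume W: "openin (zariski ?Y) W"
    then obtain T where T: "openin (zariski X) T" "W = T \<inter> S" unfolding openin_subvariety by blast
    show "regular ?Y W (\<lambda>_. c)" unfolding regular_subvariety
      using sheafy_const[OF X T(1), of c] T by (intro ballI exI[of _ T] exI[of _ "\<lambda>_. c"]) auto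
  next
    fix W f g assume W: "openin (zariski ?Y) W" and fg: "regular ?Y W f" "regular ?Y W g"
    show "regular ?Y W (\<lambda>x. f x + g x)" unfolding regular_subvariety
    proof (intro ballI, goal_cases)
      case (1 x)
      obtain V h k where v: "openin (zariski X) V" "x \<in> V" "regular X V h" "regular X V k"
         "\<forall>y\<in>V \<inter> W. f y = h y \<and> g y = k y" using two[OF fg 1] by blast
      show ?case
        using sheafy_add[OF X v(1,3,4)] v by (intro exI[of _ V] exI[of _ "\<lambda>x. h x + k x"]) auto
    qed
    show "regular ?Y W (\<lambda>x. f x * g x)" unfolding regular_subvariety
    proof (intro ballI, goal_cases)
      case (1 x)
      obtain V h k where v: "openin (zariski X) V" "x \<in> V" "regular X V h" "regular X V k"
         "\<forall>y\<in>V \<inter> W. f y = h y \<and> g y = k y" using two[OF fg 1] by blast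
      show ?case
        using sheafy_mult[OF X v(1,3,4)] v by (intro exI[of _ V] exI[of _ "\<lambda>x. h x * k x"]) auto
    qed
  next
    fix W f assume W: "openin (zariski ?Y) W" and f: "regular ?Y W f"
    show "openin (zariski ?Y) {x \<in> W. f x \<noteq> 0}" by (rule opn[OF W f])
    show "regular ?Y {x \<in> W. f x \<noteq> 0} (\<lambda>x. inverse (f x))" unfolding regular_subvariety
    proof
      fix x assume x: "x \<in> {x \<in> W. f x \<noteq> 0}"
      obtain V h where 1: "openin (zariski X) V" "x \<in> V" "regular X V h" "\<forall>y\<in>V \<inter> W. f y = h y"
        using regular_subvarietyD[OF f, of x] x by blast
      show "\<exists>V h. openin (zariski X) V \<and> x \<in> V \<and> regular X V h \<and> (\<forall>y\<in>V \<inter> {x \<in> W. f x \<noteq> 0}. inverse (f y) = h y)"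
        using sheafy_open[OF X 1(1,3)] sheafy_inverse[OF X 1(1,3)] 1 x
        by (intro exI[of _ "{x\<in>V. h x \<noteq> 0}"] exI[of _ "\<lambda>x. inverse (h x)"]) auto
    qed
  next
    fix W f assume W: "openin (zariski ?Y) W" and loc: "\<forall>x\<in>W. \<exists>V g. openin (zariski ?Y) V \<and> x \<in> V \<and> regular ?Y V g \<and>
       (\<forall>y\<in>V \<inter> W. f y = g y)"
    show "regular ?Y W f" unfolding regular_subvariety
    proof
      fix x assume x: "x \<in> W"
      then obtain V g where V: "openin (zariski ?Y) V" "x \<in> V" "regular ?Y V g" "\<forall>y\<in>V \<inter> W. f y = g y"
        using loc by blast
      obtain T where T: "openin (zariski X) T" "V = T \<inter> S" using V(1) unfolding openin_subvariety by blast
      obtain A h where 1: "openin (zariski X) A" "x \<in> A" "regular X A h" "\<forall>y\<in>A \<inter> V. g y = h y"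
        using regular_subvarietyD[OF V(3,2)] by blast
      have WS: "W \<subseteq> S" using W unfolding openin_subvariety by blast
      have o: "openin (zariski X) (A \<inter> T)" using 1 T by blast
      have "regular X (A \<inter> T) h" using sheafy_restrict[OF X 1(1) o _ 1(3)] by auto
      then show "\<exists>V h. openin (zariski X) V \<and> x \<in> V \<and> regular X V h \<and> (\<forall>y\<in>V \<inter> W. f y = h y)"
        using o 1 V T WS by (intro exI[of _ "A \<inter> T"] exI[of _ h]) auto
    qed
  qed
qed

lemma morphism_from_subvariety:
  assumes f: "morphism X Y f" shows "morphism (subvariety X S) Y f"
proof (rule morphismI)
  show "continuous_map (zariski (subvariety X S)) (zariski Y) f"
    using morphism_continuous[OF f] unfolding subvariety_def by (simp add: continuous_map_from_subtopology)
  fix W g assume W: "openin (zariski Y) W" "regular Y W g"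
  have "\<exists>V h. openin (zariski X) V \<and> x \<in> V \<and> regular X V h \<and> (\<forall>y\<in>V \<inter> {x \<in> points (subvariety X S). f x \<in> W}. g (f y) = h y)"
    if "x \<in> points X" "f x \<in> W" for x
    using morphism_open[OF f W(1)] morphism_regular[OF f W] that
    by (intro exI[of _ "{x \<in> points X. f x \<in> W}"] exI[of _ "\<lambda>x. g (f x)"]) auto
  then show "regular (subvariety X S) {x \<in> points (subvariety X S). f x \<in> W} (\<lambda>x. g (f x))"
    unfolding regular_subvariety points_subvariety by blast
qed

lemma morphism_into_subvariety:
  assumes X: "sheafy X" and f: "morphism X Y f" and S: "\<And>x. x \<in> points X \<Longrightarrow> f x \<in> S"
  shows "morphism X (subvariety Y S) f"
proof (rule morphismI)
  show "continuous_map (zariski X) (zariski (subvariety Y S)) f"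
    using morphism_continuous[OF f] S unfolding subvariety_def by (auto simp: continuous_map_in_subtopology)
  then have o: "openin (zariski X) {x \<in> points X. f x \<in> W}" if "openin (zariski (subvariety Y S)) W" for W
    using that by (rule openin_continuous_map_preimage)
  fix W g assume W: "openin (zariski (subvariety Y S)) W" "regular (subvariety Y S) W g"
  show "regular X {x \<in> points X. f x \<in> W} (\<lambda>x. g (f x))"
  proof (rule sheafy_local[OF X o[OF W(1)]])
    fix x assume x: "x \<in> {x \<in> points X. f x \<in> W}"
    then obtain V h where V: "openin (zariski Y) V" "f x \<in> V" "regular Y V h" "\<forall>y\<in>V \<inter> W. g y = h y"
      using regular_subvarietyD[OF W(2), of "f x"] by blast
    show "\<exists>V ga. openin (zariski X) V \<and> x \<in> V \<and> regular X V ga \<and> (\<forall>y\<in>V \<inter> {x \<in> points X. f x \<in> W}. g (f y) = ga y)"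
      using morphism_open[OF f V(1)] morphism_regular[OF f V(1,3)] V x
      by (intro exI[of _ "{x \<in> points X. f x \<in> V}"] exI[of _ "\<lambda>x. h (f x)"]) auto
  qed
qed

section \<open>Spaces with a dense family of points\<close>

text \<open>A function \<open>h\<close> on the index set of the dense family \<open>e\<close> extends regularly to a neighbourhood of
  \<open>p\<close>, with value \<open>c\<close> at \<open>p\<close>. Regularity is only asked for near \<open>p\<close>, while \<open>h\<close> may be undefined (such
  as a quotient \<open>x / 0\<close>) at indices away from \<open>p\<close>.\<close>

definition germ :: "'a fspace \<Rightarrow> ('d \<Rightarrow> 'a) \<Rightarrow> 'd set \<Rightarrow> 'a \<Rightarrow> ('d \<Rightarrow> complex) \<Rightarrow> complex \<Rightarrow> bool" where
  "germ X e D p h c \<longleftrightarrow> (\<exists>N k. openin (zariski X) N \<and> p \<in> N \<and> regular X N k \<and> k p = c \<and>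
     (\<forall>d\<in>D. e d \<in> N \<longrightarrow> k (e d) = h d))"

text \<open>Indices in \<open>D\<close> will be tuples, and proportional tuples name the same point;
  so the dense set is given by a map \<open>e\<close> and not as a subset, and one \<open>D\<close>
  serves all spaces.\<close>

definition dspace :: "'a fspace \<Rightarrow> ('d \<Rightarrow> 'a) \<Rightarrow> 'd set \<Rightarrow> bool" where
  "dspace X e D \<longleftrightarrow> sheafy X \<and> (\<forall>d\<in>D. e d \<in> points X) \<and>
     (\<forall>N p. openin (zariski X) N \<longrightarrow> p \<in> N \<longrightarrow> (\<exists>d\<in>D. e d \<in> N))"

lemma dspace_sheafy: "dspace X e D \<Longrightarrow> sheafy X"
  and dspace_points: "dspace X e D \<Longrightarrow> d \<in> D \<Longrightarrow> e d \<in> points X"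
  and dspace_dense: "dspace X e D \<Longrightarrow> openin (zariski X) N \<Longrightarrow> p \<in> N \<Longrightarrow> \<exists>d\<in>D. e d \<in> N"
  unfolding dspace_def by blast+

lemma regular_subset: "sheafy X \<Longrightarrow> openin (zariski X) W \<Longrightarrow> openin (zariski X) V \<Longrightarrow> V \<subseteq> W \<Longrightarrow> regular X W f \<Longrightarrow> regular X V f"
  by (erule (4) sheafy_restrict) simp

lemma germI: "openin (zariski X) N \<Longrightarrow> p \<in> N \<Longrightarrow> regular X N k \<Longrightarrow> k p = c \<Longrightarrow>
     (\<And>d. d \<in> D \<Longrightarrow> e d \<in> N \<Longrightarrow> k (e d) = h d) \<Longrightarrow> germ X e D p h c"
  unfolding germ_def by (intro exI[of _ N] exI[of _ k]) auto

lemma germE: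
  assumes "germ X e D p h c"
  obtains N k where "openin (zariski X) N" "p \<in> N" "regular X N k" "k p = c"
     "\<And>d. d \<in> D \<Longrightarrow> e d \<in> N \<Longrightarrow> k (e d) = h d"
  using assms unfolding germ_def by (elim exE conjE) auto

lemma germ2E:
  assumes X: "sheafy X" and "germ X e D p h c" "germ X e D p h' c'"
  obtains N k k' where "openin (zariski X) N" "p \<in> N" "regular X N k" "k p = c"
     "\<And>d. d \<in> D \<Longrightarrow> e d \<in> N \<Longrightarrow> k (e d) = h d" "regular X N k'" "k' p = c'"
     "\<And>d. d \<in> D \<Longrightarrow> e d \<in> N \<Longrightarrow> k' (e d) = h' d"
proof -
  obtain N k where 1: "openin (zariski X) N" "p \<in> N" "regular X N k" "k p = c"
     "\<And>d. d \<in> D \<Longrightarrow> e d \<in> N \<Longrightarrow> k (e d) = h d" using germE[OF assms(2)] by metis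
  obtain N' k' where 2: "openin (zariski X) N'" "p \<in> N'" "regular X N' k'" "k' p = c'"
     "\<And>d. d \<in> D \<Longrightarrow> e d \<in> N' \<Longrightarrow> k' (e d) = h' d" using germE[OF assms(3)] by metis
  have o: "openin (zariski X) (N \<inter> N')" using 1 2 by blast
  show ?thesis
    by (rule that[OF o _ regular_subset[OF X 1(1) o _ 1(3)] _ _ regular_subset[OF X 2(1) o _ 2(3)]]) (use 1 2 in auto)
qed

text \<open>Two extensions agree on the dense family, while the locus where they differ is open and
  would contain \<open>p\<close>. This takes over the role that integrality plays for rational
  functions.\<close>

lemma germ_unique:
  assumes X: "dspace X e D" and "germ X e D p h c" "germ X e D p h c'"
  shows "c = c'"
proof (rule ccontr)
  assume ne: "c \<noteq> c'"
  note S = dspace_sheafy[OF X]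
  obtain N k k' where 1: "openin (zariski X) N" "p \<in> N" "regular X N k" "k p = c"
     "\<And>d. d \<in> D \<Longrightarrow> e d \<in> N \<Longrightarrow> k (e d) = h d" "regular X N k'" "k' p = c'"
     "\<And>d. d \<in> D \<Longrightarrow> e d \<in> N \<Longrightarrow> k' (e d) = h d" using germ2E[OF S assms(2,3)] by metis
  have "openin (zariski X) {x \<in> N. k x - k' x \<noteq> 0}"
    by (rule sheafy_open[OF S 1(1) sheafy_minus[OF S 1(1,3,6)]])
  from dspace_dense[OF X this, of p] 1 ne show False by auto
qed

lemma germ_const: "sheafy X \<Longrightarrow> p \<in> points X \<Longrightarrow> germ X e D p (\<lambda>_. c) c"
  by (rule germI[of _ "points X" _ "\<lambda>_. c"]) (auto intro: sheafy_const)

lemma germ_add: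
  assumes X: "sheafy X" and "germ X e D p h c" "germ X e D p h' c'"
  shows "germ X e D p (\<lambda>d. h d + h' d) (c + c')"
  by (rule germ2E[OF assms], rule germI, assumption, assumption, erule (2) sheafy_add[OF X]) auto

lemma germ_mult:
  assumes X: "sheafy X" and "germ X e D p h c" "germ X e D p h' c'"
  shows "germ X e D p (\<lambda>d. h d * h' d) (c * c')"
  by (rule germ2E[OF assms], rule germI, assumption, assumption, erule (2) sheafy_mult[OF X]) auto

lemma germ_diff:
  assumes X: "sheafy X" and "germ X e D p h c" "germ X e D p h' c'"
  shows "germ X e D p (\<lambda>d. h d - h' d) (c - c')"
  by (rule germ2E[OF assms], rule germI, assumption, assumption, erule (2) sheafy_minus[OF X]) auto

lemma germ_inverse:
  assumes X: "sheafy X" and g: "germ X e D p h c" and "c \<noteq> 0"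
  shows "germ X e D p (\<lambda>d. inverse (h d)) (inverse c)"
proof -
  obtain N k where 1: "openin (zariski X) N" "p \<in> N" "regular X N k" "k p = c"
     "\<And>d. d \<in> D \<Longrightarrow> e d \<in> N \<Longrightarrow> k (e d) = h d" using germE[OF g] by metis
  show ?thesis
    by (rule germI[OF sheafy_open[OF X 1(1,3)] _ sheafy_inverse[OF X 1(1,3)]]) (use 1 assms(3) in auto)
qed

text \<open>Only indices whose points lie near \<open>p\<close> count, so identities between
  quotients may be used wherever the denominators are known to be nonzero.\<close>

lemma germ_cong:
  assumes X: "sheafy X" and g: "germ X e D p h c" and N: "openin (zariski X) N" "p \<in> N"
    and eq: "\<And>d. d \<in> D \<Longrightarrow> e d \<in> N \<Longrightarrow> h d = h' d"
  shows "germ X e D p h' c"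
proof -
  obtain M k where 1: "openin (zariski X) M" "p \<in> M" "regular X M k" "k p = c"
     "\<And>d. d \<in> D \<Longrightarrow> e d \<in> M \<Longrightarrow> k (e d) = h d" using germE[OF g] by metis
  have o: "openin (zariski X) (M \<inter> N)" using 1 N by blast
  show ?thesis
    by (rule germI[OF o _ regular_subset[OF X 1(1) o _ 1(3)]]) (use 1 N eq in auto)
qed

lemma germ_point: "germ X e D p h c \<Longrightarrow> p \<in> points X"
  by (erule germE) (meson openin_subset subsetD)

lemma germ_cong': "sheafy X \<Longrightarrow> germ X e D p h c \<Longrightarrow> (\<And>d. d \<in> D \<Longrightarrow> h d = h' d) \<Longrightarrow> germ X e D p h' c"
  using germ_cong[of X e D p h c "points X" h'] germ_point[of X e D p h c] by auto

lemma germ_sum: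
  assumes X: "sheafy X" and p: "p \<in> points X" and "finite A" "\<And>i. i \<in> A \<Longrightarrow> germ X e D p (h i) (c i)"
  shows "germ X e D p (\<lambda>d. \<Sum>i\<in>A. h i d) (\<Sum>i\<in>A. c i)"
  using assms(3,4)
proof induction
  case empty
  then show ?case using germ_const[OF X p, of e D 0] by simp
next
  case (insert i A)
  then show ?case using germ_add[OF X, of e D p "h i" "c i" "\<lambda>d. \<Sum>i\<in>A. h i d"] by simp
qed

lemma germ_prod:
  assumes X: "sheafy X" and p: "p \<in> points X" and "finite A" "\<And>i. i \<in> A \<Longrightarrow> germ X e D p (h i) (c i)"
  shows "germ X e D p (\<lambda>d. \<Prod>i\<in>A. h i d) (\<Prod>i\<in>A. c i)"
  using assms(3,4)
proof induction
  case empty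
  then show ?case using germ_const[OF X p, of e D 1] by simp
next
  case (insert i A)
  then show ?case using germ_mult[OF X, of e D p "h i" "c i" "\<lambda>d. \<Prod>i\<in>A. h i d"] by simp
qed

text \<open>The extension that witnesses the germ at \<open>p\<close> also witnesses it at every
  nearby point, so extendability is an open condition.\<close>

lemma germ_spread:
  assumes "germ X e D p h c"
  obtains N k where "openin (zariski X) N" "p \<in> N" "regular X N k" "k p = c"
    "\<And>q. q \<in> N \<Longrightarrow> germ X e D q h (k q)"
proof -
  obtain N k where 1: "openin (zariski X) N" "p \<in> N" "regular X N k" "k p = c"
     "\<And>d. d \<in> D \<Longrightarrow> e d \<in> N \<Longrightarrow> k (e d) = h d" using germE[OF assms] by metis
  show ?thesis by (rule that[OF 1(1-4)], rule germI[OF 1(1) _ 1(3)]) (use 1(5) in auto)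
qed

lemma open_finite_inter:
  assumes "finite A" "p \<in> points X" "\<And>a. a \<in> A \<Longrightarrow> \<exists>N. openin (zariski X) N \<and> p \<in> N \<and> (\<forall>q\<in>N. P a q)"
  shows "\<exists>N. openin (zariski X) N \<and> p \<in> N \<and> (\<forall>q\<in>N. \<forall>a\<in>A. P a q)"
  using assms(1,3)
proof induction
  case empty
  then show ?case using assms(2) by auto
next
  case (insert a A)
  then obtain N where "openin (zariski X) N" "p \<in> N" "\<forall>q\<in>N. \<forall>a\<in>A. P a q" by blast
  moreover obtain M where "openin (zariski X) M" "p \<in> M" "\<forall>q\<in>M. P a q" using insert.prems[of a] by auto
  ultimately show ?case by (intro exI[of _ "N \<inter> M"]) auto
qed

lemma germs_spread:
  assumes "finite A" "p \<in> points X" "\<And>a. a \<in> A \<Longrightarrow> \<exists>c. germ X e D p (h a) c"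
  shows "\<exists>N. openin (zariski X) N \<and> p \<in> N \<and> (\<forall>q\<in>N. \<forall>a\<in>A. \<exists>c. germ X e D q (h a) c)"
proof (rule open_finite_inter[OF assms(1,2)])
  fix a assume "a \<in> A"
  then obtain c where "germ X e D p (h a) c" using assms(3) by blast
  then show "\<exists>N. openin (zariski X) N \<and> p \<in> N \<and> (\<forall>q\<in>N. \<exists>c. germ X e D q (h a) c)"
    by (rule germ_spread) blast
qed

lemma regular_germ:
  assumes "openin (zariski X) N" "regular X N k" "p \<in> N"
  shows "germ X e D p (\<lambda>d. k (e d)) (k p)"
  by (rule germI[OF assms(1,3,2)]) auto

text \<open>Uniqueness of values forces every local extension of \<open>h\<close> to agree with
  \<open>g\<close>, so pointwise extendability of one expression already yields regularity.\<close>

lemma regular_of_germs: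
  assumes X: "dspace X e D" and W: "openin (zariski X) W" and g: "\<And>x. x \<in> W \<Longrightarrow> germ X e D x h (g x)"
  shows "regular X W g"
proof (rule sheafy_local[OF dspace_sheafy[OF X] W])
  fix x assume x: "x \<in> W"
  obtain N k where 1: "openin (zariski X) N" "x \<in> N" "regular X N k" "k x = g x"
    "\<And>q. q \<in> N \<Longrightarrow> germ X e D q h (k q)" using germ_spread[OF g[OF x]] by metis
  have "\<forall>y\<in>N \<inter> W. g y = k y" using germ_unique[OF X g 1(5)] by blast
  then show "\<exists>V k. openin (zariski X) V \<and> x \<in> V \<and> regular X V k \<and> (\<forall>y\<in>V \<inter> W. g y = k y)"
    using 1 by (intro exI[of _ N] exI[of _ k]) auto
qed

lemma germ_pullback:
  assumes f: "morphism M Y f" and fe: "\<And>d. d \<in> D \<Longrightarrow> f (e d) = e' d" and p: "p \<in> points M"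
    and g: "germ Y e' D (f p) h c"
  shows "germ M e D p h c"
proof -
  obtain N k where 1: "openin (zariski Y) N" "f p \<in> N" "regular Y N k" "k (f p) = c"
     "\<And>d. d \<in> D \<Longrightarrow> e' d \<in> N \<Longrightarrow> k (e' d) = h d" using germE[OF g] by metis
  show ?thesis
    by (rule germI[OF morphism_open[OF f 1(1)] _ morphism_regular[OF f 1(1,3)]]) (use 1 p fe in auto)
qed

text \<open>The working criterion for constructing maps into a glued space: each coordinate function
  is handled by one expression \<open>h\<close> on \<open>D\<close> that serves all points, so
  regularity of its pullback reduces to pointwise germs.\<close>

lemma morphism_by_germs:
  assumes M: "dspace M e D"
    and pts: "\<And>p. p \<in> points M \<Longrightarrow> f p \<in> points (fspace_of_charts C)"
    and opn: "\<And>U F p. (U, F) \<in> C \<Longrightarrow> p \<in> points M \<Longrightarrow> f p \<in> U \<Longrightarrow>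
        \<exists>N. openin (zariski M) N \<and> p \<in> N \<and> (\<forall>q\<in>N. f q \<in> U)"
    and reg: "\<And>U F g. (U, F) \<in> C \<Longrightarrow> g \<in> F \<Longrightarrow> \<exists>h. \<forall>p\<in>points M. f p \<in> U \<longrightarrow> germ M e D p h (g (f p))"
  shows "morphism M (fspace_of_charts C) f"
proof (rule morphism_into_charts[OF dspace_sheafy[OF M] pts])
  fix U F assume UF: "(U, F) \<in> C"
  show o: "openin (zariski M) {p \<in> points M. f p \<in> U}"
  proof (subst openin_subopen, intro ballI)
    fix p assume "p \<in> {p \<in> points M. f p \<in> U}"
    then obtain N where "openin (zariski M) N" "p \<in> N" "\<forall>q\<in>N. f q \<in> U" using opn[OF UF] by blast
    then show "\<exists>T. openin (zariski M) T \<and> p \<in> T \<and> T \<subseteq> {p \<in> points M. f p \<in> U}"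
      using openin_subset by (intro exI[of _ N]) fast
  qed
  fix g assume "g \<in> F"
  then obtain h where "\<forall>p\<in>points M. f p \<in> U \<longrightarrow> germ M e D p h (g (f p))" using reg[OF UF] by blast
  then show "regular M {p \<in> points M. f p \<in> U} (\<lambda>p. g (f p))"
    by (intro regular_of_germs[OF M o]) auto
qed

section \<open>Products of varieties\<close>

definition product_charts :: "'i set \<Rightarrow> ('i \<Rightarrow> 'a fspace) \<Rightarrow> (('i \<Rightarrow> 'a) set \<times> (('i \<Rightarrow> 'a) \<Rightarrow> complex) set) set" where
  "product_charts I X = {(Pi\<^sub>E I W, {\<lambda>p. g (p i) | i g. i \<in> I \<and> regular (X i) (W i) g}) | W.
       \<forall>i\<in>I. openin (zariski (X i)) (W i)}"

lemma variety_product_charts: "variety_product I X = fspace_of_charts (product_charts I X)"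
  unfolding variety_product_def product_charts_def ..

text \<open>Boxes are closed under intersection and regular functions restrict, so the chart on the
  intersected box dominates both with constant denominator 1.\<close>

lemma product_charts_directed:
  assumes X: "\<And>i. i \<in> I \<Longrightarrow> sheafy (X i)"
  shows "directed_atlas (product_charts I X)"
  unfolding directed_atlas_def
proof (intro allI impI, elim conjE)
  fix U F U' F' x
  assume "(U, F) \<in> product_charts I X" "(U', F') \<in> product_charts I X" and x: "x \<in> U" "x \<in> U'"
  then obtain W W' where W: "\<forall>i\<in>I. openin (zariski (X i)) (W i)" "U = Pi\<^sub>E I W"
     "F = {\<lambda>p. g (p i) | i g. i \<in> I \<and> regular (X i) (W i) g}"
    and W': "\<forall>i\<in>I. openin (zariski (X i)) (W' i)" "U' = Pi\<^sub>E I W'"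
     "F' = {\<lambda>p. g (p i) | i g. i \<in> I \<and> regular (X i) (W' i) g}"
    unfolding product_charts_def by blast
  define V where "V i = W i \<inter> W' i" for i
  define G where "G = {\<lambda>p. g (p i) | i g. i \<in> I \<and> regular (X i) (V i) g}"
  have V: "openin (zariski (X i)) (V i)" if "i \<in> I" for i using W W' that unfolding V_def by blast
  have c: "(Pi\<^sub>E I V, G) \<in> product_charts I X" unfolding product_charts_def G_def using V by blast
  have sub: "F \<subseteq> G" "F' \<subseteq> G"
  proof -
    have "regular (X i) (V i) g" if "i \<in> I" "regular (X i) (W i) g" for i g
      using sheafy_restrict[OF X[OF that(1)] _ V[OF that(1)] _ that(2)] W(1) that(1) V_def by blast
    then show "F \<subseteq> G" unfolding W(3) G_def by blast
    have "regular (X i) (V i) g" if "i \<in> I" "regular (X i) (W' i) g" for i g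
      using sheafy_restrict[OF X[OF that(1)] _ V[OF that(1)] _ that(2)] W'(1) that(1) V_def by blast
    then show "F' \<subseteq> G" unfolding W'(3) G_def by blast
  qed
  have xV: "x \<in> Pi\<^sub>E I V" using x W(2) W'(2) unfolding V_def by (auto simp: PiE_iff)
  have VU: "Pi\<^sub>E I V \<subseteq> U" "Pi\<^sub>E I V \<subseteq> U'" unfolding W(2) W'(2) V_def by (auto simp: PiE_iff)
  have "dominated U F (Pi\<^sub>E I V) G x" "dominated U' F' (Pi\<^sub>E I V) G x"
    unfolding dominated_def using xV VU sub function_algebra.const[of 1 G]
    by (auto intro!: local_fraction_algebra function_algebra.gen bexI[of _ "\<lambda>_. 1"])
  then show "\<exists>V G. (V, G) \<in> product_charts I X \<and> dominated U F V G x \<and> dominated U' F' V G x"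
    using c by blast
qed

lemma sheafy_product: "(\<And>i. i \<in> I \<Longrightarrow> sheafy (X i)) \<Longrightarrow> sheafy (variety_product I X)"
  unfolding variety_product_charts by (rule sheafy_charts[OF product_charts_directed])

lemma points_product: "points (variety_product I X) = (\<Pi>\<^sub>E i\<in>I. points (X i))"
proof -
  have 1: "Pi\<^sub>E I W \<subseteq> (\<Pi>\<^sub>E i\<in>I. points (X i))" if "\<forall>i\<in>I. openin (zariski (X i)) (W i)" for W
    by (rule PiE_mono) (use that in \<open>auto dest: openin_subset\<close>)
  have 2: "fst ` product_charts I X = {Pi\<^sub>E I W | W. \<forall>i\<in>I. openin (zariski (X i)) (W i)}"
    unfolding product_charts_def by (auto simp: image_def)
  have 3: "(\<Pi>\<^sub>E i\<in>I. points (X i)) \<in> {Pi\<^sub>E I W | W. \<forall>i\<in>I. openin (zariski (X i)) (W i)}"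
    by (rule CollectI, rule exI[of _ "\<lambda>i. points (X i)"]) simp
  show ?thesis unfolding variety_product_charts points_charts 2
  proof
    show "\<Union> {Pi\<^sub>E I W | W. \<forall>i\<in>I. openin (zariski (X i)) (W i)} \<subseteq> (\<Pi>\<^sub>E i\<in>I. points (X i))"
      using 1 by (intro Union_least) blast
  qed (rule Union_upper[OF 3])
qed

lemma morphism_projection:
  assumes X: "\<And>i. i \<in> I \<Longrightarrow> sheafy (X i)" and i: "i \<in> I"
  shows "morphism (variety_product I X) (X i) (\<lambda>p. p i)"
proof -
  have box: "{p \<in> points (variety_product I X). p i \<in> W} = Pi\<^sub>E I (\<lambda>j. if j = i then W else points (X j))"
    if "openin (zariski (X i)) W" for W
    unfolding points_product using openin_subset[OF that] i
    by (auto simp: PiE_iff extensional_def split: if_splits; metis subsetD)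
  have c: "(Pi\<^sub>E I (\<lambda>j. if j = i then W else points (X j)),
      {\<lambda>p. g (p k) | k g. k \<in> I \<and> regular (X k) (if k = i then W else points (X k)) g}) \<in> product_charts I X"
    if "openin (zariski (X i)) W" for W
    unfolding product_charts_def
    by (rule CollectI, rule exI[of _ "\<lambda>j. if j = i then W else points (X j)"]) (use that in auto)
  show ?thesis
  proof (rule morphismI)
    show "continuous_map (zariski (variety_product I X)) (zariski (X i)) (\<lambda>p. p i)"
      unfolding continuous_map
    proof (intro conjI allI impI)
      show "(\<lambda>p. p i) ` points (variety_product I X) \<subseteq> points (X i)"
        unfolding points_product using i by auto
      fix W assume W: "openin (zariski (X i)) W"
      show "openin (zariski (variety_product I X)) {p \<in> points (variety_product I X). p i \<in> W}"
        unfolding box[OF W] using openin_chart[OF c[OF W]] unfolding variety_product_charts .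
    qed
    fix W g assume W: "openin (zariski (X i)) W" "regular (X i) W g"
    show "regular (variety_product I X) {p \<in> points (variety_product I X). p i \<in> W} (\<lambda>p. g (p i))"
      unfolding box[OF W(1)] unfolding variety_product_charts
      by (rule regular_chart_generator[OF c[OF W(1)]], rule CollectI, rule exI[of _ i], rule exI[of _ g]) (use i W(2) in simp)
  qed
qed

lemma morphism_pairing:
  assumes I: "finite I" and M: "sheafy M" and f: "\<And>i. i \<in> I \<Longrightarrow> morphism M (X i) (f i)"
  shows "morphism M (variety_product I X) (\<lambda>p. \<lambda>i\<in>I. f i p)"
  unfolding variety_product_charts
proof (rule morphism_into_charts[OF M])
  show "(\<lambda>i\<in>I. f i p) \<in> points (fspace_of_charts (product_charts I X))" if "p \<in> points M" for p
    using morphism_points[OF f that] unfolding variety_product_charts[symmetric] points_product by auto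
next
  fix U F assume "(U, F) \<in> product_charts I X"
  then obtain W where W: "\<And>i. i \<in> I \<Longrightarrow> openin (zariski (X i)) (W i)" "U = Pi\<^sub>E I W"
     "F = {\<lambda>p. g (p i) | i g. i \<in> I \<and> regular (X i) (W i) g}" unfolding product_charts_def by blast
  have U: "{p \<in> points M. (\<lambda>i\<in>I. f i p) \<in> U} = points M \<inter> (\<Inter>i\<in>I. {p \<in> points M. f i p \<in> W i})"
    unfolding W(2) by (auto simp: PiE_iff)
  show o: "openin (zariski M) {p \<in> points M. (\<lambda>i\<in>I. f i p) \<in> U}"
  proof (cases "I = {}")
    case True
    then show ?thesis unfolding U by simp
  next
    case False
    then show ?thesis unfolding U
      by (intro openin_Int openin_topspace openin_INT2 I morphism_open[OF f W(1)]) auto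
  qed
  fix g assume "g \<in> F"
  then obtain i h where i: "i \<in> I" "regular (X i) (W i) h" "g = (\<lambda>p. h (p i))" unfolding W(3) by blast
  show "regular M {p \<in> points M. (\<lambda>i\<in>I. f i p) \<in> U} (\<lambda>p. g (\<lambda>i\<in>I. f i p))"
    by (rule sheafy_restrict[OF M morphism_open[OF f[OF i(1)] W(1)[OF i(1)]] o _
        morphism_regular[OF f[OF i(1)] W(1)[OF i(1)] i(2)]])
      (use i U in auto)
qed

section \<open>Closures of dense families\<close>

definition closure_model :: "'a fspace \<Rightarrow> ('d \<Rightarrow> 'a) \<Rightarrow> 'd set \<Rightarrow> 'a fspace" where
  "closure_model P e D = subvariety P (zariski P closure_of (e ` D))"

lemma dspace_closure_model:
  assumes P: "sheafy P" and e: "\<And>d. d \<in> D \<Longrightarrow> e d \<in> points P"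
  shows "dspace (closure_model P e D) e D"
  unfolding dspace_def
proof (intro conjI ballI allI impI)
  have sub: "e ` D \<subseteq> zariski P closure_of (e ` D)" using e by (intro closure_of_subset) auto
  show "sheafy (closure_model P e D)" unfolding closure_model_def by (rule sheafy_subvariety[OF P])
  show "e d \<in> points (closure_model P e D)" if "d \<in> D" for d
    unfolding closure_model_def points_subvariety using e sub that by auto
  fix N p assume N: "openin (zariski (closure_model P e D)) N" "p \<in> N"
  then obtain T where T: "openin (zariski P) T" "N = T \<inter> zariski P closure_of (e ` D)"
    unfolding closure_model_def openin_subvariety by blast
  then have "p \<in> zariski P closure_of (e ` D)" "p \<in> T" using N(2) by auto
  then obtain y where "y \<in> e ` D" "y \<in> T" using T(1) unfolding in_closure_of by metis
  then show "\<exists>d\<in>D. e d \<in> N" using T sub by blast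
qed

text \<open>Continuity controls the image: the preimage of a neighbourhood of \<open>f x\<close> is
  open and so meets the dense family.\<close>

lemma morphism_into_closure_model:
  assumes M: "dspace M e' D" and f: "morphism M P f" and fe: "\<And>d. d \<in> D \<Longrightarrow> f (e' d) = e d"
  shows "morphism M (closure_model P e D) f"
  unfolding closure_model_def
proof (rule morphism_into_subvariety[OF dspace_sheafy[OF M] f])
  fix x assume x: "x \<in> points M"
  show "f x \<in> zariski P closure_of (e ` D)" unfolding in_closure_of
  proof (intro conjI allI impI)
    show "f x \<in> points P" by (rule morphism_points[OF f x])
    fix T assume T: "f x \<in> T \<and> openin (zariski P) T"
    then obtain d where "d \<in> D" "e' d \<in> {x \<in> points M. f x \<in> T}"
      using dspace_dense[OF M morphism_open[OF f, of T], of x] x by blast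
    then show "\<exists>y. y \<in> e ` D \<and> y \<in> T" using fe by auto
  qed
qed

section \<open>Isomorphisms and transport along injections\<close>

lemma isomorphic_sym: "isomorphic_varieties X Y \<Longrightarrow> isomorphic_varieties Y X"
  unfolding isomorphic_varieties_def by blast

lemma isomorphic_trans:
  assumes "isomorphic_varieties X Y" "isomorphic_varieties Y Z"
  shows "isomorphic_varieties X Z"
proof -
  obtain f g where 1: "morphism X Y f" "morphism Y X g" "\<And>x. x \<in> points X \<Longrightarrow> g (f x) = x" "\<And>y. y \<in> points Y \<Longrightarrow> f (g y) = y"
    using assms(1) unfolding isomorphic_varieties_def by blast
  obtain h k where 2: "morphism Y Z h" "morphism Z Y k" "\<And>x. x \<in> points Y \<Longrightarrow> k (h x) = x" "\<And>y. y \<in> points Z \<Longrightarrow> h (k y) = y"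
    using assms(2) unfolding isomorphic_varieties_def by blast
  show ?thesis unfolding isomorphic_varieties_def
    using 1(3,4) 2(3,4) morphism_points[OF 1(1)] morphism_points[OF 2(2)]
    by (intro exI[of _ "h \<circ> f"] exI[of _ "g \<circ> k"] conjI morphism_compose[OF 1(1) 2(1)] morphism_compose[OF 2(2) 1(2)]) auto
qed

lemma isomorphic_transport:
  assumes X: "sheafy X" and h: "inj_on h (points X)"
  shows "isomorphic_varieties X (transport h X)"
proof -
  let ?T = "transport h X" and ?k = "inv_into (points X) h"
  have kh: "?k (h x) = x" if "x \<in> points X" for x using h that by simp
  have o: "openin (zariski ?T) S \<longleftrightarrow> (\<exists>U. openin (zariski X) U \<and> S = ?k -` U \<inter> h ` points X)" for S
    unfolding transport_def by (simp add: openin_pullback_topology)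
  have pts: "points ?T = h ` points X"
    unfolding transport_def by (auto simp: topspace_pullback_topology kh)
  have 1: "morphism X ?T h"
  proof (rule morphismI)
    have pre: "{x \<in> points X. h x \<in> ?k -` U \<inter> h ` points X} = U" if "openin (zariski X) U" for U
    proof -
      have "h x \<in> ?k -` U \<inter> h ` points X \<longleftrightarrow> x \<in> U" if "x \<in> points X" for x
        using kh[OF that] that by simp
      then show ?thesis using openin_subset[OF that] by blast
    qed
    show "continuous_map (zariski X) (zariski ?T) h"
      unfolding continuous_map
    proof (intro conjI allI impI)
      show "h ` points X \<subseteq> points ?T" using pts by simp
      fix S assume "openin (zariski ?T) S"
      then obtain U where "openin (zariski X) U" "S = ?k -` U \<inter> h ` points X" unfolding o by blast
      then show "openin (zariski X) {x \<in> points X. h x \<in> S}" using pre by simp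
    qed
    show "regular X {x \<in> points X. h x \<in> W} (\<lambda>x. g (h x))" if "regular ?T W g" for W g
      using that unfolding transport_def by (simp add: comp_def)
  qed
  have 2: "morphism ?T X ?k"
  proof (rule morphismI)
    show "continuous_map (zariski ?T) (zariski X) ?k"
      unfolding continuous_map
    proof (intro conjI allI impI)
      show "?k ` points ?T \<subseteq> points X" using pts kh by auto
      fix U assume U: "openin (zariski X) U"
      have "{x \<in> points ?T. ?k x \<in> U} = ?k -` U \<inter> h ` points X" using pts by auto
      then show "openin (zariski ?T) {x \<in> points ?T. ?k x \<in> U}" using U unfolding o by blast
    qed
    fix W g assume W: "openin (zariski X) W" "regular X W g"
    have e: "{x \<in> points X. h x \<in> {y \<in> points ?T. ?k y \<in> W}} = W"
    proof -
      have "h x \<in> {y \<in> points ?T. ?k y \<in> W} \<longleftrightarrow> x \<in> W" if "x \<in> points X" for x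
        using kh[OF that] that pts by simp
      then show ?thesis using openin_subset[OF W(1)] by blast
    qed
    have "regular X W (\<lambda>x. g (?k (h x)))"
      by (rule sheafy_restrict[OF X W(1) W(1) _ W(2)]) (use openin_subset[OF W(1)] kh in \<open>auto simp: subset_iff\<close>)
    then have "regular X {x \<in> points X. h x \<in> {y \<in> points ?T. ?k y \<in> W}} ((\<lambda>x. g (?k x)) \<circ> h)"
      unfolding e comp_def .
    then show "regular ?T {x \<in> points ?T. ?k x \<in> W} (\<lambda>x. g (?k x))"
      unfolding transport_def by simp
  qed
  show ?thesis unfolding isomorphic_varieties_def
    using 1 2 kh pts by (intro exI[of _ h] exI[of _ ?k]) auto
qed

section \<open>Universal property of the blowup\<close>

lemma ideal_sectionsI: "regular X W f \<Longrightarrow> (\<And>z. z \<in> W \<Longrightarrow> z \<in> Z \<Longrightarrow> f z = 0) \<Longrightarrow> f \<in> ideal_sections X Z W"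
  by (simp add: ideal_sections_def)

lemma ideal_sections_zero: "f \<in> ideal_sections X Z W \<Longrightarrow> z \<in> W \<Longrightarrow> z \<in> Z \<Longrightarrow> f z = 0"
  by (simp add: ideal_sections_def)

lemma ideal_sections_subset:
  assumes "sheafy X" "openin (zariski X) W" "openin (zariski X) V" "V \<subseteq> W" "f \<in> ideal_sections X Z W"
  shows "f \<in> ideal_sections X Z V"
  using assms(4,5) regular_subset[OF assms(1-4)] by (auto simp: ideal_sections_def)

lemma ideal_atI: "openin (zariski X) W \<Longrightarrow> x \<in> W \<Longrightarrow> f \<in> ideal_sections X Z W \<Longrightarrow> f \<in> ideal_at X Z x"
  by (auto simp: ideal_at_def)

lemma ideal_at_common:
  assumes X: "sheafy X" and "f \<in> ideal_at X Z x" "g \<in> ideal_at X Z x"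
  obtains W where "openin (zariski X) W" "x \<in> W" "f \<in> ideal_sections X Z W" "g \<in> ideal_sections X Z W"
proof -
  obtain W V where 1: "openin (zariski X) W" "x \<in> W" "f \<in> ideal_sections X Z W"
    "openin (zariski X) V" "x \<in> V" "g \<in> ideal_sections X Z V" using assms(2,3) unfolding ideal_at_def by auto
  have "openin (zariski X) (W \<inter> V)" using 1 by blast
  then show ?thesis
    using that[of "W \<inter> V"] 1 ideal_sections_subset[OF X 1(1) _ _ 1(3), of "W \<inter> V"]
      ideal_sections_subset[OF X 1(4) _ _ 1(6), of "W \<inter> V"] by auto
qed

lemma blowup_fibre_nonzero:
  assumes "\<phi> \<in> blowup_fibre X Z x"
  obtains f where "f \<in> ideal_at X Z x" "\<phi> f \<noteq> 0"
  using assms unfolding blowup_fibre_def by auto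

lemma blowup_fibre_outside: "\<phi> \<in> blowup_fibre X Z x \<Longrightarrow> f \<notin> ideal_at X Z x \<Longrightarrow> \<phi> f = 0"
  unfolding blowup_fibre_def by auto

lemma blowup_fibre_equation:
  fixes a :: "nat \<Rightarrow> 'a \<Rightarrow> complex" and f :: "nat \<Rightarrow> nat \<Rightarrow> 'a \<Rightarrow> complex"
  assumes "\<phi> \<in> blowup_fibre X Z x" "openin (zariski X) W" "x \<in> W"
    "\<And>j. j < N \<Longrightarrow> regular X W (a j)" "\<And>j i. j < N \<Longrightarrow> i < d \<Longrightarrow> f j i \<in> ideal_sections X Z W"
    "\<And>y. y \<in> W \<Longrightarrow> y \<notin> Z \<Longrightarrow> (\<Sum>j<N. a j y * (\<Prod>i<d. f j i y)) = 0"
  shows "(\<Sum>j<N. a j x * (\<Prod>i<d. \<phi> (f j i))) = 0"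
proof -
  note e = assms(1)[unfolded blowup_fibre_def mem_Collect_eq, THEN conjunct2, THEN conjunct2,
      THEN spec[of _ W], THEN spec[of _ N], THEN spec[of _ d], THEN spec[of _ a], THEN spec[of _ f], THEN mp]
  show ?thesis by (rule e) (use assms(2-) in \<open>simp\<close>)
qed

text \<open>The degree one case of the defining equations of the fibre, with the three terms of - h
  + a f + b g = 0.\<close>

lemma blowup_fibre_linear:
  assumes X: "sheafy X" and phi: "\<phi> \<in> blowup_fibre X Z x" and W: "openin (zariski X) W" "x \<in> W"
    and reg: "regular X W a" "regular X W b"
    and fgh: "f \<in> ideal_sections X Z W" "g \<in> ideal_sections X Z W" "h \<in> ideal_sections X Z W"
    and eq: "\<And>y. y \<in> W \<Longrightarrow> h y = a y * f y + b y * g y"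
  shows "\<phi> h = a x * \<phi> f + b x * \<phi> g"
proof -
  define A where "A j = (if j = 0 then (\<lambda>_. -1) else if j = Suc 0 then a else b)" for j :: nat
  define F where "F j i = (if j = 0 then h else if j = Suc 0 then f else g)" for j i :: nat
  have "(\<Sum>j<3. A j x * (\<Prod>i<1. \<phi> (F j i))) = 0"
    by (rule blowup_fibre_equation[OF phi W])
      (use reg fgh eq sheafy_const[OF X W(1)] in \<open>auto simp: A_def F_def numeral_3_eq_3\<close>)
  then have "a x * \<phi> f - \<phi> h + b x * \<phi> g = 0" by (simp add: A_def F_def numeral_3_eq_3)
  then show ?thesis by algebra
qed

lemma scalar_class_self: "\<phi> \<in> scalar_class \<phi>"
  unfolding scalar_class_def by (rule CollectI, rule exI[of _ 1]) simp

lemma scalar_classE: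
  assumes "\<psi> \<in> scalar_class \<phi>"
  obtains c where "c \<noteq> 0" "\<psi> = (\<lambda>f. c * \<phi> f)"
  using assms unfolding scalar_class_def by blast

lemma scalar_class_scaled:
  assumes "c \<noteq> 0" shows "scalar_class (\<lambda>f. c * \<phi> f) = scalar_class \<phi>"
proof (intro set_eqI iffI)
  fix \<psi> assume "\<psi> \<in> scalar_class (\<lambda>f. c * \<phi> f)"
  then obtain k where "k \<noteq> 0" "\<psi> = (\<lambda>f. k * (c * \<phi> f))" by (rule scalar_classE)
  then show "\<psi> \<in> scalar_class \<phi>" unfolding scalar_class_def using assms
    by (intro CollectI exI[of _ "k * c"]) (auto simp: mult.assoc)
next
  fix \<psi> assume "\<psi> \<in> scalar_class \<phi>"
  then obtain k where "k \<noteq> 0" "\<psi> = (\<lambda>f. k * \<phi> f)" by (rule scalar_classE)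
  then show "\<psi> \<in> scalar_class (\<lambda>f. c * \<phi> f)" unfolding scalar_class_def using assms
    by (intro CollectI exI[of _ "k / c"]) auto
qed

lemma scalar_class_eqD:
  assumes "scalar_class \<phi> = scalar_class \<psi>"
  obtains c where "c \<noteq> 0" "\<phi> = (\<lambda>f. c * \<psi> f)"
  using scalar_class_self[of \<phi>] unfolding assms by (rule scalar_classE)

definition section_quotient :: "('a \<Rightarrow> complex) \<Rightarrow> ('a \<Rightarrow> complex) \<Rightarrow> 'a blowup_point \<Rightarrow> complex" where
  "section_quotient h f = (\<lambda>p. (let \<phi> = (SOME \<phi>. \<phi> \<in> snd p) in \<phi> h / \<phi> f))"

lemma section_quotient: "section_quotient h f (x, scalar_class \<phi>) = \<phi> h / \<phi> f"
proof -
  have "(SOME \<psi>. \<psi> \<in> scalar_class \<phi>) \<in> scalar_class \<phi>"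
    by (rule someI[where P="\<lambda>\<psi>. \<psi> \<in> scalar_class \<phi>", OF scalar_class_self])
  then obtain c where "c \<noteq> 0" "(SOME \<psi>. \<psi> \<in> scalar_class \<phi>) = (\<lambda>f. c * \<phi> f)" by (rule scalar_classE)
  then show ?thesis unfolding section_quotient_def by simp
qed

section \<open>Charts of the blowup\<close>

definition blowup_chart :: "'a fspace \<Rightarrow> 'a set \<Rightarrow> 'a set \<Rightarrow> ('a \<Rightarrow> complex) \<Rightarrow> 'a blowup_point set" where
  "blowup_chart X Z W f = {(x, scalar_class \<phi>) | x \<phi>. x \<in> W \<and> \<phi> \<in> blowup_fibre X Z x \<and> \<phi> f \<noteq> 0}"

definition blowup_functions :: "'a fspace \<Rightarrow> 'a set \<Rightarrow> 'a set \<Rightarrow> ('a \<Rightarrow> complex) \<Rightarrow> ('a blowup_point \<Rightarrow> complex) set" where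
  "blowup_functions X Z W f = {\<lambda>p. a (fst p) | a. regular X W a} \<union>
       {section_quotient h f | h. h \<in> ideal_sections X Z W}"

definition blowup_charts :: "'a fspace \<Rightarrow> 'a set \<Rightarrow> ('a blowup_point set \<times> ('a blowup_point \<Rightarrow> complex) set) set" where
  "blowup_charts X Z = {(blowup_chart X Z W f, blowup_functions X Z W f) | W f.
     openin (zariski X) W \<and> f \<in> ideal_sections X Z W}"

lemma blowup_eq: "blowup X Z = fspace_of_charts (blowup_charts X Z)"
  unfolding blowup_def blowup_charts_def blowup_chart_def blowup_functions_def section_quotient_def ..

lemma blowup_chartI: "x \<in> W \<Longrightarrow> \<phi> \<in> blowup_fibre X Z x \<Longrightarrow> \<phi> f \<noteq> 0 \<Longrightarrow> (x, scalar_class \<phi>) \<in> blowup_chart X Z W f"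
  unfolding blowup_chart_def by blast

lemma blowup_chartE:
  assumes "p \<in> blowup_chart X Z W f"
  obtains x \<phi> where "p = (x, scalar_class \<phi>)" "x \<in> W" "\<phi> \<in> blowup_fibre X Z x" "\<phi> f \<noteq> 0"
  using assms unfolding blowup_chart_def by blast

lemma blowup_chart_nonzero:
  assumes "(x, scalar_class \<phi>) \<in> blowup_chart X Z W f" shows "\<phi> f \<noteq> 0" "x \<in> W"
proof -
  obtain \<psi> where "x \<in> W" "\<psi> f \<noteq> 0" "scalar_class \<phi> = scalar_class \<psi>"
    using assms by (auto elim: blowup_chartE)
  moreover from this(3) obtain c where "c \<noteq> 0" "\<phi> = (\<lambda>f. c * \<psi> f)" by (rule scalar_class_eqD)
  ultimately show "\<phi> f \<noteq> 0" "x \<in> W" by auto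
qed

lemma blowup_charts_mem:
  "openin (zariski X) W \<Longrightarrow> f \<in> ideal_sections X Z W \<Longrightarrow> (blowup_chart X Z W f, blowup_functions X Z W f) \<in> blowup_charts X Z"
  unfolding blowup_charts_def by blast

text \<open>Two charts at a common point are dominated by the chart of \<open>f\<close> over
  \<open>W \<inter> W'\<close>: the coordinate f' / f is nonzero at the point, its nonvanishing puts
  a point into the chart of \<open>f'\<close>, and h / f' is the quotient of h / f by f' /
  f.\<close>

lemma blowup_directed:
  assumes X: "sheafy X" shows "directed_atlas (blowup_charts X Z)"
  unfolding directed_atlas_def
proof (intro allI impI, elim conjE)
  fix U F U' F' p
  assume "(U, F) \<in> blowup_charts X Z" "(U', F') \<in> blowup_charts X Z" and p: "p \<in> U" "p \<in> U'"
  then obtain W f W' f' where W: "openin (zariski X) W" "f \<in> ideal_sections X Z W"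
      "U = blowup_chart X Z W f" "F = blowup_functions X Z W f"
    and W': "openin (zariski X) W'" "f' \<in> ideal_sections X Z W'"
      "U' = blowup_chart X Z W' f'" "F' = blowup_functions X Z W' f'"
    unfolding blowup_charts_def by blast
  let ?V = "W \<inter> W'" and ?U = "blowup_chart X Z (W \<inter> W') f" and ?F = "blowup_functions X Z (W \<inter> W') f"
  have V: "openin (zariski X) ?V" using W W' by blast
  obtain x \<phi> where x: "p = (x, scalar_class \<phi>)" "x \<in> W" "\<phi> \<in> blowup_fibre X Z x" "\<phi> f \<noteq> 0"
    using p(1) unfolding W(3) by (rule blowup_chartE)
  have x': "\<phi> f' \<noteq> 0" "x \<in> W'" using p(2) blowup_chart_nonzero[of x \<phi>] unfolding W'(3) x(1) by auto
  have fV: "f \<in> ideal_sections X Z ?V" "f' \<in> ideal_sections X Z ?V"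
    using ideal_sections_subset[OF X W(1) V _ W(2)] ideal_sections_subset[OF X W'(1) V _ W'(2)] by auto
  have pV: "p \<in> ?U" unfolding x(1) by (rule blowup_chartI) (use x x' in auto)
  have gen: "section_quotient h f \<in> function_algebra ?F" if "h \<in> ideal_sections X Z ?V" for h
    by (rule function_algebra.gen) (use that in \<open>auto simp: blowup_functions_def\<close>)
  have base: "(\<lambda>p. a (fst p)) \<in> function_algebra ?F" if "regular X ?V a" for a
    by (rule function_algebra.gen) (use that in \<open>auto simp: blowup_functions_def\<close>)
  have 1: "g \<in> function_algebra ?F" if "g \<in> F" for g
  proof -
    from that consider a where "regular X W a" "g = (\<lambda>p. a (fst p))" | h where "h \<in> ideal_sections X Z W" "g = section_quotient h f"
      unfolding W(4) blowup_functions_def by blast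
    then show ?thesis
      using gen[OF ideal_sections_subset[OF X W(1) V]] base[OF regular_subset[OF X W(1) V]] by cases auto
  qed
  have d1: "dominated U F ?U ?F p"
    unfolding dominated_def
  proof (intro conjI pV ballI)
    show "\<exists>b\<in>function_algebra ?F. b p \<noteq> 0 \<and> (\<forall>y\<in>?U. b y \<noteq> 0 \<longrightarrow> y \<in> U)"
      unfolding W(3) by (rule bexI[OF _ function_algebra.const[of 1]]) (auto elim!: blowup_chartE intro: blowup_chartI)
    show "local_fraction ?U ?F p g" if "g \<in> F" for g by (rule local_fraction_algebra[OF 1[OF that]])
  qed
  have U': "y \<in> U'" if "y \<in> ?U" "section_quotient f' f y \<noteq> 0" for y
  proof -
    from that(1) obtain z \<psi> where z: "y = (z, scalar_class \<psi>)" "z \<in> ?V" "\<psi> \<in> blowup_fibre X Z z" "\<psi> f \<noteq> 0"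
      by (rule blowup_chartE)
    show ?thesis unfolding z(1) W'(3)
      by (rule blowup_chartI) (use z that(2) in \<open>auto simp: section_quotient\<close>)
  qed
  have nz: "section_quotient f' f p \<noteq> 0" unfolding x(1) section_quotient using x x' by simp
  have d2: "dominated U' F' ?U ?F p"
    unfolding dominated_def
  proof (intro conjI pV ballI)
    show "\<exists>b\<in>function_algebra ?F. b p \<noteq> 0 \<and> (\<forall>y\<in>?U. b y \<noteq> 0 \<longrightarrow> y \<in> U')"
      using U' nz by (intro bexI[OF _ gen[OF fV(2)]]) auto
    fix g assume "g \<in> F'"
    then consider a where "regular X W' a" "g = (\<lambda>p. a (fst p))" | h where "h \<in> ideal_sections X Z W'" "g = section_quotient h f'"
      unfolding W'(4) blowup_functions_def by blast
    then show "local_fraction ?U ?F p g"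
    proof cases
      case 1
      then show ?thesis using base[OF regular_subset[OF X W'(1) V]] by (auto intro: local_fraction_algebra)
    next
      case 2
      have h: "h \<in> ideal_sections X Z ?V" by (rule ideal_sections_subset[OF X W'(1) V _ 2(1)]) auto
      show ?thesis unfolding 2(2)
      proof (rule local_fractionI[OF gen[OF h] gen[OF fV(2)] nz])
        fix y assume y: "y \<in> ?U" "section_quotient f' f y \<noteq> 0"
        obtain z \<psi> where z: "y = (z, scalar_class \<psi>)" "z \<in> ?V" "\<psi> \<in> blowup_fibre X Z z" "\<psi> f \<noteq> 0"
          using y(1) by (rule blowup_chartE)
        show "section_quotient h f' y = section_quotient h f y / section_quotient f' f y"
          unfolding z(1) section_quotient using z(4) by simp
      qed
    qed
  qed
  show "\<exists>V G. (V, G) \<in> blowup_charts X Z \<and> dominated U F V G p \<and> dominated U' F' V G p"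
    using d1 d2 blowup_charts_mem[OF V fV(1)] by blast
qed

lemma sheafy_blowup: "sheafy X \<Longrightarrow> sheafy (blowup X Z)"
  unfolding blowup_eq by (rule sheafy_charts[OF blowup_directed])

lemma blowup_pointE:
  assumes "p \<in> points (blowup X Z)"
  obtains x \<phi> where "p = (x, scalar_class \<phi>)" "x \<in> points X" "\<phi> \<in> blowup_fibre X Z x"
proof -
  obtain W f where W: "openin (zariski X) W" "p \<in> blowup_chart X Z W f"
    using assms unfolding blowup_eq points_charts blowup_charts_def by auto
  then obtain x \<phi> where "p = (x, scalar_class \<phi>)" "x \<in> W" "\<phi> \<in> blowup_fibre X Z x" by (auto elim: blowup_chartE)
  then show ?thesis using that openin_subset[OF W(1)] by blast
qed

lemma openin_blowup_chart:
  assumes "openin (zariski X) W" "f \<in> ideal_sections X Z W"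
  shows "openin (zariski (blowup X Z)) (blowup_chart X Z W f)"
  unfolding blowup_eq by (rule openin_chart[OF blowup_charts_mem[OF assms]])

lemma blowup_pointI:
  assumes "\<phi> \<in> blowup_fibre X Z x"
  shows "(x, scalar_class \<phi>) \<in> points (blowup X Z)"
proof -
  obtain f where "f \<in> ideal_at X Z x" "\<phi> f \<noteq> 0" using assms by (rule blowup_fibre_nonzero)
  then obtain W where "openin (zariski X) W" "x \<in> W" "f \<in> ideal_sections X Z W" unfolding ideal_at_def by blast
  then show ?thesis using openin_subset[OF openin_blowup_chart, of X W f Z] blowup_chartI[OF _ assms \<open>\<phi> f \<noteq> 0\<close>] by blast
qed

lemma morphism_blowdown:
  assumes X: "sheafy X" shows "morphism (blowup X Z) X fst"
proof -
  have loc: "\<exists>W' f. openin (zariski X) W' \<and> W' \<subseteq> W \<and> f \<in> ideal_sections X Z W' \<and> p \<in> blowup_chart X Z W' f"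
    if p: "p \<in> points (blowup X Z)" and W: "openin (zariski X) W" "fst p \<in> W" for W p
  proof -
    obtain x \<phi> where x: "p = (x, scalar_class \<phi>)" "\<phi> \<in> blowup_fibre X Z x" using p by (rule blowup_pointE)
    obtain f where f: "f \<in> ideal_at X Z x" "\<phi> f \<noteq> 0" using x(2) by (rule blowup_fibre_nonzero)
    then obtain V where V: "openin (zariski X) V" "x \<in> V" "f \<in> ideal_sections X Z V" unfolding ideal_at_def by blast
    have o: "openin (zariski X) (V \<inter> W)" using V W by blast
    show ?thesis
      using o ideal_sections_subset[OF X V(1) o _ V(3)] blowup_chartI[of x "V \<inter> W", OF _ x(2) f(2)] x(1) V W
      by (intro exI[of _ "V \<inter> W"] exI[of _ f]) auto
  qed
  have chart: "blowup_chart X Z W' f \<subseteq> {p \<in> points (blowup X Z). fst p \<in> W}"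
    if "openin (zariski X) W'" "W' \<subseteq> W" "f \<in> ideal_sections X Z W'" for W W' f
  proof
    fix p assume p: "p \<in> blowup_chart X Z W' f"
    then show "p \<in> {p \<in> points (blowup X Z). fst p \<in> W}"
      using that(2) by (auto elim!: blowup_chartE intro: blowup_pointI)
  qed
  have o: "openin (zariski (blowup X Z)) {p \<in> points (blowup X Z). fst p \<in> W}" if W: "openin (zariski X) W" for W
  proof (subst openin_subopen, intro ballI)
    fix p assume "p \<in> {p \<in> points (blowup X Z). fst p \<in> W}"
    then obtain W' f where f: "openin (zariski X) W'" "W' \<subseteq> W" "f \<in> ideal_sections X Z W'" "p \<in> blowup_chart X Z W' f"
      using loc[OF _ W] by blast
    show "\<exists>T. openin (zariski (blowup X Z)) T \<and> p \<in> T \<and> T \<subseteq> {p \<in> points (blowup X Z). fst p \<in> W}"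
      by (intro exI[of _ "blowup_chart X Z W' f"] conjI openin_blowup_chart chart f)
  qed
  show ?thesis
  proof (rule morphismI)
    show "continuous_map (zariski (blowup X Z)) (zariski X) fst"
      unfolding continuous_map using o by (auto elim: blowup_pointE)
    fix W a assume W: "openin (zariski X) W" "regular X W a"
    show "regular (blowup X Z) {p \<in> points (blowup X Z). fst p \<in> W} (\<lambda>p. a (fst p))"
    proof (rule sheafy_local[OF sheafy_blowup[OF X] o[OF W(1)]])
      fix p assume "p \<in> {p \<in> points (blowup X Z). fst p \<in> W}"
      then obtain W' f where f: "openin (zariski X) W'" "W' \<subseteq> W" "f \<in> ideal_sections X Z W'" "p \<in> blowup_chart X Z W' f"
        using loc[OF _ W(1)] by blast
      have "(\<lambda>p. a (fst p)) \<in> blowup_functions X Z W' f"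
        unfolding blowup_functions_def using regular_subset[OF X W(1) f(1,2) W(2)] by auto
      then have "regular (blowup X Z) (blowup_chart X Z W' f) (\<lambda>p. a (fst p))"
        unfolding blowup_eq by (rule regular_chart_generator[OF blowup_charts_mem[OF f(1,3)]])
      then show "\<exists>V g. openin (zariski (blowup X Z)) V \<and> p \<in> V \<and> regular (blowup X Z) V g \<and>
         (\<forall>y\<in>V \<inter> {p \<in> points (blowup X Z). fst p \<in> W}. a (fst y) = g y)"
        using openin_blowup_chart[OF f(1,3)] f(4)
        by (intro exI[of _ "blowup_chart X Z W' f"] exI[of _ "\<lambda>p. a (fst p)"]) auto
    qed
  qed
qed

text \<open>At a lifted point of the family the functional is evaluation, so the chart coordinate h
  / f restricts to the quotient of the values of \<open>h\<close> and \<open>f\<close>. Hence a map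
  to the blowup makes these quotients extend.\<close>

lemma germ_section_quotient:
  assumes X: "sheafy X" and psi: "morphism M (blowup X Z) \<psi>" "\<forall>d\<in>D. \<psi> (e d) = blowup_lift X Z (e' d)"
    and p: "p \<in> points M" "\<psi> p = (x, scalar_class \<phi>)" "\<phi> \<in> blowup_fibre X Z x" "\<phi> f \<noteq> 0"
    and W: "openin (zariski X) W" "x \<in> W" "f \<in> ideal_sections X Z W" "h \<in> ideal_sections X Z W"
  shows "germ M e D p (\<lambda>d. h (e' d) / f (e' d)) (\<phi> h / \<phi> f)"
    and "\<exists>N. openin (zariski M) N \<and> p \<in> N \<and> (\<forall>d\<in>D. e d \<in> N \<longrightarrow> e' d \<in> W \<and> f (e' d) \<noteq> 0)"
proof -
  let ?U = "blowup_chart X Z W f" let ?N = "{q \<in> points M. \<psi> q \<in> ?U}"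
  note o = openin_blowup_chart[OF W(1,3)]
  have r: "regular (blowup X Z) ?U (section_quotient h f)"
    unfolding blowup_eq
    by (rule regular_chart_generator[OF blowup_charts_mem[OF W(1,3)]]) (use W(4) in \<open>auto simp: blowup_functions_def\<close>)
  have pN: "p \<in> ?N" using p W by (auto intro: blowup_chartI)
  have D: "e' d \<in> W \<and> f (e' d) \<noteq> 0 \<and> section_quotient h f (\<psi> (e d)) = h (e' d) / f (e' d)"
    if d: "d \<in> D" "e d \<in> ?N" for d
  proof -
    have "(e' d, scalar_class (\<lambda>f. if f \<in> ideal_at X Z (e' d) then f (e' d) else 0)) \<in> ?U"
      using d psi(2)[rule_format, OF d(1)] unfolding blowup_lift_def by simp
    from blowup_chart_nonzero[OF this] have 1: "e' d \<in> W" "f (e' d) \<noteq> 0" by (auto split: if_splits)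
    have "f \<in> ideal_at X Z (e' d)" "h \<in> ideal_at X Z (e' d)" using ideal_atI[OF W(1) 1(1)] W by auto
    then show ?thesis using 1 unfolding psi(2)[rule_format, OF d(1)] blowup_lift_def section_quotient by simp
  qed
  show "germ M e D p (\<lambda>d. h (e' d) / f (e' d)) (\<phi> h / \<phi> f)"
    by (rule germI[OF morphism_open[OF psi(1) o] pN morphism_regular[OF psi(1) o r]])
      (use D p(2) in \<open>auto simp: section_quotient\<close>)
  show "\<exists>N. openin (zariski M) N \<and> p \<in> N \<and> (\<forall>d\<in>D. e d \<in> N \<longrightarrow> e' d \<in> W \<and> f (e' d) \<noteq> 0)"
    using morphism_open[OF psi(1) o] pN D by (intro exI[of _ ?N]) auto
qed

text \<open>The class of \<phi> is known once all ratios \<phi> h / \<phi> f are, and these are germ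
  values of expressions on \<open>D\<close> shared by both maps. That a denominator for one map also
  serves the other is seen from f' / f and f / f', which extend with product 1.\<close>

lemma morphism_blowup_unique:
  assumes M: "dspace M e D" and X: "sheafy X"
    and psi: "morphism M (blowup X Z) \<psi>" "\<forall>d\<in>D. \<psi> (e d) = blowup_lift X Z (e' d)"
    and psi': "morphism M (blowup X Z) \<psi>'" "\<forall>d\<in>D. \<psi>' (e d) = blowup_lift X Z (e' d)"
    and p: "p \<in> points M" and fst: "fst (\<psi> p) = fst (\<psi>' p)"
  shows "\<psi> p = \<psi>' p"
proof -
  note S = dspace_sheafy[OF M]
  obtain x \<phi> where x: "\<psi> p = (x, scalar_class \<phi>)" "\<phi> \<in> blowup_fibre X Z x"
    using morphism_points[OF psi(1) p] by (rule blowup_pointE)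
  obtain x' \<phi>' where x': "\<psi>' p = (x', scalar_class \<phi>')" "\<phi>' \<in> blowup_fibre X Z x'"
    using morphism_points[OF psi'(1) p] by (rule blowup_pointE)
  have xx: "x' = x" using fst x x' by simp
  obtain f where f: "f \<in> ideal_at X Z x" "\<phi> f \<noteq> 0" using x(2) by (rule blowup_fibre_nonzero)
  obtain f' where f': "f' \<in> ideal_at X Z x" "\<phi>' f' \<noteq> 0" using x'(2) unfolding xx by (rule blowup_fibre_nonzero)
  obtain W where W: "openin (zariski X) W" "x \<in> W" "f \<in> ideal_sections X Z W" "f' \<in> ideal_sections X Z W"
    using ideal_at_common[OF X f(1) f'(1)] .
  have g1: "germ M e D p (\<lambda>d. f' (e' d) / f (e' d)) (\<phi> f' / \<phi> f)"
    using germ_section_quotient(1)[where \<psi>=\<psi> and D=D and e=e and e'=e', OF X psi p x f(2) W(1,2,3,4)] .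
  have g2: "germ M e D p (\<lambda>d. f (e' d) / f' (e' d)) (\<phi>' f / \<phi>' f')"
    using germ_section_quotient(1)[where \<psi>=\<psi>' and D=D and e=e and e'=e', OF X psi' p x'[unfolded xx] f'(2) W(1,2,4,3)] .
  from germ_section_quotient(2)[where \<psi>=\<psi> and D=D and e=e and e'=e', OF X psi p x f(2) W(1,2,3,4)]
  obtain N where N: "openin (zariski M) N" "p \<in> N" "\<forall>d\<in>D. e d \<in> N \<longrightarrow> e' d \<in> W \<and> f (e' d) \<noteq> 0"
    by (elim exE conjE) (rule that)
  from germ_section_quotient(2)[where \<psi>=\<psi>' and D=D and e=e and e'=e', OF X psi' p x'[unfolded xx] f'(2) W(1,2,4,3)]
  obtain N' where N': "openin (zariski M) N'" "p \<in> N'" "\<forall>d\<in>D. e d \<in> N' \<longrightarrow> e' d \<in> W \<and> f' (e' d) \<noteq> 0"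
    by (elim exE conjE) (rule that)
  have "germ M e D p (\<lambda>_. 1) ((\<phi> f' / \<phi> f) * (\<phi>' f / \<phi>' f'))"
    by (rule germ_cong[OF S germ_mult[OF S g1 g2], of "N \<inter> N'"]) (use N N' in auto)
  from germ_unique[OF M this germ_const[OF S p]] have c1: "(\<phi> f' / \<phi> f) * (\<phi>' f / \<phi>' f') = 1" .
  have main: "\<phi> h = (\<phi> f / \<phi>' f) * \<phi>' h" for h
  proof (cases "h \<in> ideal_at X Z x")
    case False
    then show ?thesis using blowup_fibre_outside[OF x(2)] blowup_fibre_outside[OF x'(2)] unfolding xx by auto
  next
    case True
    obtain V where V: "openin (zariski X) V" "x \<in> V" "f \<in> ideal_sections X Z V" "h \<in> ideal_sections X Z V"
      using ideal_at_common[OF X f(1) True] .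
    have f2: "\<phi>' f \<noteq> 0" using c1 by auto
    have 1: "germ M e D p (\<lambda>d. h (e' d) / f (e' d)) (\<phi> h / \<phi> f)"
      using germ_section_quotient(1)[where \<psi>=\<psi> and D=D and e=e and e'=e', OF X psi p x f(2) V] .
    have 2: "germ M e D p (\<lambda>d. h (e' d) / f (e' d)) (\<phi>' h / \<phi>' f)"
      using germ_section_quotient(1)[where \<psi>=\<psi>' and D=D and e=e and e'=e', OF X psi' p x'[unfolded xx] f2 V] .
    show ?thesis using germ_unique[OF M 1 2] f(2) f2 by (simp add: field_simps)
  qed
  have "scalar_class \<phi> = scalar_class (\<lambda>h. (\<phi> f / \<phi>' f) * \<phi>' h)"
    by (rule arg_cong[where f=scalar_class], rule ext, rule main)
  also have "\<dots> = scalar_class \<phi>'" using c1 f(2) by (intro scalar_class_scaled) auto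
  finally show ?thesis using x x' xx by simp
qed

text \<open>Along \<open>\<pi>\<close>, the section \<open>f\<close> generates the pullback of the ideal sheaf of \<open>Z\<close> near \<open>p\<close>.\<close>

definition local_generator :: "'b fspace \<Rightarrow> ('d \<Rightarrow> 'b) \<Rightarrow> 'd set \<Rightarrow> 'a fspace \<Rightarrow> 'a set \<Rightarrow> ('d \<Rightarrow> 'a) \<Rightarrow> ('b \<Rightarrow> 'a) \<Rightarrow>
    'b \<Rightarrow> ('a \<Rightarrow> complex) \<Rightarrow> bool" where
  "local_generator M e D X Z e' \<pi> p f \<longleftrightarrow> (\<exists>N W. openin (zariski M) N \<and> p \<in> N \<and> openin (zariski X) W \<and>
     (\<forall>q\<in>N. \<pi> q \<in> W) \<and> f \<in> ideal_sections X Z W \<and> (\<forall>d\<in>D. e d \<in> N \<longrightarrow> f (e' d) \<noteq> 0) \<and>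
     (\<forall>q\<in>N. \<forall>h\<in>ideal_at X Z (\<pi> q). \<exists>c. germ M e D q (\<lambda>d. h (e' d) / f (e' d)) c))"

text \<open>The universal property for maps along which the ideal becomes principal: with a local
  generator \<open>f\<close>, the point over \<open>\<pi> p\<close> is the functional that sends
  \<open>h\<close> to the value at \<open>p\<close> of h / f, and \<open>f\<close> itself to
  1.\<close>

lemma blowup_universal:
  fixes X :: "'a fspace"
  assumes M: "dspace M e D" and X: "sheafy X" and Z: "closedin (zariski X) Z"
    and pi: "morphism M X \<pi>" "\<And>d. d \<in> D \<Longrightarrow> \<pi> (e d) = e' d"
    and DZ: "\<And>d. d \<in> D \<Longrightarrow> e' d \<notin> Z"
    and gen: "\<And>p. p \<in> points M \<Longrightarrow> \<exists>f. local_generator M e D X Z e' \<pi> p f"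
  shows "\<exists>\<psi>. morphism M (blowup X Z) \<psi> \<and> (\<forall>p\<in>points M. fst (\<psi> p) = \<pi> p) \<and>
     (\<forall>p\<in>points M. \<pi> p \<notin> Z \<longrightarrow> \<psi> p = blowup_lift X Z (\<pi> p))"
proof -
  note S = dspace_sheafy[OF M]
  define val where "val p f h = (THE c. germ M e D p (\<lambda>d. h (e' d) / f (e' d)) c)" for p f h
  define Phi where "Phi p f = (\<lambda>h. if h \<in> ideal_at X Z (\<pi> p) then val p f h else 0)" for p f
  let ?G = "local_generator M e D X Z e' \<pi>"
  have val: "val p f h = c" if "germ M e D p (\<lambda>d. h (e' d) / f (e' d)) c" for p f h c
    unfolding val_def using that germ_unique[OF M] by blast
  have genE: "\<exists>c. germ M e D p (\<lambda>d. h (e' d) / f (e' d)) c" if "?G p f" "h \<in> ideal_at X Z (\<pi> p)" for p f h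
    using that unfolding local_generator_def by blast
  have valg: "germ M e D p (\<lambda>d. h (e' d) / f (e' d)) (val p f h)" if "?G p f" "h \<in> ideal_at X Z (\<pi> p)" for p f h
    using genE[OF that] val by blast
  have Gpt: "p \<in> points M" if "?G p f" for p f
    using that openin_subset unfolding local_generator_def by blast
  have Gself: "f \<in> ideal_at X Z (\<pi> p)" "\<exists>N. openin (zariski M) N \<and> p \<in> N \<and> (\<forall>d\<in>D. e d \<in> N \<longrightarrow> f (e' d) \<noteq> 0) \<and> (\<forall>q\<in>N. ?G q f)"
    if G: "?G p f" for p f
  proof -
    obtain N W where NW: "openin (zariski M) N" "p \<in> N" "openin (zariski X) W"
     "\<forall>q\<in>N. \<pi> q \<in> W" "f \<in> ideal_sections X Z W" "\<forall>d\<in>D. e d \<in> N \<longrightarrow> f (e' d) \<noteq> 0"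
     "\<forall>q\<in>N. \<forall>h\<in>ideal_at X Z (\<pi> q). \<exists>c. germ M e D q (\<lambda>d. h (e' d) / f (e' d)) c"
      using G unfolding local_generator_def by blast
    show "f \<in> ideal_at X Z (\<pi> p)" using NW ideal_atI[of X W "\<pi> p" f Z] by blast
    have "?G q f" if "q \<in> N" for q unfolding local_generator_def using NW that by blast
    then show "\<exists>N. openin (zariski M) N \<and> p \<in> N \<and> (\<forall>d\<in>D. e d \<in> N \<longrightarrow> f (e' d) \<noteq> 0) \<and> (\<forall>q\<in>N. ?G q f)"
      using NW by blast
  qed
  have fibre: "Phi p f \<in> blowup_fibre X Z (\<pi> p)" if G: "?G p f" for p f
  proof -
    note p = Gpt[OF G]
    obtain N where N: "openin (zariski M) N" "p \<in> N" "\<forall>d\<in>D. e d \<in> N \<longrightarrow> f (e' d) \<noteq> 0"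
      using Gself(2)[OF G] by blast
    have one: "Phi p f f = 1"
    proof -
      have "germ M e D p (\<lambda>d. f (e' d) / f (e' d)) 1"
        by (rule germ_cong[OF S germ_const[OF S p, of e D 1] N(1,2)]) (use N(3) in auto)
      then show ?thesis unfolding Phi_def using val Gself(1)[OF G] by simp
    qed
    show ?thesis unfolding blowup_fibre_def
    proof (intro CollectI conjI allI impI)
      show "\<exists>fa\<in>ideal_at X Z (\<pi> p). Phi p f fa \<noteq> 0"
        using one Gself(1)[OF G] by (intro bexI[of _ f]) auto
      show "Phi p f h = 0" if "h \<notin> ideal_at X Z (\<pi> p)" for h using that unfolding Phi_def by simp
      fix W k n and a :: "nat \<Rightarrow> 'a \<Rightarrow> complex" and g :: "nat \<Rightarrow> nat \<Rightarrow> 'a \<Rightarrow> complex"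
      assume "openin (zariski X) W \<and> \<pi> p \<in> W \<and> (\<forall>j<k. regular X W (a j)) \<and>
          (\<forall>j<k. \<forall>i<n. g j i \<in> ideal_sections X Z W) \<and>
          (\<forall>y\<in>W - Z. (\<Sum>j<k. a j y * (\<Prod>i<n. g j i y)) = 0)"
      then have W: "openin (zariski X) W" "\<pi> p \<in> W" and a: "\<And>j. j < k \<Longrightarrow> regular X W (a j)"
        and g: "\<And>j i. j < k \<Longrightarrow> i < n \<Longrightarrow> g j i \<in> ideal_sections X Z W"
        and z: "\<And>y. y \<in> W \<Longrightarrow> y \<notin> Z \<Longrightarrow> (\<Sum>j<k. a j y * (\<Prod>i<n. g j i y)) = 0" by auto
      have gi: "g j i \<in> ideal_at X Z (\<pi> p)" if "j < k" "i < n" for j i using ideal_atI[OF W g[OF that]] .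
      let ?h = "\<lambda>d. \<Sum>j<k. a j (e' d) * (\<Prod>i<n. g j i (e' d) / f (e' d))"
      have ga: "germ M e D p (\<lambda>d. a j (e' d)) (a j (\<pi> p))" if "j < k" for j
        by (rule germ_pullback[OF pi(1) pi(2) p regular_germ[OF W(1) a[OF that] W(2)]])
      have "germ M e D p ?h (\<Sum>j<k. a j (\<pi> p) * (\<Prod>i<n. Phi p f (g j i)))"
      proof (intro germ_sum[OF S p] germ_mult[OF S] germ_prod[OF S p])
        fix j i assume "j \<in> {..<k}" "i \<in> {..<n}"
        then show "germ M e D p (\<lambda>d. g j i (e' d) / f (e' d)) (Phi p f (g j i))"
          unfolding Phi_def using gi valg[OF G] by simp
      qed (use ga in auto)
      \<comment> \<open>The relation is homogeneous of degree \<open>n\<close>, so division by the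
        \<open>n\<close>-th power of \<open>f\<close> turns it into the same relation between
        quotients; it holds on \<open>D\<close> near \<open>p\<close> because \<open>D\<close>
        avoids \<open>Z\<close>.\<close>
      moreover have "germ M e D p ?h 0"
      proof (rule germ_cong[OF S germ_const[OF S p, of e D 0]])
        show "openin (zariski M) (N \<inter> {q \<in> points M. \<pi> q \<in> W})" using N(1) morphism_open[OF pi(1) W(1)] by blast
        show "p \<in> N \<inter> {q \<in> points M. \<pi> q \<in> W}" using N p W by blast
        fix d assume d: "d \<in> D" "e d \<in> N \<inter> {q \<in> points M. \<pi> q \<in> W}"
        then have e': "e' d \<in> W" "e' d \<notin> Z" "f (e' d) \<noteq> 0" using pi(2) DZ N(3) by auto
        have "?h d = (\<Sum>j<k. a j (e' d) * (\<Prod>i<n. g j i (e' d))) / f (e' d) ^ n"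
          by (simp add: prod_dividef sum_divide_distrib)
        then show "0 = ?h d" using z[OF e'(1,2)] by simp
      qed
      ultimately show "(\<Sum>j<k. a j (\<pi> p) * (\<Prod>i<n. Phi p f (g j i))) = 0" by (rule germ_unique[OF M])
    qed
  qed
  \<comment> \<open>Each of two local generators divides the other, so the two functionals differ by
    a nonzero constant.\<close>
  have indep: "scalar_class (Phi p f) = scalar_class (Phi p f')" if G: "?G p f" and G': "?G p f'" for p f f'
  proof -
    note p = Gpt[OF G]
    obtain N where N: "openin (zariski M) N" "p \<in> N" "\<forall>d\<in>D. e d \<in> N \<longrightarrow> f (e' d) \<noteq> 0"
      using Gself(2)[OF G] by blast
    obtain N' where N': "openin (zariski M) N'" "p \<in> N'" "\<forall>d\<in>D. e d \<in> N' \<longrightarrow> f' (e' d) \<noteq> 0"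
      using Gself(2)[OF G'] by blast
    have o: "openin (zariski M) (N \<inter> N')" "p \<in> N \<inter> N'" using N N' by auto
    let ?c = "val p f f'" and ?c' = "val p f' f"
    note c = valg[OF G Gself(1)[OF G']] and c' = valg[OF G' Gself(1)[OF G]]
    have "germ M e D p (\<lambda>_. 1) (?c * ?c')"
      by (rule germ_cong[OF S germ_mult[OF S c c'] o]) (use N N' in auto)
    from germ_unique[OF M this germ_const[OF S p]] have cc: "?c * ?c' = 1" .
    have "Phi p f h = ?c * Phi p f' h" for h
    proof (cases "h \<in> ideal_at X Z (\<pi> p)")
      case True
      have "germ M e D p (\<lambda>d. h (e' d) / f (e' d)) (?c * val p f' h)"
        by (rule germ_cong[OF S germ_mult[OF S c valg[OF G' True]] o]) (use N N' in auto)
      then show ?thesis unfolding Phi_def using val True by simp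
    qed (simp add: Phi_def)
    then have "scalar_class (Phi p f) = scalar_class (\<lambda>h. ?c * Phi p f' h)" by presburger
    also have "\<dots> = scalar_class (Phi p f')" by (rule scalar_class_scaled) (use cc in auto)
    finally show ?thesis .
  qed
  define \<psi> where "\<psi> p = (\<pi> p, scalar_class (Phi p (SOME f. ?G p f)))" for p
  have psi: "\<psi> p = (\<pi> p, scalar_class (Phi p f))" if "?G p f" for p f
    unfolding \<psi>_def using indep[OF someI[of "?G p", OF that] that] by simp
  have mor: "morphism M (blowup X Z) \<psi>"
    unfolding blowup_eq
  proof (rule morphism_by_germs[OF M], fold blowup_eq)
    fix p assume "p \<in> points M"
    then obtain f where f: "?G p f" using gen by blast
    show "\<psi> p \<in> points (blowup X Z)" unfolding psi[OF f] by (rule blowup_pointI[OF fibre[OF f]])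
  next
    fix U F p assume "(U, F) \<in> blowup_charts X Z" and p: "p \<in> points M" "\<psi> p \<in> U"
    then obtain W f where W: "openin (zariski X) W" "f \<in> ideal_sections X Z W" "U = blowup_chart X Z W f"
      unfolding blowup_charts_def by blast
    obtain f0 where f0: "?G p f0" using gen p by blast
    obtain N where N: "openin (zariski M) N" "p \<in> N" "\<forall>q\<in>N. ?G q f0" using Gself(2)[OF f0] by blast
    have "(\<pi> p, scalar_class (Phi p f0)) \<in> blowup_chart X Z W f" using p(2) unfolding psi[OF f0] W(3) .
    note nz = blowup_chart_nonzero[OF this]
    have fp: "f \<in> ideal_at X Z (\<pi> p)" using ideal_atI[OF W(1) nz(2) W(2)] .
    \<comment> \<open>Membership of the image in the chart of \<open>f\<close> is read off the
      extension of f / f0, whose nonvanishing is open.\<close>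
    obtain K k where K: "openin (zariski M) K" "p \<in> K" "regular M K k" "k p = val p f0 f"
      "\<And>q. q \<in> K \<Longrightarrow> germ M e D q (\<lambda>d. f (e' d) / f0 (e' d)) (k q)"
      using germ_spread[OF valg[OF f0 fp]] by metis
    have k0: "k p \<noteq> 0" using nz(1) fp unfolding K(4) Phi_def by simp
    let ?N = "N \<inter> {q \<in> K. k q \<noteq> 0} \<inter> {q \<in> points M. \<pi> q \<in> W}"
    have "openin (zariski M) ?N" using N(1) sheafy_open[OF S K(1,3)] morphism_open[OF pi(1) W(1)] by blast
    moreover have "p \<in> ?N" using N K k0 p nz by blast
    moreover have "\<psi> q \<in> U" if q: "q \<in> ?N" for q
    proof -
      have G: "?G q f0" using N q by blast
      have fq: "f \<in> ideal_at X Z (\<pi> q)" using ideal_atI[OF W(1) _ W(2)] q by blast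
      have "Phi q f0 f = k q" unfolding Phi_def using fq val[OF K(5)] q by simp
      then show ?thesis unfolding psi[OF G] W(3) using q by (intro blowup_chartI fibre[OF G]) auto
    qed
    ultimately show "\<exists>N. openin (zariski M) N \<and> p \<in> N \<and> (\<forall>q\<in>N. \<psi> q \<in> U)" by (intro exI[of _ ?N]) auto
  next
    fix U F g assume "(U, F) \<in> blowup_charts X Z" and "g \<in> F"
    then obtain W f where W: "openin (zariski X) W" "f \<in> ideal_sections X Z W" "U = blowup_chart X Z W f"
      and g: "g \<in> blowup_functions X Z W f"
      unfolding blowup_charts_def by blast
    from g consider a where "regular X W a" "g = (\<lambda>p. a (fst p))" | h where "h \<in> ideal_sections X Z W" "g = section_quotient h f"
      unfolding blowup_functions_def by blast
    then show "\<exists>h. \<forall>p\<in>points M. \<psi> p \<in> U \<longrightarrow> germ M e D p h (g (\<psi> p))"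
    proof cases
      case 1
      have "germ M e D p (\<lambda>d. a (e' d)) (a (\<pi> p))" if "p \<in> points M" "\<psi> p \<in> U" for p
      proof (rule germ_pullback[OF pi(1) pi(2) that(1) regular_germ[OF W(1) 1(1)]])
        show "\<pi> p \<in> W" by (rule blowup_chart_nonzero(2)[OF that(2)[unfolded \<psi>_def W(3)]])
      qed
      then show ?thesis unfolding 1(2) by (intro exI[of _ "\<lambda>d. a (e' d)"]) (simp add: \<psi>_def)
    next
      case 2
      have "germ M e D p (\<lambda>d. h (e' d) / f (e' d)) (section_quotient h f (\<psi> p))" if p: "p \<in> points M" "\<psi> p \<in> U" for p
      proof -
        obtain f0 where f0: "?G p f0" using gen p by blast
        obtain N where N: "openin (zariski M) N" "p \<in> N" "\<forall>d\<in>D. e d \<in> N \<longrightarrow> f0 (e' d) \<noteq> 0" using Gself(2)[OF f0] by blast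
        have "(\<pi> p, scalar_class (Phi p f0)) \<in> blowup_chart X Z W f" using p(2) unfolding psi[OF f0] W(3) .
        note nz = blowup_chart_nonzero[OF this]
        have fp: "f \<in> ideal_at X Z (\<pi> p)" "h \<in> ideal_at X Z (\<pi> p)" using ideal_atI[OF W(1) nz(2)] W(2) 2 by auto
        have "germ M e D p (\<lambda>d. h (e' d) / f (e' d)) (val p f0 h * inverse (val p f0 f))"
          by (rule germ_cong[OF S germ_mult[OF S valg[OF f0 fp(2)] germ_inverse[OF S valg[OF f0 fp(1)]]] N(1,2)])
            (use nz fp N(3) in \<open>auto simp: Phi_def\<close>)
        moreover have "section_quotient h f (\<psi> p) = val p f0 h * inverse (val p f0 f)"
          unfolding psi[OF f0] section_quotient using fp by (simp add: Phi_def field_simps)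
        ultimately show ?thesis by simp
      qed
      then show ?thesis unfolding 2(2) by blast
    qed
  qed
  have lift: "\<psi> p = blowup_lift X Z (\<pi> p)" if p: "p \<in> points M" "\<pi> p \<notin> Z" for p
  proof -
    let ?W = "points X - Z" let ?N = "{q \<in> points M. \<pi> q \<in> ?W}"
    have W: "openin (zariski X) ?W" using Z by blast
    have v: "germ M e D q (\<lambda>d. h (e' d) / 1) (h (\<pi> q))" if q: "q \<in> points M" "h \<in> ideal_at X Z (\<pi> q)" for q h
    proof -
      obtain V where V: "openin (zariski X) V" "\<pi> q \<in> V" "regular X V h"
        using q(2) unfolding ideal_at_def ideal_sections_def by blast
      show ?thesis using germ_pullback[OF pi(1) pi(2) q(1) regular_germ[OF V(1,3,2)]] by simp
    qed
    \<comment> \<open>Off \<open>Z\<close> the ideal is the unit ideal, so the constant 1 generates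
      it; with this generator the functional is evaluation at \<open>\<pi> p\<close>, which is the
      lift.\<close>
    have G: "?G p (\<lambda>_. 1)"
      unfolding local_generator_def
      using W morphism_open[OF pi(1) W] p morphism_points[OF pi(1) p(1)] sheafy_const[OF X W, of 1] v
      by (intro exI[of _ ?N] exI[of _ ?W]) (auto simp: ideal_sections_def)
    have "Phi p (\<lambda>_. 1) = (\<lambda>f. if f \<in> ideal_at X Z (\<pi> p) then f (\<pi> p) else 0)"
    proof
      fix h
      show "Phi p (\<lambda>_. 1) h = (if h \<in> ideal_at X Z (\<pi> p) then h (\<pi> p) else 0)"
        using val[where f="\<lambda>_. 1" and h=h and p=p and c="h (\<pi> p)"] v[OF p(1), of h] unfolding Phi_def by simp
    qed
    then show ?thesis unfolding psi[OF G] blowup_lift_def by simp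
  qed
  show ?thesis using mor lift by (intro exI[of _ \<psi>]) (auto simp: \<psi>_def)
qed

section \<open>Projective spaces\<close>

lemma germ_spread_ex:
  assumes "germ X e D p h c"
  shows "\<exists>N k. openin (zariski X) N \<and> p \<in> N \<and> regular X N k \<and> k p = c \<and> (\<forall>q\<in>N. germ X e D q h (k q))"
proof -
  obtain N k where 1: "openin (zariski X) N" "p \<in> N" "regular X N k" "k p = c"
    and 2: "\<And>q. q \<in> N \<Longrightarrow> germ X e D q h (k q)" using germ_spread[OF assms] by metis
  show ?thesis by (intro exI conjI ballI) (rule 1 2, assumption?)+
qed

definition block_subspace :: "nat \<Rightarrow> nat set \<Rightarrow> (nat \<Rightarrow> complex) set" where
  "block_subspace n B = {x \<in> coordinate_space n. \<forall>i\<in>B. \<forall>j\<in>B. x i = x j}"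

definition root_form :: "nat \<Rightarrow> nat \<Rightarrow> nat \<Rightarrow> complex" where
  "root_form i j = (\<lambda>k. (if k = i then 1 else 0) - (if k = j then 1 else 0))"

lemma linear_form_root: "i \<le> n \<Longrightarrow> j \<le> n \<Longrightarrow> linear_form n (root_form i j) x = x i - x j"
proof -
  assume a: "i \<le> n" "j \<le> n"
  have "linear_form n (root_form i j) x = (\<Sum>k=0..n. (if k = i then x k else 0) - (if k = j then x k else 0))"
    unfolding linear_form_def root_form_def by (rule sum.cong) auto
  then show ?thesis using a by (simp add: sum_subtractf)
qed

lemma linear_form_combination: "linear_form n l (\<lambda>i. u i + c * x i) = linear_form n l u + c * linear_form n l x"
proof -
  show ?thesis unfolding linear_form_def sum_distrib_left sum.distrib[symmetric] by (rule sum.cong) (auto simp: algebra_simps)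
qed

lemma block_subspace_zero: "(\<lambda>_. 0) \<in> block_subspace n B"
  unfolding block_subspace_def coordinate_space_def by simp

lemma block_subspace_combination:
  "u \<in> block_subspace n B \<Longrightarrow> v \<in> block_subspace n B \<Longrightarrow> (\<lambda>i. u i + c * v i) \<in> block_subspace n B"
proof -
  assume u: "u \<in> block_subspace n B" and v: "v \<in> block_subspace n B"
  have "u i = u j" "v i = v j" if "i \<in> B" "j \<in> B" for i j
    using u v that unfolding block_subspace_def by blast+
  then have "u i + c * v i = u j + c * v j" if "i \<in> B" "j \<in> B" for i j using that by metis
  moreover have "(\<lambda>i. u i + c * v i) \<in> coordinate_space n"
    using u v unfolding block_subspace_def coordinate_space_def by simp
  ultimately show ?thesis unfolding block_subspace_def by blast
qed

lemma annihilator_zero: "l \<in> annihilator n U \<Longrightarrow> u \<in> U \<Longrightarrow> linear_form n l u = 0"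
  unfolding annihilator_def by blast

lemma root_form_annihilator:
  assumes "B \<subseteq> {0..n}" "i \<in> B" "j \<in> B"
  shows "root_form i j \<in> annihilator n (block_subspace n B)"
proof -
  have "i \<le> n" "j \<le> n" using assms by auto
  moreover from this have "root_form i j \<in> coordinate_space n" by (auto simp: coordinate_space_def root_form_def)
  moreover have "linear_form n (root_form i j) u = 0" if "u \<in> block_subspace n B" for u
  proof -
    have "u i = u j" using that assms(2,3) unfolding block_subspace_def by blast
    then show ?thesis unfolding linear_form_root[OF \<open>i \<le> n\<close> \<open>j \<le> n\<close>] by simp
  qed
  ultimately show ?thesis by (simp add: annihilator_def)
qed

text \<open>Testing \<open>l\<close> on the indicator of a coordinate outside \<open>B\<close> and
  on the indicator of \<open>B\<close> shows that \<open>l\<close> is supported on \<open>B\<close>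
  with coefficient sum zero. So the shift by \<open>c\<close> is free; later it subtracts one
  coordinate of the point.\<close>

lemma linear_form_block:
  assumes B: "B \<subseteq> {0..n}" and l: "l \<in> annihilator n (block_subspace n B)"
  shows "linear_form n l x = (\<Sum>i\<in>B. l i * (x i - c))"
proof -
  have out: "l i = 0" if "i \<notin> B" for i
  proof (cases "i \<le> n")
    case True
    have "(\<lambda>k. if k = i then 1 else 0) \<in> block_subspace n B"
      using that True unfolding block_subspace_def coordinate_space_def by auto
    from annihilator_zero[OF l this] show ?thesis
      using True by (simp add: linear_form_def sum.delta if_distrib cong: if_cong)
  qed (use l in \<open>auto simp: annihilator_def coordinate_space_def\<close>)
  have res: "linear_form n l y = (\<Sum>i\<in>B. l i * y i)" for y
    unfolding linear_form_def by (rule sum.mono_neutral_right) (use B out in auto)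
  have "(\<lambda>k. if k \<in> B then 1 else 0) \<in> block_subspace n B"
    using B unfolding block_subspace_def coordinate_space_def by auto
  from annihilator_zero[OF l this] have "(\<Sum>i\<in>B. l i) = 0" unfolding res by simp
  then show ?thesis unfolding res by (simp add: right_diff_distrib sum_subtractf flip: sum_distrib_right)
qed

lemma line_class_memE:
  assumes "x \<in> line_class U y" obtains u c where "u \<in> U" "x = (\<lambda>i. u i + c * y i)"
  using assms unfolding line_class_def mem_Collect_eq by (elim exE conjE) (rule that)

lemma line_class_self: "x \<in> line_class (block_subspace n B) x"
  unfolding line_class_def
  by (rule CollectI, rule exI[of _ "\<lambda>_. 0"], rule exI[of _ 1]) (simp add: block_subspace_zero)

lemma line_class_block_subset:
  assumes x: "x \<in> coordinate_space n" "y \<in> coordinate_space n"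
    and eq: "\<And>i j. i \<in> B \<Longrightarrow> j \<in> B \<Longrightarrow> x i - x j = c * (y i - y j)"
  shows "line_class (block_subspace n B) x \<subseteq> line_class (block_subspace n B) y"
proof
  fix z assume "z \<in> line_class (block_subspace n B) x"
  then obtain u a where u: "u \<in> block_subspace n B" "z = (\<lambda>i. u i + a * x i)" by (rule line_class_memE)
  have w: "(\<lambda>i. x i - c * y i) \<in> block_subspace n B"
    using x eq unfolding block_subspace_def coordinate_space_def
    by (auto simp: algebra_simps)
  have "z = (\<lambda>i. (u i + a * (x i - c * y i)) + (a * c) * y i)" unfolding u by (auto simp: algebra_simps)
  then show "z \<in> line_class (block_subspace n B) y"
    unfolding line_class_def using block_subspace_combination[OF u(1) w, of a]
    by (intro CollectI exI[of _ "\<lambda>i. u i + a * (x i - c * y i)"] exI[of _ "a * c"]) simp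
qed

lemma line_class_block_eq:
  assumes x: "x \<in> coordinate_space n" "y \<in> coordinate_space n" and c: "c \<noteq> 0"
    and eq: "\<And>i j. i \<in> B \<Longrightarrow> j \<in> B \<Longrightarrow> x i - x j = c * (y i - y j)"
  shows "line_class (block_subspace n B) x = line_class (block_subspace n B) y"
proof
  show "line_class (block_subspace n B) x \<subseteq> line_class (block_subspace n B) y"
    by (rule line_class_block_subset[OF x eq])
  show "line_class (block_subspace n B) y \<subseteq> line_class (block_subspace n B) x"
    by (rule line_class_block_subset[OF x(2,1), of _ "1 / c"]) (use c eq in simp)
qed

lemma line_class_form:
  assumes "l \<in> annihilator n (block_subspace n B)" "line_class (block_subspace n B) x = line_class (block_subspace n B) y"
    "linear_form n l x \<noteq> 0"
  shows "linear_form n l y \<noteq> 0"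
proof -
  have "x \<in> line_class (block_subspace n B) y" using line_class_self assms(2) by blast
  then obtain u c where u: "u \<in> block_subspace n B" "x = (\<lambda>i. u i + c * y i)" by (rule line_class_memE)
  show ?thesis using assms(3) unfolding u(2) linear_form_combination annihilator_zero[OF assms(1) u(1)] by auto
qed

definition form_quotient :: "nat \<Rightarrow> (nat \<Rightarrow> complex) \<Rightarrow> (nat \<Rightarrow> complex) \<Rightarrow> (nat \<Rightarrow> complex) set \<Rightarrow> complex" where
  "form_quotient n k l = (\<lambda>p. (let x = (SOME x. x \<in> p \<and> linear_form n l x \<noteq> 0) in linear_form n k x / linear_form n l x))"

lemma form_quotient:
  assumes k: "k \<in> annihilator n (block_subspace n B)" and l: "l \<in> annihilator n (block_subspace n B)"
    and x: "linear_form n l x \<noteq> 0"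
  shows "form_quotient n k l (line_class (block_subspace n B) x) = linear_form n k x / linear_form n l x"
proof -
  let ?y = "SOME y. y \<in> line_class (block_subspace n B) x \<and> linear_form n l y \<noteq> 0"
  have y: "?y \<in> line_class (block_subspace n B) x \<and> linear_form n l ?y \<noteq> 0"
    by (rule someI[where P="\<lambda>y. y \<in> line_class (block_subspace n B) x \<and> linear_form n l y \<noteq> 0" and x=x])
      (use x line_class_self in auto)
  then obtain u c where u: "u \<in> block_subspace n B" "?y = (\<lambda>i. u i + c * x i)" by (auto elim: line_class_memE)
  have e: "linear_form n m ?y = c * linear_form n m x" if "m \<in> annihilator n (block_subspace n B)" for m
    unfolding u(2) linear_form_combination annihilator_zero[OF that u(1)] by simp
  have "c \<noteq> 0" using y e[OF l] by auto
  then show ?thesis unfolding form_quotient_def Let_def e[OF k] e[OF l] by simp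
qed

definition form_chart :: "nat \<Rightarrow> nat set \<Rightarrow> (nat \<Rightarrow> complex) \<Rightarrow> (nat \<Rightarrow> complex) set set" where
  "form_chart n B l = {line_class (block_subspace n B) x | x. x \<in> coordinate_space n \<and> linear_form n l x \<noteq> 0}"

definition form_charts :: "nat \<Rightarrow> nat set \<Rightarrow> ((nat \<Rightarrow> complex) set set \<times> ((nat \<Rightarrow> complex) set \<Rightarrow> complex) set) set" where
  "form_charts n B = {(form_chart n B l, {form_quotient n k l | k. k \<in> annihilator n (block_subspace n B)}) | l.
     l \<in> annihilator n (block_subspace n B)}"

lemma projective_quotient_block: "projective_quotient n (block_subspace n B) = fspace_of_charts (form_charts n B)"
  unfolding projective_quotient_def form_charts_def form_chart_def form_quotient_def ..

lemma form_chartE: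
  assumes "p \<in> form_chart n B l"
  obtains x where "p = line_class (block_subspace n B) x" "x \<in> coordinate_space n" "linear_form n l x \<noteq> 0"
  using assms unfolding form_chart_def by blast

lemma form_chartI: "x \<in> coordinate_space n \<Longrightarrow> linear_form n l x \<noteq> 0 \<Longrightarrow> line_class (block_subspace n B) x \<in> form_chart n B l"
  unfolding form_chart_def by blast

lemma form_chartD:
  assumes l: "l \<in> annihilator n (block_subspace n B)" and p: "line_class (block_subspace n B) x \<in> form_chart n B l"
  shows "linear_form n l x \<noteq> 0"
proof -
  obtain y where "line_class (block_subspace n B) x = line_class (block_subspace n B) y" "linear_form n l y \<noteq> 0"
    using p by (rule form_chartE)
  then show ?thesis using line_class_form[OF l, of y x] by simp
qed

lemma form_charts_mem: "l \<in> annihilator n (block_subspace n B) \<Longrightarrow>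
   (form_chart n B l, {form_quotient n k l | k. k \<in> annihilator n (block_subspace n B)}) \<in> form_charts n B"
  unfolding form_charts_def by blast

text \<open>The chart of \<open>l\<close> itself already dominates the other one, with l' / l as the
  denominator.\<close>

lemma form_charts_directed: "directed_atlas (form_charts n B)"
  unfolding directed_atlas_def
proof (intro allI impI, elim conjE)
  fix U F U' F' p
  let ?A = "annihilator n (block_subspace n B)"
  assume "(U, F) \<in> form_charts n B" "(U', F') \<in> form_charts n B" and p: "p \<in> U" "p \<in> U'"
  then obtain l l' where l: "l \<in> ?A" "U = form_chart n B l" "F = {form_quotient n k l | k. k \<in> ?A}"
    and l': "l' \<in> ?A" "U' = form_chart n B l'" "F' = {form_quotient n k l' | k. k \<in> ?A}"
    unfolding form_charts_def by blast
  have gen: "form_quotient n k l \<in> function_algebra F" if "k \<in> ?A" for k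
    by (rule function_algebra.gen) (use that l(3) in blast)
  have d1: "dominated U F U F p" unfolding dominated_def
  proof (intro conjI p ballI)
    show "\<exists>b\<in>function_algebra F. b p \<noteq> 0 \<and> (\<forall>y\<in>U. b y \<noteq> 0 \<longrightarrow> y \<in> U)"
      by (rule bexI[OF _ function_algebra.const[of 1]]) auto
    show "local_fraction U F p g" if "g \<in> F" for g by (rule local_fraction_algebra[OF function_algebra.gen[OF that]])
  qed
  obtain x where x: "p = line_class (block_subspace n B) x" "x \<in> coordinate_space n" "linear_form n l x \<noteq> 0"
    using p(1) unfolding l(2) by (rule form_chartE)
  have nz: "form_quotient n l' l p \<noteq> 0"
    using form_chartD[OF l'(1), of x] p(2) x unfolding l'(2) x(1) form_quotient[OF l'(1) l(1) x(3)] by simp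
  have d2: "dominated U' F' U F p" unfolding dominated_def
  proof (intro conjI p ballI)
    have "y \<in> U'" if "y \<in> U" "form_quotient n l' l y \<noteq> 0" for y
    proof -
      from that(1) obtain z where z: "y = line_class (block_subspace n B) z" "z \<in> coordinate_space n" "linear_form n l z \<noteq> 0"
        unfolding l(2) by (rule form_chartE)
      show ?thesis unfolding l'(2) z(1)
        by (rule form_chartI[OF z(2)]) (use that(2) in \<open>auto simp: z(1) form_quotient[OF l'(1) l(1) z(3)]\<close>)
    qed
    then show "\<exists>b\<in>function_algebra F. b p \<noteq> 0 \<and> (\<forall>y\<in>U. b y \<noteq> 0 \<longrightarrow> y \<in> U')"
      using nz gen[OF l'(1)] by blast
    fix g assume "g \<in> F'"
    then obtain k where k: "k \<in> ?A" "g = form_quotient n k l'" unfolding l'(3) by blast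
    show "local_fraction U F p g" unfolding k(2)
    proof (rule local_fractionI[OF gen[OF k(1)] gen[OF l'(1)] nz])
      fix y assume y: "y \<in> U" "form_quotient n l' l y \<noteq> 0"
      from y(1) obtain z where z: "y = line_class (block_subspace n B) z" "z \<in> coordinate_space n" "linear_form n l z \<noteq> 0"
        unfolding l(2) by (rule form_chartE)
      have "linear_form n l' z \<noteq> 0" using y(2) unfolding z(1) form_quotient[OF l'(1) l(1) z(3)] by auto
      then show "form_quotient n k l' y = form_quotient n k l y / form_quotient n l' l y"
        using z(3) unfolding z(1) by (simp add: form_quotient[OF k(1) l'(1)] form_quotient[OF k(1) l(1)] form_quotient[OF l'(1) l(1)])
    qed
  qed
  show "\<exists>V G. (V, G) \<in> form_charts n B \<and> dominated U F V G p \<and> dominated U' F' V G p"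
    using d1 d2 form_charts_mem[OF l(1)] l(2,3) by blast
qed

lemma sheafy_projective: "sheafy (projective_quotient n (block_subspace n B))"
  unfolding projective_quotient_block by (rule sheafy_charts[OF form_charts_directed])

lemma projective_pointE:
  assumes B: "B \<subseteq> {0..n}" and p: "p \<in> points (projective_quotient n (block_subspace n B))"
  obtains x i j where "p = line_class (block_subspace n B) x" "x \<in> coordinate_space n" "i \<in> B" "j \<in> B" "x i \<noteq> x j"
proof -
  obtain l where l: "l \<in> annihilator n (block_subspace n B)" "p \<in> form_chart n B l"
    using p unfolding projective_quotient_block points_charts form_charts_def by auto
  obtain x where x: "p = line_class (block_subspace n B) x" "x \<in> coordinate_space n" "linear_form n l x \<noteq> 0"
    using l(2) by (rule form_chartE)
  have "\<exists>i\<in>B. \<exists>j\<in>B. x i \<noteq> x j"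
  proof (rule ccontr)
    assume "\<not> ?thesis"
    then have "x \<in> block_subspace n B" using x(2) unfolding block_subspace_def by blast
    then show False using annihilator_zero[OF l(1)] x(3) by blast
  qed
  then show ?thesis using that x by blast
qed

lemma projective_pointI:
  assumes B: "B \<subseteq> {0..n}" and x: "x \<in> coordinate_space n" and ij: "i \<in> B" "j \<in> B" "x i \<noteq> x j"
  shows "line_class (block_subspace n B) x \<in> points (projective_quotient n (block_subspace n B))"
proof -
  have "i \<le> n" "j \<le> n" using B ij by auto
  then have "line_class (block_subspace n B) x \<in> form_chart n B (root_form i j)"
    using ij(3) by (intro form_chartI[OF x]) (simp add: linear_form_root)
  then show ?thesis unfolding projective_quotient_block points_charts
    using form_charts_mem[OF root_form_annihilator[OF B ij(1,2)]] by force
qed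

text \<open>The nonvanishing clause keeps the quotients of the last clause away from the convention
  x / 0 = 0 at the indices near \<open>p\<close>.\<close>

definition block_generator :: "'a fspace \<Rightarrow> ((nat \<Rightarrow> complex) \<Rightarrow> 'a) \<Rightarrow> (nat \<Rightarrow> complex) set \<Rightarrow> nat set \<Rightarrow> 'a \<Rightarrow> nat \<Rightarrow> nat \<Rightarrow> bool" where
  "block_generator M e D B p i j \<longleftrightarrow> i \<in> B \<and> j \<in> B \<and>
     (\<exists>N. openin (zariski M) N \<and> p \<in> N \<and> (\<forall>d\<in>D. e d \<in> N \<longrightarrow> d i \<noteq> d j)) \<and>
     (\<forall>k\<in>B. \<forall>l\<in>B. \<exists>c. germ M e D p (\<lambda>d. (d k - d l) / (d i - d j)) c)"

lemma block_generatorE: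
  assumes "block_generator M e D B p i j"
  obtains N where "i \<in> B" "j \<in> B" "openin (zariski M) N" "p \<in> N" "\<forall>d\<in>D. e d \<in> N \<longrightarrow> d i \<noteq> d j"
    "\<forall>k\<in>B. \<forall>l\<in>B. \<exists>c. germ M e D p (\<lambda>d. (d k - d l) / (d i - d j)) c"
  using assms unfolding block_generator_def by (elim exE conjE) (rule that)

text \<open>Both clauses are open conditions, the second because it concerns finitely many
  germs.\<close>

lemma block_generator_spread:
  assumes B: "finite B" and g: "block_generator M e D B p i j"
  shows "\<exists>N. openin (zariski M) N \<and> p \<in> N \<and> (\<forall>q\<in>N. block_generator M e D B q i j)"
proof -
  obtain N where N: "i \<in> B" "j \<in> B" "openin (zariski M) N" "p \<in> N" "\<forall>d\<in>D. e d \<in> N \<longrightarrow> d i \<noteq> d j"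
    "\<forall>k\<in>B. \<forall>l\<in>B. \<exists>c. germ M e D p (\<lambda>d. (d k - d l) / (d i - d j)) c"
    by (rule block_generatorE[OF g], rule that)
  have p: "p \<in> points M" using N openin_subset by blast
  obtain K where K: "openin (zariski M) K" "p \<in> K"
    "\<forall>q\<in>K. \<forall>a\<in>B \<times> B. \<exists>c. germ M e D q (\<lambda>d. (d (fst a) - d (snd a)) / (d i - d j)) c"
    using germs_spread[of "B \<times> B" p M e D "\<lambda>a d. (d (fst a) - d (snd a)) / (d i - d j)"] B p N(6) by auto
  have "block_generator M e D B q i j" if q: "q \<in> N \<inter> K" for q
    unfolding block_generator_def
  proof (intro conjI ballI N(1,2))
    show "\<exists>N. openin (zariski M) N \<and> q \<in> N \<and> (\<forall>d\<in>D. e d \<in> N \<longrightarrow> d i \<noteq> d j)"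
      using N(3,5) q by (intro exI[of _ N]) auto
    show "\<exists>c. germ M e D q (\<lambda>d. (d k - d l) / (d i - d j)) c" if "k \<in> B" "l \<in> B" for k l
      using K(3)[rule_format, of q "(k, l)"] q that by simp
  qed
  then show ?thesis using N(3,4) K(1,2) by (intro exI[of _ "N \<inter> K"]) auto
qed

definition block_value :: "'a fspace \<Rightarrow> ((nat \<Rightarrow> complex) \<Rightarrow> 'a) \<Rightarrow> (nat \<Rightarrow> complex) set \<Rightarrow> 'a \<Rightarrow> nat \<Rightarrow> nat \<Rightarrow> nat \<Rightarrow> nat \<Rightarrow> complex" where
  "block_value M e D p i j k l = (THE c. germ M e D p (\<lambda>d. (d k - d l) / (d i - d j)) c)"

lemma block_value_eq:
  assumes "dspace M e D" "germ M e D p (\<lambda>d. (d k - d l) / (d i - d j)) c"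
  shows "block_value M e D p i j k l = c"
  unfolding block_value_def
proof (rule the_equality)
  show "germ M e D p (\<lambda>d. (d k - d l) / (d i - d j)) c" by (rule assms(2))
  show "c' = c" if "germ M e D p (\<lambda>d. (d k - d l) / (d i - d j)) c'" for c'
    by (rule germ_unique[OF assms(1) that assms(2)])
qed

lemma block_value_germ:
  assumes "dspace M e D" "block_generator M e D B p i j" "k \<in> B" "l \<in> B"
  shows "germ M e D p (\<lambda>d. (d k - d l) / (d i - d j)) (block_value M e D p i j k l)"
proof -
  obtain c where c: "germ M e D p (\<lambda>d. (d k - d l) / (d i - d j)) c"
    using assms(2-4) unfolding block_generator_def by blast
  then show ?thesis unfolding block_value_eq[OF assms(1) c] .
qed

text \<open>The factor is the value of the quotient of the two generating differences; its
  reciprocal extends as well, so it is nonzero.\<close>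

lemma block_value_change:
  assumes M: "dspace M e D" and g: "block_generator M e D B p i j" and g': "block_generator M e D B p i' j'"
  shows "\<exists>c. c \<noteq> 0 \<and> (\<forall>k\<in>B. \<forall>l\<in>B. block_value M e D p i j k l = c * block_value M e D p i' j' k l)"
proof -
  note S = dspace_sheafy[OF M]
  obtain N where N: "i \<in> B" "j \<in> B" "openin (zariski M) N" "p \<in> N" "\<forall>d\<in>D. e d \<in> N \<longrightarrow> d i \<noteq> d j"
    by (rule block_generatorE[OF g], rule that)
  obtain N' where N': "i' \<in> B" "j' \<in> B" "openin (zariski M) N'" "p \<in> N'" "\<forall>d\<in>D. e d \<in> N' \<longrightarrow> d i' \<noteq> d j'"
    by (rule block_generatorE[OF g'], rule that)
  have o: "openin (zariski M) (N \<inter> N')" "p \<in> N \<inter> N'" using N N' by auto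
  have p: "p \<in> points M" using N openin_subset by blast
  let ?c = "block_value M e D p i j i' j'"
  note c = block_value_germ[OF M g N'(1,2)] and c' = block_value_germ[OF M g' N(1,2)]
  have "germ M e D p (\<lambda>_. 1) (?c * block_value M e D p i' j' i j)"
  proof (rule germ_cong[OF S germ_mult[OF S c c'] o])
    fix d assume d: "d \<in> D" "e d \<in> N \<inter> N'"
    then have "d i - d j \<noteq> 0" "d i' - d j' \<noteq> 0" using N(5) N'(5) by auto
    then show "(d i' - d j') / (d i - d j) * ((d i - d j) / (d i' - d j')) = 1" by simp
  qed
  from germ_unique[OF M this germ_const[OF S p]] have "?c \<noteq> 0" by auto
  moreover have "block_value M e D p i j k l = ?c * block_value M e D p i' j' k l" if "k \<in> B" "l \<in> B" for k l
  proof (rule block_value_eq[OF M germ_cong[OF S germ_mult[OF S c block_value_germ[OF M g' that]] o]])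
    fix d assume d: "d \<in> D" "e d \<in> N \<inter> N'"
    then have "d i - d j \<noteq> 0" "d i' - d j' \<noteq> 0" using N(5) N'(5) by auto
    then show "(d i' - d j') / (d i - d j) * ((d k - d l) / (d i' - d j')) = (d k - d l) / (d i - d j)" by simp
  qed
  ultimately show ?thesis by blast
qed

lemma block_value_diff:
  assumes M: "dspace M e D" and g: "block_generator M e D B p i j" and kl: "k \<in> B" "l \<in> B" "m \<in> B"
  shows "block_value M e D p i j k m - block_value M e D p i j l m = block_value M e D p i j k l"
proof -
  note S = dspace_sheafy[OF M]
  have "germ M e D p (\<lambda>d. (d k - d l) / (d i - d j)) (block_value M e D p i j k m - block_value M e D p i j l m)"
    by (rule germ_cong'[OF S germ_diff[OF S block_value_germ[OF M g kl(1,3)] block_value_germ[OF M g kl(2,3)]]])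
      (simp add: diff_divide_distrib)
  from block_value_eq[OF M this] show ?thesis ..
qed

lemma germ_at: "germ M e D (e d) h c \<Longrightarrow> d \<in> D \<Longrightarrow> c = h d"
proof - 
 assume a: "germ M e D (e d) h c" "d \<in> D"
 show ?thesis by (rule germE[OF a(1)]) (use a(2) in metis)
qed

text \<open>The differences d_k - d_j divided by the generator d_i - d_j have no common zero, as the
  one with k = i is 1. Their values at \<open>p\<close> are homogeneous coordinates of the image,
  and a change of generator multiplies them by a nonzero factor.\<close>

lemma projective_universal:
  assumes M: "dspace M e D" and B: "B \<subseteq> {0..n}" and D: "D \<subseteq> coordinate_space n"
    and gen: "\<And>p. p \<in> points M \<Longrightarrow> \<exists>i j. block_generator M e D B p i j"
  shows "\<exists>\<psi>. morphism M (projective_quotient n (block_subspace n B)) \<psi> \<and>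
     (\<forall>d\<in>D. \<psi> (e d) = line_class (block_subspace n B) d)"
proof -
  note S = dspace_sheafy[OF M]
  let ?G = "block_generator M e D B" and ?v = "block_value M e D" and ?L = "line_class (block_subspace n B)"
  have fB: "finite B" using B finite_subset by blast
  \<comment> \<open>A representative normalised by subtracting the coordinate at \<open>j\<close>
    and set to 0 outside \<open>B\<close>; modulo \<open>block_subspace n B\<close> only differences
    over \<open>B\<close> matter.\<close>
  define vec where "vec p i j = (\<lambda>k. if k \<in> B then ?v p i j k j else 0)" for p i j
  have vec_space: "vec p i j \<in> coordinate_space n" for p i j
    using B unfolding vec_def coordinate_space_def by auto
  have vec_diff: "vec p i j k - vec p i j l = ?v p i j k l" if "?G p i j" "k \<in> B" "l \<in> B" for p i j k l
  proof -
    have "j \<in> B" using that(1) unfolding block_generator_def by blast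
    from block_value_diff[OF M that this] show ?thesis using that unfolding vec_def by simp
  qed
  have gpt: "p \<in> points M" if "?G p i j" for p i j
    using that openin_subset unfolding block_generator_def by blast
  have vij: "?v p i j i j = 1" if g: "?G p i j" for p i j
  proof -
    obtain N where N: "openin (zariski M) N" "p \<in> N" "\<forall>d\<in>D. e d \<in> N \<longrightarrow> d i \<noteq> d j"
      by (rule block_generatorE[OF g], rule that)
    show ?thesis
      by (rule block_value_eq[OF M germ_cong[OF S germ_const[OF S gpt[OF g]] N(1,2)]]) (use N(3) in simp)
  qed
  have indep: "?L (vec p i j) = ?L (vec p i' j')" if g: "?G p i j" and g': "?G p i' j'" for p i j i' j'
  proof -
    obtain c where c: "c \<noteq> 0" "\<forall>k\<in>B. \<forall>l\<in>B. ?v p i j k l = c * ?v p i' j' k l"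
      using block_value_change[OF M g g'] by blast
    show ?thesis
      by (rule line_class_block_eq[OF vec_space vec_space c(1)]) (simp add: vec_diff[OF g] vec_diff[OF g'] c(2))
  qed
  define \<psi> where "\<psi> p = (let (i, j) = (SOME a. ?G p (fst a) (snd a)) in ?L (vec p i j))" for p
  have psi: "\<psi> p = ?L (vec p i j)" if g: "?G p i j" for p i j
  proof -
    have "?G p (fst (SOME a. ?G p (fst a) (snd a))) (snd (SOME a. ?G p (fst a) (snd a)))"
      by (rule someI[where P="\<lambda>a. ?G p (fst a) (snd a)" and x="(i, j)"]) (use g in simp)
    from indep[OF this g] show ?thesis unfolding \<psi>_def by (simp add: split_beta)
  qed
  have form: "germ M e D p (\<lambda>d. linear_form n l d / (d i - d j)) (linear_form n l (vec p i j))"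
    if g: "?G p i j" and l: "l \<in> annihilator n (block_subspace n B)" for p i j l
  proof -
    have j: "j \<in> B" using g unfolding block_generator_def by blast
    have "germ M e D p (\<lambda>d. \<Sum>k\<in>B. l k * ((d k - d j) / (d i - d j))) (\<Sum>k\<in>B. l k * ?v p i j k j)"
      by (intro germ_sum[OF S gpt[OF g] fB] germ_mult[OF S germ_const[OF S gpt[OF g]]] block_value_germ[OF M g _ j])
    moreover have "(\<Sum>k\<in>B. l k * ?v p i j k j) = linear_form n l (vec p i j)"
      unfolding linear_form_block[OF B l, of "vec p i j" 0] by (rule sum.cong) (auto simp: vec_def)
    moreover have "(\<Sum>k\<in>B. l k * ((d k - d j) / (d i - d j))) = linear_form n l d / (d i - d j)" for d :: "nat \<Rightarrow> complex"
      unfolding linear_form_block[OF B l, of d "d j"] by (simp add: sum_divide_distrib)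
    ultimately show ?thesis by simp
  qed
  have mor: "morphism M (projective_quotient n (block_subspace n B)) \<psi>"
    unfolding projective_quotient_block
  proof (rule morphism_by_germs[OF M], fold projective_quotient_block)
    fix p assume "p \<in> points M"
    then obtain i j where g: "?G p i j" using gen by blast
    then have ij: "i \<in> B" "j \<in> B" unfolding block_generator_def by auto
    show "\<psi> p \<in> points (projective_quotient n (block_subspace n B))"
      unfolding psi[OF g]
      by (rule projective_pointI[OF B vec_space ij]) (use vec_diff[OF g ij] vij[OF g] in auto)
  next
    fix U F p assume "(U, F) \<in> form_charts n B" and p: "p \<in> points M" "\<psi> p \<in> U"
    then obtain l where l: "l \<in> annihilator n (block_subspace n B)" "U = form_chart n B l"
      unfolding form_charts_def by blast
    obtain i j where g: "?G p i j" using gen p by blast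
    obtain N where N: "openin (zariski M) N" "p \<in> N" "\<forall>q\<in>N. ?G q i j" using block_generator_spread[OF fB g] by blast
    have nz: "linear_form n l (vec p i j) \<noteq> 0"
      using p(2) unfolding psi[OF g] l(2) by (rule form_chartD[OF l(1)])
    from germ_spread_ex[OF form[OF g l(1)]]
    obtain K k where K: "openin (zariski M) K" "p \<in> K" "regular M K k" "k p = linear_form n l (vec p i j)"
      "\<forall>q\<in>K. germ M e D q (\<lambda>d. linear_form n l d / (d i - d j)) (k q)"
      by (elim exE conjE) (rule that)
    let ?N = "N \<inter> {q \<in> K. k q \<noteq> 0}"
    have "openin (zariski M) ?N" using N(1) sheafy_open[OF S K(1,3)] by blast
    moreover have "p \<in> ?N" using N K nz by simp
    moreover have "\<psi> q \<in> U" if q: "q \<in> ?N" for q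
    proof -
      have G: "?G q i j" using N q by blast
      have "linear_form n l (vec q i j) = k q" using germ_unique[OF M form[OF G l(1)] K(5)[rule_format, of q]] q by blast
      then show ?thesis unfolding psi[OF G] l(2) using q by (intro form_chartI[OF vec_space]) auto
    qed
    ultimately show "\<exists>N. openin (zariski M) N \<and> p \<in> N \<and> (\<forall>q\<in>N. \<psi> q \<in> U)" by (intro exI[of _ ?N]) auto
  next
    fix U F f assume "(U, F) \<in> form_charts n B" and "f \<in> F"
    then obtain l k where l: "l \<in> annihilator n (block_subspace n B)" "U = form_chart n B l"
      and k: "k \<in> annihilator n (block_subspace n B)" "f = form_quotient n k l"
      unfolding form_charts_def by blast
    have "germ M e D p (\<lambda>d. linear_form n k d / linear_form n l d) (f (\<psi> p))" if p: "p \<in> points M" "\<psi> p \<in> U" for p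
    proof -
      obtain i j where g: "?G p i j" using gen p by blast
      obtain N where N: "openin (zariski M) N" "p \<in> N" "\<forall>d\<in>D. e d \<in> N \<longrightarrow> d i \<noteq> d j"
        by (rule block_generatorE[OF g], rule that)
      have nz: "linear_form n l (vec p i j) \<noteq> 0"
        using p(2) unfolding psi[OF g] l(2) by (rule form_chartD[OF l(1)])
      have "germ M e D p (\<lambda>d. linear_form n k d / linear_form n l d)
          (linear_form n k (vec p i j) * inverse (linear_form n l (vec p i j)))"
        by (rule germ_cong[OF S germ_mult[OF S form[OF g k(1)] germ_inverse[OF S form[OF g l(1)] nz]] N(1,2)])
          (use N(3) in \<open>simp add: divide_simps\<close>)
      moreover have "f (\<psi> p) = linear_form n k (vec p i j) * inverse (linear_form n l (vec p i j))"
        unfolding psi[OF g] k(2) form_quotient[OF k(1) l(1) nz] by (simp add: divide_inverse)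
      ultimately show ?thesis by simp
    qed
    then show "\<exists>h. \<forall>p\<in>points M. \<psi> p \<in> U \<longrightarrow> germ M e D p h (f (\<psi> p))" by blast
  qed
  have "\<psi> (e d) = ?L d" if d: "d \<in> D" for d
  proof -
    obtain i j where g: "?G (e d) i j" using gen[OF dspace_points[OF M d]] by blast
    obtain N where N: "e d \<in> N" "\<forall>d\<in>D. e d \<in> N \<longrightarrow> d i \<noteq> d j"
        by (rule block_generatorE[OF g], rule that)
    have v: "?v (e d) i j k l = (d k - d l) / (d i - d j)" if "k \<in> B" "l \<in> B" for k l
      using germ_at[OF block_value_germ[OF M g that] d] .
    show ?thesis unfolding psi[OF g]
      by (rule line_class_block_eq[OF vec_space subsetD[OF D d], of "1 / (d i - d j)"])
        (use N(2)[rule_format, OF d N(1)] in \<open>simp_all add: vec_diff[OF g] v\<close>)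
  qed
  then show ?thesis using mor by blast
qed

text \<open>On the chart of the form x_i - x_j the quotients of differences are coordinate
  functions, so a map to the projective space makes them extend. This is the converse of
  \<open>projective_universal\<close>.\<close>

lemma projective_germ:
  assumes psi: "morphism M (projective_quotient n (block_subspace n B)) \<psi>"
      "\<forall>d\<in>D. \<psi> (e d) = line_class (block_subspace n B) d"
    and B: "B \<subseteq> {0..n}" and p: "p \<in> points M" "\<psi> p = line_class (block_subspace n B) x" "x \<in> coordinate_space n"
    and ij: "i \<in> B" "j \<in> B" "x i \<noteq> x j"
  shows "k \<in> B \<Longrightarrow> l \<in> B \<Longrightarrow> germ M e D p (\<lambda>d. (d k - d l) / (d i - d j)) ((x k - x l) / (x i - x j))"
    and "block_generator M e D B p i j"
proof -
  let ?P = "projective_quotient n (block_subspace n B)" and ?r = "root_form i j"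
  let ?U = "form_chart n B ?r" let ?N = "{q \<in> points M. \<psi> q \<in> ?U}"
  have le: "k \<le> n" if "k \<in> B" for k using that B by auto
  note r = root_form_annihilator[OF B]
  note rf = linear_form_root[OF le le]
  have o: "openin (zariski ?P) ?U"
    unfolding projective_quotient_block by (rule openin_chart[OF form_charts_mem[OF r[OF ij(1,2)]]])
  have N: "openin (zariski M) ?N" by (rule morphism_open[OF psi(1) o])
  have pN: "p \<in> ?N" using p ij by (auto intro!: form_chartI simp: rf)
  have dij: "d i \<noteq> d j" if "d \<in> D" "e d \<in> ?N" for d
    using form_chartD[OF r[OF ij(1,2)], of d] that psi(2) by (auto simp: rf[OF ij(1,2)])
  have g: "germ M e D p (\<lambda>d. (d k - d l) / (d i - d j)) ((x k - x l) / (x i - x j))" if kl: "k \<in> B" "l \<in> B" for k l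
  proof (rule germI[OF N pN])
    have "regular ?P ?U (form_quotient n (root_form k l) ?r)"
      unfolding projective_quotient_block
      by (rule regular_chart_generator[OF form_charts_mem[OF r[OF ij(1,2)]]]) (use r[OF kl] in blast)
    from morphism_regular[OF psi(1) o this]
    show "regular M ?N (\<lambda>q. form_quotient n (root_form k l) ?r (\<psi> q))" .
    have q: "form_quotient n (root_form k l) ?r (line_class (block_subspace n B) y) = (y k - y l) / (y i - y j)" if "y i \<noteq> y j" for y
      using form_quotient[OF r[OF kl] r[OF ij(1,2)], of y] that by (simp add: rf ij kl)
    show "form_quotient n (root_form k l) ?r (\<psi> p) = (x k - x l) / (x i - x j)" unfolding p(2) by (rule q[OF ij(3)])
    fix d assume d: "d \<in> D" "e d \<in> ?N"
    show "form_quotient n (root_form k l) ?r (\<psi> (e d)) = (d k - d l) / (d i - d j)"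
      using psi(2) d q[OF dij[OF d]] by simp
  qed
  then show "k \<in> B \<Longrightarrow> l \<in> B \<Longrightarrow> germ M e D p (\<lambda>d. (d k - d l) / (d i - d j)) ((x k - x l) / (x i - x j))" .
  show "block_generator M e D B p i j" unfolding block_generator_def using ij N pN dij g by blast
qed

lemma projective_block_generator:
  assumes psi: "morphism M (projective_quotient n (block_subspace n B)) \<psi>"
      "\<forall>d\<in>D. \<psi> (e d) = line_class (block_subspace n B) d"
    and B: "B \<subseteq> {0..n}" and p: "p \<in> points M"
  shows "\<exists>i j. block_generator M e D B p i j"
proof -
  obtain x i j where "\<psi> p = line_class (block_subspace n B) x" "x \<in> coordinate_space n" "i \<in> B" "j \<in> B" "x i \<noteq> x j"
    using projective_pointE[OF B morphism_points[OF psi(1) p]] .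
  from projective_germ(2)[OF psi B p this] show ?thesis by blast
qed

text \<open>The homogeneous coordinates of both images are values of germs of the same quotients, up
  to the factor from a change of generator.\<close>

lemma projective_unique:
  assumes M: "dspace M e D" and B: "B \<subseteq> {0..n}"
    and psi: "morphism M (projective_quotient n (block_subspace n B)) \<psi>"
      "\<forall>d\<in>D. \<psi> (e d) = line_class (block_subspace n B) d"
    and psi': "morphism M (projective_quotient n (block_subspace n B)) \<psi>'"
      "\<forall>d\<in>D. \<psi>' (e d) = line_class (block_subspace n B) d"
    and p: "p \<in> points M"
  shows "\<psi> p = \<psi>' p"
proof -
  obtain x i j where x: "\<psi> p = line_class (block_subspace n B) x" "x \<in> coordinate_space n" "i \<in> B" "j \<in> B" "x i \<noteq> x j"
    using projective_pointE[OF B morphism_points[OF psi(1) p]] .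
  obtain y i' j' where y: "\<psi>' p = line_class (block_subspace n B) y" "y \<in> coordinate_space n" "i' \<in> B" "j' \<in> B" "y i' \<noteq> y j'"
    using projective_pointE[OF B morphism_points[OF psi'(1) p]] .
  note gx = projective_germ[OF psi B p x] and gy = projective_germ[OF psi' B p y]
  obtain c where c: "c \<noteq> 0" "\<forall>k\<in>B. \<forall>l\<in>B. block_value M e D p i j k l = c * block_value M e D p i' j' k l"
    using block_value_change[OF M gx(2) gy(2)] by blast
  have "x k - x l = ((x i - x j) * c / (y i' - y j')) * (y k - y l)" if kl: "k \<in> B" "l \<in> B" for k l
  proof -
    have "(x k - x l) / (x i - x j) = c * ((y k - y l) / (y i' - y j'))"
      using c(2) kl block_value_eq[OF M gx(1)[OF kl]] block_value_eq[OF M gy(1)[OF kl]] by simp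
    then show ?thesis using x(5) by (simp add: field_simps)
  qed
  then show ?thesis unfolding x(1) y(1)
    by (intro line_class_block_eq[OF x(2) y(2), of "(x i - x j) * c / (y i' - y j')"]) (use c(1) x(5) y(5) in auto)
qed

section \<open>The toric variety of the Weyl chambers\<close>

text \<open>Exponent vector of the character t_i / t_j.\<close>

definition root_vector :: "nat \<Rightarrow> nat \<Rightarrow> nat \<Rightarrow> int" where
  "root_vector i j = (\<lambda>k. (if k = i then 1 else 0) - (if k = j then 1 else 0))"

text \<open>The face of the chamber of \<open>s\<close> on which the steps in \<open>E\<close> are
  equalities. The faces in \<open>weyl_fan\<close> are given by supporting forms; this is their
  explicit shape.\<close>

definition chain_cone :: "nat \<Rightarrow> (nat \<Rightarrow> nat) \<Rightarrow> nat set \<Rightarrow> (nat \<Rightarrow> real) set" where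
  "chain_cone n s E = {x. (\<forall>i. i \<notin> {1..n} \<longrightarrow> x i = 0) \<and>
     (\<forall>k. 1 \<le> k \<and> k < n \<longrightarrow> x (s k) \<le> x (s (Suc k))) \<and> (\<forall>k\<in>E. x (s k) = x (s (Suc k)))}"

lemma abel_sum:
  fixes a y :: "nat \<Rightarrow> 'a :: comm_ring_1"
  shows "(\<Sum>k=1..n. a k * y k) = y 1 * (\<Sum>k=1..n. a k) + (\<Sum>k=1..<n. (\<Sum>j=Suc k..n. a j) * (y (Suc k) - y k))"
proof (induction n)
  case (Suc n)
  have tel: "(\<Sum>k=1..<Suc n. y (Suc k) - y k) = y (Suc n) - y 1"
    by (subst sum_Suc_diff') auto
  have "(\<Sum>k=1..<Suc n. (\<Sum>j=Suc k..Suc n. a j) * (y (Suc k) - y k)) =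
      (\<Sum>k=1..<Suc n. (\<Sum>j=Suc k..n. a j) * (y (Suc k) - y k) + a (Suc n) * (y (Suc k) - y k))"
    by (rule sum.cong) (auto simp: algebra_simps)
  also have "\<dots> = (\<Sum>k=1..<Suc n. (\<Sum>j=Suc k..n. a j) * (y (Suc k) - y k)) + a (Suc n) * (y (Suc n) - y 1)"
    unfolding sum.distrib tel[symmetric] sum_distrib_left ..
  also have "(\<Sum>k=1..<Suc n. (\<Sum>j=Suc k..n. a j) * (y (Suc k) - y k)) = (\<Sum>k=1..<n. (\<Sum>j=Suc k..n. a j) * (y (Suc k) - y k))"
    by (cases n) auto
  finally show ?case using Suc.IH by (simp add: algebra_simps)
qed simp

text \<open>Expresses a form with coefficient sum zero through the successive steps along the
  chamber of \<open>s\<close>, so that membership in the dual cone becomes a sign condition on tail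
  sums.\<close>

lemma abel_sum_permuted:
  fixes u x :: "nat \<Rightarrow> 'a :: comm_ring_1"
  assumes s: "s permutes {1..n}" and u: "(\<Sum>i=1..n. u i) = 0"
  shows "(\<Sum>i=1..n. u i * x i) = (\<Sum>k=1..<n. (\<Sum>j=Suc k..n. u (s j)) * (x (s (Suc k)) - x (s k)))"
proof -
  have "(\<Sum>i=1..n. u i * x i) = (\<Sum>k=1..n. u (s k) * x (s k))"
    using sum.permute[OF s, of "\<lambda>i. u i * x i"] by (simp add: comp_def)
  moreover have "(\<Sum>k=1..n. u (s k)) = 0" using u sum.permute[OF s, of u] by (simp add: comp_def)
  ultimately show ?thesis using abel_sum[of "\<lambda>k. u (s k)" "\<lambda>k. x (s k)" n] by simp
qed

lemma permutes_in: "s permutes {1..n} \<Longrightarrow> k \<in> {1..n} \<Longrightarrow> s k \<in> {1..n::nat}"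
  by (simp only: permutes_in_image)

lemma permutes_obtain:
  assumes "s permutes {1..n}" "i \<in> {1..n::nat}"
  obtains k where "k \<in> {1..n}" "i = s k"
  using assms permutes_image[OF assms(1)] by (metis imageE)

lemma sum_indicator_product:
  fixes u :: "nat \<Rightarrow> 'a :: comm_ring_1"
  assumes "i \<in> {1..n}" shows "(\<Sum>j=1..n. u j * (if j = i then 1 else 0)) = u i"
  using assms by (simp add: if_distrib[of "\<lambda>c. u _ * c"] sum.delta cong: if_cong)

text \<open>These indicators generate the rays of the face modulo constants; pairing with them
  extracts the tail sums one by one.\<close>

lemma step_in_chain_cone:
  assumes s: "s permutes {1..n}" and E: "E \<subseteq> {1..<n}" and k: "k \<in> {1..<n}" "k \<notin> E"
  shows "(\<lambda>i. if i \<in> s ` {Suc k..n} then 1 else 0) \<in> chain_cone n s E"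
proof -
  have inj: "s j \<in> s ` {Suc k..n} \<longleftrightarrow> j \<in> {Suc k..n}" for j
    using permutes_inj[OF s] by (simp add: inj_image_mem_iff)
  have out: "i \<notin> s ` {Suc k..n}" if "i \<notin> {1..n}" for i
    using permutes_in[OF s] that k by fastforce
  show ?thesis unfolding chain_cone_def mem_Collect_eq inj
    using out E k by (auto simp: subset_iff) (metis Suc_leI le_antisym not_less_eq_eq)
qed

lemma dual_coneD: "u \<in> dual_cone n \<sigma> \<Longrightarrow> x \<in> \<sigma> \<Longrightarrow> 0 \<le> (\<Sum>i=1..n. u i * x i)"
  unfolding dual_cone_def by simp

lemma dual_coefficient_nonneg:
  assumes s: "s permutes {1..n}" and E: "E \<subseteq> {1..<n}" and k: "k \<in> {1..<n}" "k \<notin> E"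
    and u: "u \<in> dual_cone n (chain_cone n s E)"
  shows "0 \<le> (\<Sum>j=Suc k..n. u (s j))"
proof -
  let ?x = "\<lambda>i. if i \<in> s ` {Suc k..n} then 1 else 0 :: real"
  have sub: "s ` {Suc k..n} \<subseteq> {1..n}" using permutes_in[OF s] k by fastforce
  have "0 \<le> (\<Sum>i=1..n. u i * ?x i)"
    by (rule dual_coneD[OF u step_in_chain_cone[OF s E k]])
  also have "(\<Sum>i=1..n. u i * ?x i) = (\<Sum>i\<in>s ` {Suc k..n}. u i)"
    by (rule sum.mono_neutral_cong_right) (use sub in auto)
  also have "\<dots> = (\<Sum>j=Suc k..n. u (s j))"
    by (subst sum.reindex) (use permutes_inj[OF s] in \<open>auto simp: inj_on_def\<close>)
  finally show ?thesis .
qed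

lemma weyl_fanE:
  assumes "\<sigma> \<in> weyl_fan n"
  obtains s E where "s permutes {1..n}" "E \<subseteq> {1..<n}" "\<sigma> = chain_cone n s E"
proof -
  obtain \<sigma>0 u where 1: "\<sigma>0 \<in> weyl_chambers n" "u \<in> dual_cone n \<sigma>0" "\<sigma> = {x \<in> \<sigma>0. (\<Sum>i=1..n. u i * x i) = 0}"
    using assms unfolding weyl_fan_def by blast
  obtain s where s: "s permutes {1..n}" and "\<sigma>0 = {x. (\<forall>i. i \<notin> {1..n} \<longrightarrow> x i = 0) \<and> (\<forall>k. 1 \<le> k \<and> k < n \<longrightarrow> x (s k) \<le> x (s (Suc k)))}"
    using 1(1) unfolding weyl_chambers_def by blast
  then have \<sigma>0: "\<sigma>0 = chain_cone n s {}" unfolding chain_cone_def by simp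
  define c where "c k = (\<Sum>j=Suc k..n. u (s j))" for k
  have c: "0 \<le> c k" if "k \<in> {1..<n}" for k
    unfolding c_def using dual_coefficient_nonneg[OF s _ that _ 1(2)[unfolded \<sigma>0]] by simp
  have u0: "(\<Sum>i=1..n. u i) = 0" using 1(2) unfolding dual_cone_def by blast
  \<comment> \<open>On the chamber the form is a sum of nonnegative terms, so it vanishes exactly
    where every step with nonzero coefficient does.\<close>
  define E where "E = {k \<in> {1..<n}. c k \<noteq> 0}"
  have "(\<Sum>i=1..n. u i * x i) = 0 \<longleftrightarrow> (\<forall>k\<in>E. x (s k) = x (s (Suc k)))" if x: "x \<in> \<sigma>0" for x
  proof -
    have pos: "0 \<le> c k * (x (s (Suc k)) - x (s k))" if "k \<in> {1..<n}" for k
      using c[OF that] x that unfolding \<sigma>0 chain_cone_def by auto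
    have "(\<Sum>i=1..n. u i * x i) = (\<Sum>k=1..<n. c k * (x (s (Suc k)) - x (s k)))"
      unfolding c_def by (rule abel_sum_permuted[OF s u0])
    also have "\<dots> = 0 \<longleftrightarrow> (\<forall>k\<in>{1..<n}. c k * (x (s (Suc k)) - x (s k)) = 0)"
      by (rule sum_nonneg_eq_0_iff) (use pos in auto)
    finally show ?thesis unfolding E_def by auto
  qed
  then have "\<sigma> = chain_cone n s E" unfolding 1(3) unfolding \<sigma>0 chain_cone_def by blast
  moreover have "E \<subseteq> {1..<n}" unfolding E_def by blast
  ultimately show ?thesis using that s by blast
qed

lemma chain_cone_fan:
  assumes s: "s permutes {1..n}" and E: "E \<subseteq> {1..<n}"
  shows "chain_cone n s E \<in> weyl_fan n"
proof -
  let ?\<sigma> = "chain_cone n s {}"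
  have ch: "?\<sigma> \<in> weyl_chambers n" unfolding weyl_chambers_def chain_cone_def using s by auto
  have fE: "finite E" using E finite_subset by blast
  \<comment> \<open>The sum of the steps in \<open>E\<close>, a supporting form that vanishes on the
    chamber exactly where all these steps do.\<close>
  define u where "u i = (\<Sum>k\<in>E. (if i = s (Suc k) then 1 else 0) - (if i = s k then 1 else 0 :: real))" for i
  have in1: "s k \<in> {1..n}" "s (Suc k) \<in> {1..n}" if "k \<in> E" for k
    using permutes_in[OF s] E that by auto
  have ux: "(\<Sum>i=1..n. u i * x i) = (\<Sum>k\<in>E. x (s (Suc k)) - x (s k))" for x
  proof -
    have "(\<Sum>i=1..n. u i * x i) = (\<Sum>i=1..n. \<Sum>k\<in>E. x i * (if i = s (Suc k) then 1 else 0) - x i * (if i = s k then 1 else 0))"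
      unfolding u_def sum_distrib_right by (intro sum.cong) (auto simp: algebra_simps)
    also have "\<dots> = (\<Sum>k\<in>E. (\<Sum>i=1..n. x i * (if i = s (Suc k) then 1 else 0)) - (\<Sum>i=1..n. x i * (if i = s k then 1 else 0)))"
      by (subst sum.swap) (simp add: sum_subtractf)
    also have "\<dots> = (\<Sum>k\<in>E. x (s (Suc k)) - x (s k))"
      by (rule sum.cong[OF refl]) (simp only: sum_indicator_product in1)
    finally show ?thesis .
  qed
  have pos: "0 \<le> x (s (Suc k)) - x (s k)" if "x \<in> ?\<sigma>" "k \<in> E" for x k
    using that E unfolding chain_cone_def by auto
  have u: "u \<in> dual_cone n ?\<sigma>" unfolding dual_cone_def mem_Collect_eq
  proof (intro conjI allI impI ballI)
    show "u i = 0" if "i \<notin> {1..n}" for i unfolding u_def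
      by (rule sum.neutral) (use in1 that in fastforce)
    show "(\<Sum>i=1..n. u i) = 0" using ux[of "\<lambda>_. 1"] by simp
    show "0 \<le> (\<Sum>i=1..n. u i * x i)" if "x \<in> ?\<sigma>" for x unfolding ux using pos[OF that] by (rule sum_nonneg)
  qed
  have "chain_cone n s E = {x \<in> ?\<sigma>. (\<Sum>i=1..n. u i * x i) = 0}"
  proof -
    have "(\<Sum>i=1..n. u i * x i) = 0 \<longleftrightarrow> (\<forall>k\<in>E. x (s k) = x (s (Suc k)))" if "x \<in> ?\<sigma>" for x
      unfolding ux using sum_nonneg_eq_0_iff[OF fE pos[OF that]] by auto
    then show ?thesis unfolding chain_cone_def by blast
  qed
  then show ?thesis unfolding weyl_fan_def using ch u by blast
qed

lemma chain_cone_mono: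
  assumes x: "x \<in> chain_cone n s E" and "k \<le> l" "1 \<le> k" "l \<le> n"
  shows "x (s k) \<le> x (s l)"
  using assms(2-4)
proof (induction l rule: dec_induct)
  case (step l)
  then have "x (s k) \<le> x (s l)" by simp
  also have "\<dots> \<le> x (s (Suc l))" using x step unfolding chain_cone_def by auto
  finally show ?case .
qed simp

definition pairing :: "nat \<Rightarrow> (nat \<Rightarrow> int) \<Rightarrow> (nat \<Rightarrow> real) \<Rightarrow> real" where
  "pairing n m x = (\<Sum>i=1..n. real_of_int (m i) * x i)"

lemma dual_monoid_iff: "m \<in> dual_monoid n \<sigma> \<longleftrightarrow> m \<in> character_lattice n \<and> (\<forall>x\<in>\<sigma>. 0 \<le> pairing n m x)"
proof -
  have "(\<Sum>i=1..n. real_of_int (m i)) = 0" if "(\<Sum>i=1..n. m i) = 0"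
    using that by (metis of_int_0 of_int_sum)
  then show ?thesis unfolding dual_monoid_def dual_cone_def character_lattice_def pairing_def by auto
qed

lemma pairing_add: "pairing n (\<lambda>i. m i + m' i) x = pairing n m x + pairing n m' x"
  unfolding pairing_def by (simp add: algebra_simps sum.distrib)

lemma pairing_root: "i \<in> {1..n} \<Longrightarrow> j \<in> {1..n} \<Longrightarrow> pairing n (root_vector i j) x = x i - x j"
proof -
  assume ij: "i \<in> {1..n}" "j \<in> {1..n}"
  have "pairing n (root_vector i j) x = (\<Sum>k=1..n. x k * (if k = i then 1 else 0) - x k * (if k = j then 1 else 0))"
    unfolding pairing_def root_vector_def by (rule sum.cong) auto
  then show ?thesis by (simp only: sum_subtractf sum_indicator_product[OF ij(1)] sum_indicator_product[OF ij(2)])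
qed

lemma root_character: "i \<in> {1..n} \<Longrightarrow> j \<in> {1..n} \<Longrightarrow> root_vector i j \<in> character_lattice n"
proof -
  assume ij: "i \<in> {1..n}" "j \<in> {1..n}"
  have "(\<Sum>k=1..n. root_vector i j k) = (\<Sum>k=1..n. 1 * (if k = i then 1 else 0) - 1 * (if k = j then 1 else 0))"
    unfolding root_vector_def by (rule sum.cong) auto
  also have "\<dots> = 0" by (simp only: sum_subtractf sum_indicator_product[OF ij(1)] sum_indicator_product[OF ij(2)])
  finally show ?thesis unfolding character_lattice_def using ij by (auto simp: root_vector_def)
qed

lemma character_zero: "(\<lambda>_. 0) \<in> character_lattice n"
  and character_add: "m \<in> character_lattice n \<Longrightarrow> m' \<in> character_lattice n \<Longrightarrow> (\<lambda>i. m i + m' i) \<in> character_lattice n"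
  unfolding character_lattice_def by (auto simp: sum.distrib)

lemma dual_monoid_zero: "(\<lambda>_. 0) \<in> dual_monoid n \<sigma>"
  unfolding dual_monoid_iff by (simp add: character_zero pairing_def)

lemma dual_monoid_add: "m \<in> dual_monoid n \<sigma> \<Longrightarrow> m' \<in> dual_monoid n \<sigma> \<Longrightarrow> (\<lambda>i. m i + m' i) \<in> dual_monoid n \<sigma>"
  unfolding dual_monoid_iff by (auto simp: character_add pairing_add)

lemma dual_monoid_antimono: "\<tau> \<subseteq> \<sigma> \<Longrightarrow> dual_monoid n \<sigma> \<subseteq> dual_monoid n \<tau>"
  unfolding dual_monoid_iff subset_iff by blast

lemma root_dual_iff: "i \<in> {1..n} \<Longrightarrow> j \<in> {1..n} \<Longrightarrow> root_vector i j \<in> dual_monoid n \<sigma> \<longleftrightarrow> (\<forall>x\<in>\<sigma>. x j \<le> x i)"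
  unfolding dual_monoid_iff by (simp add: root_character pairing_root)

text \<open>The dual monoid of the face is generated by the simple roots of the chamber together
  with the negatives of those in \<open>E\<close>: summation by parts expands \<open>m\<close> in
  simple roots, with coefficients that are nonnegative off \<open>E\<close>.\<close>

lemma chain_induct:
  assumes s: "s permutes {1..n}" and E: "E \<subseteq> {1..<n}" and m: "m \<in> dual_monoid n (chain_cone n s E)"
    and z: "P (\<lambda>_. 0)"
    and add: "\<And>m m'. m \<in> dual_monoid n (chain_cone n s E) \<Longrightarrow> m' \<in> dual_monoid n (chain_cone n s E) \<Longrightarrow>
       P m \<Longrightarrow> P m' \<Longrightarrow> P (\<lambda>i. m i + m' i)"
    and step: "\<And>k. k \<in> {1..<n} \<Longrightarrow> P (root_vector (s (Suc k)) (s k))"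
    and flat: "\<And>k. k \<in> E \<Longrightarrow> P (root_vector (s k) (s (Suc k)))"
  shows "P m"
proof -
  let ?\<sigma> = "chain_cone n s E"
  define Q where "Q m \<longleftrightarrow> m \<in> dual_monoid n ?\<sigma> \<and> P m" for m
  have Q0: "Q (\<lambda>_. 0)" unfolding Q_def using z dual_monoid_zero by blast
  have Qadd: "Q (\<lambda>i. m i + m' i)" if "Q m" "Q m'" for m m'
    using that add dual_monoid_add unfolding Q_def by blast
  have sk: "s k \<in> {1..n}" "s (Suc k) \<in> {1..n}" if "k \<in> {1..<n}" for k using permutes_in[OF s] that by auto
  have up: "Q (root_vector (s (Suc k)) (s k))" if k: "k \<in> {1..<n}" for k
    unfolding Q_def root_dual_iff[OF sk(2)[OF k] sk(1)[OF k]] using step[OF k] k by (auto simp: chain_cone_def)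
  have down: "Q (root_vector (s k) (s (Suc k)))" if k: "k \<in> E" for k
  proof -
    have k': "k \<in> {1..<n}" using k E by blast
    show ?thesis
      unfolding Q_def root_dual_iff[OF sk(1)[OF k'] sk(2)[OF k']] using flat[OF k] k by (auto simp: chain_cone_def)
  qed
  have Qmult: "Q (\<lambda>i. int t * r i)" if "Q r" for t r
  proof (induction t)
    case (Suc t)
    have "(\<lambda>i. int (Suc t) * r i) = (\<lambda>i. r i + int t * r i)" by (auto simp: algebra_simps)
    then show ?case using Qadd[OF that Suc] by simp
  qed (simp add: Q0)
  define c where "c k = (\<Sum>j=Suc k..n. m (s j))" for k
  have c: "0 \<le> c k" if "k \<in> {1..<n}" "k \<notin> E" for k
  proof -
    have "(\<lambda>i. real_of_int (m i)) \<in> dual_cone n ?\<sigma>" using m unfolding dual_monoid_def by blast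
    from dual_coefficient_nonneg[OF s E that this]
    have "0 \<le> real_of_int (c k)" unfolding c_def by simp
    then show ?thesis by simp
  qed
  let ?r = "\<lambda>k. root_vector (s (Suc k)) (s k)"
  have one: "Q (\<lambda>i. c k * ?r k i)" if k: "k \<in> {1..<n}" for k
  proof (cases "0 \<le> c k")
    case True
    then show ?thesis using Qmult[OF up[OF k], of "nat (c k)"] by simp
  next
    case False
    then have "k \<in> E" using c[OF k] by blast
    have "(\<lambda>i. c k * ?r k i) = (\<lambda>i. int (nat (- c k)) * root_vector (s k) (s (Suc k)) i)"
      using False by (auto simp: root_vector_def)
    then show ?thesis using Qmult[OF down[OF \<open>k \<in> E\<close>], of "nat (- c k)"] by simp
  qed
  have "finite K \<Longrightarrow> K \<subseteq> {1..<n} \<Longrightarrow> Q (\<lambda>i. \<Sum>k\<in>K. c k * ?r k i)" for K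
  proof (induction K rule: finite_induct)
    case (insert k K)
    then show ?case using Qadd[OF one[of k], of "\<lambda>i. \<Sum>k\<in>K. c k * ?r k i"] by simp
  qed (simp add: Q0)
  then have QS: "Q (\<lambda>i. \<Sum>k=1..<n. c k * ?r k i)" by simp
  have "m i = (\<Sum>k=1..<n. c k * ?r k i)" for i
  proof (cases "i \<in> {1..n}")
    case True
    have m0: "(\<Sum>i=1..n. m i) = 0" using m unfolding dual_monoid_iff character_lattice_def by blast
    \<comment> \<open>The coordinate at \<open>i\<close> is the pairing of \<open>m\<close> with the
      indicator of \<open>i\<close>, to which summation by parts applies.\<close>
    have "m i = (\<Sum>j=1..n. m j * (if j = i then 1 else 0))" by (rule sum_indicator_product[OF True, symmetric])
    also have "\<dots> = (\<Sum>k=1..<n. c k * ((if s (Suc k) = i then 1 else 0) - (if s k = i then 1 else 0)))"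
      unfolding c_def by (rule abel_sum_permuted[OF s m0])
    also have "\<dots> = (\<Sum>k=1..<n. c k * ?r k i)" by (rule sum.cong) (auto simp: root_vector_def)
    finally show ?thesis .
  next
    case False
    have "?r k i = 0" if "k \<in> {1..<n}" for k using sk[OF that] False unfolding root_vector_def by auto
    then have "(\<Sum>k=1..<n. c k * ?r k i) = 0" by (intro sum.neutral) auto
    then show ?thesis using False m unfolding dual_monoid_iff character_lattice_def by auto
  qed
  then have "m = (\<lambda>i. \<Sum>k=1..<n. c k * ?r k i)" by blast
  then show ?thesis using QS unfolding Q_def by simp
qed

text \<open>A form of \<open>chain_induct\<close> that mentions neither the permutation nor the
  face, at the price of treating all roots in the monoid.\<close>

lemma dual_monoid_induct:
  assumes \<sigma>: "\<sigma> \<in> weyl_fan n" and m: "m \<in> dual_monoid n \<sigma>"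
    and z: "P (\<lambda>_. 0)"
    and add: "\<And>m m'. m \<in> dual_monoid n \<sigma> \<Longrightarrow> m' \<in> dual_monoid n \<sigma> \<Longrightarrow> P m \<Longrightarrow> P m' \<Longrightarrow> P (\<lambda>i. m i + m' i)"
    and root: "\<And>i j. i \<in> {1..n} \<Longrightarrow> j \<in> {1..n} \<Longrightarrow> root_vector i j \<in> dual_monoid n \<sigma> \<Longrightarrow> P (root_vector i j)"
  shows "P m"
proof -
  obtain s E where s: "s permutes {1..n}" "E \<subseteq> {1..<n}" "\<sigma> = chain_cone n s E" using \<sigma> by (rule weyl_fanE)
  have sk: "s k \<in> {1..n}" "s (Suc k) \<in> {1..n}" if "k \<in> {1..<n}" for k using permutes_in[OF s(1)] that by auto
  show ?thesis
  proof (rule chain_induct[OF s(1,2) m[unfolded s(3)], of P, OF z add[unfolded s(3)]])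
    show "P (root_vector (s (Suc k)) (s k))" if k: "k \<in> {1..<n}" for k
      by (rule root[OF sk(2,1)[OF k]]) (use k in \<open>auto simp: root_dual_iff[OF sk(2,1)[OF k]] s(3) chain_cone_def\<close>)
    show "P (root_vector (s k) (s (Suc k)))" if k: "k \<in> E" for k
    proof -
      have k': "k \<in> {1..<n}" using k s by blast
      show ?thesis
        by (rule root[OF sk[OF k']]) (use k in \<open>auto simp: root_dual_iff[OF sk[OF k']] s(3) chain_cone_def\<close>)
    qed
  qed
qed

text \<open>No cone of the fan crosses a hyperplane x_i = x_j, since its points are all weakly
  sorted by one permutation. On the side of the blocks this corresponds to
  \<open>{0, i, j}\<close>.\<close>

lemma fan_total:
  assumes \<sigma>: "\<sigma> \<in> weyl_fan n" and ij: "i \<in> {1..n}" "j \<in> {1..n}"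
  shows "root_vector i j \<in> dual_monoid n \<sigma> \<or> root_vector j i \<in> dual_monoid n \<sigma>"
proof -
  obtain s E where s: "s permutes {1..n}" "E \<subseteq> {1..<n}" "\<sigma> = chain_cone n s E" using \<sigma> by (rule weyl_fanE)
  obtain k where k: "k \<in> {1..n}" "i = s k" using permutes_obtain[OF s(1) ij(1)] .
  obtain l where l: "l \<in> {1..n}" "j = s l" using permutes_obtain[OF s(1) ij(2)] .
  have "(\<forall>x\<in>\<sigma>. x j \<le> x i) \<or> (\<forall>x\<in>\<sigma>. x i \<le> x j)"
    using chain_cone_mono[of _ n s E k l] chain_cone_mono[of _ n s E l k] k l s(3) by (cases "k \<le> l") auto
  then show ?thesis unfolding root_dual_iff[OF ij] root_dual_iff[OF ij(2,1)] .
qed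

text \<open>A cone of this fan is cut out by the comparisons of two coordinates that hold on it, so
  comparing cones reduces to comparing the roots in their dual monoids.\<close>

lemma fan_mem_iff:
  assumes \<sigma>: "\<sigma> \<in> weyl_fan n"
  shows "x \<in> \<sigma> \<longleftrightarrow> (\<forall>i. i \<notin> {1..n} \<longrightarrow> x i = 0) \<and>
    (\<forall>i\<in>{1..n}. \<forall>j\<in>{1..n}. root_vector i j \<in> dual_monoid n \<sigma> \<longrightarrow> x j \<le> x i)" (is "_ \<longleftrightarrow> ?R")
proof
  obtain s E where s: "s permutes {1..n}" "E \<subseteq> {1..<n}" "\<sigma> = chain_cone n s E" using \<sigma> by (rule weyl_fanE)
  have sk: "s k \<in> {1..n}" "s (Suc k) \<in> {1..n}" if "k \<in> {1..<n}" for k using permutes_in[OF s(1)] that by auto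
  show "x \<in> \<sigma> \<Longrightarrow> ?R" using s(3) by (auto simp: root_dual_iff chain_cone_def)
  assume R: ?R
  have le: "x (s k) \<le> x (s (Suc k))" if k: "k \<in> {1..<n}" for k
  proof -
    have "root_vector (s (Suc k)) (s k) \<in> dual_monoid n \<sigma>"
      unfolding root_dual_iff[OF sk(2,1)[OF k]] s(3) using k by (auto simp: chain_cone_def)
    then show ?thesis using R sk[OF k] by blast
  qed
  have ge: "x (s (Suc k)) \<le> x (s k)" if k: "k \<in> E" for k
  proof -
    have k': "k \<in> {1..<n}" using k s by blast
    have "root_vector (s k) (s (Suc k)) \<in> dual_monoid n \<sigma>"
      unfolding root_dual_iff[OF sk[OF k']] s(3) using k by (auto simp: chain_cone_def)
    then show ?thesis using R sk[OF k'] by blast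
  qed
  show "x \<in> \<sigma>" unfolding s(3) chain_cone_def mem_Collect_eq
  proof (intro conjI allI impI ballI)
    show "x i = 0" if "i \<notin> {1..n}" for i using R that by blast
    show "x (s k) \<le> x (s (Suc k))" if "1 \<le> k \<and> k < n" for k using le[of k] that by simp
    show "x (s k) = x (s (Suc k))" if "k \<in> E" for k using le[of k] ge[of k] that s(2) by fastforce
  qed
qed

text \<open>For \<open>a\<close> vanishing off \<open>{1..n}\<close> this is the smallest cone of
  the fan that contains \<open>a\<close>, encoded by the weak order of its coordinates. The
  condition \<open>a \<in> order_cone n a\<close>, frequent below, says just that \<open>a\<close>
  vanishes off \<open>{1..n}\<close>.\<close>

definition order_cone :: "nat \<Rightarrow> (nat \<Rightarrow> real) \<Rightarrow> (nat \<Rightarrow> real) set" where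
  "order_cone n a = {x. (\<forall>i. i \<notin> {1..n} \<longrightarrow> x i = 0) \<and> (\<forall>i\<in>{1..n}. \<forall>j\<in>{1..n}. a i \<le> a j \<longrightarrow> x i \<le> x j)}"

lemma sorting_permutation:
  fixes a :: "nat \<Rightarrow> real"
  obtains s where "s permutes {1..n}" "\<forall>k l. 1 \<le> k \<longrightarrow> k \<le> l \<longrightarrow> l \<le> n \<longrightarrow> a (s k) \<le> a (s l)"
proof -
  define xs where "xs = sort_key a [1..<Suc n]"
  have xs: "length xs = n" "distinct xs" "set xs = {1..n}" "sorted (map a xs)"
    unfolding xs_def by (auto simp: set_sort distinct_sort)
  define s where "s k = (if k \<in> {1..n} then xs ! (k - 1) else k)" for k
  have "bij_betw (\<lambda>k. xs ! k) {..<n} {1..n}" using bij_betw_nth[OF xs(2), of "{..<n}" "{1..n}"] xs by simp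
  moreover have "bij_betw (\<lambda>k. k - 1) {1..n} {..<n}"
    by (rule bij_betw_byWitness[where f'=Suc]) auto
  ultimately have "bij_betw ((\<lambda>k. xs ! k) \<circ> (\<lambda>k. k - 1)) {1..n} {1..n}" by (rule bij_betw_trans[rotated])
  moreover have "bij_betw s {1..n} {1..n} \<longleftrightarrow> bij_betw ((\<lambda>k. xs ! k) \<circ> (\<lambda>k. k - 1)) {1..n} {1..n}"
    by (rule bij_betw_cong) (auto simp: s_def)
  ultimately have "bij_betw s {1..n} {1..n}" by simp
  then have "s permutes {1..n}" by (rule bij_imp_permutes) (auto simp: s_def)
  moreover have "a (s k) \<le> a (s l)" if "1 \<le> k" "k \<le> l" "l \<le> n" for k l
    using sorted_nth_mono[OF xs(4), of "k - 1" "l - 1"] that xs(1) unfolding s_def by auto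
  ultimately show ?thesis using that by blast
qed

lemma order_cone_fan: "order_cone n a \<in> weyl_fan n"
proof -
  obtain s where s: "s permutes {1..n}" and mono': "\<forall>k l. 1 \<le> k \<longrightarrow> k \<le> l \<longrightarrow> l \<le> n \<longrightarrow> a (s k) \<le> a (s l)"
    by (rule sorting_permutation[of n a])
  have mono: "a (s k) \<le> a (s l)" if "1 \<le> k" "k \<le> l" "l \<le> n" for k l using mono' that by blast
  define E where "E = {k \<in> {1..<n}. a (s k) = a (s (Suc k))}"
  have sk: "s k \<in> {1..n}" if "k \<in> {1..n}" for k using permutes_in[OF s that] .
  have "order_cone n a = chain_cone n s E"
  proof (intro set_eqI iffI)
    fix x assume x: "x \<in> order_cone n a"
    have le: "x (s k) \<le> x (s l)" if "k \<in> {1..n}" "l \<in> {1..n}" "a (s k) \<le> a (s l)" for k l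
      using x sk that unfolding order_cone_def by blast
    show "x \<in> chain_cone n s E" unfolding chain_cone_def mem_Collect_eq
    proof (intro conjI allI impI ballI)
      show "x i = 0" if "i \<notin> {1..n}" for i using x that unfolding order_cone_def by blast
      show "x (s k) \<le> x (s (Suc k))" if "1 \<le> k \<and> k < n" for k using le[of k "Suc k"] mono[of k "Suc k"] that by auto
      show "x (s k) = x (s (Suc k))" if "k \<in> E" for k
        using le[of k "Suc k"] le[of "Suc k" k] that unfolding E_def by auto
    qed
  next
    fix x assume x: "x \<in> chain_cone n s E"
    show "x \<in> order_cone n a" unfolding order_cone_def mem_Collect_eq
    proof (intro conjI allI impI ballI)
      show "x i = 0" if "i \<notin> {1..n}" for i using x that unfolding chain_cone_def by blast
      fix i j assume ij: "i \<in> {1..n}" "j \<in> {1..n}" "a i \<le> a j"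
      obtain k where k: "k \<in> {1..n}" "i = s k" using permutes_obtain[OF s ij(1)] .
      obtain l where l: "l \<in> {1..n}" "j = s l" using permutes_obtain[OF s ij(2)] .
      show "x i \<le> x j"
      proof (cases "k \<le> l")
        case True
        then show ?thesis using chain_cone_mono[OF x True] k l by simp
      next
        case False
        \<comment> \<open>Here the sorted positions and the order of the values disagree, so all
          values of \<open>a\<close> between the two positions are equal; every step in between
          belongs to \<open>E\<close>, and \<open>x\<close> is constant along them.\<close>
        have eq: "r \<le> k \<Longrightarrow> x (s r) = x (s l)" if "l \<le> r" for r
          using that
        proof (induction r rule: dec_induct)
          case (step r)
          have "a (s r) = a (s (Suc r))"
            using mono[of l r] mono[of r "Suc r"] mono[of "Suc r" k] step k l ij(3) by force
          then have "r \<in> E" unfolding E_def using step k l by auto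
          then show ?case using x step unfolding chain_cone_def by auto
        qed simp
        have "x (s k) = x (s l)" by (rule eq) (use False in auto)
        then show ?thesis unfolding k(2) l(2) by simp
      qed
    qed
  qed
  moreover have "E \<subseteq> {1..<n}" unfolding E_def by blast
  ultimately show ?thesis using chain_cone_fan[OF s] by simp
qed

lemma order_cone_self: "(\<And>i. i \<notin> {1..n} \<Longrightarrow> a i = 0) \<Longrightarrow> a \<in> order_cone n a"
  unfolding order_cone_def by auto

lemma order_cone_subset:
  assumes \<sigma>: "\<sigma> \<in> weyl_fan n" and a: "a \<in> \<sigma>" shows "order_cone n a \<subseteq> \<sigma>"
proof
  fix x assume x: "x \<in> order_cone n a"
  show "x \<in> \<sigma>" unfolding fan_mem_iff[OF \<sigma>]
  proof (intro conjI allI impI ballI)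
    show "x i = 0" if "i \<notin> {1..n}" for i using x that unfolding order_cone_def by blast
    fix i j assume ij: "i \<in> {1..n}" "j \<in> {1..n}" "root_vector i j \<in> dual_monoid n \<sigma>"
    then have "a j \<le> a i" using a unfolding root_dual_iff[OF ij(1,2)] by blast
    then show "x j \<le> x i" using x ij unfolding order_cone_def by blast
  qed
qed

section \<open>Points of the affine charts as limits\<close>

definition monomial :: "nat \<Rightarrow> (nat \<Rightarrow> complex) \<Rightarrow> (nat \<Rightarrow> int) \<Rightarrow> complex" where
  "monomial n c m = (\<Prod>i=1..n. c i powi m i)"

lemma torus_cover_nonzero: "c \<in> torus_cover n \<Longrightarrow> i \<in> {1..n} \<Longrightarrow> c i \<noteq> 0"
  unfolding torus_cover_def by blast

lemma monomial_zero: "monomial n c (\<lambda>_. 0) = 1"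
  unfolding monomial_def by simp

lemma monomial_add: "c \<in> torus_cover n \<Longrightarrow> monomial n c (\<lambda>i. m i + m' i) = monomial n c m * monomial n c m'"
  unfolding monomial_def prod.distrib[symmetric]
  by (rule prod.cong) (use torus_cover_nonzero in \<open>auto simp: power_int_add\<close>)

lemma monomial_root:
  assumes c: "c \<in> torus_cover n" and ij: "i \<in> {1..n}" "j \<in> {1..n}"
  shows "monomial n c (root_vector i j) = c i / c j"
proof -
  have "monomial n c (root_vector i j) = (\<Prod>k=1..n. (if k = i then c i else 1) * (if k = j then inverse (c j) else 1))"
    unfolding monomial_def root_vector_def
    by (rule prod.cong) (use torus_cover_nonzero[OF c] in \<open>auto simp: power_int_minus\<close>)
  also have "\<dots> = c i * inverse (c j)" using ij by (simp add: prod.distrib)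
  finally show ?thesis by (simp add: divide_inverse)
qed

text \<open>The limit of the characters along the curve \<open>c\<^sub>i s\<^sup>a\<^sup>i\<close> as \<open>s\<close> tends to \<open>0\<close>; by
  \<open>affine_toric_limit\<close> below all points of the affine charts are such limits.\<close>

definition limit_value :: "nat \<Rightarrow> (nat \<Rightarrow> real) set \<Rightarrow> (nat \<Rightarrow> real) \<Rightarrow> (nat \<Rightarrow> complex) \<Rightarrow> (nat \<Rightarrow> int) \<Rightarrow> complex" where
  "limit_value n \<sigma> a c = (\<lambda>m. if m \<in> dual_monoid n \<sigma> \<and> pairing n m a = 0 then monomial n c m else 0)"

text \<open>The pairings of the dual monoid with \<open>a\<close> are nonnegative, so the pairing of
  a sum vanishes only if both summands do; this makes the truncated monomial multiplicative.\<close>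

lemma limit_value_affine:
  assumes a: "a \<in> \<sigma>" and c: "c \<in> torus_cover n"
  shows "limit_value n \<sigma> a c \<in> affine_toric n \<sigma>"
  unfolding affine_toric_def mem_Collect_eq
proof (intro conjI ballI allI impI)
  have "pairing n (\<lambda>_. 0) a = 0" by (simp add: pairing_def)
  then show "limit_value n \<sigma> a c (\<lambda>_. 0) = 1"
    unfolding limit_value_def using dual_monoid_zero[of n \<sigma>] by (simp add: monomial_zero)
  fix m m' assume m: "m \<in> dual_monoid n \<sigma>" "m' \<in> dual_monoid n \<sigma>"
  then have "0 \<le> pairing n m a" "0 \<le> pairing n m' a" using a unfolding dual_monoid_iff by blast+
  then show "limit_value n \<sigma> a c (\<lambda>i. m i + m' i) = limit_value n \<sigma> a c m * limit_value n \<sigma> a c m'"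
    unfolding limit_value_def using m dual_monoid_add[OF m] by (auto simp: pairing_add monomial_add[OF c])
next
  show "limit_value n \<sigma> a c m = 0" if "m \<notin> dual_monoid n \<sigma>" for m using that unfolding limit_value_def by simp
qed

lemma limit_value_root:
  assumes "c \<in> torus_cover n" "i \<in> {1..n}" "j \<in> {1..n}" "root_vector i j \<in> dual_monoid n \<sigma>"
  shows "limit_value n \<sigma> a c (root_vector i j) = (if a i = a j then c i / c j else 0)"
  unfolding limit_value_def using assms by (simp add: pairing_root monomial_root)

lemma affine_toric_mult: "\<phi> \<in> affine_toric n \<sigma> \<Longrightarrow> m \<in> dual_monoid n \<sigma> \<Longrightarrow> m' \<in> dual_monoid n \<sigma> \<Longrightarrow>
   \<phi> (\<lambda>i. m i + m' i) = \<phi> m * \<phi> m'"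
  and affine_toric_zero: "\<phi> \<in> affine_toric n \<sigma> \<Longrightarrow> \<phi> (\<lambda>_. 0) = 1"
  and affine_toric_outside: "\<phi> \<in> affine_toric n \<sigma> \<Longrightarrow> m \<notin> dual_monoid n \<sigma> \<Longrightarrow> \<phi> m = 0"
  unfolding affine_toric_def by blast+

lemma root_cancel: "(\<lambda>k. root_vector i j k + root_vector j i k) = (\<lambda>_. 0)"
  unfolding root_vector_def by auto

lemma affine_toric_inverse:
  assumes "\<phi> \<in> affine_toric n \<sigma>" "root_vector i j \<in> dual_monoid n \<sigma>" "root_vector j i \<in> dual_monoid n \<sigma>"
  shows "\<phi> (root_vector i j) * \<phi> (root_vector j i) = 1"
  using affine_toric_mult[OF assms] affine_toric_zero[OF assms(1)] unfolding root_cancel by simp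

lemma affine_toric_eqI:
  assumes \<sigma>: "\<sigma> \<in> weyl_fan n" and phi: "\<phi> \<in> affine_toric n \<sigma>" "\<psi> \<in> affine_toric n \<sigma>"
    and root: "\<And>i j. i \<in> {1..n} \<Longrightarrow> j \<in> {1..n} \<Longrightarrow> root_vector i j \<in> dual_monoid n \<sigma> \<Longrightarrow> \<phi> (root_vector i j) = \<psi> (root_vector i j)"
  shows "\<phi> = \<psi>"
proof
  fix m
  show "\<phi> m = \<psi> m"
  proof (cases "m \<in> dual_monoid n \<sigma>")
    case True
    show ?thesis
      by (rule dual_monoid_induct[OF \<sigma> True, of "\<lambda>m. \<phi> m = \<psi> m"])
        (use root affine_toric_zero[OF phi(1)] affine_toric_zero[OF phi(2)]
          affine_toric_mult[OF phi(1)] affine_toric_mult[OF phi(2)] in auto)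
  next
    case False
    then show ?thesis using affine_toric_outside phi by metis
  qed
qed

text \<open>The values on the simple roots of the chain determine the point. Along the chain
  \<open>a\<close> increases by 1 at each simple root with value 0, and \<open>c\<close> is
  multiplied by the value at every other one.\<close>

lemma affine_toric_limit:
  assumes \<sigma>: "\<sigma> \<in> weyl_fan n" and phi: "\<phi> \<in> affine_toric n \<sigma>"
  obtains a c where "a \<in> \<sigma>" "c \<in> torus_cover n" "\<phi> = limit_value n \<sigma> a c"
proof -
  obtain s E where s: "s permutes {1..n}" "E \<subseteq> {1..<n}" "\<sigma> = chain_cone n s E" using \<sigma> by (rule weyl_fanE)
  have sk: "s k \<in> {1..n}" "s (Suc k) \<in> {1..n}" if "k \<in> {1..<n}" for k using permutes_in[OF s(1)] that by auto
  have up: "root_vector (s (Suc k)) (s k) \<in> dual_monoid n \<sigma>" if k: "k \<in> {1..<n}" for k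
    unfolding root_dual_iff[OF sk(2,1)[OF k]] s(3) using k by (auto simp: chain_cone_def)
  have down: "root_vector (s k) (s (Suc k)) \<in> dual_monoid n \<sigma>" if k: "k \<in> E" for k
  proof -
    have k': "k \<in> {1..<n}" using k s by blast
    show ?thesis unfolding root_dual_iff[OF sk[OF k']] s(3) using k by (auto simp: chain_cone_def)
  qed
  define y where "y k = \<phi> (root_vector (s (Suc k)) (s k))" for k
  define A where "A k = (\<Sum>j=1..<k. if y j = 0 then 1 else 0 :: real)" for k
  define G where "G k = (\<Prod>j=1..<k. if y j = 0 then 1 else y j)" for k
  define a where "a i = (if i \<in> {1..n} then A (inv s i) else 0)" for i
  define c where "c i = (if i \<in> {1..n} then G (inv s i) else 0)" for i
  have G0: "G k \<noteq> 0" for k unfolding G_def by (simp add: prod_zero_iff)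
  have as: "a (s k) = A k" "c (s k) = G k" if "k \<in> {1..n}" for k
    using permutes_in[OF s(1) that] permutes_inverses(2)[OF s(1)] unfolding a_def c_def by auto
  have A: "A (Suc k) = A k + (if y k = 0 then 1 else 0)" "G (Suc k) = G k * (if y k = 0 then 1 else y k)"
    if "1 \<le> k" for k using that unfolding A_def G_def by auto
  \<comment> \<open>Steps in \<open>E\<close> are invertible characters, hence nonzero at the point;
    so \<open>a\<close> stays constant along them and lies in the face.\<close>
  have yE: "y k \<noteq> 0" if "k \<in> E" for k
    using affine_toric_inverse[OF phi up down[OF that]] that s(2) unfolding y_def by fastforce
  have aS: "a \<in> \<sigma>" unfolding s(3) chain_cone_def mem_Collect_eq
  proof (intro conjI allI impI ballI)
    show "a i = 0" if "i \<notin> {1..n}" for i using that by (auto simp: a_def)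
    show "a (s k) \<le> a (s (Suc k))" if "1 \<le> k \<and> k < n" for k using as[of k] as[of "Suc k"] A[of k] that by auto
    show "a (s k) = a (s (Suc k))" if "k \<in> E" for k
      using as[of k] as[of "Suc k"] A[of k] that yE[OF that] s(2) by fastforce
  qed
  have cT: "c \<in> torus_cover n" unfolding torus_cover_def c_def using G0 by auto
  note lim = limit_value_affine[OF aS cT]
  have step: "\<phi> (root_vector (s (Suc k)) (s k)) = limit_value n \<sigma> a c (root_vector (s (Suc k)) (s k))" if k: "k \<in> {1..<n}" for k
    unfolding limit_value_root[OF cT sk(2,1)[OF k] up[OF k]] y_def[symmetric]
    using as[of k] as[of "Suc k"] A[of k] k G0 by auto
  have back': "\<phi> (root_vector (s k) (s (Suc k))) = limit_value n \<sigma> a c (root_vector (s k) (s (Suc k)))" if k: "k \<in> E" for k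
  proof -
    have k': "k \<in> {1..<n}" using k s by blast
    have "\<phi> (root_vector (s (Suc k)) (s k)) * \<phi> (root_vector (s k) (s (Suc k))) = 1"
      by (rule affine_toric_inverse[OF phi up[OF k'] down[OF k]])
    moreover have "limit_value n \<sigma> a c (root_vector (s (Suc k)) (s k)) * limit_value n \<sigma> a c (root_vector (s k) (s (Suc k))) = 1"
      by (rule affine_toric_inverse[OF lim up[OF k'] down[OF k]])
    ultimately have "limit_value n \<sigma> a c (root_vector (s (Suc k)) (s k)) \<noteq> 0"
      "limit_value n \<sigma> a c (root_vector (s (Suc k)) (s k)) * \<phi> (root_vector (s k) (s (Suc k))) =
       limit_value n \<sigma> a c (root_vector (s (Suc k)) (s k)) * limit_value n \<sigma> a c (root_vector (s k) (s (Suc k)))"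
      unfolding step[OF k'] by auto
    then show ?thesis by simp
  qed
  have "\<phi> m = limit_value n \<sigma> a c m" for m
  proof (cases "m \<in> dual_monoid n \<sigma>")
    case True
    show ?thesis
    proof (rule chain_induct[OF s(1,2) True[unfolded s(3)], of "\<lambda>m. \<phi> m = limit_value n \<sigma> a c m"])
      show "\<phi> (\<lambda>_. 0) = limit_value n \<sigma> a c (\<lambda>_. 0)" using affine_toric_zero[OF phi] affine_toric_zero[OF lim] by simp
      fix m m' assume "m \<in> dual_monoid n (chain_cone n s E)" "m' \<in> dual_monoid n (chain_cone n s E)"
        "\<phi> m = limit_value n \<sigma> a c m" "\<phi> m' = limit_value n \<sigma> a c m'"
      then show "\<phi> (\<lambda>i. m i + m' i) = limit_value n \<sigma> a c (\<lambda>i. m i + m' i)"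
        using affine_toric_mult[OF phi, of m m'] affine_toric_mult[OF lim, of m m'] unfolding s(3)[symmetric] by simp
    qed (fact step, fact back')
  next
    case False
    then show ?thesis using affine_toric_outside[OF phi] affine_toric_outside[OF lim] by simp
  qed
  then show ?thesis using that[OF aS cT] by blast
qed

text \<open>The gluing class listed by its representatives, one in each cone that contains
  \<open>a\<close>; no chart has to be chosen.\<close>

definition toric_limit :: "nat \<Rightarrow> (nat \<Rightarrow> real) \<Rightarrow> (nat \<Rightarrow> complex) \<Rightarrow> toric_point" where
  "toric_limit n a c = {(\<sigma>, limit_value n \<sigma> a c) | \<sigma>. \<sigma> \<in> weyl_fan n \<and> a \<in> \<sigma>}"

lemma toric_limit_mem: "(\<sigma>, \<phi>) \<in> toric_limit n a c \<longleftrightarrow> \<sigma> \<in> weyl_fan n \<and> a \<in> \<sigma> \<and> \<phi> = limit_value n \<sigma> a c"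
  unfolding toric_limit_def by blast

lemma toric_class_limit:
  assumes \<sigma>: "\<sigma> \<in> weyl_fan n" and a: "a \<in> \<sigma>" and c: "c \<in> torus_cover n"
  shows "toric_class n (weyl_fan n) \<sigma> (limit_value n \<sigma> a c) = toric_limit n a c"
proof (intro set_eqI iffI)
  fix z assume "z \<in> toric_limit n a c"
  then obtain \<sigma>' where z: "z = (\<sigma>', limit_value n \<sigma>' a c)" "\<sigma>' \<in> weyl_fan n" "a \<in> \<sigma>'" unfolding toric_limit_def by blast
  have sub: "dual_monoid n \<sigma> \<subseteq> dual_monoid n (\<sigma> \<inter> \<sigma>')" "dual_monoid n \<sigma>' \<subseteq> dual_monoid n (\<sigma> \<inter> \<sigma>')"
    by (rule dual_monoid_antimono; blast)+
  have "limit_value n (\<sigma> \<inter> \<sigma>') a c \<in> affine_toric n (\<sigma> \<inter> \<sigma>')" using limit_value_affine[OF _ c] a z by blast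
  moreover have "\<forall>m\<in>dual_monoid n \<sigma>. limit_value n (\<sigma> \<inter> \<sigma>') a c m = limit_value n \<sigma> a c m"
    "\<forall>m\<in>dual_monoid n \<sigma>'. limit_value n (\<sigma> \<inter> \<sigma>') a c m = limit_value n \<sigma>' a c m"
    using sub unfolding limit_value_def by auto
  ultimately show "z \<in> toric_class n (weyl_fan n) \<sigma> (limit_value n \<sigma> a c)"
    unfolding toric_class_def z(1) using z limit_value_affine[OF z(3) c] by blast
next
  fix z assume "z \<in> toric_class n (weyl_fan n) \<sigma> (limit_value n \<sigma> a c)"
  then obtain \<sigma>' \<phi>' \<psi> where z: "z = (\<sigma>', \<phi>')" "\<sigma>' \<in> weyl_fan n" "\<phi>' \<in> affine_toric n \<sigma>'"
    and psi: "\<psi> \<in> affine_toric n (\<sigma> \<inter> \<sigma>')" "\<forall>m\<in>dual_monoid n \<sigma>. \<psi> m = limit_value n \<sigma> a c m" "\<forall>m\<in>dual_monoid n \<sigma>'. \<psi> m = \<phi>' m"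
    unfolding toric_class_def by blast
  have sub: "dual_monoid n \<sigma> \<subseteq> dual_monoid n (\<sigma> \<inter> \<sigma>')" "dual_monoid n \<sigma>' \<subseteq> dual_monoid n (\<sigma> \<inter> \<sigma>')"
    by (rule dual_monoid_antimono; blast)+
  \<comment> \<open>Roots suffice to identify a point glued to the limit. A root in the dual of
    \<open>\<sigma>'\<close> but not in that of \<open>\<sigma>\<close> has its negative in the
    latter, so its value on the intersection is invertible; then the limit is nonzero on the
    negative root, which forces \<open>a i = a j\<close>.\<close>
  have key: "a j \<le> a i \<and> \<phi>' (root_vector i j) = (if a i = a j then c i / c j else 0)"
    if ij: "i \<in> {1..n}" "j \<in> {1..n}" and r: "root_vector i j \<in> dual_monoid n \<sigma>'" for i j
  proof (cases "root_vector i j \<in> dual_monoid n \<sigma>")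
    case True
    have "a j \<le> a i" using a True unfolding root_dual_iff[OF ij] by blast
    moreover have "\<phi>' (root_vector i j) = \<psi> (root_vector i j)" using psi(3) r by simp
    moreover have "\<psi> (root_vector i j) = limit_value n \<sigma> a c (root_vector i j)" using psi(2) True by simp
    ultimately show ?thesis unfolding limit_value_root[OF c ij True, of a] by simp
  next
    case False
    then have r': "root_vector j i \<in> dual_monoid n \<sigma>" using fan_total[OF \<sigma> ij] by blast
    have "\<psi> (root_vector i j) * \<psi> (root_vector j i) = 1"
      by (rule affine_toric_inverse[OF psi(1)]) (use r r' sub in blast)+
    moreover have "\<psi> (root_vector j i) = (if a j = a i then c j / c i else 0)"
      using psi(2) r' limit_value_root[OF c ij(2,1) r', of a] by simp
    moreover have "\<psi> (root_vector i j) = \<phi>' (root_vector i j)" using psi(3) r by blast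
    ultimately show ?thesis using torus_cover_nonzero[OF c ij(1)] torus_cover_nonzero[OF c ij(2)]
      by (auto simp: field_simps split: if_splits)
  qed
  have a': "a \<in> \<sigma>'" unfolding fan_mem_iff[OF z(2)] using key a unfolding fan_mem_iff[OF \<sigma>] by blast
  have "\<phi>' = limit_value n \<sigma>' a c"
    by (rule affine_toric_eqI[OF z(2,3) limit_value_affine[OF a' c]]) (use key limit_value_root[OF c] in auto)
  then show "z \<in> toric_limit n a c" unfolding z(1) toric_limit_mem using z(2) a' by blast
qed

section \<open>Charts of the toric variety\<close>

definition chart_value :: "(nat \<Rightarrow> real) set \<Rightarrow> (nat \<Rightarrow> int) \<Rightarrow> toric_point \<Rightarrow> complex" where
  "chart_value \<sigma> m = (\<lambda>p. (THE \<phi>. (\<sigma>, \<phi>) \<in> p) m)"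

lemma chart_value_limit: "\<sigma> \<in> weyl_fan n \<Longrightarrow> a \<in> \<sigma> \<Longrightarrow> chart_value \<sigma> m (toric_limit n a c) = limit_value n \<sigma> a c m"
  unfolding chart_value_def toric_limit_mem by simp

definition toric_chart :: "nat \<Rightarrow> (nat \<Rightarrow> real) set \<Rightarrow> toric_point set" where
  "toric_chart n \<sigma> = {toric_limit n a c | a c. a \<in> \<sigma> \<and> c \<in> torus_cover n}"

definition toric_charts :: "nat \<Rightarrow> (toric_point set \<times> (toric_point \<Rightarrow> complex) set) set" where
  "toric_charts n = {(toric_chart n \<sigma>, {chart_value \<sigma> m | m. m \<in> dual_monoid n \<sigma>}) | \<sigma>. \<sigma> \<in> weyl_fan n}"

lemma toric_chart_image: "\<sigma> \<in> weyl_fan n \<Longrightarrow> toric_class n (weyl_fan n) \<sigma> ` affine_toric n \<sigma> = toric_chart n \<sigma>"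
proof (intro set_eqI iffI)
  assume \<sigma>: "\<sigma> \<in> weyl_fan n"
  fix p assume "p \<in> toric_class n (weyl_fan n) \<sigma> ` affine_toric n \<sigma>"
  then obtain \<phi> where p: "\<phi> \<in> affine_toric n \<sigma>" "p = toric_class n (weyl_fan n) \<sigma> \<phi>" by blast
  obtain a c where "a \<in> \<sigma>" "c \<in> torus_cover n" "\<phi> = limit_value n \<sigma> a c" using affine_toric_limit[OF \<sigma> p(1)] .
  then show "p \<in> toric_chart n \<sigma>" unfolding p(2) toric_chart_def using toric_class_limit[OF \<sigma>] by blast
next
  assume \<sigma>: "\<sigma> \<in> weyl_fan n"
  fix p assume "p \<in> toric_chart n \<sigma>"
  then obtain a c where "a \<in> \<sigma>" "c \<in> torus_cover n" "p = toric_limit n a c" unfolding toric_chart_def by blast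
  then show "p \<in> toric_class n (weyl_fan n) \<sigma> ` affine_toric n \<sigma>"
    using toric_class_limit[OF \<sigma>, of a c] limit_value_affine[of a \<sigma> c n] by force
qed

lemma weyl_toric_variety_charts: "weyl_toric_variety n = fspace_of_charts (toric_charts n)"
proof -
  have "{(toric_class n (weyl_fan n) \<sigma> ` affine_toric n \<sigma>,
       {\<lambda>p. (THE \<phi>. (\<sigma>, \<phi>) \<in> p) m | m. m \<in> dual_monoid n \<sigma>}) | \<sigma>. \<sigma> \<in> weyl_fan n} = toric_charts n"
    unfolding toric_charts_def chart_value_def using toric_chart_image by (intro Collect_cong ex_cong1) auto
  then show ?thesis unfolding weyl_toric_variety_def toric_variety_def by simp
qed

lemma toric_chartI: "a \<in> \<sigma> \<Longrightarrow> c \<in> torus_cover n \<Longrightarrow> toric_limit n a c \<in> toric_chart n \<sigma>"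
  unfolding toric_chart_def by blast

lemma toric_chartE:
  assumes "p \<in> toric_chart n \<sigma>" obtains a c where "p = toric_limit n a c" "a \<in> \<sigma>" "c \<in> torus_cover n"
  using assms unfolding toric_chart_def mem_Collect_eq by (elim exE conjE) (rule that)

lemma toric_chart_limit_iff:
  assumes \<sigma>: "\<sigma> \<in> weyl_fan n" and c: "c \<in> torus_cover n"
  shows "toric_limit n a c \<in> toric_chart n \<sigma> \<longleftrightarrow> a \<in> \<sigma>"
proof
  assume "toric_limit n a c \<in> toric_chart n \<sigma>"
  then obtain a' c' where "toric_limit n a c = toric_limit n a' c'" "a' \<in> \<sigma>" by (rule toric_chartE)
  then have "(\<sigma>, limit_value n \<sigma> a' c') \<in> toric_limit n a c" using \<sigma> toric_limit_mem by simp
  then show "a \<in> \<sigma>" unfolding toric_limit_mem by blast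
qed (rule toric_chartI[OF _ c])

lemma toric_charts_mem: "\<sigma> \<in> weyl_fan n \<Longrightarrow> (toric_chart n \<sigma>, {chart_value \<sigma> m | m. m \<in> dual_monoid n \<sigma>}) \<in> toric_charts n"
  unfolding toric_charts_def by blast

lemma fan_outside: "\<sigma> \<in> weyl_fan n \<Longrightarrow> a \<in> \<sigma> \<Longrightarrow> i \<notin> {1..n} \<Longrightarrow> a i = 0"
  using fan_mem_iff by blast

lemma chart_value_subcone:
  assumes "\<tau> \<in> weyl_fan n" "\<sigma> \<in> weyl_fan n" "\<tau> \<subseteq> \<sigma>" "m \<in> dual_monoid n \<sigma>" "y \<in> toric_chart n \<tau>"
  shows "chart_value \<sigma> m y = chart_value \<tau> m y"
proof -
  obtain a c where y: "y = toric_limit n a c" "a \<in> \<tau>" using assms(5) by (rule toric_chartE)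
  have "m \<in> dual_monoid n \<tau>" using dual_monoid_antimono[OF assms(3)] assms(4) by blast
  then show ?thesis unfolding y(1) chart_value_limit[OF assms(1) y(2)] chart_value_limit[OF assms(2) subsetD[OF assms(3) y(2)]]
    unfolding limit_value_def using assms(4) by simp
qed

definition chart_functions :: "nat \<Rightarrow> (nat \<Rightarrow> real) set \<Rightarrow> (toric_point \<Rightarrow> complex) set" where
  "chart_functions n \<sigma> = {chart_value \<sigma> m | m. m \<in> dual_monoid n \<sigma>}"

lemma toric_chart_order_cone:
  "\<sigma> \<in> weyl_fan n \<Longrightarrow> a \<in> \<sigma> \<Longrightarrow> c \<in> torus_cover n \<Longrightarrow> toric_limit n a c \<in> toric_chart n (order_cone n a)"
  by (rule toric_chartI[OF order_cone_self]) (rule fan_outside)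

text \<open>The chart of \<open>order_cone n a\<close> lies inside that of every cone containing
  \<open>a\<close>, and characters restrict to characters. Hence it dominates all charts around the
  limit, which makes the atlas directed.\<close>

lemma toric_dominated:
  assumes s: "\<sigma> \<in> weyl_fan n" "a \<in> \<sigma>" and c: "c \<in> torus_cover n"
  shows "dominated (toric_chart n \<sigma>) (chart_functions n \<sigma>) (toric_chart n (order_cone n a))
    (chart_functions n (order_cone n a)) (toric_limit n a c)" (is "dominated _ _ ?V ?G ?p")
  unfolding dominated_def
proof (intro conjI ballI toric_chart_order_cone[OF s c])
  let ?t = "order_cone n a"
  have sub: "?t \<subseteq> \<sigma>" by (rule order_cone_subset[OF s])
  show "\<exists>b\<in>function_algebra ?G. b ?p \<noteq> 0 \<and> (\<forall>y\<in>?V. b y \<noteq> 0 \<longrightarrow> y \<in> toric_chart n \<sigma>)"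
    by (rule bexI[OF _ function_algebra.const[of 1]]) (use sub in \<open>auto elim!: toric_chartE intro!: toric_chartI\<close>)
  fix g assume "g \<in> chart_functions n \<sigma>"
  then obtain m where m: "m \<in> dual_monoid n \<sigma>" "g = chart_value \<sigma> m" unfolding chart_functions_def by blast
  have mt: "chart_value ?t m \<in> ?G" unfolding chart_functions_def using dual_monoid_antimono[OF sub] m by blast
  show "local_fraction ?V ?G ?p g" unfolding m(2)
    by (intro local_fractionI[of "chart_value ?t m" _ "\<lambda>_. 1"] function_algebra.const function_algebra.gen mt)
      (simp_all add: chart_value_subcone[OF order_cone_fan s(1) sub m(1)])
qed

lemma toric_charts_directed: "directed_atlas (toric_charts n)"
  unfolding directed_atlas_def
proof (intro allI impI, elim conjE)
  fix U F U' F' p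
  assume "(U, F) \<in> toric_charts n" "(U', F') \<in> toric_charts n" and p: "p \<in> U" "p \<in> U'"
  then obtain \<sigma> \<sigma>' where s: "\<sigma> \<in> weyl_fan n" "U = toric_chart n \<sigma>" "F = chart_functions n \<sigma>"
    and s': "\<sigma>' \<in> weyl_fan n" "U' = toric_chart n \<sigma>'" "F' = chart_functions n \<sigma>'"
    unfolding toric_charts_def chart_functions_def by blast
  obtain a c where ac: "p = toric_limit n a c" "a \<in> \<sigma>" "c \<in> torus_cover n" using p(1) unfolding s(2) by (rule toric_chartE)
  have a': "a \<in> \<sigma>'" using p(2) unfolding s'(2) ac(1) toric_chart_limit_iff[OF s'(1) ac(3)] .
  show "\<exists>V G. (V, G) \<in> toric_charts n \<and> dominated U F V G p \<and> dominated U' F' V G p"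
    unfolding s(2,3) s'(2,3) ac(1)
    using toric_dominated[OF s(1) ac(2,3)] toric_dominated[OF s'(1) a' ac(3)]
      toric_charts_mem[OF order_cone_fan, of n a, folded chart_functions_def] by blast
qed

lemma sheafy_toric: "sheafy (weyl_toric_variety n)"
  unfolding weyl_toric_variety_charts by (rule sheafy_charts[OF toric_charts_directed])

lemma openin_toric_chart: "\<sigma> \<in> weyl_fan n \<Longrightarrow> openin (zariski (weyl_toric_variety n)) (toric_chart n \<sigma>)"
  unfolding weyl_toric_variety_charts by (rule openin_chart[OF toric_charts_mem])

lemma regular_chart_value: "\<sigma> \<in> weyl_fan n \<Longrightarrow> m \<in> dual_monoid n \<sigma> \<Longrightarrow>
   regular (weyl_toric_variety n) (toric_chart n \<sigma>) (chart_value \<sigma> m)"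
  unfolding weyl_toric_variety_charts by (rule regular_chart_generator[OF toric_charts_mem]) auto

lemma toric_pointE:
  assumes "p \<in> points (weyl_toric_variety n)"
  obtains a c where "p = toric_limit n a c" "c \<in> torus_cover n" "a \<in> order_cone n a"
proof -
  obtain \<sigma> where s: "\<sigma> \<in> weyl_fan n" "p \<in> toric_chart n \<sigma>"
    using assms unfolding weyl_toric_variety_charts points_charts toric_charts_def by auto
  obtain a c where ac: "p = toric_limit n a c" "a \<in> \<sigma>" "c \<in> torus_cover n" using s(2) by (rule toric_chartE)
  have "a \<in> order_cone n a" by (rule order_cone_self) (rule fan_outside[OF s(1) ac(2)])
  then show ?thesis using that ac by blast
qed

lemma toric_pointI: "a \<in> order_cone n a \<Longrightarrow> c \<in> torus_cover n \<Longrightarrow> toric_limit n a c \<in> points (weyl_toric_variety n)"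
  using openin_subset[OF openin_toric_chart[OF order_cone_fan]] toric_chartI by blast

lemma zero_in_fan: "\<sigma> \<in> weyl_fan n \<Longrightarrow> (\<lambda>_. 0) \<in> \<sigma>"
  unfolding fan_mem_iff by simp

abbreviation toric_torus :: "nat \<Rightarrow> (nat \<Rightarrow> complex) \<Rightarrow> toric_point" where
  "toric_torus n t \<equiv> toric_limit n (\<lambda>_. 0) t"

lemma chart_value_torus: "\<sigma> \<in> weyl_fan n \<Longrightarrow> m \<in> dual_monoid n \<sigma> \<Longrightarrow> chart_value \<sigma> m (toric_torus n t) = monomial n t m"
  unfolding chart_value_limit[OF _ zero_in_fan] limit_value_def by (simp add: pairing_def)

text \<open>Order and ties of \<open>a\<close> decide in which cones the limit lies and on which
  roots it is nonzero, and a point of a chart is determined by its values on roots.\<close>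

lemma toric_limit_eqI:
  assumes c: "c \<in> torus_cover n" "c' \<in> torus_cover n" and a: "a \<in> order_cone n a" "a' \<in> order_cone n a'"
    and ord: "\<And>i j. i \<in> {1..n} \<Longrightarrow> j \<in> {1..n} \<Longrightarrow> a i \<le> a j \<longleftrightarrow> a' i \<le> a' j"
    and rat: "\<And>i j. i \<in> {1..n} \<Longrightarrow> j \<in> {1..n} \<Longrightarrow> a i = a j \<Longrightarrow> c i / c j = c' i / c' j"
  shows "toric_limit n a c = toric_limit n a' c'"
proof -
  have oc: "order_cone n a = order_cone n a'" using ord unfolding order_cone_def by blast
  have mem: "a \<in> \<sigma> \<longleftrightarrow> a' \<in> \<sigma>" if "\<sigma> \<in> weyl_fan n" for \<sigma>
    using order_cone_subset[OF that] a oc by blast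
  have eq: "a i = a j \<longleftrightarrow> a' i = a' j" if "i \<in> {1..n}" "j \<in> {1..n}" for i j
    using ord[OF that] ord[OF that(2,1)] by auto
  have "limit_value n \<sigma> a c = limit_value n \<sigma> a' c'" if s: "\<sigma> \<in> weyl_fan n" "a \<in> \<sigma>" for \<sigma>
  proof (rule affine_toric_eqI[OF s(1) limit_value_affine[OF s(2) c(1)] limit_value_affine[OF _ c(2)]])
    show "a' \<in> \<sigma>" using mem s by blast
    fix i j assume ij: "i \<in> {1..n}" "j \<in> {1..n}" and r: "root_vector i j \<in> dual_monoid n \<sigma>"
    show "limit_value n \<sigma> a c (root_vector i j) = limit_value n \<sigma> a' c' (root_vector i j)"
      unfolding limit_value_root[OF c(1) ij r] limit_value_root[OF c(2) ij r] using eq[OF ij] rat[OF ij] by simp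
  qed
  then show ?thesis unfolding toric_limit_def using mem by (intro Collect_cong ex_cong1) auto
qed

text \<open>Recognises the zero cone in \<open>torus_embedding\<close>, written there as a line, as
  the order cone of a constant, so that the torus chart is treated like the others.\<close>

lemma order_cone_zero: "order_cone n (\<lambda>_. 0) = {x. \<exists>c. x = (\<lambda>i. if i \<in> {1..n} then c else 0)}"
proof (intro set_eqI iffI)
  fix x assume x: "x \<in> order_cone n (\<lambda>_. 0)"
  have "x = (\<lambda>i. if i \<in> {1..n} then x 1 else 0)"
  proof
    fix i show "x i = (if i \<in> {1..n} then x 1 else 0)"
    proof (cases "i \<in> {1..n}")
      case True
      then have "1 \<in> {1..n}" by auto
      then have "x i \<le> x 1" "x 1 \<le> x i" using x True unfolding order_cone_def by blast+
      then show ?thesis using True by simp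
    qed (use x in \<open>auto simp: order_cone_def\<close>)
  qed
  then show "x \<in> {x. \<exists>c. x = (\<lambda>i. if i \<in> {1..n} then c else 0)}" by blast
qed (auto simp: order_cone_def)

lemma character_scaling:
  assumes m: "m \<in> character_lattice n" and k: "k \<noteq> (0::complex)"
  shows "(\<Prod>i=1..n. (k * t i) powi m i) = (\<Prod>i=1..n. t i powi m i)"
proof -
  have "(\<Prod>i=1..n. k powi m i) = k powi (\<Sum>i=1..n. m i)"
  proof (induction n)
    case (Suc n)
    then show ?case using k by (simp add: power_int_add)
  qed simp
  also have "\<dots> = 1" using m unfolding character_lattice_def by simp
  finally show ?thesis by (simp add: power_int_mult_distrib prod.distrib)
qed

lemma torus_character_class:
  assumes "m \<in> character_lattice n" shows "torus_character n m (scalar_class t) = monomial n t m"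
proof -
  have "(SOME u. u \<in> scalar_class t) \<in> scalar_class t"
    by (rule someI[where P="\<lambda>u. u \<in> scalar_class t", OF scalar_class_self])
  then obtain k where k: "k \<noteq> 0" "(SOME u. u \<in> scalar_class t) = (\<lambda>i. k * t i)" by (rule scalar_classE)
  show ?thesis unfolding torus_character_def Let_def k(2) monomial_def using character_scaling[OF assms k(1)] .
qed

lemma torus_embedding_class:
  assumes t: "t \<in> torus_cover n"
  shows "torus_embedding n (scalar_class t) = toric_torus n t"
proof -
  let ?o = "order_cone n (\<lambda>_. 0)"
  have p0: "pairing n m (\<lambda>_. 0) = 0" for m by (simp add: pairing_def)
  have "m \<in> dual_monoid n ?o" if m: "m \<in> character_lattice n" for m
  proof -
    have "pairing n m x = 0" if "x \<in> ?o" for x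
    proof -
      from that obtain c where x: "x = (\<lambda>i. if i \<in> {1..n} then c else 0)" unfolding order_cone_zero by blast
      have "pairing n m x = (\<Sum>i=1..n. real_of_int (m i) * c)" unfolding pairing_def x by (rule sum.cong) auto
      also have "\<dots> = real_of_int (\<Sum>i=1..n. m i) * c" by (simp add: sum_distrib_right)
      also have "(\<Sum>i=1..n. m i) = 0" using m unfolding character_lattice_def by blast
      finally show ?thesis by simp
    qed
    then show ?thesis unfolding dual_monoid_iff using m by simp
  qed
  then have dual: "m \<in> dual_monoid n ?o \<longleftrightarrow> m \<in> character_lattice n" for m unfolding dual_monoid_iff by blast
  have "(\<lambda>m. if m \<in> character_lattice n then torus_character n m (scalar_class t) else 0) = limit_value n ?o (\<lambda>_. 0) t"
    unfolding limit_value_def dual p0 by (auto simp: torus_character_class)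
  then show ?thesis unfolding torus_embedding_def order_cone_zero[symmetric]
    using toric_class_limit[OF order_cone_fan order_cone_self t, of "\<lambda>_. 0"] by simp
qed

text \<open>A curve in the torus that tends to the limit point as \<open>s\<close> decreases to 0.
  The factor 1 + s i separates coordinates with equal \<open>a\<close> and equal \<open>c\<close>,
  so that its points near the limit have pairwise distinct coordinates. The parameter is positive
  real because the exponents are real.\<close>

definition limit_curve :: "nat \<Rightarrow> (nat \<Rightarrow> real) \<Rightarrow> (nat \<Rightarrow> complex) \<Rightarrow> real \<Rightarrow> nat \<Rightarrow> complex" where
  "limit_curve n a c s = (\<lambda>i. if i \<in> {1..n} then c i * of_real (1 + s * real i) * of_real (s powr a i) else 0)"

lemma limit_curve_cover: "c \<in> torus_cover n \<Longrightarrow> 0 < s \<Longrightarrow> limit_curve n a c s \<in> torus_cover n"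
proof -
  assume c: "c \<in> torus_cover n" and s: "0 < s"
  have "1 + s * real i \<noteq> 0" for i using s by (smt (verit) mult_nonneg_nonneg of_nat_0_le_iff)
  then have "complex_of_real (1 + s * real i) \<noteq> 0" for i by (metis of_real_eq_0_iff)
  then show ?thesis using torus_cover_nonzero[OF c] s unfolding torus_cover_def limit_curve_def by auto
qed

lemma monomial_limit_curve:
  assumes s: "0 < s"
  shows "monomial n (limit_curve n a c s) m =
     monomial n c m * (\<Prod>i=1..n. of_real (1 + s * real i) powi m i) * of_real (s powr pairing n m a)"
proof -
  have pw: "complex_of_real (s powr a i) powi m i = of_real (s powr (real_of_int (m i) * a i))" for i
    using s powr_real_of_int'[of "s powr a i" "m i"] by (simp add: powr_powr mult.commute flip: of_real_power_int)
  have "monomial n (limit_curve n a c s) m =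
      (\<Prod>i=1..n. c i powi m i * of_real (1 + s * real i) powi m i * of_real (s powr (real_of_int (m i) * a i)))"
    unfolding monomial_def limit_curve_def by (rule prod.cong[OF refl]) (simp only: if_True power_int_mult_distrib pw)
  also have "\<dots> = monomial n c m * (\<Prod>i=1..n. of_real (1 + s * real i) powi m i) * of_real (\<Prod>i=1..n. s powr (real_of_int (m i) * a i))"
    by (simp add: prod.distrib monomial_def)
  also have "(\<Prod>i=1..n. s powr (real_of_int (m i) * a i)) = s powr pairing n m a"
    using s by (simp add: powr_sum pairing_def)
  finally show ?thesis .
qed

lemma powr_limit:
  fixes p :: real
  assumes "0 \<le> p"
  shows "((\<lambda>s. s powr p) \<longlongrightarrow> (if p = 0 then 1 else 0)) (at_right 0)"
proof (cases "p = 0")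
  case True
  have "eventually (\<lambda>s::real. s powr p = 1) (at_right 0)"
    using eventually_at_right_less[of 0] by (rule eventually_mono) (simp add: True)
  then show ?thesis using True by (simp add: tendsto_eventually)
next
  case False
  have "((\<lambda>s::real. s powr p) \<longlongrightarrow> 0) (at_right 0)"
  proof (rule tendsto_zero_powrI[OF tendsto_ident_at tendsto_const])
    show "\<forall>\<^sub>F s::real in at_right 0. 0 \<le> s" using eventually_at_right_less[of 0] by (rule eventually_mono) simp
  qed (use False assms in simp)
  then show ?thesis using False by simp
qed

lemma linear_factor_limit: "((\<lambda>s. complex_of_real (1 + s * real i)) \<longlongrightarrow> 1) (at_right 0)"
proof -
  have "((\<lambda>s. complex_of_real (1 + s * real i)) \<longlongrightarrow> complex_of_real (1 + 0 * real i)) (at_right 0)"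
    by (intro tendsto_intros)
  then show ?thesis by simp
qed

lemma monomial_limit:
  assumes p: "0 \<le> pairing n m a"
  shows "((\<lambda>s. monomial n (limit_curve n a c s) m) \<longlongrightarrow> (if pairing n m a = 0 then monomial n c m else 0)) (at_right 0)"
proof -
  have "((\<lambda>s. complex_of_real (1 + s * real i) powi m i) \<longlongrightarrow> 1 powi m i) (at_right 0)" for i
    by (rule tendsto_power_int[OF linear_factor_limit]) simp
  then have P: "((\<lambda>s. \<Prod>i=1..n. complex_of_real (1 + s * real i) powi m i) \<longlongrightarrow> (\<Prod>i=1..n. 1)) (at_right 0)"
    by (intro tendsto_prod) simp
  have "((\<lambda>s. monomial n c m * (\<Prod>i=1..n. complex_of_real (1 + s * real i) powi m i) * of_real (s powr pairing n m a))
     \<longlongrightarrow> monomial n c m * (\<Prod>i=1..n. 1) * of_real (if pairing n m a = 0 then 1 else 0)) (at_right 0)"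
    by (intro tendsto_mult tendsto_const P tendsto_of_real powr_limit p)
  also have "monomial n c m * (\<Prod>i=1..n. 1) * of_real (if pairing n m a = 0 then 1 else 0) = (if pairing n m a = 0 then monomial n c m else 0)"
    by simp
  finally show ?thesis
    by (rule Lim_transform_eventually) (use eventually_at_right_less[of 0] in \<open>rule eventually_mono\<close>, simp add: monomial_limit_curve)
qed

lemma limit_curve_distinct:
  assumes c: "c \<in> torus_cover n" and ij: "i \<in> {1..n}" "j \<in> {1..n}" "i \<noteq> j" and a: "a i \<le> a j"
  shows "\<forall>\<^sub>F s in at_right 0. limit_curve n a c s i \<noteq> limit_curve n a c s j"
proof -
  have ci: "c i \<noteq> 0" "c j \<noteq> 0" using torus_cover_nonzero[OF c] ij by auto
  have pos: "\<forall>\<^sub>F s in at_right 0. (0::real) < s" by (rule eventually_at_right_less)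
  \<comment> \<open>Division by \<open>s powr a i\<close> leaves an inequality decided by its limit,
    except when both \<open>a\<close> and \<open>c\<close> tie; then the factors 1 + s i and 1 + s j
    differ.\<close>
  have ev: "\<forall>\<^sub>F s in at_right 0. c i * complex_of_real (1 + s * real i) \<noteq> c j * complex_of_real (1 + s * real j) * complex_of_real (s powr (a j - a i))"
  proof (cases "a i = a j \<and> c i = c j")
    case True
    show ?thesis using pos
    proof (rule eventually_mono)
      fix s :: real assume s: "0 < s"
      then have "1 + s * real i \<noteq> 1 + s * real j" using ij(3) by simp
      then have "complex_of_real (1 + s * real i) \<noteq> complex_of_real (1 + s * real j)" by (metis of_real_eq_iff)
      then show "c i * complex_of_real (1 + s * real i) \<noteq> c j * complex_of_real (1 + s * real j) * complex_of_real (s powr (a j - a i))"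
        using True ci s by simp
    qed
  next
    case False
    have "((\<lambda>s. c i * complex_of_real (1 + s * real i) - c j * complex_of_real (1 + s * real j) * complex_of_real (s powr (a j - a i)))
      \<longlongrightarrow> c i * 1 - c j * 1 * complex_of_real (if a j - a i = 0 then 1 else 0)) (at_right 0)"
      by (intro tendsto_diff tendsto_mult tendsto_const linear_factor_limit tendsto_of_real powr_limit) (use a in simp)
    moreover have "c i * 1 - c j * 1 * complex_of_real (if a j - a i = 0 then 1 else 0) \<noteq> 0" using False ci by auto
    ultimately have "\<forall>\<^sub>F s in at_right 0. c i * complex_of_real (1 + s * real i) - c j * complex_of_real (1 + s * real j) * complex_of_real (s powr (a j - a i)) \<noteq> 0"
      by (rule tendsto_imp_eventually_ne)
    then show ?thesis by (rule eventually_mono) auto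
  qed
  show ?thesis using eventually_conj[OF pos ev]
  proof (rule eventually_mono, elim conjE)
    fix s :: real assume s: "0 < s" "c i * complex_of_real (1 + s * real i) \<noteq> c j * complex_of_real (1 + s * real j) * complex_of_real (s powr (a j - a i))"
    have "complex_of_real (s powr a j) = complex_of_real (s powr (a j - a i)) * complex_of_real (s powr a i)"
      using s(1) by (simp flip: of_real_mult powr_add)
    then have "limit_curve n a c s j = (c j * complex_of_real (1 + s * real j) * complex_of_real (s powr (a j - a i))) * complex_of_real (s powr a i)"
      unfolding limit_curve_def using ij by simp
    moreover have "limit_curve n a c s i = (c i * complex_of_real (1 + s * real i)) * complex_of_real (s powr a i)"
      unfolding limit_curve_def using ij by simp
    moreover have "complex_of_real (s powr a i) \<noteq> 0" using s(1) by simp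
    ultimately show "limit_curve n a c s i \<noteq> limit_curve n a c s j" using s(2) by simp
  qed
qed

text \<open>Chart functions converge along \<open>limit_curve\<close> in the usual topology of the
  complex numbers, so one that is nonzero at the limit stays nonzero for small \<open>s\<close>.
  Analytic limits thus give Zariski density, even for the points with distinct coordinates.\<close>

lemma toric_dense:
  assumes N: "openin (zariski (weyl_toric_variety n)) N" "p \<in> N"
  shows "\<exists>t\<in>torus_cover n. inj_on t {1..n} \<and> toric_torus n t \<in> N"
proof -
  obtain U F b where U: "(U, F) \<in> toric_charts n" "b \<in> function_algebra F" "p \<in> U" "b p \<noteq> 0" "\<forall>y\<in>U. b y \<noteq> 0 \<longrightarrow> y \<in> N"
    using chart_base[OF toric_charts_directed N[unfolded weyl_toric_variety_charts]] by (elim exE conjE) (rule that)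
  obtain \<sigma> where s: "\<sigma> \<in> weyl_fan n" "U = toric_chart n \<sigma>" "F = {chart_value \<sigma> m | m. m \<in> dual_monoid n \<sigma>}"
    using U(1) unfolding toric_charts_def by blast
  obtain a c where ac: "p = toric_limit n a c" "a \<in> \<sigma>" "c \<in> torus_cover n" using U(3) unfolding s(2) by (rule toric_chartE)
  let ?t = "limit_curve n a c"
  have lim: "((\<lambda>s. f (toric_torus n (?t s))) \<longlongrightarrow> f p) (at_right 0)" if "f \<in> function_algebra F" for f
    using that
  proof induction
    case (gen f)
    then obtain m where m: "m \<in> dual_monoid n \<sigma>" "f = chart_value \<sigma> m" unfolding s(3) by blast
    have "0 \<le> pairing n m a" using m(1) ac(2) unfolding dual_monoid_iff by blast
    from monomial_limit[OF this, of c] show ?case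
      unfolding m(2) ac(1) chart_value_torus[OF s(1) m(1)] chart_value_limit[OF s(1) ac(2)] limit_value_def using m(1) by simp
  qed (auto intro: tendsto_add tendsto_mult)
  have "\<forall>\<^sub>F s in at_right 0. b (toric_torus n (?t s)) \<noteq> 0"
    by (rule tendsto_imp_eventually_ne[OF lim[OF U(2)] U(4)])
  moreover have "\<forall>\<^sub>F s in at_right 0. \<forall>z\<in>{(i, j). i \<in> {1..n} \<and> j \<in> {1..n} \<and> i \<noteq> j}. ?t s (fst z) \<noteq> ?t s (snd z)"
  proof (rule eventually_ball_finite)
    show "finite {(i, j). i \<in> {1..n} \<and> j \<in> {1..n} \<and> i \<noteq> j}"
      by (rule finite_subset[of _ "{1..n} \<times> {1..n}"]) auto
    show "\<forall>z\<in>{(i, j). i \<in> {1..n} \<and> j \<in> {1..n} \<and> i \<noteq> j}. \<forall>\<^sub>F s in at_right 0. ?t s (fst z) \<noteq> ?t s (snd z)"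
    proof (intro ballI, clarify)
      fix i j assume ij: "i \<in> {1..n}" "j \<in> {1..n}" "i \<noteq> j"
      show "\<forall>\<^sub>F s in at_right 0. ?t s (fst (i, j)) \<noteq> ?t s (snd (i, j))"
      proof (cases "a i \<le> a j")
        case True
        from limit_curve_distinct[OF ac(3) ij True] show ?thesis by simp
      next
        case False
        then have "\<forall>\<^sub>F s in at_right 0. ?t s j \<noteq> ?t s i" using limit_curve_distinct[OF ac(3) ij(2,1)] ij(3) by simp
        then show ?thesis by (rule eventually_mono) auto
      qed
    qed
  qed
  moreover have "\<forall>\<^sub>F s in at_right 0. (0::real) < s" by (rule eventually_at_right_less)
  ultimately have ev: "\<forall>\<^sub>F s in at_right 0. b (toric_torus n (?t s)) \<noteq> 0 \<and>
      (\<forall>z\<in>{(i, j). i \<in> {1..n} \<and> j \<in> {1..n} \<and> i \<noteq> j}. ?t s (fst z) \<noteq> ?t s (snd z)) \<and> 0 < s"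
    by (intro eventually_conj)
  from eventually_happens'[OF trivial_limit_at_right_real ev]
  obtain s where S: "b (toric_torus n (?t s)) \<noteq> 0" "\<forall>z\<in>{(i, j). i \<in> {1..n} \<and> j \<in> {1..n} \<and> i \<noteq> j}. ?t s (fst z) \<noteq> ?t s (snd z)" "0 < s"
    by (elim exE conjE) (rule that)
  have t: "?t s \<in> torus_cover n" by (rule limit_curve_cover[OF ac(3) S(3)])
  have "toric_torus n (?t s) \<in> U" unfolding s(2) by (rule toric_chartI[OF zero_in_fan[OF s(1)] t])
  moreover have "inj_on (?t s) {1..n}" using S(2) unfolding inj_on_def by force
  ultimately show ?thesis using t U(5) S(1) by blast
qed

lemma dspace_toric:
  assumes D: "D \<subseteq> torus_cover n" "\<And>t. t \<in> torus_cover n \<Longrightarrow> inj_on t {1..n} \<Longrightarrow> t \<in> D"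
  shows "dspace (weyl_toric_variety n) (toric_torus n) D"
  unfolding dspace_def
proof (intro conjI ballI allI impI sheafy_toric)
  show "toric_torus n d \<in> points (weyl_toric_variety n)" if "d \<in> D" for d
    using D(1) that by (intro toric_pointI[OF order_cone_self]) auto
  show "\<exists>d\<in>D. toric_torus n d \<in> N" if "openin (zariski (weyl_toric_variety n)) N" "p \<in> N" for N p
    using toric_dense[OF that] D(2) by blast
qed

text \<open>The ratios behave at \<open>p\<close> as along a curve with exponents \<open>a\<close>
  and leading coefficients \<open>c\<close>; such data describe the image of \<open>p\<close> in the
  toric variety.\<close>

definition adapted :: "nat \<Rightarrow> 'a fspace \<Rightarrow> ((nat \<Rightarrow> complex) \<Rightarrow> 'a) \<Rightarrow> (nat \<Rightarrow> complex) set \<Rightarrow> 'a \<Rightarrow> (nat \<Rightarrow> real) \<Rightarrow> (nat \<Rightarrow> complex) \<Rightarrow> bool" where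
  "adapted n M e D p a c \<longleftrightarrow> a \<in> order_cone n a \<and> c \<in> torus_cover n \<and> (\<forall>i\<in>{1..n}. \<forall>j\<in>{1..n}. a j \<le> a i \<longrightarrow>
     germ M e D p (\<lambda>d. d i / d j) (if a i = a j then c i / c j else 0))"

lemma adaptedD: "adapted n M e D p a c \<Longrightarrow> i \<in> {1..n} \<Longrightarrow> j \<in> {1..n} \<Longrightarrow> a j \<le> a i \<Longrightarrow>
     germ M e D p (\<lambda>d. d i / d j) (if a i = a j then c i / c j else 0)"
  unfolding adapted_def by blast

lemma germ_ratio_inverse:
  assumes M: "dspace M e D" and D: "D \<subseteq> torus_cover n" and ij: "i \<in> {1..n}" "j \<in> {1..n}"
    and g: "germ M e D p (\<lambda>d. d i / d j) u" "germ M e D p (\<lambda>d. d j / d i) v"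
  shows "u * v = 1"
proof -
  note S = dspace_sheafy[OF M]
  have "germ M e D p (\<lambda>_. 1) (u * v)"
    by (rule germ_cong'[OF S germ_mult[OF S g]]) (use D torus_cover_nonzero ij in \<open>auto simp: subset_iff\<close>)
  from germ_unique[OF M this germ_const[OF S germ_point[OF g(1)]]] show ?thesis .
qed

text \<open>Otherwise the reciprocal ratio extends with value 0 at \<open>p\<close>, although the
  two extensions have product 1.\<close>

lemma adapted_order:
  assumes M: "dspace M e D" and D: "D \<subseteq> torus_cover n" and ad: "adapted n M e D p a c"
    and ij: "i \<in> {1..n}" "j \<in> {1..n}" and g: "germ M e D p (\<lambda>d. d i / d j) v"
  shows "a j \<le> a i"
proof (rule ccontr)
  assume ne: "\<not> a j \<le> a i"
  then have "germ M e D p (\<lambda>d. d j / d i) 0" using adaptedD[OF ad ij(2,1)] by auto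
  from germ_ratio_inverse[OF M D ij g this] show False by simp
qed

lemma adapted_unique:
  assumes M: "dspace M e D" and D: "D \<subseteq> torus_cover n" and ad: "adapted n M e D p a c" "adapted n M e D p a' c'"
  shows "toric_limit n a c = toric_limit n a' c'"
proof -
  have ord: "a j \<le> a i \<longleftrightarrow> a' j \<le> a' i" if ij: "i \<in> {1..n}" "j \<in> {1..n}" for i j
    using adapted_order[OF M D ad(1) ij adaptedD[OF ad(2) ij]] adapted_order[OF M D ad(2) ij adaptedD[OF ad(1) ij]] by blast
  have "c i / c j = c' i / c' j" if ij: "i \<in> {1..n}" "j \<in> {1..n}" and eq: "a i = a j" for i j
  proof -
    have "a' i = a' j" using ord[OF ij] ord[OF ij(2,1)] eq by simp
    then show ?thesis
      using germ_unique[OF M adaptedD[OF ad(1) ij] adaptedD[OF ad(2) ij]] eq by simp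
  qed
  then show ?thesis
    using ad ord unfolding adapted_def by (intro toric_limit_eqI) auto
qed

lemma adapted_morphism:
  assumes D: "D \<subseteq> torus_cover n" and pi: "morphism M (weyl_toric_variety n) \<pi>" "\<forall>d\<in>D. \<pi> (e d) = toric_torus n d"
    and p: "p \<in> points M" and ac: "\<pi> p = toric_limit n a c" "a \<in> order_cone n a" "c \<in> torus_cover n"
  shows "adapted n M e D p a c"
  unfolding adapted_def
proof (intro conjI ballI impI ac(2,3))
  fix i j assume ij: "i \<in> {1..n}" "j \<in> {1..n}" and le: "a j \<le> a i"
  let ?t = "order_cone n a" let ?r = "root_vector i j"
  have r: "?r \<in> dual_monoid n ?t" unfolding root_dual_iff[OF ij] using le ij unfolding order_cone_def by blast
  have pt: "\<pi> p \<in> toric_chart n ?t" unfolding ac(1) by (rule toric_chartI[OF ac(2,3)])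
  have "germ (weyl_toric_variety n) (toric_torus n) D (\<pi> p) (\<lambda>d. chart_value ?t ?r (toric_torus n d)) (chart_value ?t ?r (\<pi> p))"
    by (rule regular_germ[OF openin_toric_chart[OF order_cone_fan] regular_chart_value[OF order_cone_fan r] pt])
  then have "germ (weyl_toric_variety n) (toric_torus n) D (\<pi> p) (\<lambda>d. d i / d j) (chart_value ?t ?r (\<pi> p))"
    by (rule germ_cong'[OF sheafy_toric]) (use D in \<open>auto simp: chart_value_torus[OF order_cone_fan r] monomial_root[OF _ ij]\<close>)
  then have "germ M e D p (\<lambda>d. d i / d j) (chart_value ?t ?r (\<pi> p))"
    by (intro germ_pullback[OF pi(1) _ p]) (use pi(2) in auto)
  then show "germ M e D p (\<lambda>d. d i / d j) (if a i = a j then c i / c j else 0)"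
    unfolding ac(1) chart_value_limit[OF order_cone_fan ac(2)] limit_value_root[OF ac(3) ij r] .
qed

lemma toric_unique:
  assumes M: "dspace M e D" and D: "D \<subseteq> torus_cover n"
    and pi: "morphism M (weyl_toric_variety n) \<pi>" "\<forall>d\<in>D. \<pi> (e d) = toric_torus n d"
    and pi': "morphism M (weyl_toric_variety n) \<pi>'" "\<forall>d\<in>D. \<pi>' (e d) = toric_torus n d"
    and p: "p \<in> points M"
  shows "\<pi> p = \<pi>' p"
proof -
  obtain a c where ac: "\<pi> p = toric_limit n a c" "c \<in> torus_cover n" "a \<in> order_cone n a"
    using toric_pointE[OF morphism_points[OF pi(1) p]] .
  obtain a' c' where ac': "\<pi>' p = toric_limit n a' c'" "c' \<in> torus_cover n" "a' \<in> order_cone n a'"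
    using toric_pointE[OF morphism_points[OF pi'(1) p]] .
  show ?thesis unfolding ac(1) ac'(1)
    by (rule adapted_unique[OF M D adapted_morphism[OF D pi p ac(1,3,2)] adapted_morphism[OF D pi' p ac'(1,3,2)]])
qed

text \<open>Totality orders the coordinates weakly by their rate of vanishing at \<open>p\<close>.
  The exponent \<open>a j\<close> is a rank, counting the \<open>i\<close> for which t_j / t_i
  vanishes at \<open>p\<close>, and \<open>c j\<close> compares t_j with the coordinate of least
  index in its class.\<close>

lemma adapted_exists:
  assumes M: "dspace M e D" and D: "D \<subseteq> torus_cover n" and p: "p \<in> points M"
    and tot: "\<And>i j. i \<in> {1..n} \<Longrightarrow> j \<in> {1..n} \<Longrightarrow> (\<exists>u. germ M e D p (\<lambda>d. d i / d j) u) \<or> (\<exists>u. germ M e D p (\<lambda>d. d j / d i) u)"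
  shows "\<exists>a c. adapted n M e D p a c"
proof -
  note S = dspace_sheafy[OF M]
  let ?g = "\<lambda>i j u. germ M e D p (\<lambda>d. d i / d j) u"
  have refl: "?g i i 1" if "i \<in> {1..n}" for i
    by (rule germ_cong'[OF S germ_const[OF S p]]) (use D torus_cover_nonzero that in \<open>auto simp: subset_iff\<close>)
  have trans: "?g i k (u * v)" if "?g i j u" "?g j k v" "j \<in> {1..n}" for i j k u v
    by (rule germ_cong'[OF S germ_mult[OF S that(1,2)]]) (use D torus_cover_nonzero that(3) in \<open>auto simp: subset_iff\<close>)
  have inv: "?g j i (inverse u)" if "?g i j u" "u \<noteq> 0" for i j u
    by (rule germ_cong'[OF S germ_inverse[OF S that]]) auto
  define lt where "lt j = {i \<in> {1..n}. ?g j i 0}" for j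
  define eqv where "eqv j = {i \<in> {1..n}. \<exists>u. u \<noteq> 0 \<and> ?g j i u}" for j
  define a where "a j = (if j \<in> {1..n} then real (card (lt j)) else 0)" for j
  define c where "c j = (if j \<in> {1..n} then (THE u. ?g j (Min (eqv j)) u) else 0)" for j
  have fin: "finite (lt j)" "finite (eqv j)" for j unfolding lt_def eqv_def by auto
  have less: "a i < a j" if ij: "i \<in> {1..n}" "j \<in> {1..n}" "?g j i 0" for i j
  proof -
    have "lt i \<subseteq> lt j" unfolding lt_def using trans[OF ij(3) _ ij(1)] by auto
    moreover have "i \<in> lt j" unfolding lt_def using ij by blast
    moreover have "i \<notin> lt i" unfolding lt_def using germ_unique[OF M refl[OF ij(1)], of 0] by auto
    ultimately have "card (lt i) < card (lt j)" using fin by (intro psubset_card_mono) auto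
    then show ?thesis unfolding a_def using ij by simp
  qed
  have same: "a i = a j" "eqv i = eqv j" if ij: "i \<in> {1..n}" "j \<in> {1..n}" "?g j i u" "u \<noteq> 0" for i j u
  proof -
    note ji = ij(3) and ij' = inv[OF ij(3,4)]
    have "lt i = lt j" unfolding lt_def using trans[OF ji _ ij(1)] trans[OF ij' _ ij(2)] by fastforce
    then show "a i = a j" unfolding a_def using ij by simp
    show "eqv i = eqv j"
    proof (intro set_eqI iffI)
      fix k assume "k \<in> eqv i"
      then obtain v where v: "k \<in> {1..n}" "v \<noteq> 0" "?g i k v" unfolding eqv_def by blast
      have "u * v \<noteq> 0" using v ij by simp
      then show "k \<in> eqv j" unfolding eqv_def using trans[OF ji v(3) ij(1)] v(1) by blast
    next
      fix k assume "k \<in> eqv j"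
      then obtain v where v: "k \<in> {1..n}" "v \<noteq> 0" "?g j k v" unfolding eqv_def by blast
      have "inverse u * v \<noteq> 0" using v ij by simp
      then show "k \<in> eqv i" unfolding eqv_def using trans[OF ij' v(3) ij(2)] v(1) by blast
    qed
  qed
  have cg: "?g j (Min (eqv j)) (c j) \<and> c j \<noteq> 0 \<and> Min (eqv j) \<in> {1..n}" if j: "j \<in> {1..n}" for j
  proof -
    have "j \<in> eqv j" unfolding eqv_def mem_Collect_eq by (intro conjI exI[of _ 1] refl j) simp
    then have "Min (eqv j) \<in> eqv j" using Min_in[OF fin(2)] by blast
    then obtain u where u: "u \<noteq> 0" "?g j (Min (eqv j)) u" "Min (eqv j) \<in> {1..n}" unfolding eqv_def by auto
    have "(THE u. ?g j (Min (eqv j)) u) = u"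
    proof (rule the_equality)
      show "?g j (Min (eqv j)) u" by (rule u(2))
      show "v = u" if "?g j (Min (eqv j)) v" for v by (rule germ_unique[OF M that u(2)])
    qed
    then show ?thesis unfolding c_def using u j by simp
  qed
  have cT: "c \<in> torus_cover n" unfolding torus_cover_def using cg by (auto simp: c_def)
  have "adapted n M e D p a c" unfolding adapted_def
  proof (intro conjI ballI impI cT)
    show "a \<in> order_cone n a" by (rule order_cone_self) (auto simp: a_def)
    fix i j assume ij: "i \<in> {1..n}" "j \<in> {1..n}" and le: "a j \<le> a i"
    have "\<exists>u. ?g i j u"
    proof (rule ccontr)
      assume no: "\<not> ?thesis"
      then obtain v where v: "?g j i v" using tot[OF ij] by blast
      have "v = 0" using inv[OF v] no by blast
      then show False using less[OF ij] v le by simp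
    qed
    then obtain u where u: "?g i j u" by blast
    show "?g i j (if a i = a j then c i / c j else 0)"
    proof (cases "u = 0")
      case True
      then have "a j < a i" using less[OF ij(2,1)] u by simp
      then show ?thesis using u True by simp
    next
      case False
      note s = same[OF ij(2,1) u False]
      have cj: "?g j (Min (eqv i)) (c j)" "c j \<noteq> 0" "Min (eqv i) \<in> {1..n}" using cg[OF ij(2)] unfolding s(2) by auto
      have "?g i j (c i * inverse (c j))" using trans[OF _ inv[OF cj(1,2)] cj(3)] cg[OF ij(1)] by blast
      then show ?thesis using s(1) by (simp add: divide_inverse)
    qed
  qed
  then show ?thesis by blast
qed

lemma adapted_monomial:
  assumes M: "dspace M e D" and D: "D \<subseteq> torus_cover n" and ad: "adapted n M e D p a c"
    and s: "\<sigma> \<in> weyl_fan n" "a \<in> \<sigma>" and p: "p \<in> points M" and m: "m \<in> dual_monoid n \<sigma>"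
  shows "germ M e D p (\<lambda>d. monomial n d m) (limit_value n \<sigma> a c m)"
proof -
  note S = dspace_sheafy[OF M]
  have c: "c \<in> torus_cover n" using ad unfolding adapted_def by blast
  note A = limit_value_affine[OF s(2) c]
  show ?thesis
  proof (rule dual_monoid_induct[OF s(1) m, of "\<lambda>m. germ M e D p (\<lambda>d. monomial n d m) (limit_value n \<sigma> a c m)"])
    show "germ M e D p (\<lambda>d. monomial n d (\<lambda>_. 0)) (limit_value n \<sigma> a c (\<lambda>_. 0))"
      unfolding monomial_zero affine_toric_zero[OF A] by (rule germ_const[OF S p])
    fix m m' assume m: "m \<in> dual_monoid n \<sigma>" "m' \<in> dual_monoid n \<sigma>"
      "germ M e D p (\<lambda>d. monomial n d m) (limit_value n \<sigma> a c m)" "germ M e D p (\<lambda>d. monomial n d m') (limit_value n \<sigma> a c m')"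
    show "germ M e D p (\<lambda>d. monomial n d (\<lambda>i. m i + m' i)) (limit_value n \<sigma> a c (\<lambda>i. m i + m' i))"
      unfolding affine_toric_mult[OF A m(1,2)]
      by (rule germ_cong'[OF S germ_mult[OF S m(3,4)]]) (use D in \<open>auto simp: monomial_add\<close>)
  next
    fix i j assume ij: "i \<in> {1..n}" "j \<in> {1..n}" and r: "root_vector i j \<in> dual_monoid n \<sigma>"
    have "a j \<le> a i" using r s(2) unfolding root_dual_iff[OF ij] by blast
    from adaptedD[OF ad ij this] have "germ M e D p (\<lambda>d. d i / d j) (limit_value n \<sigma> a c (root_vector i j))"
      unfolding limit_value_root[OF c ij r] .
    then show "germ M e D p (\<lambda>d. monomial n d (root_vector i j)) (limit_value n \<sigma> a c (root_vector i j))"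
      by (rule germ_cong'[OF S]) (use D ij in \<open>auto simp: monomial_root\<close>)
  qed
qed

lemma toric_universal:
  assumes M: "dspace M e D" and D: "D \<subseteq> torus_cover n"
    and tot: "\<And>p i j. p \<in> points M \<Longrightarrow> i \<in> {1..n} \<Longrightarrow> j \<in> {1..n} \<Longrightarrow>
       (\<exists>u. germ M e D p (\<lambda>d. d i / d j) u) \<or> (\<exists>u. germ M e D p (\<lambda>d. d j / d i) u)"
  shows "\<exists>\<pi>. morphism M (weyl_toric_variety n) \<pi> \<and> (\<forall>d\<in>D. \<pi> (e d) = toric_torus n d)"
proof -
  note S = dspace_sheafy[OF M]
  have ex: "\<exists>z. adapted n M e D p (fst z) (snd z)" if "p \<in> points M" for p
    using adapted_exists[OF M D that tot[OF that]] by auto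
  define z where "z p = (SOME z. adapted n M e D p (fst z) (snd z))" for p
  have z: "adapted n M e D p (fst (z p)) (snd (z p))" if "p \<in> points M" for p
    unfolding z_def using ex[OF that] by (rule someI_ex)
  define \<pi> where "\<pi> p = toric_limit n (fst (z p)) (snd (z p))" for p
  have zc: "fst (z p) \<in> order_cone n (fst (z p))" "snd (z p) \<in> torus_cover n" if "p \<in> points M" for p
    using z[OF that] unfolding adapted_def by auto
  have "morphism M (weyl_toric_variety n) \<pi>"
    unfolding weyl_toric_variety_charts
  proof (rule morphism_by_germs[OF M], fold weyl_toric_variety_charts)
    show "\<pi> p \<in> points (weyl_toric_variety n)" if "p \<in> points M" for p
      unfolding \<pi>_def by (rule toric_pointI[OF zc[OF that]])
  next
    fix U F p assume "(U, F) \<in> toric_charts n" and p: "p \<in> points M" "\<pi> p \<in> U"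
    then obtain \<sigma> where s: "\<sigma> \<in> weyl_fan n" "U = toric_chart n \<sigma>" unfolding toric_charts_def by blast
    have a: "fst (z p) \<in> \<sigma>" using p(2) unfolding s(2) \<pi>_def toric_chart_limit_iff[OF s(1) zc(2)[OF p(1)]] .
    \<comment> \<open>That the image lies in the chart of \<open>\<sigma>\<close> amounts to
      extendability of the finitely many ratios given by roots in its dual monoid, and this is an
      open condition.\<close>
    let ?R = "{r \<in> {1..n} \<times> {1..n}. root_vector (fst r) (snd r) \<in> dual_monoid n \<sigma>}"
    have "\<exists>N. openin (zariski M) N \<and> p \<in> N \<and> (\<forall>q\<in>N. \<forall>r\<in>?R. \<exists>u. germ M e D q (\<lambda>d. d (fst r) / d (snd r)) u)"
    proof (rule germs_spread[OF _ p(1)])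
      show "finite ?R" by simp
      fix r assume r: "r \<in> ?R"
      then have ij: "fst r \<in> {1..n}" "snd r \<in> {1..n}" by auto
      have "fst (z p) (snd r) \<le> fst (z p) (fst r)" using r a unfolding mem_Collect_eq root_dual_iff[OF ij] by blast
      from adaptedD[OF z[OF p(1)] ij this] show "\<exists>u. germ M e D p (\<lambda>d. d (fst r) / d (snd r)) u" by blast
    qed
    then obtain N where N: "openin (zariski M) N" "p \<in> N" "\<forall>q\<in>N. \<forall>r\<in>?R. \<exists>u. germ M e D q (\<lambda>d. d (fst r) / d (snd r)) u"
      by (elim exE conjE) (rule that)
    have "\<pi> q \<in> U" if q: "q \<in> N" for q
    proof -
      have qM: "q \<in> points M" using openin_subset[OF N(1)] q by blast
      have "fst (z q) j \<le> fst (z q) i" if ij: "i \<in> {1..n}" "j \<in> {1..n}" and r: "root_vector i j \<in> dual_monoid n \<sigma>" for i j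
      proof -
        obtain u where "germ M e D q (\<lambda>d. d i / d j) u" using N(3)[rule_format, OF q, of "(i, j)"] ij r by auto
        then show ?thesis by (rule adapted_order[OF M D z[OF qM] ij])
      qed
      then have "fst (z q) \<in> \<sigma>" unfolding fan_mem_iff[OF s(1)]
        using fan_outside[OF order_cone_fan zc(1)[OF qM]] by blast
      then show ?thesis unfolding s(2) \<pi>_def by (rule toric_chartI[OF _ zc(2)[OF qM]])
    qed
    then show "\<exists>N. openin (zariski M) N \<and> p \<in> N \<and> (\<forall>q\<in>N. \<pi> q \<in> U)" using N by blast
  next
    fix U F g assume "(U, F) \<in> toric_charts n" and "g \<in> F"
    then obtain \<sigma> m where s: "\<sigma> \<in> weyl_fan n" "U = toric_chart n \<sigma>" and m: "m \<in> dual_monoid n \<sigma>" "g = chart_value \<sigma> m"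
      unfolding toric_charts_def by blast
    have "germ M e D p (\<lambda>d. monomial n d m) (g (\<pi> p))" if p: "p \<in> points M" "\<pi> p \<in> U" for p
    proof -
      have a: "fst (z p) \<in> \<sigma>" using p(2) unfolding s(2) \<pi>_def toric_chart_limit_iff[OF s(1) zc(2)[OF p(1)]] .
      show ?thesis unfolding m(2) \<pi>_def chart_value_limit[OF s(1) a]
        by (rule adapted_monomial[OF M D z[OF p(1)] s(1) a p(1) m(1)])
    qed
    then show "\<exists>h. \<forall>p\<in>points M. \<pi> p \<in> U \<longrightarrow> germ M e D p h (g (\<pi> p))" by blast
  qed
  moreover have "\<pi> (e d) = toric_torus n d" if d: "d \<in> D" for d
  proof -
    have pM: "e d \<in> points M" by (rule dspace_points[OF M d])
    have "adapted n M e D (e d) (\<lambda>_. 0) d" unfolding adapted_def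
    proof (intro conjI ballI impI)
      show "d \<in> torus_cover n" using d D by blast
      show "(\<lambda>_. 0) \<in> order_cone n (\<lambda>_. 0)" by (rule order_cone_self) simp
      fix i j assume ij: "i \<in> {1..n}" "j \<in> {1..n}"
      have g: "c = d k / d l" if "germ M e D (e d) (\<lambda>d. d k / d l) c" for k l c using that d by (erule_tac germE) auto
      have dz: "d i \<noteq> 0" "d j \<noteq> 0" using torus_cover_nonzero D d ij by blast+
      \<comment> \<open>At a point of the family both ratios are nonzero, so if only the reciprocal
        is known to extend, its inverse extends too.\<close>
      have "germ M e D (e d) (\<lambda>d. d i / d j) (d i / d j)"
      proof (cases "\<exists>u. germ M e D (e d) (\<lambda>d. d i / d j) u")
        case True
        then show ?thesis using g by blast
      next
        case False
        then obtain u where u: "germ M e D (e d) (\<lambda>d. d j / d i) u" using tot[OF pM ij] by blast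
        have u': "u = d j / d i" by (rule g[OF u])
        then have "u \<noteq> 0" using dz by simp
        from germ_cong'[OF S germ_inverse[OF S u this], of "\<lambda>d. d i / d j"] False show ?thesis by auto
      qed
      then show "germ M e D (e d) (\<lambda>d. d i / d j) (if (0::real) = 0 then d i / d j else 0)" by simp
    qed
    from adapted_unique[OF M D z[OF pM] this] show ?thesis unfolding \<pi>_def .
  qed
  ultimately show ?thesis by blast
qed

section \<open>The ideal of the closure of a layer\<close>

text \<open>The ideal generated by \<open>G\<close> in the local ring at \<open>x\<close>, with
  functions in place of germs; the rule \<open>cong\<close> identifies functions that agree near
  \<open>x\<close>.\<close>

inductive local_ideal :: "'a fspace \<Rightarrow> 'a \<Rightarrow> ('a \<Rightarrow> complex) set \<Rightarrow> ('a \<Rightarrow> complex) \<Rightarrow> bool" for X x G where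
  gen: "g \<in> G \<Longrightarrow> local_ideal X x G g"
| add: "local_ideal X x G f \<Longrightarrow> local_ideal X x G g \<Longrightarrow> local_ideal X x G (\<lambda>y. f y + g y)"
| mult: "openin (zariski X) N \<Longrightarrow> x \<in> N \<Longrightarrow> regular X N c \<Longrightarrow> local_ideal X x G f \<Longrightarrow> local_ideal X x G (\<lambda>y. c y * f y)"
| cong: "local_ideal X x G f \<Longrightarrow> openin (zariski X) N \<Longrightarrow> x \<in> N \<Longrightarrow> (\<And>y. y \<in> N \<Longrightarrow> f y = f' y) \<Longrightarrow> local_ideal X x G f'"

lemma local_ideal_zero: "local_ideal X x G f \<Longrightarrow> (\<And>g. g \<in> G \<Longrightarrow> g x = 0) \<Longrightarrow> f x = 0"
  by (induction rule: local_ideal.induct) auto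

text \<open>\<phi> is linear over the local ring, so vanishing spreads from generators to the ideal.
  Contrapositively, a point of the blowup is nonzero on some generator, which then provides a chart
  around it.\<close>

lemma local_ideal_fibre:
  assumes X: "sheafy X" and phi: "\<phi> \<in> blowup_fibre X Z x" and f: "local_ideal X x G f"
    and G: "\<And>g. g \<in> G \<Longrightarrow> g \<in> ideal_at X Z x" "\<And>g. g \<in> G \<Longrightarrow> \<phi> g = 0"
  shows "f \<in> ideal_at X Z x \<and> \<phi> f = 0"
  using f
proof induction
  case (gen g)
  then show ?case using G by blast
next
  case (add f g)
  then obtain W where W: "openin (zariski X) W" "x \<in> W" "f \<in> ideal_sections X Z W" "g \<in> ideal_sections X Z W"
    using ideal_at_common[OF X] by metis
  note one = sheafy_const[OF X W(1), of 1]
  have h: "(\<lambda>y. f y + g y) \<in> ideal_sections X Z W"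
    using W sheafy_add[OF X W(1), of f g] unfolding ideal_sections_def by auto
  have "\<phi> (\<lambda>y. f y + g y) = 1 * \<phi> f + 1 * \<phi> g"
    by (rule blowup_fibre_linear[OF X phi W(1,2) one one W(3,4) h]) simp
  then show ?case using add ideal_atI[OF W(1,2) h] by simp
next
  case (mult N c f)
  then obtain W where W: "openin (zariski X) W" "x \<in> W" "f \<in> ideal_sections X Z W" unfolding ideal_at_def by blast
  have o: "openin (zariski X) (N \<inter> W)" "x \<in> N \<inter> W" using mult W by auto
  note f = ideal_sections_subset[OF X W(1) o(1) _ W(3)]
  have c: "regular X (N \<inter> W) c" using regular_subset[OF X mult(1) o(1) _ mult(3)] by blast
  have h: "(\<lambda>y. c y * f y) \<in> ideal_sections X Z (N \<inter> W)"
    using f sheafy_mult[OF X o(1) c, of f] unfolding ideal_sections_def by auto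
  have "\<phi> (\<lambda>y. c y * f y) = c x * \<phi> f + 0 * \<phi> f"
    by (rule blowup_fibre_linear[OF X phi o c sheafy_const[OF X o(1)] f f h]) auto
  then show ?case using mult ideal_atI[OF o h] by simp
next
  case (cong f N f')
  then obtain W where W: "openin (zariski X) W" "x \<in> W" "f \<in> ideal_sections X Z W" unfolding ideal_at_def by blast
  have o: "openin (zariski X) (N \<inter> W)" "x \<in> N \<inter> W" using cong W by auto
  note f = ideal_sections_subset[OF X W(1) o(1) _ W(3)]
  have eq: "f y = f' y" if "y \<in> N \<inter> W" for y using cong(4) that by blast
  have "regular X (N \<inter> W) f" using f unfolding ideal_sections_def by auto
  from sheafy_restrict[OF X o(1) o(1) _ this eq] have "regular X (N \<inter> W) f'" by simp
  then have h: "f' \<in> ideal_sections X Z (N \<inter> W)" using f eq unfolding ideal_sections_def by force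
  have "\<phi> f' = 1 * \<phi> f + 0 * \<phi> f"
    by (rule blowup_fibre_linear[OF X phi o sheafy_const[OF X o(1)] sheafy_const[OF X o(1)] f f h]) (use eq in auto)
  then show ?case using cong ideal_atI[OF o h] by simp
qed

text \<open>Coefficients pull back to regular functions, so divisibility by \<open>w\<close> has to
  be checked on generators only.\<close>

lemma local_ideal_germ:
  assumes M: "dspace M e D" and pi: "morphism M X \<pi>" "\<forall>d\<in>D. \<pi> (e d) = e' d" and q: "q \<in> points M" "\<pi> q = x"
    and f: "local_ideal X x G f" and G: "\<And>g. g \<in> G \<Longrightarrow> \<exists>u. germ M e D q (\<lambda>d. g (e' d) / w d) u"
  shows "\<exists>u. germ M e D q (\<lambda>d. f (e' d) / w d) u"
  using f
proof induction
  case (gen g)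
  then show ?case using G by blast
next
  case (add f g)
  then obtain u v where "germ M e D q (\<lambda>d. f (e' d) / w d) u" "germ M e D q (\<lambda>d. g (e' d) / w d) v" by blast
  from germ_add[OF dspace_sheafy[OF M] this] show ?case by (auto simp: add_divide_distrib)
next
  case (mult N c f)
  then obtain u where u: "germ M e D q (\<lambda>d. f (e' d) / w d) u" by blast
  have "germ X e' D (\<pi> q) (\<lambda>d. c (e' d)) (c (\<pi> q))" by (rule regular_germ[OF mult(1,3)]) (use mult(2) q in simp)
  then have "germ M e D q (\<lambda>d. c (e' d)) (c (\<pi> q))" by (intro germ_pullback[OF pi(1) _ q(1)]) (use pi(2) in auto)
  from germ_mult[OF dspace_sheafy[OF M] this u] show ?case by auto
next
  case (cong f N f')
  then obtain u where u: "germ M e D q (\<lambda>d. f (e' d) / w d) u" by blast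
  have "germ M e D q (\<lambda>d. f' (e' d) / w d) u"
  proof (rule germ_cong[OF dspace_sheafy[OF M] u morphism_open[OF pi(1) cong(2)]])
    show "q \<in> {q \<in> points M. \<pi> q \<in> N}" using q cong(3) by blast
    fix d assume d: "d \<in> D" "e d \<in> {q \<in> points M. \<pi> q \<in> N}"
    then have "e' d \<in> N" using pi(2) by auto
    then show "f (e' d) / w d = f' (e' d) / w d" using cong(4) by simp
  qed
  then show ?case by blast
qed

section \<open>Equations of the closure of a layer and the retraction onto it\<close>

definition block_points :: "nat \<Rightarrow> nat set \<Rightarrow> toric_point set" where
  "block_points n B = {toric_torus n t | t. t \<in> torus_cover n \<and> (\<forall>i\<in>B. \<forall>j\<in>B. t i = t j)}"

definition block_closure :: "nat \<Rightarrow> nat set \<Rightarrow> toric_point set" where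
  "block_closure n B = zariski (weyl_toric_variety n) closure_of block_points n B"

lemma toric_torus_point: "t \<in> torus_cover n \<Longrightarrow> toric_torus n t \<in> points (weyl_toric_variety n)"
  by (rule toric_pointI[OF order_cone_self]) auto

lemma block_points_closure: "block_points n B \<subseteq> block_closure n B"
  unfolding block_closure_def
  by (rule closure_of_subset) (auto simp: block_points_def intro: toric_torus_point)

definition block_equation :: "(nat \<Rightarrow> real) set \<Rightarrow> nat \<Rightarrow> nat \<Rightarrow> toric_point \<Rightarrow> complex" where
  "block_equation \<sigma> k b = (\<lambda>p. chart_value \<sigma> (root_vector k b) p - 1)"

lemma block_equation_regular:
  assumes "\<sigma> \<in> weyl_fan n" "root_vector k b \<in> dual_monoid n \<sigma>"
  shows "regular (weyl_toric_variety n) (toric_chart n \<sigma>) (block_equation \<sigma> k b)"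
  unfolding block_equation_def
  by (rule sheafy_minus[OF sheafy_toric openin_toric_chart[OF assms(1)] regular_chart_value[OF assms]
        sheafy_const[OF sheafy_toric openin_toric_chart[OF assms(1)]]])

lemma block_equation_torus:
  assumes "\<sigma> \<in> weyl_fan n" "root_vector k b \<in> dual_monoid n \<sigma>" "k \<in> {1..n}" "b \<in> {1..n}" "t \<in> torus_cover n"
  shows "block_equation \<sigma> k b (toric_torus n t) = t k / t b - 1"
  unfolding block_equation_def chart_value_torus[OF assms(1,2)] monomial_root[OF assms(5,3,4)] ..

text \<open>The equation vanishes at the torus points of the layer, and its nonvanishing locus is
  open, so it vanishes on the closure.\<close>

lemma block_equation_ideal:
  assumes s: "\<sigma> \<in> weyl_fan n" and kb: "k \<in> B" "b \<in> B" and B: "B \<subseteq> {1..n}" and r: "root_vector k b \<in> dual_monoid n \<sigma>"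
  shows "block_equation \<sigma> k b \<in> ideal_sections (weyl_toric_variety n) (block_closure n B) (toric_chart n \<sigma>)"
proof (rule ideal_sectionsI[OF block_equation_regular[OF s r]])
  fix z assume z: "z \<in> toric_chart n \<sigma>" "z \<in> block_closure n B"
  show "block_equation \<sigma> k b z = 0"
  proof (rule ccontr)
    let ?N = "{y \<in> toric_chart n \<sigma>. block_equation \<sigma> k b y \<noteq> 0}"
    assume "block_equation \<sigma> k b z \<noteq> 0"
    then have "z \<in> ?N" using z by blast
    moreover have "openin (zariski (weyl_toric_variety n)) ?N"
      by (rule sheafy_open[OF sheafy_toric openin_toric_chart[OF s] block_equation_regular[OF s r]])
    moreover have "\<forall>T. z \<in> T \<and> openin (zariski (weyl_toric_variety n)) T \<longrightarrow> (\<exists>y. y \<in> block_points n B \<and> y \<in> T)"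
      using z(2) unfolding block_closure_def in_closure_of by (rule conjunct2)
    ultimately have "\<exists>y. y \<in> block_points n B \<and> y \<in> ?N" by (elim allE[of _ ?N]) simp
    then obtain y where y: "y \<in> block_points n B" "y \<in> ?N" by blast
    then obtain t where t: "y = toric_torus n t" "t \<in> torus_cover n" "t k = t b" unfolding block_points_def using kb by blast
    have k: "k \<in> {1..n}" "b \<in> {1..n}" using kb B by auto
    have "block_equation \<sigma> k b y = 0"
      unfolding t(1) block_equation_torus[OF s r k t(2)] using t(3) torus_cover_nonzero[OF t(2) k(2)] by simp
    then show False using y(2) by simp
  qed
qed

lemma torus_not_in_block_closure:
  assumes t: "t \<in> torus_cover n" and ij: "i \<in> B" "j \<in> B" "t i \<noteq> t j" and B: "B \<subseteq> {1..n}"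
  shows "toric_torus n t \<notin> block_closure n B"
proof
  assume Z: "toric_torus n t \<in> block_closure n B"
  let ?o = "order_cone n (\<lambda>_. 0)"
  have i: "i \<in> {1..n}" "j \<in> {1..n}" using ij B by auto
  have o: "?o \<in> weyl_fan n" by (rule order_cone_fan)
  have r: "root_vector i j \<in> dual_monoid n ?o" unfolding root_dual_iff[OF i] using i unfolding order_cone_def by blast
  have "toric_torus n t \<in> toric_chart n ?o" by (rule toric_chartI[OF zero_in_fan[OF o] t])
  from ideal_sections_zero[OF block_equation_ideal[OF o ij(1,2) B r] this Z]
  show False unfolding block_equation_torus[OF o r i t] using ij(3) torus_cover_nonzero[OF t i(2)] by simp
qed

definition collapse :: "nat set \<Rightarrow> nat \<Rightarrow> (nat \<Rightarrow> complex) \<Rightarrow> nat \<Rightarrow> complex" where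
  "collapse B b t = (\<lambda>i. if i \<in> B then t b else t i)"

lemma collapse_cover: "t \<in> torus_cover n \<Longrightarrow> B \<subseteq> {1..n} \<Longrightarrow> b \<in> B \<Longrightarrow> collapse B b t \<in> torus_cover n"
  unfolding torus_cover_def collapse_def by auto

lemma collapse_block: "t \<in> torus_cover n \<Longrightarrow> B \<subseteq> {1..n} \<Longrightarrow> b \<in> B \<Longrightarrow> toric_torus n (collapse B b t) \<in> block_closure n B"
  using block_points_closure collapse_cover[of t n B b] unfolding block_points_def collapse_def by fastforce

lemma monomial_scale: "monomial n t (\<lambda>i. z * r i) = monomial n t r powi z"
proof -
  have "(\<Prod>i\<in>A. f i) powi z = (\<Prod>i\<in>A. f i powi z)" for A :: "nat set" and f :: "nat \<Rightarrow> complex"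
    by (induction A rule: infinite_finite_induct) (auto simp: power_int_mult_distrib)
  moreover have "t i powi (z * r i) = (t i powi r i) powi z" for i
    using power_int_mult[of "t i" "r i" z] by (simp add: mult.commute)
  ultimately show ?thesis unfolding monomial_def by simp
qed

text \<open>Adding this to \<open>m\<close> moves all exponents in \<open>B\<close> to
  \<open>b\<close>, which is how a character pulls back along \<open>collapse\<close>.\<close>

definition gather :: "nat set \<Rightarrow> nat \<Rightarrow> (nat \<Rightarrow> int) \<Rightarrow> nat \<Rightarrow> int" where
  "gather B b m = (\<lambda>i. \<Sum>j\<in>B. m j * root_vector b j i)"

lemma monomial_gather:
  assumes t: "t \<in> torus_cover n" and B: "B \<subseteq> {1..n}" and b: "b \<in> B"
  shows "monomial n t (\<lambda>i. m i + gather B b m i) = monomial n (collapse B b t) m"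
proof -
  have b': "b \<in> {1..n}" using b B by blast
  have "finite K \<Longrightarrow> K \<subseteq> B \<Longrightarrow> monomial n t (gather K b m) = (\<Prod>j\<in>K. (t b / t j) powi m j)" for K
  proof (induction K rule: finite_induct)
    case empty
    then show ?case by (simp add: gather_def monomial_zero)
  next
    case (insert j K)
    have j: "j \<in> {1..n}" using insert B by blast
    have "gather (insert j K) b m = (\<lambda>i. m j * root_vector b j i + gather K b m i)"
      unfolding gather_def using insert by simp
    then show ?case using insert by (simp add: monomial_add[OF t] monomial_scale monomial_root[OF t b' j])
  qed
  then have "monomial n t (gather B b m) = (\<Prod>j\<in>B. (t b / t j) powi m j)" using finite_subset[OF B] by simp
  also have "\<dots> = (\<Prod>j=1..n. if j \<in> B then (t b / t j) powi m j else 1)"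
    using B by (simp add: prod.If_cases Int_absorb1)
  finally have "monomial n t (\<lambda>i. m i + gather B b m i) = (\<Prod>j=1..n. t j powi m j * (if j \<in> B then (t b / t j) powi m j else 1))"
    unfolding monomial_add[OF t] by (simp add: monomial_def prod.distrib)
  also have "\<dots> = monomial n (collapse B b t) m"
    unfolding monomial_def collapse_def
    by (rule prod.cong) (use torus_cover_nonzero[OF t] in \<open>auto simp flip: power_int_mult_distrib\<close>)
  finally show ?thesis .
qed

lemma chart_value_add:
  assumes s: "\<sigma> \<in> weyl_fan n" and m: "m \<in> dual_monoid n \<sigma>" "m' \<in> dual_monoid n \<sigma>" and y: "y \<in> toric_chart n \<sigma>"
  shows "chart_value \<sigma> (\<lambda>i. m i + m' i) y = chart_value \<sigma> m y * chart_value \<sigma> m' y"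
proof -
  obtain a c where a: "y = toric_limit n a c" "a \<in> \<sigma>" "c \<in> torus_cover n" using y by (rule toric_chartE)
  show ?thesis unfolding a(1) chart_value_limit[OF s a(2)] by (rule affine_toric_mult[OF limit_value_affine[OF a(2,3)] m])
qed

text \<open>\<^const>\<open>collapse\<close> retracts a neighbourhood of the block closure onto it, and a regular function is
  congruent to its composition with the retraction modulo the equations \<open>t\<^sub>k / t\<^sub>b = 1\<close>.\<close>

lemma collapse_congruence:
  assumes B: "B \<subseteq> {1..n}" and b: "b \<in> B" and a: "a \<in> order_cone n a" and c: "c \<in> torus_cover n"
    and const: "\<forall>k\<in>B. a k = a b" and alpha: "\<alpha> \<in> function_algebra (chart_functions n (order_cone n a))"
  shows "\<exists>\<alpha>'. regular (weyl_toric_variety n) (toric_chart n (order_cone n a)) \<alpha>' \<and>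
    (\<forall>t\<in>torus_cover n. \<alpha>' (toric_torus n t) = \<alpha> (toric_torus n (collapse B b t))) \<and>
    local_ideal (weyl_toric_variety n) (toric_limit n a c) ((\<lambda>k. block_equation (order_cone n a) k b) ` B) (\<lambda>y. \<alpha> y - \<alpha>' y)"
proof -
  let ?X = "weyl_toric_variety n" and ?t = "order_cone n a" and ?x = "toric_limit n a c"
  let ?V = "toric_chart n ?t" and ?D = "dual_monoid n ?t"
  let ?LI = "local_ideal ?X ?x ((\<lambda>k. block_equation ?t k b) ` B)"
  note S = sheafy_toric[of n]
  have t: "?t \<in> weyl_fan n" by (rule order_cone_fan)
  have V: "openin (zariski ?X) ?V" by (rule openin_toric_chart[OF t])
  have xV: "?x \<in> ?V" by (rule toric_chartI[OF a c])
  note regc = regular_chart_value[OF t]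
  have LIzero: "?LI (\<lambda>_. 0)"
  proof -
    have "?LI (block_equation ?t b b)" by (rule local_ideal.gen) (use b in blast)
    from local_ideal.mult[OF V xV sheafy_const[OF S V, of 0] this] show ?thesis by simp
  qed
  have alg: "regular ?X ?V f" if "f \<in> function_algebra (chart_functions n ?t)" for f
    using that
  proof induction
    case (gen f)
    then show ?case using regc unfolding chart_functions_def by auto
  qed (auto intro: sheafy_const[OF S V] sheafy_add[OF S V] sheafy_mult[OF S V])
  have bB: "k \<in> {1..n}" if "k \<in> B" for k using that B by blast
  \<comment> \<open>As \<open>a\<close> is constant on \<open>B\<close>, both t_k / t_b and its
    inverse are regular on the chart, so exponents can be moved in either direction.\<close>
  have roots: "root_vector k b \<in> ?D" "root_vector b k \<in> ?D" if "k \<in> B" for k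
    using const[rule_format, OF that] bB[OF that] bB[OF b] unfolding root_dual_iff[OF bB[OF that] bB[OF b]] root_dual_iff[OF bB[OF b] bB[OF that]]
    by (auto simp: order_cone_def)
  \<comment> \<open>Multiplication by the character \<open>\<kappa>\<close> is the identity modulo
    the equations. Demanding this after multiplication with every \<open>m\<close> makes the
    property additive in \<open>\<kappa>\<close>, so the roots between \<open>b\<close> and the
    elements of \<open>B\<close> are enough.\<close>
  define P where "P \<kappa> \<longleftrightarrow> \<kappa> \<in> ?D \<and> (\<forall>m\<in>?D. ?LI (\<lambda>y. chart_value ?t m y - chart_value ?t (\<lambda>i. m i + \<kappa> i) y))" for \<kappa>
  have P0: "P (\<lambda>_. 0)" unfolding P_def using LIzero dual_monoid_zero by auto
  have Padd: "P (\<lambda>i. \<kappa> i + \<mu> i)" if k: "P \<kappa>" and l: "P \<mu>" for \<kappa> \<mu>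
    unfolding P_def
  proof (intro conjI ballI)
    show "(\<lambda>i. \<kappa> i + \<mu> i) \<in> ?D" using k l dual_monoid_add unfolding P_def by blast
    fix m assume m: "m \<in> ?D"
    have mk: "(\<lambda>i. m i + \<kappa> i) \<in> ?D" using m k dual_monoid_add unfolding P_def by blast
    have "?LI (\<lambda>y. (chart_value ?t m y - chart_value ?t (\<lambda>i. m i + \<kappa> i) y) +
        (chart_value ?t (\<lambda>i. m i + \<kappa> i) y - chart_value ?t (\<lambda>i. (m i + \<kappa> i) + \<mu> i) y))"
      by (rule local_ideal.add) (use k l m mk in \<open>auto simp: P_def\<close>)
    then show "?LI (\<lambda>y. chart_value ?t m y - chart_value ?t (\<lambda>i. m i + (\<kappa> i + \<mu> i)) y)"
      by (simp add: add.assoc)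
  qed
  have Pup: "P (root_vector k b)" if k: "k \<in> B" for k
    unfolding P_def
  proof (intro conjI ballI roots[OF k])
    fix m assume m: "m \<in> ?D"
    have "regular ?X ?V (\<lambda>y. -1 * chart_value ?t m y)" by (rule sheafy_mult[OF S V sheafy_const[OF S V] regc[OF m]])
    then have "?LI (\<lambda>y. (-1 * chart_value ?t m y) * block_equation ?t k b y)"
      by (intro local_ideal.mult[OF V xV] local_ideal.gen) (use k in auto)
    then show "?LI (\<lambda>y. chart_value ?t m y - chart_value ?t (\<lambda>i. m i + root_vector k b i) y)"
    proof (rule local_ideal.cong[OF _ V xV])
      fix y assume "y \<in> ?V"
      from chart_value_add[OF t m roots(1)[OF k] this]
      show "(-1 * chart_value ?t m y) * block_equation ?t k b y = chart_value ?t m y - chart_value ?t (\<lambda>i. m i + root_vector k b i) y"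
        unfolding block_equation_def by (simp add: algebra_simps)
    qed
  qed
  have Pdown: "P (root_vector b k)" if k: "k \<in> B" for k
    unfolding P_def
  proof (intro conjI ballI roots[OF k])
    fix m assume m: "m \<in> ?D"
    let ?m = "\<lambda>i. m i + root_vector b k i"
    have m': "?m \<in> ?D" by (rule dual_monoid_add[OF m roots(2)[OF k]])
    have "?LI (\<lambda>y. chart_value ?t ?m y * block_equation ?t k b y)"
      by (intro local_ideal.mult[OF V xV regc[OF m']] local_ideal.gen) (use k in auto)
    then show "?LI (\<lambda>y. chart_value ?t m y - chart_value ?t ?m y)"
    proof (rule local_ideal.cong[OF _ V xV])
      fix y assume "y \<in> ?V"
      from chart_value_add[OF t m' roots(1)[OF k] this]
      have "chart_value ?t (\<lambda>i. ?m i + root_vector k b i) y = chart_value ?t ?m y * chart_value ?t (root_vector k b) y" .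
      moreover have "(\<lambda>i. ?m i + root_vector k b i) = m" unfolding root_vector_def by auto
      ultimately show "chart_value ?t ?m y * block_equation ?t k b y = chart_value ?t m y - chart_value ?t ?m y"
        unfolding block_equation_def by (simp add: algebra_simps)
    qed
  qed
  have Pmult: "P (\<lambda>i. int z * r i)" if "P r" for z r
  proof (induction z)
    case (Suc z)
    have "(\<lambda>i. int (Suc z) * r i) = (\<lambda>i. r i + int z * r i)" by (auto simp: algebra_simps)
    then show ?case using Padd[OF that Suc] by simp
  qed (simp add: P0)
  have Proot: "P (\<lambda>i. z * root_vector b k i)" if k: "k \<in> B" for k z
  proof (cases "0 \<le> z")
    case True
    then show ?thesis using Pmult[OF Pdown[OF k], of "nat z"] by simp
  next
    case False
    have "(\<lambda>i. z * root_vector b k i) = (\<lambda>i. int (nat (- z)) * root_vector k b i)"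
      using False by (auto simp: root_vector_def)
    then show ?thesis using Pmult[OF Pup[OF k], of "nat (- z)"] by simp
  qed
  have Pgather: "P (gather B b m)" for m
  proof -
    have "finite K \<Longrightarrow> K \<subseteq> B \<Longrightarrow> P (gather K b m)" for K
    proof (induction K rule: finite_induct)
      case (insert k K)
      then show ?case using Padd[OF Proot[of k "m k"], of "gather K b m"] unfolding gather_def by simp
    qed (simp add: gather_def P0)
    then show ?thesis using finite_subset[OF B] by simp
  qed
  show ?thesis using alpha
  proof induction
    case (const z)
    show ?case using LIzero sheafy_const[OF S V] by (intro exI[of _ "\<lambda>_. z"]) simp
  next
    case (gen f)
    then obtain m where m: "m \<in> ?D" "f = chart_value ?t m" unfolding chart_functions_def by blast
    let ?m = "\<lambda>i. m i + gather B b m i"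
    have g: "gather B b m \<in> ?D" using Pgather unfolding P_def by blast
    have m': "?m \<in> ?D" by (rule dual_monoid_add[OF m(1) g])
    show ?case
    proof (intro exI[of _ "chart_value ?t ?m"] conjI ballI regc[OF m'])
      show "chart_value ?t ?m (toric_torus n s) = f (toric_torus n (collapse B b s))" if s: "s \<in> torus_cover n" for s
        unfolding m(2) chart_value_torus[OF t m'] chart_value_torus[OF t m(1)] by (rule monomial_gather[OF s B b])
      show "?LI (\<lambda>y. f y - chart_value ?t ?m y)" unfolding m(2) using Pgather m(1) unfolding P_def by blast
    qed
  next
    case (add f g)
    from add.IH(1) obtain f' where f: "regular ?X ?V f'" "\<forall>t\<in>torus_cover n. f' (toric_torus n t) = f (toric_torus n (collapse B b t))"
      "?LI (\<lambda>y. f y - f' y)" by (elim exE conjE) (rule that)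
    from add.IH(2) obtain g' where g: "regular ?X ?V g'" "\<forall>t\<in>torus_cover n. g' (toric_torus n t) = g (toric_torus n (collapse B b t))"
      "?LI (\<lambda>y. g y - g' y)" by (elim exE conjE) (rule that)
    have "?LI (\<lambda>y. (f y + g y) - (f' y + g' y))" using local_ideal.add[OF f(3) g(3)] by (simp add: algebra_simps)
    then show ?case using f(2) g(2) sheafy_add[OF S V f(1) g(1)] by (intro exI[of _ "\<lambda>y. f' y + g' y"]) auto
  next
    case (mult f g)
    from mult.IH(1) obtain f' where f: "regular ?X ?V f'" "\<forall>t\<in>torus_cover n. f' (toric_torus n t) = f (toric_torus n (collapse B b t))"
      "?LI (\<lambda>y. f y - f' y)" by (elim exE conjE) (rule that)
    from mult.IH(2) obtain g' where g: "regular ?X ?V g'" "\<forall>t\<in>torus_cover n. g' (toric_torus n t) = g (toric_torus n (collapse B b t))"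
      "?LI (\<lambda>y. g y - g' y)" by (elim exE conjE) (rule that)
    \<comment> \<open>Product rule for congruences: f g - f' g' = g (f - f') + f' (g - g').\<close>
    have "?LI (\<lambda>y. g y * (f y - f' y) + f' y * (g y - g' y))"
      by (intro local_ideal.add local_ideal.mult[OF V xV] alg mult f g)
    then have "?LI (\<lambda>y. f y * g y - f' y * g' y)" by (simp add: algebra_simps)
    then show ?case using f(2) g(2) sheafy_mult[OF S V f(1) g(1)] by (intro exI[of _ "\<lambda>y. f' y * g' y"]) auto
  qed
qed

text \<open>If some equation is nonzero at the point, it is a unit there. Otherwise \<open>a\<close>
  is constant on \<open>B\<close>, and f = \<alpha> / \<beta> near the point. The pullback of
  \<alpha> along the retraction vanishes because \<open>f\<close> vanishes on the closure of the
  layer, so \<alpha> is congruent to 0 modulo the equations.\<close>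

lemma block_ideal_generated:
  assumes B: "B \<subseteq> {1..n}" and b: "b \<in> B" and s: "\<sigma> \<in> weyl_fan n" "a \<in> \<sigma>" and c: "c \<in> torus_cover n"
    and roots: "\<And>k. k \<in> B \<Longrightarrow> root_vector k b \<in> dual_monoid n \<sigma>"
    and f: "f \<in> ideal_at (weyl_toric_variety n) (block_closure n B) (toric_limit n a c)"
  shows "local_ideal (weyl_toric_variety n) (toric_limit n a c) ((\<lambda>k. block_equation \<sigma> k b) ` B) f"
proof -
  let ?X = "weyl_toric_variety n" and ?x = "toric_limit n a c" and ?Z = "block_closure n B"
  note S = sheafy_toric[of n]
  obtain W where W: "openin (zariski ?X) W" "?x \<in> W" "regular ?X W f" "\<And>z. z \<in> W \<Longrightarrow> z \<in> ?Z \<Longrightarrow> f z = 0"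
    using f unfolding ideal_at_def ideal_sections_def by blast
  have bB: "k \<in> {1..n}" if "k \<in> B" for k using that B by blast
  have xU: "?x \<in> toric_chart n \<sigma>" by (rule toric_chartI[OF s(2) c])
  have U: "openin (zariski ?X) (toric_chart n \<sigma>)" by (rule openin_toric_chart[OF s(1)])
  show ?thesis
  proof (cases "\<exists>k\<in>B. block_equation \<sigma> k b ?x \<noteq> 0")
    case True
    then obtain k where k: "k \<in> B" "block_equation \<sigma> k b ?x \<noteq> 0" by blast
    let ?g = "block_equation \<sigma> k b"
    have o: "openin (zariski ?X) (W \<inter> toric_chart n \<sigma>)" using W U by blast
    note g = regular_subset[OF S U o _ block_equation_regular[OF s(1) roots[OF k(1)]]]
    note f' = regular_subset[OF S W(1) o _ W(3)]
    let ?N = "{y \<in> W \<inter> toric_chart n \<sigma>. ?g y \<noteq> 0}"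
    have N: "openin (zariski ?X) ?N" by (rule sheafy_open[OF S o]) (rule g, blast)
    have x: "?x \<in> ?N" using k W xU by blast
    have q: "regular ?X ?N (\<lambda>y. f y / ?g y)" by (rule regular_divide_local[OF S o f' g]) auto
    have "local_ideal ?X ?x ((\<lambda>k. block_equation \<sigma> k b) ` B) (\<lambda>y. f y / ?g y * ?g y)"
      by (rule local_ideal.mult[OF N x q local_ideal.gen]) (use k in blast)
    then show ?thesis by (rule local_ideal.cong[OF _ N x]) simp
  next
    case False
    have aa: "a \<in> order_cone n a" by (rule order_cone_self) (rule fan_outside[OF s])
    have const: "\<forall>k\<in>B. a k = a b"
    proof
      fix k assume k: "k \<in> B"
      have "limit_value n \<sigma> a c (root_vector k b) = 1"
        using False k unfolding block_equation_def chart_value_limit[OF s] by simp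
      then show "a k = a b" unfolding limit_value_root[OF c bB[OF k] bB[OF b] roots[OF k]] by (simp split: if_splits)
    qed
    let ?t = "order_cone n a" let ?V = "toric_chart n ?t" let ?F = "chart_functions n ?t"
    let ?LI = "local_ideal ?X ?x ((\<lambda>k. block_equation \<sigma> k b) ` B)"
    have t: "?t \<in> weyl_fan n" by (rule order_cone_fan)
    have V: "openin (zariski ?X) ?V" by (rule openin_toric_chart[OF t])
    have xV: "?x \<in> ?V" by (rule toric_chartI[OF aa c])
    have sub: "?t \<subseteq> \<sigma>" by (rule order_cone_subset[OF s])
    have beq: "block_equation \<sigma> k b y = block_equation ?t k b y" if "k \<in> B" "y \<in> ?V" for k y
      unfolding block_equation_def using chart_value_subcone[OF t s(1) sub roots[OF that(1)] that(2)] by simp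
    have LI: "?LI g" if "local_ideal ?X ?x ((\<lambda>k. block_equation ?t k b) ` B) g" for g
      using that
    proof induction
      case (gen g)
      then obtain k where k: "k \<in> B" "g = block_equation ?t k b" by blast
      have "?LI (block_equation \<sigma> k b)" by (rule local_ideal.gen) (use k in blast)
      then show ?case unfolding k(2) by (rule local_ideal.cong[OF _ V xV]) (rule beq[OF k(1)])
    qed (auto intro: local_ideal.intros)
    have alg: "regular ?X ?V g" if "g \<in> function_algebra ?F" for g
      using that
    proof induction
      case (gen f)
      then show ?case using regular_chart_value[OF t] unfolding chart_functions_def by auto
    qed (auto intro: sheafy_const[OF S V] sheafy_add[OF S V] sheafy_mult[OF S V])
    obtain U0 F0 where rep: "(U0, F0) \<in> toric_charts n" "chart_rep U0 F0 W f ?x"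
      using W(3) regular_charts[OF toric_charts_directed, of n W f] W(1,2) unfolding weyl_toric_variety_charts[symmetric] by blast
    then obtain \<sigma>0 where s0: "\<sigma>0 \<in> weyl_fan n" "U0 = toric_chart n \<sigma>0" "F0 = chart_functions n \<sigma>0"
      unfolding toric_charts_def chart_functions_def by blast
    have "?x \<in> toric_chart n \<sigma>0" using rep(2) unfolding s0 chart_rep_def by blast
    then have a0: "a \<in> \<sigma>0" unfolding toric_chart_limit_iff[OF s0(1) c] .
    have "chart_rep ?V ?F W f ?x"
      using chart_rep_dominated[OF rep(2)[unfolded s0] toric_dominated[OF s0(1) a0 c]] .
    then obtain \<alpha> \<beta> where ab: "\<alpha> \<in> function_algebra ?F" "\<beta> \<in> function_algebra ?F" "\<beta> ?x \<noteq> 0"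
      "\<forall>y\<in>?V. \<beta> y \<noteq> 0 \<longrightarrow> y \<in> W \<and> f y = \<alpha> y / \<beta> y" unfolding chart_rep_def by blast
    from collapse_congruence[OF B b aa c const ab(1)] obtain \<alpha>' where al: "regular ?X ?V \<alpha>'"
      "\<forall>t\<in>torus_cover n. \<alpha>' (toric_torus n t) = \<alpha> (toric_torus n (collapse B b t))"
      "local_ideal ?X ?x ((\<lambda>k. block_equation ?t k b) ` B) (\<lambda>y. \<alpha> y - \<alpha>' y)" by (elim exE conjE) (rule that)
    from collapse_congruence[OF B b aa c const ab(2)] obtain \<beta>' where be: "regular ?X ?V \<beta>'"
      "\<forall>t\<in>torus_cover n. \<beta>' (toric_torus n t) = \<beta> (toric_torus n (collapse B b t))"
      "local_ideal ?X ?x ((\<lambda>k. block_equation ?t k b) ` B) (\<lambda>y. \<beta> y - \<beta>' y)" by (elim exE conjE) (rule that)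
    \<comment> \<open>All equations vanish at the point, so \<beta> and its pullback \<beta>' agree
      there. Where \<beta>' is nonzero, collapsed torus points stay in the domain of the formula f =
      \<alpha> / \<beta>.\<close>
    have "\<beta> ?x - \<beta>' ?x = 0"
    proof (rule local_ideal_zero[OF be(3)])
      show "g ?x = 0" if "g \<in> (\<lambda>k. block_equation ?t k b) ` B" for g using that False beq xV by auto
    qed
    then have bx: "\<beta>' ?x \<noteq> 0" using ab(3) by simp
    let ?N = "{y \<in> ?V. \<beta>' y \<noteq> 0}"
    have N: "openin (zariski ?X) ?N" by (rule sheafy_open[OF S V be(1)])
    have xN: "?x \<in> ?N" using xV bx by blast
    have alN: "regular ?X ?N \<alpha>'" by (rule regular_subset[OF S V N _ al(1)]) blast
    \<comment> \<open>By density it is enough to look at torus points, where \<alpha>' takes the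
      value of \<alpha> at the collapsed point.\<close>
    have zero: "\<alpha>' y = 0" if y: "y \<in> ?N" for y
    proof (rule ccontr)
      assume "\<alpha>' y \<noteq> 0"
      then have "y \<in> {y \<in> ?N. \<alpha>' y \<noteq> 0}" using y by blast
      from toric_dense[OF sheafy_open[OF S N alN] this]
      obtain u where u: "u \<in> torus_cover n" "toric_torus n u \<in> ?N" "\<alpha>' (toric_torus n u) \<noteq> 0" by blast
      let ?r = "toric_torus n (collapse B b u)"
      have "\<beta> ?r \<noteq> 0" using be(2) u by auto
      moreover have "?r \<in> ?V" by (rule toric_chartI[OF zero_in_fan[OF t] collapse_cover[OF u(1) B b]])
      ultimately have r: "?r \<in> W" "f ?r = \<alpha> ?r / \<beta> ?r" using ab(4) by auto
      have "f ?r = 0" by (rule W(4)[OF r(1) collapse_block[OF u(1) B b]])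
      then have "\<alpha> ?r = 0" using r(2) \<open>\<beta> ?r \<noteq> 0\<close> by simp
      then show False using al(2) u by simp
    qed
    have LIa: "?LI \<alpha>"
      by (rule local_ideal.cong[OF LI[OF al(3)] N xN]) (simp add: zero)
    let ?K = "{y \<in> ?V. \<beta> y \<noteq> 0}"
    have K: "openin (zariski ?X) ?K" "?x \<in> ?K" using sheafy_open[OF S V alg[OF ab(2)]] xV ab(3) by auto
    have "?LI (\<lambda>y. inverse (\<beta> y) * \<alpha> y)"
      by (rule local_ideal.mult[OF K sheafy_inverse[OF S V alg[OF ab(2)]] LIa])
    then show ?thesis by (rule local_ideal.cong[OF _ K]) (use ab(4) in \<open>auto simp: field_simps\<close>)
  qed
qed

section \<open>Models as closures\<close>

lemma minimal_index:
  fixes a :: "nat \<Rightarrow> real"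
  assumes "finite B" "B \<noteq> {}"
  obtains b where "b \<in> B" "\<forall>k\<in>B. a b \<le> a k"
  using arg_min_if_finite[OF assms, of a] that[of "arg_min_on a B"] by (meson linorder_not_less)

lemma order_cone_root:
  assumes "k \<in> {1..n}" "b \<in> {1..n}" "a b \<le> a k"
  shows "root_vector k b \<in> dual_monoid n (order_cone n a)"
  unfolding root_dual_iff[OF assms(1,2)] using assms unfolding order_cone_def by blast

lemma ratio_difference_quotient:
  fixes x y z u v :: complex
  assumes "b \<noteq> 0" shows "(x / b - y / b) / (u / b - v / b) = (x - y) / (u - v)"
  using assms by (simp flip: diff_divide_distrib)

text \<open>Choosing \<open>b\<close> with minimal exponent makes all t_k / t_b with k in B regular
  near the image. The generating difference divided by t_b is a difference of two equations, hence a
  section of the ideal; along the map it divides every equation and so every section.\<close>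

lemma blowup_local_generator:
  assumes M: "dspace M e D" and D: "D \<subseteq> torus_cover n"
    and pi: "morphism M (weyl_toric_variety n) \<pi>" "\<forall>d\<in>D. \<pi> (e d) = toric_torus n d"
    and B: "B \<subseteq> {1..n}" and p: "p \<in> points M" and g: "block_generator M e D B p i j"
  shows "\<exists>f. local_generator M e D (weyl_toric_variety n) (block_closure n B) (toric_torus n) \<pi> p f"
proof -
  let ?X = "weyl_toric_variety n" and ?Z = "block_closure n B"
  note S = sheafy_toric[of n] and SM = dspace_sheafy[OF M]
  have fB: "finite B" using B finite_subset by blast
  have bB: "k \<in> {1..n}" if "k \<in> B" for k using that B by blast
  have ij: "i \<in> B" "j \<in> B" using g unfolding block_generator_def by auto
  obtain a c where ac: "\<pi> p = toric_limit n a c" "c \<in> torus_cover n" "a \<in> order_cone n a"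
    using toric_pointE[OF morphism_points[OF pi(1) p]] .
  obtain b where b: "b \<in> B" "\<forall>k\<in>B. a b \<le> a k" using minimal_index[OF fB, of a] ij by blast
  let ?s = "order_cone n a" let ?U = "toric_chart n ?s"
  have s: "?s \<in> weyl_fan n" by (rule order_cone_fan)
  have U: "openin (zariski ?X) ?U" by (rule openin_toric_chart[OF s])
  have root: "root_vector k b \<in> dual_monoid n ?s" if "k \<in> B" for k
    by (rule order_cone_root[OF bB[OF that] bB[OF b(1)]]) (use b that in blast)
  define f where "f = (\<lambda>y. block_equation ?s i b y - block_equation ?s j b y)"
  have bI: "block_equation ?s k b \<in> ideal_sections ?X ?Z ?U" if "k \<in> B" for k
    by (rule block_equation_ideal[OF s that b(1) B root[OF that]])
  have f: "f \<in> ideal_sections ?X ?Z ?U"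
    using bI[OF ij(1)] bI[OF ij(2)] sheafy_minus[OF S U, of "block_equation ?s i b" "block_equation ?s j b"]
    unfolding ideal_sections_def f_def by auto
  have eqd: "block_equation ?s k b (toric_torus n d) = d k / d b - 1" if "k \<in> B" "d \<in> D" for k d
    using block_equation_torus[OF s root bB bB] that b D by blast
  have fd: "f (toric_torus n d) = d i / d b - d j / d b" if "d \<in> D" for d
    unfolding f_def using eqd[OF ij(1) that] eqd[OF ij(2) that] by simp
  have db: "d b \<noteq> 0" if "d \<in> D" for d using torus_cover_nonzero D that bB[OF b(1)] by blast
  obtain N1 where N1: "openin (zariski M) N1" "p \<in> N1" "\<forall>q\<in>N1. block_generator M e D B q i j"
    using block_generator_spread[OF fB g] by blast
  obtain N2 where N2: "openin (zariski M) N2" "p \<in> N2" "\<forall>d\<in>D. e d \<in> N2 \<longrightarrow> d i \<noteq> d j"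
    by (rule block_generatorE[OF g], rule that)
  let ?N = "N1 \<inter> N2 \<inter> {q \<in> points M. \<pi> q \<in> ?U}"
  have N: "openin (zariski M) ?N" using N1 N2 morphism_open[OF pi(1) U] by blast
  have "\<pi> p \<in> ?U" unfolding ac(1) by (rule toric_chartI[OF ac(3,2)])
  then have pN: "p \<in> ?N" using N1(2) N2(2) p by blast
  have "\<exists>u. germ M e D q (\<lambda>d. h (toric_torus n d) / f (toric_torus n d)) u"
    if q: "q \<in> ?N" and h: "h \<in> ideal_at ?X ?Z (\<pi> q)" for q h
  proof -
    have qM: "q \<in> points M" and qU: "\<pi> q \<in> ?U" and gq: "block_generator M e D B q i j" using q N1(3) by auto
    obtain a' c' where ac': "\<pi> q = toric_limit n a' c'" "a' \<in> ?s" "c' \<in> torus_cover n" using qU by (rule toric_chartE)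
    have "local_ideal ?X (toric_limit n a' c') ((\<lambda>k. block_equation ?s k b) ` B) h"
      by (rule block_ideal_generated[OF B b(1) s ac'(2,3)]) (use root h ac'(1) in auto)
    then show ?thesis
    proof (rule local_ideal_germ[OF M pi qM ac'(1)])
      fix g assume "g \<in> (\<lambda>k. block_equation ?s k b) ` B"
      then obtain k where k: "k \<in> B" "g = block_equation ?s k b" by blast
      obtain u where u: "germ M e D q (\<lambda>d. (d k - d b) / (d i - d j)) u"
        using gq k(1) b(1) unfolding block_generator_def by blast
      have "germ M e D q (\<lambda>d. g (toric_torus n d) / f (toric_torus n d)) u"
      proof (rule germ_cong'[OF SM u])
        fix d assume d: "d \<in> D"
        have "g (toric_torus n d) / f (toric_torus n d) = (d k / d b - d b / d b) / (d i / d b - d j / d b)"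
          unfolding k(2) eqd[OF k(1) d] fd[OF d] using db[OF d] by simp
        then show "(d k - d b) / (d i - d j) = g (toric_torus n d) / f (toric_torus n d)"
          unfolding ratio_difference_quotient[OF db[OF d]] by simp
      qed
      then show "\<exists>u. germ M e D q (\<lambda>d. g (toric_torus n d) / f (toric_torus n d)) u" by blast
    qed
  qed
  moreover have "f (toric_torus n d) \<noteq> 0" if "d \<in> D" "e d \<in> ?N" for d
    unfolding fd[OF that(1)] using N2(3) that db[OF that(1)] by (simp flip: diff_divide_distrib)
  ultimately show ?thesis unfolding local_generator_def
    using N pN U f by (intro exI[of _ f] exI[of _ ?N] exI[of _ ?U]) auto
qed

lemma block_generatorI:
  assumes M: "dspace M e D" and ij: "i \<in> B" "j \<in> B" and N: "openin (zariski M) N" "p \<in> N" "\<And>d. d \<in> D \<Longrightarrow> e d \<in> N \<Longrightarrow> d i \<noteq> d j"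
    and g: "\<And>k. k \<in> B \<Longrightarrow> \<exists>u. germ M e D p (\<lambda>d. (d k - d j) / (d i - d j)) u"
  shows "block_generator M e D B p i j"
  unfolding block_generator_def
proof (intro conjI ballI ij)
  show "\<exists>N. openin (zariski M) N \<and> p \<in> N \<and> (\<forall>d\<in>D. e d \<in> N \<longrightarrow> d i \<noteq> d j)" using N by (intro exI[of _ N]) auto
  fix k l assume kl: "k \<in> B" "l \<in> B"
  obtain u where u: "germ M e D p (\<lambda>d. (d k - d j) / (d i - d j)) u" using g[OF kl(1)] by blast
  obtain v where v: "germ M e D p (\<lambda>d. (d l - d j) / (d i - d j)) v" using g[OF kl(2)] by blast
  have "germ M e D p (\<lambda>d. (d k - d l) / (d i - d j)) (u - v)"
    by (rule germ_cong'[OF dspace_sheafy[OF M] germ_diff[OF dspace_sheafy[OF M] u v]]) (simp add: diff_divide_distrib)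
  then show "\<exists>c. germ M e D p (\<lambda>d. (d k - d l) / (d i - d j)) c" by blast
qed

text \<open>A point of the blowup is nonzero on some section, hence on one of the generating
  equations, say that of \<open>i\<close>. The quotients of the other equations by it are chart
  coordinates, and on \<open>D\<close> they are quotients of differences with t_b.\<close>

lemma blowup_block_generator:
  assumes M: "dspace M e D" and D: "D \<subseteq> torus_cover n" and B: "B \<subseteq> {1..n}" "B \<noteq> {}"
    and psi: "morphism M (blowup (weyl_toric_variety n) (block_closure n B)) \<psi>"
      "\<forall>d\<in>D. \<psi> (e d) = blowup_lift (weyl_toric_variety n) (block_closure n B) (toric_torus n d)"
    and p: "p \<in> points M"
  shows "\<exists>i j. block_generator M e D B p i j"
proof -
  let ?X = "weyl_toric_variety n" and ?Z = "block_closure n B"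
  note S = sheafy_toric[of n] and SM = dspace_sheafy[OF M]
  have fB: "finite B" using B finite_subset by blast
  have bB: "k \<in> {1..n}" if "k \<in> B" for k using that B by blast
  obtain x \<phi> where x: "\<psi> p = (x, scalar_class \<phi>)" "x \<in> points ?X" "\<phi> \<in> blowup_fibre ?X ?Z x"
    using morphism_points[OF psi(1) p] by (rule blowup_pointE)
  obtain a c where ac: "x = toric_limit n a c" "c \<in> torus_cover n" "a \<in> order_cone n a" using x(2) by (rule toric_pointE)
  obtain b where b: "b \<in> B" "\<forall>k\<in>B. a b \<le> a k" using minimal_index[OF fB B(2), of a] .
  let ?s = "order_cone n a" let ?U = "toric_chart n ?s"
  have s: "?s \<in> weyl_fan n" by (rule order_cone_fan)
  have U: "openin (zariski ?X) ?U" by (rule openin_toric_chart[OF s])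
  have xU: "x \<in> ?U" unfolding ac(1) by (rule toric_chartI[OF ac(3,2)])
  have root: "root_vector k b \<in> dual_monoid n ?s" if "k \<in> B" for k
    by (rule order_cone_root[OF bB[OF that] bB[OF b(1)]]) (use b that in blast)
  have bI: "block_equation ?s k b \<in> ideal_sections ?X ?Z ?U" if "k \<in> B" for k
    by (rule block_equation_ideal[OF s that b(1) B(1) root[OF that]])
  have eqd: "block_equation ?s k b (toric_torus n d) = d k / d b - d b / d b" if "k \<in> B" "d \<in> D" for k d
    using block_equation_torus[OF s root[OF that(1)] bB[OF that(1)] bB[OF b(1)], of d] that D
      torus_cover_nonzero[OF _ bB[OF b(1)], of d] by auto
  have db: "d b \<noteq> 0" if "d \<in> D" for d using torus_cover_nonzero D that bB[OF b(1)] by blast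
  have "\<exists>k\<in>B. \<phi> (block_equation ?s k b) \<noteq> 0"
  proof (rule ccontr)
    assume no: "\<not> ?thesis"
    obtain f where f: "f \<in> ideal_at ?X ?Z x" "\<phi> f \<noteq> 0" using x(3) by (rule blowup_fibre_nonzero)
    have "local_ideal ?X x ((\<lambda>k. block_equation ?s k b) ` B) f"
      unfolding ac(1) by (rule block_ideal_generated[OF B(1) b(1) s ac(3,2)]) (use root f ac(1) in auto)
    from local_ideal_fibre[OF S x(3) this] have "\<phi> f = 0"
      using no ideal_atI[OF U xU bI] by blast
    then show False using f by simp
  qed
  then obtain i where i: "i \<in> B" "\<phi> (block_equation ?s i b) \<noteq> 0" by blast
  note q = germ_section_quotient[where D=D and e=e and e'="toric_torus n", OF S psi p x(1,3) i(2) U xU bI[OF i(1)]]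
  obtain N where N: "openin (zariski M) N" "p \<in> N" "\<forall>d\<in>D. e d \<in> N \<longrightarrow> toric_torus n d \<in> ?U \<and> block_equation ?s i b (toric_torus n d) \<noteq> 0"
    using q(2)[OF bI[OF i(1)]] by (elim exE conjE) (rule that)
  have "block_generator M e D B p i b"
  proof (rule block_generatorI[OF M i(1) b(1) N(1,2)])
    show "d i \<noteq> d b" if "d \<in> D" "e d \<in> N" for d
      using N(3) that eqd[OF i(1) that(1)] by auto
    fix k assume k: "k \<in> B"
    have "germ M e D p (\<lambda>d. (d k - d b) / (d i - d b)) (\<phi> (block_equation ?s k b) / \<phi> (block_equation ?s i b))"
    proof (rule germ_cong'[OF SM q(1)[OF bI[OF k]]])
      fix d assume d: "d \<in> D"
      show "block_equation ?s k b (toric_torus n d) / block_equation ?s i b (toric_torus n d) = (d k - d b) / (d i - d b)"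
        unfolding eqd[OF k d] eqd[OF i(1) d] by (rule ratio_difference_quotient[OF db[OF d]])
    qed
    then show "\<exists>u. germ M e D p (\<lambda>d. (d k - d b) / (d i - d b)) u" by blast
  qed
  then show ?thesis by blast
qed

text \<open>Index 0 lies outside \<open>{1..n}\<close>, so the tuples of \<open>torus_cover\<close>
  automatically lie in the slice x_0 = 0.\<close>

lemma torus_cover_origin: "d \<in> torus_cover n \<Longrightarrow> d 0 = 0"
  unfolding torus_cover_def by fastforce

text \<open>As d_0 = 0, differences with 0 are the coordinates themselves, and the coordinate of
  least exponent at the image of \<open>p\<close> divides the others in \<open>B\<close>.\<close>

lemma toric_block_generator:
  assumes M: "dspace M e D" and D: "D \<subseteq> torus_cover n"
    and pi: "morphism M (weyl_toric_variety n) \<pi>" "\<forall>d\<in>D. \<pi> (e d) = toric_torus n d"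
    and B: "B \<subseteq> {0..n}" "0 \<in> B" "B \<noteq> {0}" and p: "p \<in> points M"
  shows "\<exists>i j. block_generator M e D B p i j"
proof -
  note SM = dspace_sheafy[OF M]
  have sub: "B - {0} \<subseteq> {1..n}"
  proof
    fix k assume "k \<in> B - {0}"
    then show "k \<in> {1..n}" using B(1) by (auto simp: subset_iff Suc_le_eq)
  qed
  obtain a c where ac: "\<pi> p = toric_limit n a c" "c \<in> torus_cover n" "a \<in> order_cone n a"
    using toric_pointE[OF morphism_points[OF pi(1) p]] .
  note ad = adapted_morphism[OF D pi p ac(1,3,2)]
  obtain i where i: "i \<in> B - {0}" "\<forall>k\<in>B - {0}. a i \<le> a k"
    using minimal_index[of "B - {0}" a] finite_subset[OF sub] B by blast
  have i': "i \<in> {1..n}" using i sub by blast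
  have d0: "d 0 = 0" "d i \<noteq> 0" if "d \<in> D" for d
    using D that torus_cover_origin torus_cover_nonzero[OF _ i'] by blast+
  have "block_generator M e D B p i 0"
  proof (rule block_generatorI[OF M _ B(2) openin_topspace p])
    show "i \<in> B" using i by blast
    show "d i \<noteq> d 0" if "d \<in> D" for d using d0[OF that] by simp
    fix k assume k: "k \<in> B"
    show "\<exists>u. germ M e D p (\<lambda>d. (d k - d 0) / (d i - d 0)) u"
    proof (cases "k = 0")
      case True
      then show ?thesis using germ_const[OF SM p, of e D 0] by auto
    next
      case False
      then have k': "k \<in> {1..n}" "a i \<le> a k" using k sub i by blast+
      from adaptedD[OF ad k'(1) i' k'(2)]
      have "germ M e D p (\<lambda>d. (d k - d 0) / (d i - d 0)) (if a k = a i then c k / c i else 0)"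
        by (rule germ_cong'[OF SM]) (simp only: d0(1) diff_zero)
      then show ?thesis by blast
    qed
  qed
  then show ?thesis by blast
qed

text \<open>Divide the coordinates by the generating difference. The values at \<open>p\<close> for
  \<open>i'\<close> and \<open>j'\<close> differ by 1 and the value for 0 is 0, so the one for
  \<open>i\<close> or the one for \<open>j\<close> is nonzero; that coordinate divides the
  other.\<close>

lemma block_generator_total:
  assumes M: "dspace M e D" and D: "D \<subseteq> torus_cover n" and g: "block_generator M e D {0, i, j} p i' j'"
    and ij: "i \<in> {1..n}" "j \<in> {1..n}"
  shows "(\<exists>u. germ M e D p (\<lambda>d. d i / d j) u) \<or> (\<exists>u. germ M e D p (\<lambda>d. d j / d i) u)"
proof -
  note SM = dspace_sheafy[OF M]
  obtain N where N: "i' \<in> {0, i, j}" "j' \<in> {0, i, j}" "openin (zariski M) N" "p \<in> N" "\<forall>d\<in>D. e d \<in> N \<longrightarrow> d i' \<noteq> d j'"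
    by (rule block_generatorE[OF g], rule that)
  have p: "p \<in> points M" using N openin_subset by blast
  let ?v = "\<lambda>k. block_value M e D p i' j' k 0"
  have v: "germ M e D p (\<lambda>d. d k / (d i' - d j')) (?v k)" if "k \<in> {0, i, j}" for k
    by (rule germ_cong'[OF SM block_value_germ[OF M g that]]) (use D torus_cover_origin in auto)
  have v0: "?v 0 = 0"
    by (rule block_value_eq[OF M germ_cong'[OF SM germ_const[OF SM p]]]) simp
  have "germ M e D p (\<lambda>_. 1) (?v i' - ?v j')"
  proof (rule germ_cong[OF SM germ_diff[OF SM v[OF N(1)] v[OF N(2)]] N(3,4)])
    fix d assume "d \<in> D" "e d \<in> N"
    then show "d i' / (d i' - d j') - d j' / (d i' - d j') = 1" using N(5) by (simp flip: diff_divide_distrib)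
  qed
  from germ_unique[OF M this germ_const[OF SM p]] have "?v i' - ?v j' = 1" .
  then have "?v i \<noteq> 0 \<or> ?v j \<noteq> 0" using N(1,2) v0 by auto
  moreover have "\<exists>u. germ M e D p (\<lambda>d. d k / d l) u" if "k \<in> {0, i, j}" "l \<in> {0, i, j}" "?v l \<noteq> 0" for k l
  proof -
    have "germ M e D p (\<lambda>d. d k / d l) (?v k * inverse (?v l))"
    proof (rule germ_cong[OF SM germ_mult[OF SM v[OF that(1)] germ_inverse[OF SM v[OF that(2)] that(3)]] N(3,4)])
      fix d assume "d \<in> D" "e d \<in> N"
      then show "d k / (d i' - d j') * inverse (d l / (d i' - d j')) = d k / d l" using N(5) by simp
    qed
    then show ?thesis by blast
  qed
  ultimately show ?thesis by blast
qed

section \<open>Terminality of closures in products\<close>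

definition product_point :: "'i set \<Rightarrow> ('i \<Rightarrow> 'd \<Rightarrow> 'a) \<Rightarrow> 'd \<Rightarrow> 'i \<Rightarrow> 'a" where
  "product_point I \<epsilon> d = (\<lambda>i\<in>I. \<epsilon> i d)"

lemma dspace_product_closure:
  assumes "\<And>i. i \<in> I \<Longrightarrow> sheafy (X i)" "\<And>i d. i \<in> I \<Longrightarrow> d \<in> D \<Longrightarrow> \<epsilon> i d \<in> points (X i)"
  shows "dspace (closure_model (variety_product I X) (product_point I \<epsilon>) D) (product_point I \<epsilon>) D"
  by (rule dspace_closure_model[OF sheafy_product]) (use assms in \<open>auto simp: points_product product_point_def\<close>)

lemma product_closure_projection:
  assumes "\<And>i. i \<in> I \<Longrightarrow> sheafy (X i)" "i \<in> I"
  shows "morphism (closure_model (variety_product I X) e D) (X i) (\<lambda>p. p i)"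
  unfolding closure_model_def by (rule morphism_from_subvariety[OF morphism_projection[OF assms]])

lemma product_closure_universal:
  assumes I: "finite I" and M: "dspace M e D"
    and f: "\<And>i. i \<in> I \<Longrightarrow> \<exists>f. morphism M (X i) f \<and> (\<forall>d\<in>D. f (e d) = \<epsilon> i d)"
  shows "\<exists>f. morphism M (closure_model (variety_product I X) (product_point I \<epsilon>) D) f \<and>
    (\<forall>d\<in>D. f (e d) = product_point I \<epsilon> d)"
proof -
  obtain F where F: "\<And>i. i \<in> I \<Longrightarrow> morphism M (X i) (F i)" "\<And>i d. i \<in> I \<Longrightarrow> d \<in> D \<Longrightarrow> F i (e d) = \<epsilon> i d"
    using f by metis
  have eq: "(\<lambda>i\<in>I. F i (e d)) = product_point I \<epsilon> d" if "d \<in> D" for d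
    unfolding product_point_def by (rule restrict_ext) (rule F(2)[OF _ that])
  have "morphism M (closure_model (variety_product I X) (product_point I \<epsilon>) D) (\<lambda>p. \<lambda>i\<in>I. F i p)"
    by (rule morphism_into_closure_model[OF M morphism_pairing[OF I dspace_sheafy[OF M] F(1)] eq])
  then show ?thesis using eq by blast
qed

lemma product_closure_unique:
  assumes X: "\<And>i. i \<in> I \<Longrightarrow> sheafy (X i)" and p: "p \<in> points M"
    and f: "morphism M (closure_model (variety_product I X) (product_point I \<epsilon>) D) f" "\<forall>d\<in>D. f (e d) = product_point I \<epsilon> d"
    and g: "morphism M (closure_model (variety_product I X) (product_point I \<epsilon>) D) g" "\<forall>d\<in>D. g (e d) = product_point I \<epsilon> d"
    and uniq: "\<And>i f g. i \<in> I \<Longrightarrow> morphism M (X i) f \<Longrightarrow> \<forall>d\<in>D. f (e d) = \<epsilon> i d \<Longrightarrow> morphism M (X i) g \<Longrightarrow>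
      \<forall>d\<in>D. g (e d) = \<epsilon> i d \<Longrightarrow> f p = g p"
  shows "f p = g p"
proof (rule PiE_ext)
  have pts: "points (closure_model (variety_product I X) (product_point I \<epsilon>) D) \<subseteq> (\<Pi>\<^sub>E i\<in>I. points (X i))"
    unfolding closure_model_def points_subvariety points_product by blast
  show "f p \<in> (\<Pi>\<^sub>E i\<in>I. points (X i))" "g p \<in> (\<Pi>\<^sub>E i\<in>I. points (X i))"
    using pts morphism_points[OF f(1) p] morphism_points[OF g(1) p] by blast+
  fix i assume i: "i \<in> I"
  have "((\<lambda>p. p i) \<circ> f) p = ((\<lambda>p. p i) \<circ> g) p"
    by (rule uniq[OF i morphism_compose[OF f(1) product_closure_projection[OF X i]] _
          morphism_compose[OF g(1) product_closure_projection[OF X i]]])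
      (use f(2) g(2) i in \<open>auto simp: product_point_def\<close>)
  then show "f p i = g p i" by simp
qed

text \<open>Each composite fixes the dense family, as the identity does, so uniqueness for
  endomorphisms applies.\<close>

lemma isomorphic_terminal:
  assumes A: "dspace A a D" and B: "dspace B b D"
    and f: "morphism A B f" "\<forall>d\<in>D. f (a d) = b d" and g: "morphism B A g" "\<forall>d\<in>D. g (b d) = a d"
    and uA: "\<And>p h k. p \<in> points A \<Longrightarrow> morphism A A h \<Longrightarrow> \<forall>d\<in>D. h (a d) = a d \<Longrightarrow> morphism A A k \<Longrightarrow> \<forall>d\<in>D. k (a d) = a d \<Longrightarrow> h p = k p"
    and uB: "\<And>p h k. p \<in> points B \<Longrightarrow> morphism B B h \<Longrightarrow> \<forall>d\<in>D. h (b d) = b d \<Longrightarrow> morphism B B k \<Longrightarrow> \<forall>d\<in>D. k (b d) = b d \<Longrightarrow> h p = k p"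
  shows "isomorphic_varieties A B"
proof -
  have 1: "g (f p) = p" if p: "p \<in> points A" for p
  proof -
    have "(g \<circ> f) p = (\<lambda>x. x) p"
      by (rule uA[OF p morphism_compose[OF f(1) g(1)] _ morphism_id]) (use f(2) g(2) in auto)
    then show ?thesis by simp
  qed
  have 2: "f (g p) = p" if p: "p \<in> points B" for p
  proof -
    have "(f \<circ> g) p = (\<lambda>x. x) p"
      by (rule uB[OF p morphism_compose[OF g(1) f(1)] _ morphism_id]) (use f(2) g(2) in auto)
    then show ?thesis by simp
  qed
  show ?thesis unfolding isomorphic_varieties_def using f(1) g(1) 1 2 by (intro exI[of _ f] exI[of _ g]) auto
qed

text \<open>The model closes up the lift of all points off the centres, boundary points included,
  whereas the dense family lies in the torus. On \<open>Q\<close> the ideal of \<open>Z\<close> is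
  the unit ideal, so the lift is a morphism there; this is what identifies the two closures
  later.\<close>

lemma blowup_lift_extends:
  assumes D: "D \<subseteq> torus_cover n" "\<And>t. t \<in> torus_cover n \<Longrightarrow> inj_on t {1..n} \<Longrightarrow> t \<in> D"
    and Q: "openin (zariski (weyl_toric_variety n)) Q" "\<And>d. d \<in> D \<Longrightarrow> toric_torus n d \<in> Q"
    and Z: "closedin (zariski (weyl_toric_variety n)) Z" "Q \<inter> Z = {}"
  shows "dspace (subvariety (weyl_toric_variety n) Q) (toric_torus n) D"
    and "\<exists>\<psi>. morphism (subvariety (weyl_toric_variety n) Q) (blowup (weyl_toric_variety n) Z) \<psi> \<and>
      (\<forall>p\<in>Q. \<psi> p = blowup_lift (weyl_toric_variety n) Z p)"
proof -
  let ?X = "weyl_toric_variety n" and ?M = "subvariety (weyl_toric_variety n) Q"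
  note S = sheafy_toric[of n]
  have QX: "Q \<subseteq> points ?X" by (rule openin_subset[OF Q(1)])
  have pts: "points ?M = Q" unfolding points_subvariety using QX by blast
  show M: "dspace ?M (toric_torus n) D"
    unfolding dspace_def
  proof (intro conjI allI impI ballI)
    show "sheafy ?M" by (rule sheafy_subvariety[OF S])
    show "toric_torus n d \<in> points ?M" if "d \<in> D" for d unfolding pts by (rule Q(2)[OF that])
    fix N p assume N: "openin (zariski ?M) N" "p \<in> N"
    then obtain T where T: "openin (zariski ?X) T" "N = T \<inter> Q" unfolding openin_subvariety by blast
    have "openin (zariski ?X) N" unfolding T(2) using T(1) Q(1) by blast
    from dspace_dense[OF dspace_toric[OF D] this N(2)] show "\<exists>d\<in>D. toric_torus n d \<in> N" .
  qed
  have id: "morphism ?M ?X (\<lambda>x. x)" by (rule morphism_from_subvariety[OF morphism_id])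
  have gen: "\<exists>f. local_generator ?M (toric_torus n) D ?X Z (toric_torus n) (\<lambda>x. x) p f" if p: "p \<in> points ?M" for p
  proof -
    have g: "\<exists>c. germ ?M (toric_torus n) D q (\<lambda>d. h (toric_torus n d) / 1) c" if q: "q \<in> points ?M" "h \<in> ideal_at ?X Z q" for q h
    proof -
      obtain V where V: "openin (zariski ?X) V" "q \<in> V" "regular ?X V h"
        using q(2) unfolding ideal_at_def ideal_sections_def by blast
      have "germ ?M (toric_torus n) D q (\<lambda>d. h (toric_torus n d)) (h q)"
        by (rule germ_pullback[OF id _ q(1) regular_germ[OF V(1,3,2)]]) simp
      then show ?thesis by auto
    qed
    have "openin (zariski ?M) Q" using openin_topspace[of "zariski ?M"] unfolding pts .
    then have "local_generator ?M (toric_torus n) D ?X Z (toric_torus n) (\<lambda>x. x) p (\<lambda>_. 1)"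
      unfolding local_generator_def
      by (intro exI[of _ "points ?M"] exI[of _ Q] conjI ballI impI)
        (use p g Q(1) Z(2) pts sheafy_const[OF S Q(1), of 1] in \<open>auto simp: ideal_sections_def\<close>)
    then show ?thesis by blast
  qed
  have DZ: "toric_torus n d \<notin> Z" if "d \<in> D" for d using Q(2)[OF that] Z(2) by blast
  have "\<exists>\<psi>. morphism ?M (blowup ?X Z) \<psi> \<and> (\<forall>p\<in>points ?M. fst (\<psi> p) = p) \<and>
      (\<forall>p\<in>points ?M. p \<notin> Z \<longrightarrow> \<psi> p = blowup_lift ?X Z p)"
    by (rule blowup_universal[OF M S Z(1) id refl DZ gen])
  then obtain \<psi> where psi: "morphism ?M (blowup ?X Z) \<psi>" "\<forall>p\<in>points ?M. p \<notin> Z \<longrightarrow> \<psi> p = blowup_lift ?X Z p"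
    by (elim exE conjE) (rule that)
  have "\<psi> p = blowup_lift ?X Z p" if "p \<in> Q" for p using psi(2) Z(2) that unfolding pts by blast
  then show "\<exists>\<psi>. morphism ?M (blowup ?X Z) \<psi> \<and> (\<forall>p\<in>Q. \<psi> p = blowup_lift ?X Z p)"
    using psi(1) by (intro exI[of _ \<psi>]) simp
qed

section \<open>Building sets\<close>

definition connected_block :: "nat pair_pre_digraph \<Rightarrow> nat set \<Rightarrow> bool" where
  "connected_block H B \<longleftrightarrow> B \<subseteq> pverts H \<and> \<not> is_singleton B \<and> Digraph_Component.connected (with_proj H \<restriction> B)"

lemma connected_induced_iff:
  "Digraph_Component.connected (with_proj H \<restriction> B) \<longleftrightarrow>
   B \<noteq> {} \<and> (\<forall>u\<in>B. \<forall>v\<in>B. (u, v) \<in> rtrancl_on B (symcl {(i, j) \<in> parcs H. i \<in> B \<and> j \<in> B}))"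
proof -
  have "arcs_ends (with_proj H \<restriction> B) = {(i, j) \<in> parcs H. i \<in> B \<and> j \<in> B}"
    unfolding arcs_ends_def arc_to_ends_def induce_subgraph_def with_proj_def by (auto simp: image_def)
  then show ?thesis unfolding connected_conv by simp
qed

lemma connected_induced_nonempty: "Digraph_Component.connected (with_proj H \<restriction> B) \<Longrightarrow> B \<noteq> {}"
  unfolding connected_induced_iff by blast

lemma connected_induced_const:
  assumes c: "Digraph_Component.connected (with_proj H \<restriction> B)"
    and f: "\<And>i j. (i, j) \<in> parcs H \<Longrightarrow> i \<in> B \<Longrightarrow> j \<in> B \<Longrightarrow> f i = f j"
    and uv: "u \<in> B" "v \<in> B"
  shows "f u = f v"
proof -
  have "(u, v) \<in> rtrancl_on B (symcl {(i, j) \<in> parcs H. i \<in> B \<and> j \<in> B})"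
    using c uv unfolding connected_induced_iff by blast
  then show ?thesis
  proof (induction rule: rtrancl_on_induct)
    case (step y z)
    then have "f y = f z" using f[of y z] f[of z y] unfolding symcl_def by auto
    then show ?case using step by simp
  qed simp
qed

lemma connected_singleton: "Digraph_Component.connected (with_proj H \<restriction> {v})"
  unfolding connected_induced_iff by (simp add: rtrancl_on_refl)

text \<open>Every other vertex of \<open>B\<close> is joined to 0 by an arc of the cone, so paths
  through 0 connect \<open>B\<close> whatever the arcs of \<Gamma>.\<close>

lemma connected_block_cone:
  assumes "0 \<in> B" "B \<subseteq> insert 0 (pverts \<Gamma>)" "B \<noteq> {0}"
  shows "connected_block (graph_cone \<Gamma>) B"
proof -
  let ?R = "symcl {(i, j) \<in> parcs (graph_cone \<Gamma>). i \<in> B \<and> j \<in> B}"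
  have to: "(u, 0) \<in> rtrancl_on B ?R" if u: "u \<in> B" for u
  proof (cases "u = 0")
    case True
    then show ?thesis using u by (simp add: rtrancl_on_refl)
  next
    case False
    then have "(u, 0) \<in> ?R" using u assms unfolding symcl_def graph_cone_def by auto
    then show ?thesis using rtrancl_on_into_rtrancl_on[OF rtrancl_on_refl[OF u]] assms(1) by blast
  qed
  have fro: "(0, v) \<in> rtrancl_on B ?R" if v: "v \<in> B" for v
  proof (cases "v = 0")
    case True
    then show ?thesis using v by (simp add: rtrancl_on_refl)
  next
    case False
    then have "(0, v) \<in> ?R" using v assms unfolding symcl_def graph_cone_def by auto
    then show ?thesis using rtrancl_on_into_rtrancl_on[OF rtrancl_on_refl[OF assms(1)]] v by blast
  qed
  have "(u, v) \<in> rtrancl_on B ?R" if "u \<in> B" "v \<in> B" for u v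
    using rtrancl_on_trans[OF to[OF that(1)] fro[OF that(2)]] .
  then have "Digraph_Component.connected (with_proj (graph_cone \<Gamma>) \<restriction> B)"
    unfolding connected_induced_iff using assms(1) by blast
  moreover have "\<not> is_singleton B" using assms(1,3) by (auto simp: is_singleton_def)
  ultimately show ?thesis unfolding connected_block_def using assms(2) by (simp add: graph_cone_def)
qed

lemma connected_block_cone_iff:
  assumes "0 \<notin> B"
  shows "connected_block (graph_cone \<Gamma>) B \<longleftrightarrow> connected_block \<Gamma> B"
proof -
  have "{(i, j) \<in> parcs (graph_cone \<Gamma>). i \<in> B \<and> j \<in> B} = {(i, j) \<in> parcs \<Gamma>. i \<in> B \<and> j \<in> B}"
    using assms unfolding graph_cone_def by auto
  then show ?thesis unfolding connected_block_def connected_induced_iff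
    using assms by (auto simp: graph_cone_def)
qed

lemma connected_block_separated:
  assumes B: "connected_block H B" and d: "\<And>i j. (i, j) \<in> parcs H \<Longrightarrow> d i \<noteq> d j"
  shows "\<exists>i\<in>B. \<exists>j\<in>B. d i \<noteq> d j"
proof (rule ccontr)
  assume no: "\<not> ?thesis"
  have c: "Digraph_Component.connected (with_proj H \<restriction> B)" and ns: "\<not> is_singleton B" using B unfolding connected_block_def by auto
  obtain u v where uv: "u \<in> B" "v \<in> B" "u \<noteq> v"
    using ns connected_induced_nonempty[OF c] by (metis is_singletonI')
  \<comment> \<open>If \<open>d\<close> were constant on \<open>B\<close>, no arc would lie inside
    \<open>B\<close>. Then even the identity respects all arcs inside \<open>B\<close>, and
    connectedness makes it constant on \<open>B\<close>.\<close>
  have "(\<lambda>i. i) u = (\<lambda>i. i) v"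
    by (rule connected_induced_const[OF c _ uv(1,2)]) (use no d in blast)
  then show False using uv(3) by simp
qed

lemma one_block_partition:
  assumes pi: "\<pi> \<in> connected_partitions H" "one_nonsingleton_block \<pi>"
  obtains B where "connected_block H B" "\<And>x :: nat \<Rightarrow> 'b. constant_on_blocks \<pi> x \<longleftrightarrow> (\<forall>i\<in>B. \<forall>j\<in>B. x i = x j)"
proof -
  obtain B where B: "B \<in> \<pi>" "\<not> is_singleton B" "\<And>C. C \<in> \<pi> \<Longrightarrow> \<not> is_singleton C \<Longrightarrow> C = B"
    using pi(2) unfolding one_nonsingleton_block_def by auto
  have "B \<subseteq> pverts H" using pi(1) B(1) unfolding connected_partitions_def partition_on_def by blast
  then have "connected_block H B" using pi(1) B unfolding connected_block_def connected_partitions_def by blast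
  moreover have "constant_on_blocks \<pi> x \<longleftrightarrow> (\<forall>i\<in>B. \<forall>j\<in>B. x i = x j)" for x :: "nat \<Rightarrow> 'b"
  proof
    assume "constant_on_blocks \<pi> x"
    then show "\<forall>i\<in>B. \<forall>j\<in>B. x i = x j" using B(1) unfolding constant_on_blocks_def by blast
  next
    assume x: "\<forall>i\<in>B. \<forall>j\<in>B. x i = x j"
    show "constant_on_blocks \<pi> x" unfolding constant_on_blocks_def
    proof (intro ballI)
      fix C i j assume C: "C \<in> \<pi>" "i \<in> C" "j \<in> C"
      show "x i = x j"
      proof (cases "is_singleton C")
        case True
        then show ?thesis using C by (auto simp: is_singleton_def)
      next
        case False
        then show ?thesis using B(3)[OF C(1)] C x by blast
      qed
    qed
  qed
  ultimately show ?thesis using that by blast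
qed

lemma block_partition:
  assumes B: "connected_block H B"
  shows "\<exists>\<pi>\<in>connected_partitions H. one_nonsingleton_block \<pi> \<and>
     (\<forall>x :: nat \<Rightarrow> 'b. constant_on_blocks \<pi> x \<longleftrightarrow> (\<forall>i\<in>B. \<forall>j\<in>B. x i = x j))"
proof -
  define \<pi> where "\<pi> = insert B ((\<lambda>v. {v}) ` (pverts H - B))"
  have c: "Digraph_Component.connected (with_proj H \<restriction> B)" and sub: "B \<subseteq> pverts H" and ns: "\<not> is_singleton B"
    using B unfolding connected_block_def by auto
  have "partition_on (pverts H) \<pi>"
    unfolding partition_on_def disjoint_def \<pi>_def using sub connected_induced_nonempty[OF c] by auto
  then have 1: "\<pi> \<in> connected_partitions H"
    unfolding connected_partitions_def \<pi>_def using c connected_singleton by auto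
  have 2: "one_nonsingleton_block \<pi>" unfolding one_nonsingleton_block_def
    by (rule ex1I[of _ B]) (auto simp: \<pi>_def ns is_singletonI)
  have "constant_on_blocks \<pi> x \<longleftrightarrow> (\<forall>i\<in>B. \<forall>j\<in>B. x i = x j)" for x :: "nat \<Rightarrow> 'b"
    unfolding constant_on_blocks_def \<pi>_def by auto
  then show ?thesis using 1 2 by blast
qed

section \<open>Layers of the torus and subspaces as blocks\<close>

definition torus_block :: "nat \<Rightarrow> nat set \<Rightarrow> (nat \<Rightarrow> complex) set set" where
  "torus_block n B = scalar_class ` {t \<in> torus_cover n. \<forall>i\<in>B. \<forall>j\<in>B. t i = t j}"

lemma torus_points: "points (torus n) = scalar_class ` torus_cover n"
  unfolding torus_def points_charts by simp

lemma torus_basis: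
  assumes "openin (zariski (torus n)) W" "p \<in> W"
  shows "\<exists>b\<in>function_algebra (torus_character n ` character_lattice n). p \<in> scalar_class ` torus_cover n \<and> b p \<noteq> 0 \<and>
     (\<forall>q\<in>scalar_class ` torus_cover n. b q \<noteq> 0 \<longrightarrow> q \<in> W)"
proof -
  let ?C = "{(scalar_class ` torus_cover n, torus_character n ` character_lattice n)}"
  have d: "directed_atlas ?C"
    unfolding directed_atlas_def dominated_def
    by (auto intro!: bexI[OF _ function_algebra.const[of 1]] local_fraction_algebra function_algebra.gen)
  show ?thesis using chart_base[OF d assms[unfolded torus_def]] by blast
qed

text \<open>Scaling a logarithm of each ratio u_i / t_i gives an entire curve in the torus. Each
  coordinate depends only on its two end values, so the curve stays in every layer that contains
  both ends.\<close>

lemma geodesic: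
  assumes "t \<in> torus_cover n" "u \<in> torus_cover n"
  obtains g where "g 0 = t" "g 1 = u" "\<And>z. g z \<in> torus_cover n" "\<And>i. (\<lambda>z. g z i) holomorphic_on UNIV"
    "\<And>i j z. t i = t j \<Longrightarrow> u i = u j \<Longrightarrow> g z i = g z j"
proof -
  define g where "g z i = t i * exp (z * Ln (u i / t i))" for z i
  have "g 0 = t" by (auto simp: g_def)
  moreover have "g 1 = u"
  proof
    fix i show "g 1 i = u i"
    proof (cases "i \<in> {1..n}")
      case True
      then show ?thesis using torus_cover_nonzero[OF assms(1)] torus_cover_nonzero[OF assms(2)] by (simp add: g_def exp_Ln)
    next
      case False
      then have "t i = 0" "u i = 0" using assms unfolding torus_cover_def by blast+
      then show ?thesis by (simp add: g_def)
    qed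
  qed
  moreover have "g z \<in> torus_cover n" for z using assms unfolding torus_cover_def g_def by auto
  moreover have "(\<lambda>z. g z i) holomorphic_on UNIV" for i unfolding g_def by (intro holomorphic_intros)
  moreover have "g z i = g z j" if "t i = t j" "u i = u j" for i j z using that by (simp add: g_def)
  ultimately show ?thesis using that by blast
qed

lemma character_holomorphic:
  assumes "\<And>z. g z \<in> torus_cover n" "\<And>i. (\<lambda>z. g z i) holomorphic_on UNIV"
    and b: "b \<in> function_algebra (torus_character n ` character_lattice n)"
  shows "(\<lambda>z. b (scalar_class (g z))) holomorphic_on UNIV"
  using b
proof induction
  case (gen f)
  then obtain m where m: "m \<in> character_lattice n" "f = torus_character n m" by blast
  have "(\<lambda>z. g z i powi m i) holomorphic_on UNIV" if "i \<in> {1..n}" for i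
    using torus_cover_nonzero[OF assms(1) that] by (intro holomorphic_on_power_int assms(2)) auto
  then show ?case unfolding m(2) torus_character_class[OF m(1)] monomial_def by (intro holomorphic_on_prod) auto
qed (auto intro: holomorphic_on_add holomorphic_on_mult)

text \<open>Two disjoint nonempty open sets are separated by characters, whose product vanishes along an
  entire curve joining a point of one to a point of the other.\<close>

lemma torus_block_connected: "connected_space (subtopology (zariski (torus n)) (torus_block n B))"
  unfolding connected_space_subtopology connectedin_def
proof -
  let ?T = "zariski (torus n)"
  have sub: "torus_block n B \<subseteq> points (torus n)" unfolding torus_points torus_block_def by blast
  show ?thesis unfolding connected_space_def
  proof (intro notI, elim exE conjE)
    fix U V
    assume U: "openin (subtopology ?T (torus_block n B)) U" "openin (subtopology ?T (torus_block n B)) V"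
      and cov: "topspace (subtopology ?T (torus_block n B)) \<subseteq> U \<union> V" and dis: "U \<inter> V = {}" and ne: "U \<noteq> {}" "V \<noteq> {}"
    obtain U' V' where U': "openin ?T U'" "U = U' \<inter> torus_block n B" "openin ?T V'" "V = V' \<inter> torus_block n B"
      using U unfolding openin_subtopology by blast
    obtain t where t: "t \<in> torus_cover n" "\<forall>i\<in>B. \<forall>j\<in>B. t i = t j" "scalar_class t \<in> U'"
      using ne(1) unfolding U'(2) torus_block_def by blast
    obtain u where u: "u \<in> torus_cover n" "\<forall>i\<in>B. \<forall>j\<in>B. u i = u j" "scalar_class u \<in> V'"
      using ne(2) unfolding U'(4) torus_block_def by blast
    obtain g where g: "g 0 = t" "g 1 = u" "\<And>z. g z \<in> torus_cover n" "\<And>i. (\<lambda>z. g z i) holomorphic_on UNIV"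
       "\<And>i j z. t i = t j \<Longrightarrow> u i = u j \<Longrightarrow> g z i = g z j" using geodesic[OF t(1) u(1)] by metis
    obtain b where b: "b \<in> function_algebra (torus_character n ` character_lattice n)" "b (scalar_class t) \<noteq> 0"
       "\<forall>q\<in>scalar_class ` torus_cover n. b q \<noteq> 0 \<longrightarrow> q \<in> U'" using torus_basis[OF U'(1) t(3)] by blast
    obtain c where c: "c \<in> function_algebra (torus_character n ` character_lattice n)" "c (scalar_class u) \<noteq> 0"
       "\<forall>q\<in>scalar_class ` torus_cover n. c q \<noteq> 0 \<longrightarrow> q \<in> V'" using torus_basis[OF U'(3) u(3)] by blast
    note hb = character_holomorphic[OF g(3,4) b(1)] and hc = character_holomorphic[OF g(3,4) c(1)]
    have gB: "scalar_class (g z) \<in> torus_block n B" for z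
      unfolding torus_block_def using g(3) g(5) t(2) u(2) by blast
    have zero: "c (scalar_class (g z)) = 0" if "b (scalar_class (g z)) \<noteq> 0" for z
    proof (rule ccontr)
      assume "c (scalar_class (g z)) \<noteq> 0"
      then have "scalar_class (g z) \<in> U \<inter> V" unfolding U'(2,4) using b(3) c(3) that g(3) gB by blast
      then show False using dis by blast
    qed
    let ?S = "{z. b (scalar_class (g z)) \<noteq> 0}"
    have "continuous_on UNIV (\<lambda>z. b (scalar_class (g z)))" by (rule holomorphic_on_imp_continuous_on[OF hb])
    then have "open ?S" by (intro open_Collect_neq continuous_on_const)
    moreover have "0 \<in> ?S" using b(2) g(1) by simp
    ultimately have "0 islimpt ?S" by (simp add: interior_limit_point interior_open)
    \<comment> \<open>Identity theorem: along the curve \<open>c\<close> vanishes on the open set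
      around 0 where \<open>b\<close> does not, hence everywhere.\<close>
    have "c (scalar_class (g 1)) = 0"
      by (rule analytic_continuation[OF hc open_UNIV connected_UNIV subset_UNIV UNIV_I \<open>0 islimpt ?S\<close>])
        (use zero in auto)
    then show False using c(2) g(2) by simp
  qed
qed

lemma diagonal_line_block: "diagonal_line n = block_subspace n {0..n}"
proof (intro set_eqI iffI)
  fix x assume x: "x \<in> block_subspace n {0..n}"
  have "x i = (if i \<in> {0..n} then x 0 else 0)" for i
  proof (cases "i \<in> {0..n}")
    case True
    moreover have "0 \<in> {0..n}" by simp
    ultimately have "x i = x 0" using x unfolding block_subspace_def by blast
    then show ?thesis using True by simp
  next
    case False
    then show ?thesis using x unfolding block_subspace_def coordinate_space_def by auto
  qed
  then have "x = (\<lambda>i. if i \<in> {0..n} then x 0 else 0)" by blast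
  then show "x \<in> diagonal_line n" unfolding diagonal_line_def by blast
qed (auto simp: diagonal_line_def block_subspace_def coordinate_space_def)

lemma subspace_sum_block:
  assumes B: "B \<subseteq> {0..n}"
  shows "subspace_sum (line_class (diagonal_line n) d) (block_subspace n B) = line_class (block_subspace n B) d"
proof (intro set_eqI iffI)
  fix y assume "y \<in> subspace_sum (line_class (diagonal_line n) d) (block_subspace n B)"
  then obtain v c u where y: "v \<in> diagonal_line n" "u \<in> block_subspace n B" "y = (\<lambda>i. (v i + c * d i) + u i)"
    unfolding subspace_sum_def line_class_def by blast
  have "v \<in> block_subspace n B" using y(1) B unfolding diagonal_line_block block_subspace_def by blast
  from block_subspace_combination[OF this y(2), of 1] have "(\<lambda>i. v i + u i) \<in> block_subspace n B" by simp
  moreover have "y = (\<lambda>i. (v i + u i) + c * d i)" unfolding y(3) by auto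
  ultimately show "y \<in> line_class (block_subspace n B) d"
    unfolding line_class_def by (intro CollectI exI[of _ "\<lambda>i. v i + u i"] exI[of _ c] conjI)
next
  fix y assume "y \<in> line_class (block_subspace n B) d"
  then obtain u c where y: "u \<in> block_subspace n B" "y = (\<lambda>i. u i + c * d i)" by (rule line_class_memE)
  have "(\<lambda>i. 0 + c * d i) \<in> line_class (diagonal_line n) d"
    unfolding line_class_def diagonal_line_block
    by (intro CollectI exI[of _ "\<lambda>_. 0"] exI[of _ c] conjI refl block_subspace_zero)
  moreover have "y = (\<lambda>i. (0 + c * d i) + u i)" unfolding y(2) by auto
  ultimately show "y \<in> subspace_sum (line_class (diagonal_line n) d) (block_subspace n B)"
    unfolding subspace_sum_def using y(1) by (intro CollectI exI[of _ "\<lambda>i. 0 + c * d i"] exI[of _ u] conjI)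
qed

text \<open>By connectedness of \<open>B\<close> the arcs inside it already force equality on all of
  \<open>B\<close>, and the resulting layer is a connected space, so it is its only
  component.\<close>

lemma torus_block_component:
  assumes "connected_block \<Gamma> B" "B \<subseteq> {1..n}"
  shows "torus_block n B \<in> toric_layers n \<Gamma>"
proof -
  have c: "Digraph_Component.connected (with_proj \<Gamma> \<restriction> B)" using assms(1) unfolding connected_block_def by blast
  define S where "S = {scalar_class ` {t \<in> torus_cover n. t i = t j} | i j. (i, j) \<in> parcs \<Gamma> \<and> i \<in> B \<and> j \<in> B}"
  have S: "S \<subseteq> toric_arrangement n \<Gamma>" unfolding S_def toric_arrangement_def by blast
  have eq: "points (torus n) \<inter> \<Inter>S = torus_block n B"
  proof (intro set_eqI iffI)
    fix p assume p: "p \<in> points (torus n) \<inter> \<Inter>S"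
    then obtain t where t: "t \<in> torus_cover n" "p = scalar_class t" unfolding torus_points by blast
    have e: "t i = t j" if "(i, j) \<in> parcs \<Gamma>" "i \<in> B" "j \<in> B" for i j
    proof -
      have "scalar_class ` {t \<in> torus_cover n. t i = t j} \<in> S" unfolding S_def using that by blast
      then have "p \<in> scalar_class ` {t \<in> torus_cover n. t i = t j}" using p by blast
      then obtain u where u: "scalar_class t = scalar_class u" "u i = u j" unfolding t(2) by blast
      from u(1) obtain k where "t = (\<lambda>i. k * u i)" by (rule scalar_class_eqD)
      then show ?thesis using u(2) by simp
    qed
    have "t i = t j" if "i \<in> B" "j \<in> B" for i j
      by (rule connected_induced_const[OF c e that])
    then show "p \<in> torus_block n B" unfolding torus_block_def t(2) using t(1) by blast
  next
    fix p assume p: "p \<in> torus_block n B"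
    then obtain t where t: "t \<in> torus_cover n" "\<forall>i\<in>B. \<forall>j\<in>B. t i = t j" "p = scalar_class t" unfolding torus_block_def by blast
    have "p \<in> scalar_class ` {t \<in> torus_cover n. t i = t j}" if "i \<in> B" "j \<in> B" for i j using t that by blast
    then show "p \<in> points (torus n) \<inter> \<Inter>S" unfolding torus_points S_def using t by blast
  qed
  have sub: "torus_block n B \<subseteq> points (torus n)" using eq by blast
  then have top: "topspace (subtopology (zariski (torus n)) (torus_block n B)) = torus_block n B" by auto
  have "(\<lambda>i. if i \<in> {1..n} then 1 else 0) \<in> torus_cover n" unfolding torus_cover_def by simp
  then have "scalar_class (\<lambda>i. if i \<in> {1..n} then 1 else 0) \<in> torus_block n B"
    unfolding torus_block_def using assms(2) by (intro imageI) auto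
  then have "torus_block n B \<noteq> {}" by blast
  then have "connected_components_of (subtopology (zariski (torus n)) (torus_block n B)) = {torus_block n B}"
    using connected_components_of_connected_space[OF torus_block_connected[of n B]] top null_topspace_iff_trivial[of "subtopology (zariski (torus n)) (torus_block n B)"] by simp
  then have "torus_block n B \<in> connected_components_of (subtopology (zariski (torus n)) (points (torus n) \<inter> \<Inter>S))"
    unfolding eq by simp
  then show ?thesis unfolding toric_layers_def using S by blast
qed

lemma layer_closure_block:
  shows "layer_closure n (torus_block n B) = block_closure n B"
proof -
  have "torus_embedding n ` torus_block n B = block_points n B"
    unfolding torus_block_def block_points_def image_image
    by (auto simp: torus_embedding_class image_iff)
  then show ?thesis unfolding layer_closure_def block_closure_def by simp
qed

text \<open>A partition enters only through its one nonsingleton block, and the layer of each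
  connected block does occur among the components.\<close>

lemma toric_building_set_blocks:
  assumes V: "pverts \<Gamma> = {1..n}"
  shows "toric_building_set n \<Gamma> = torus_block n ` {B. connected_block \<Gamma> B}"
proof (intro set_eqI iffI)
  fix G assume "G \<in> toric_building_set n \<Gamma>"
  then obtain \<pi> where pi: "\<pi> \<in> connected_partitions \<Gamma>" "one_nonsingleton_block \<pi>" "G = partition_layer n \<pi>"
    unfolding toric_building_set_def by blast
  obtain B where B: "connected_block \<Gamma> B" "\<And>x :: nat \<Rightarrow> complex. constant_on_blocks \<pi> x \<longleftrightarrow> (\<forall>i\<in>B. \<forall>j\<in>B. x i = x j)"
    using one_block_partition[OF pi(1,2), where 'b=complex] by metis
  have "G = torus_block n B" unfolding pi(3) partition_layer_def torus_block_def B(2) ..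
  then show "G \<in> torus_block n ` {B. connected_block \<Gamma> B}" using B(1) by blast
next
  fix G assume "G \<in> torus_block n ` {B. connected_block \<Gamma> B}"
  then obtain B where B: "connected_block \<Gamma> B" "G = torus_block n B" by blast
  have sub: "B \<subseteq> {1..n}" using B(1) V unfolding connected_block_def by blast
  obtain \<pi> where pi: "\<pi> \<in> connected_partitions \<Gamma>" "one_nonsingleton_block \<pi>"
    "\<forall>x :: nat \<Rightarrow> complex. constant_on_blocks \<pi> x \<longleftrightarrow> (\<forall>i\<in>B. \<forall>j\<in>B. x i = x j)" using block_partition[OF B(1)] by blast
  have "G = partition_layer n \<pi>" unfolding B(2) partition_layer_def torus_block_def using pi(3) by simp
  moreover have "G \<in> toric_layers n \<Gamma>" unfolding B(2) by (rule torus_block_component[OF B(1) sub])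
  ultimately show "G \<in> toric_building_set n \<Gamma>"
    unfolding toric_building_set_def using pi(1,2) by (intro CollectI conjI bexI[of _ \<pi>])
qed

lemma block_subspace_lattice:
  assumes "connected_block H B"
  shows "block_subspace n B \<in> intersection_lattice n H"
proof -
  have c: "Digraph_Component.connected (with_proj H \<restriction> B)" using assms unfolding connected_block_def by blast
  define S where "S = {{x \<in> coordinate_space n. x i = x j} | i j. (i, j) \<in> parcs H \<and> i \<in> B \<and> j \<in> B}"
  have S: "S \<subseteq> hyperplane_arrangement n H" unfolding S_def hyperplane_arrangement_def by blast
  have "block_subspace n B = coordinate_space n \<inter> \<Inter>S"
  proof (intro set_eqI iffI)
    fix x assume x: "x \<in> coordinate_space n \<inter> \<Inter>S"
    have e: "x i = x j" if "(i, j) \<in> parcs H" "i \<in> B" "j \<in> B" for i j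
      using x that unfolding S_def by blast
    have "x i = x j" if "i \<in> B" "j \<in> B" for i j by (rule connected_induced_const[OF c e that])
    then show "x \<in> block_subspace n B" unfolding block_subspace_def using x by blast
  next
    fix x assume x: "x \<in> block_subspace n B"
    then have "x i = x j" if "i \<in> B" "j \<in> B" for i j using that unfolding block_subspace_def by blast
    then show "x \<in> coordinate_space n \<inter> \<Inter>S" using x unfolding S_def block_subspace_def by blast
  qed
  then show ?thesis unfolding intersection_lattice_def using S by blast
qed

lemma hyperplane_building_set_blocks: "hyperplane_building_set n H = block_subspace n ` {B. connected_block H B}"
proof (intro set_eqI iffI)
  fix G assume "G \<in> hyperplane_building_set n H"
  then obtain \<pi> where pi: "\<pi> \<in> connected_partitions H" "one_nonsingleton_block \<pi>" "G = partition_subspace n \<pi>"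
    unfolding hyperplane_building_set_def by blast
  obtain B where B: "connected_block H B" "\<And>x :: nat \<Rightarrow> complex. constant_on_blocks \<pi> x \<longleftrightarrow> (\<forall>i\<in>B. \<forall>j\<in>B. x i = x j)"
    using one_block_partition[OF pi(1,2), where 'b=complex] by metis
  have "G = block_subspace n B" unfolding pi(3) partition_subspace_def block_subspace_def B(2) ..
  then show "G \<in> block_subspace n ` {B. connected_block H B}" using B(1) by blast
next
  fix G assume "G \<in> block_subspace n ` {B. connected_block H B}"
  then obtain B where B: "connected_block H B" "G = block_subspace n B" by blast
  obtain \<pi> where pi: "\<pi> \<in> connected_partitions H" "one_nonsingleton_block \<pi>"
    "\<forall>x :: nat \<Rightarrow> complex. constant_on_blocks \<pi> x \<longleftrightarrow> (\<forall>i\<in>B. \<forall>j\<in>B. x i = x j)" using block_partition[OF B(1)] by blast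
  have "G = partition_subspace n \<pi>" unfolding B(2) partition_subspace_def block_subspace_def using pi(3) by simp
  moreover have "G \<in> intersection_lattice n H" unfolding B(2) by (rule block_subspace_lattice[OF B(1)])
  ultimately show "G \<in> hyperplane_building_set n H"
    unfolding hyperplane_building_set_def using pi(1,2) by (intro CollectI conjI bexI[of _ \<pi>])
qed

section \<open>The two models\<close>

locale graph_on =
  fixes n :: nat and \<Gamma> :: "nat pair_pre_digraph"
  assumes n: "n \<ge> 2" and graph: "pair_graph \<Gamma>" and V: "pverts \<Gamma> = {1..n}"
begin

text \<open>The slice \<open>x\<^sub>0 = 0\<close> identifies the complement of the cone arrangement in \<open>\<P>(V)\<close> with that
  of the toric arrangement in \<open>T\<close>; its points are indexed here by all their representatives.\<close>

definition D :: "(nat \<Rightarrow> complex) set" where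
  "D = {t \<in> torus_cover n. \<forall>(i, j)\<in>parcs \<Gamma>. t i \<noteq> t j}"

lemma arcs_in: "(i, j) \<in> parcs \<Gamma> \<Longrightarrow> i \<in> {1..n} \<and> j \<in> {1..n} \<and> i \<noteq> j"
proof -
  assume a: "(i, j) \<in> parcs \<Gamma>"
  interpret pair_graph \<Gamma> by (rule graph)
  show ?thesis using pair_no_loops[OF a] arc_fst_in_verts[OF a] arc_snd_in_verts[OF a] V by simp
qed

lemma D_cover: "D \<subseteq> torus_cover n"
  unfolding D_def by blast

lemma D_generic: "t \<in> torus_cover n \<Longrightarrow> inj_on t {1..n} \<Longrightarrow> t \<in> D"
  unfolding D_def inj_on_def using arcs_in by blast

lemma D_space: "D \<subseteq> coordinate_space n"
  using D_cover unfolding torus_cover_def coordinate_space_def by fastforce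

lemma cone_verts: "pverts (graph_cone \<Gamma>) = {0..n}"
  unfolding graph_cone_def using V by auto

lemma cone_block_subset: "connected_block (graph_cone \<Gamma>) B \<Longrightarrow> B \<subseteq> {0..n}"
  unfolding connected_block_def cone_verts by blast

lemma cone_arcs: "(i, j) \<in> parcs (graph_cone \<Gamma>) \<longleftrightarrow> (i, j) \<in> parcs \<Gamma> \<or> (i = 0 \<and> j \<in> {1..n}) \<or> (j = 0 \<and> i \<in> {1..n})"
  unfolding graph_cone_def using V by auto

lemma D_cone: "d \<in> D \<Longrightarrow> (i, j) \<in> parcs (graph_cone \<Gamma>) \<Longrightarrow> d i \<noteq> d j"
proof -
  assume d: "d \<in> D" and a: "(i, j) \<in> parcs (graph_cone \<Gamma>)"
  have t: "d \<in> torus_cover n" using d D_cover by blast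
  from a consider "(i, j) \<in> parcs \<Gamma>" | "i = 0" "j \<in> {1..n}" | "j = 0" "i \<in> {1..n}" unfolding cone_arcs by blast
  then show "d i \<noteq> d j"
  proof cases
    case 1
    then show ?thesis using d unfolding D_def by blast
  qed (use torus_cover_origin[OF t] torus_cover_nonzero[OF t] in auto)
qed

lemma D_separated: "d \<in> D \<Longrightarrow> connected_block (graph_cone \<Gamma>) B \<Longrightarrow> \<exists>i\<in>B. \<exists>j\<in>B. d i \<noteq> d j"
  using connected_block_separated D_cone by metis

text \<open>The condition that singles out the test spaces among which both models are
  terminal.\<close>

definition block_generated :: "'a fspace \<Rightarrow> ((nat \<Rightarrow> complex) \<Rightarrow> 'a) \<Rightarrow> bool" where
  "block_generated M e \<longleftrightarrow> dspace M e D \<and> (\<forall>B p. connected_block (graph_cone \<Gamma>) B \<longrightarrow> p \<in> points M \<longrightarrow>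
     (\<exists>i j. block_generator M e D B p i j))"

lemma full_block: "connected_block (graph_cone \<Gamma>) {0..n}"
  by (rule connected_block_cone) (use n V in auto)

text \<open>The type of the test space is a parameter of the lemma and is later taken to be the type
  on the toric side. Uniqueness is stated for endomorphisms, which is the form that turns the two
  composites into identities.\<close>

lemma hyperplane_terminal:
  obtains e :: "(nat \<Rightarrow> complex) \<Rightarrow> (nat \<Rightarrow> complex) set option \<Rightarrow> (nat \<Rightarrow> complex) set"
  where "block_generated (hyperplane_model n (graph_cone \<Gamma>)) e"
    "\<And>(M :: 'a fspace) a. block_generated M a \<Longrightarrow> \<exists>f. morphism M (hyperplane_model n (graph_cone \<Gamma>)) f \<and> (\<forall>d\<in>D. f (a d) = e d)"
    "\<And>p h k. p \<in> points (hyperplane_model n (graph_cone \<Gamma>)) \<Longrightarrow>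
      morphism (hyperplane_model n (graph_cone \<Gamma>)) (hyperplane_model n (graph_cone \<Gamma>)) h \<Longrightarrow> \<forall>d\<in>D. h (e d) = e d \<Longrightarrow>
      morphism (hyperplane_model n (graph_cone \<Gamma>)) (hyperplane_model n (graph_cone \<Gamma>)) k \<Longrightarrow> \<forall>d\<in>D. k (e d) = e d \<Longrightarrow> h p = k p"
proof -
  let ?H = "hyperplane_model n (graph_cone \<Gamma>)"
  define I where "I = insert None (Some ` hyperplane_building_set n (graph_cone \<Gamma>))"
  define X where "X k = (case k of None \<Rightarrow> projective_quotient n (diagonal_line n) | Some G \<Rightarrow> projective_quotient n G)" for k
  define \<epsilon> where "\<epsilon> k d = (case k of None \<Rightarrow> line_class (diagonal_line n) d | Some G \<Rightarrow> line_class G d)" for k d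
  \<comment> \<open>The factor \<open>None\<close> belongs to the full block \<open>{0..n}\<close>,
    whose subspace is the diagonal line; so all factors can be treated as blocks.\<close>
  have I: "\<exists>B. connected_block (graph_cone \<Gamma>) B \<and> X k = projective_quotient n (block_subspace n B) \<and>
      (\<forall>d. \<epsilon> k d = line_class (block_subspace n B) d)" if "k \<in> I" for k
  proof (cases k)
    case None
    then show ?thesis using full_block unfolding X_def \<epsilon>_def diagonal_line_block by auto
  next
    case (Some G)
    then show ?thesis using that unfolding I_def hyperplane_building_set_blocks X_def \<epsilon>_def by auto
  qed
  have X: "sheafy (X k)" if "k \<in> I" for k using I[OF that] sheafy_projective by metis
  have fI: "finite I"
  proof -
    have "{B. connected_block (graph_cone \<Gamma>) B} \<subseteq> Pow {0..n}" using cone_block_subset by blast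
    then have "finite {B. connected_block (graph_cone \<Gamma>) B}" by (rule finite_subset) simp
    then show ?thesis unfolding I_def hyperplane_building_set_blocks by simp
  qed
  have pt: "\<epsilon> k d \<in> points (X k)" if k: "k \<in> I" and d: "d \<in> D" for k d
  proof -
    obtain B where B: "connected_block (graph_cone \<Gamma>) B" "X k = projective_quotient n (block_subspace n B)"
      "\<forall>d. \<epsilon> k d = line_class (block_subspace n B) d" using I[OF k] by blast
    obtain i j where "i \<in> B" "j \<in> B" "d i \<noteq> d j" using D_separated[OF d B(1)] by blast
    then show ?thesis unfolding B(2) B(3)[rule_format] using D_space d
      by (intro projective_pointI[OF cone_block_subset[OF B(1)]]) auto
  qed
  let ?P = "variety_product I X" and ?e = "product_point I \<epsilon>"
  have PV: "points (projective_quotient n (diagonal_line n)) - (\<Union>H\<in>hyperplane_arrangement n (graph_cone \<Gamma>). projectivization n H)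
      = line_class (diagonal_line n) ` D" (is "?L = ?R")
  proof (intro set_eqI iffI)
    fix p assume p: "p \<in> ?L"
    then have "p \<in> points (projective_quotient n (block_subspace n {0..n}))" unfolding diagonal_line_block by blast
    then obtain x i j where x: "p = line_class (block_subspace n {0..n}) x" "x \<in> coordinate_space n" "i \<in> {0..n}" "j \<in> {0..n}" "x i \<noteq> x j"
      by (rule projective_pointE[OF subset_refl])
    have ndiag: "x \<notin> diagonal_line n" using x(3-5) unfolding diagonal_line_block block_subspace_def by blast
    have sep: "x k \<noteq> x l" if kl: "(k, l) \<in> parcs (graph_cone \<Gamma>)" for k l
    proof
      assume "x k = x l"
      then have "x \<in> {x \<in> coordinate_space n. x k = x l} - diagonal_line n" using x(2) ndiag by blast
      then have "p \<in> projectivization n {x \<in> coordinate_space n. x k = x l}"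
        unfolding projectivization_def x(1) diagonal_line_block by blast
      moreover have "{x \<in> coordinate_space n. x k = x l} \<in> hyperplane_arrangement n (graph_cone \<Gamma>)"
        unfolding hyperplane_arrangement_def using kl by blast
      ultimately show False using p by blast
    qed
    \<comment> \<open>Subtracting x_0 moves \<open>x\<close> along the diagonal into the slice x_0 =
      0 without changing its class; there the arcs at 0 say that the other coordinates are
      nonzero.\<close>
    define t where "t k = (if k \<in> {0..n} then x k - x 0 else 0)" for k
    have t0: "t k \<noteq> 0 \<longleftrightarrow> k \<in> {1..n}" for k
    proof (cases "k \<in> {1..n}")
      case True
      then have "x k \<noteq> x 0" using sep[of k 0] cone_arcs by blast
      then show ?thesis using True unfolding t_def by simp
    next
      case False
      then show ?thesis unfolding t_def by (cases "k = 0") auto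
    qed
    have "t k \<noteq> t l" if kl: "(k, l) \<in> parcs \<Gamma>" for k l
    proof -
      have "x k \<noteq> x l" using sep[of k l] kl cone_arcs by blast
      moreover have "k \<in> {0..n}" "l \<in> {0..n}" using arcs_in[OF kl] by auto
      ultimately show ?thesis unfolding t_def by simp
    qed
    then have tD: "t \<in> D" unfolding D_def torus_cover_def using t0 by blast
    have "line_class (block_subspace n {0..n}) x = line_class (block_subspace n {0..n}) t"
      by (rule line_class_block_eq[OF x(2) _ one_neq_zero]) (auto simp: t_def coordinate_space_def)
    then show "p \<in> ?R" unfolding x(1) diagonal_line_block using tD by blast
  next
    fix p assume "p \<in> ?R"
    then obtain d where d: "d \<in> D" "p = line_class (diagonal_line n) d" by blast
    have dx: "d \<in> coordinate_space n" using D_space d by blast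
    obtain i j where ij: "i \<in> {0..n}" "j \<in> {0..n}" "d i \<noteq> d j" using D_separated[OF d(1) full_block] by blast
    have "p \<in> points (projective_quotient n (diagonal_line n))"
      unfolding d(2) diagonal_line_block by (rule projective_pointI[OF subset_refl dx ij])
    moreover have "p \<notin> projectivization n H" if H: "H \<in> hyperplane_arrangement n (graph_cone \<Gamma>)" for H
    proof
      assume pH: "p \<in> projectivization n H"
      obtain k l where kl: "(k, l) \<in> parcs (graph_cone \<Gamma>)" "H = {x \<in> coordinate_space n. x k = x l}"
        using H unfolding hyperplane_arrangement_def by blast
      obtain y where y: "y k = y l" "p = line_class (diagonal_line n) y"
        using pH unfolding projectivization_def kl(2) by blast
      have le: "k \<le> n" "l \<le> n" using kl(1) arcs_in unfolding cone_arcs by auto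
      have r: "root_form k l \<in> annihilator n (block_subspace n {0..n})"
        by (rule root_form_annihilator) (use le in auto)
      have "linear_form n (root_form k l) y \<noteq> 0"
        by (rule line_class_form[OF r, of d]) (use D_cone[OF d(1) kl(1)] d(2) y(2) in \<open>auto simp: diagonal_line_block linear_form_root le\<close>)
      then show False using y(1) by (simp add: linear_form_root le)
    qed
    ultimately show "p \<in> ?L" by blast
  qed
  have emb: "(\<lambda>k\<in>I. case k of None \<Rightarrow> line_class (diagonal_line n) d | Some G \<Rightarrow> subspace_sum (line_class (diagonal_line n) d) G) = ?e d" for d
    unfolding product_point_def
  proof (rule restrict_ext)
    fix k assume k: "k \<in> I"
    show "(case k of None \<Rightarrow> line_class (diagonal_line n) d | Some G \<Rightarrow> subspace_sum (line_class (diagonal_line n) d) G) = \<epsilon> k d"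
    proof (cases k)
      case (Some G)
      then obtain B where "connected_block (graph_cone \<Gamma>) B" "G = block_subspace n B"
        using k unfolding I_def hyperplane_building_set_blocks by auto
      then show ?thesis unfolding Some \<epsilon>_def using subspace_sum_block[OF cone_block_subset] by simp
    qed (simp add: \<epsilon>_def)
  qed
  have H: "?H = closure_model ?P ?e D"
  proof -
    have "(\<lambda>p. \<lambda>k\<in>I. case k of None \<Rightarrow> p | Some G \<Rightarrow> subspace_sum p G) ` (line_class (diagonal_line n) ` D) = ?e ` D"
      unfolding image_image emb ..
    then show ?thesis
      unfolding hyperplane_model_def Let_def I_def[symmetric] X_def[abs_def, symmetric] PV closure_model_def by simp
  qed
  have ds: "dspace ?H ?e D" unfolding H by (rule dspace_product_closure[OF X pt])
  have "block_generated ?H ?e"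
    unfolding block_generated_def
  proof (intro conjI ds allI impI)
    fix B p assume B: "connected_block (graph_cone \<Gamma>) B" and p: "p \<in> points ?H"
    let ?k = "Some (block_subspace n B)"
    have k: "?k \<in> I" unfolding I_def hyperplane_building_set_blocks using B by blast
    have Xk: "X ?k = projective_quotient n (block_subspace n B)" unfolding X_def by simp
    have "morphism ?H (projective_quotient n (block_subspace n B)) (\<lambda>p. p ?k)"
      using product_closure_projection[where X=X and e="?e" and D=D, OF X k] unfolding H Xk .
    moreover have "\<forall>d\<in>D. ?e d ?k = line_class (block_subspace n B) d"
      unfolding product_point_def using k by (simp add: \<epsilon>_def)
    ultimately show "\<exists>i j. block_generator ?H ?e D B p i j"
      by (rule projective_block_generator[OF _ _ cone_block_subset[OF B] p])
  qed
  moreover have "\<exists>f. morphism M ?H f \<and> (\<forall>d\<in>D. f (a d) = ?e d)" if M: "block_generated M a" for M :: "'a fspace" and a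
    unfolding H
  proof (rule product_closure_universal[OF fI])
    show dM: "dspace M a D" using M unfolding block_generated_def by blast
    fix k assume k: "k \<in> I"
    obtain B where B: "connected_block (graph_cone \<Gamma>) B" "X k = projective_quotient n (block_subspace n B)"
      "\<forall>d. \<epsilon> k d = line_class (block_subspace n B) d" using I[OF k] by blast
    show "\<exists>f. morphism M (X k) f \<and> (\<forall>d\<in>D. f (a d) = \<epsilon> k d)"
      unfolding B(2) B(3)[rule_format]
      by (rule projective_universal[OF dM cone_block_subset[OF B(1)] D_space]) (use M B(1) in \<open>auto simp: block_generated_def\<close>)
  qed
  moreover have "h p = k p" if p: "p \<in> points ?H" and h: "morphism ?H ?H h" "\<forall>d\<in>D. h (?e d) = ?e d"
    and k: "morphism ?H ?H k" "\<forall>d\<in>D. k (?e d) = ?e d" for p h k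
  proof (rule product_closure_unique[where X=X and I=I and \<epsilon>=\<epsilon> and D=D and e="?e", OF X p])
    show "morphism ?H (closure_model ?P ?e D) h" "morphism ?H (closure_model ?P ?e D) k"
      using h(1) k(1) unfolding H by auto
    fix i f g assume i: "i \<in> I" and f: "morphism ?H (X i) f" "\<forall>d\<in>D. f (?e d) = \<epsilon> i d" and g: "morphism ?H (X i) g" "\<forall>d\<in>D. g (?e d) = \<epsilon> i d"
    obtain B where B: "connected_block (graph_cone \<Gamma>) B" "X i = projective_quotient n (block_subspace n B)"
      "\<forall>d. \<epsilon> i d = line_class (block_subspace n B) d" using I[OF i] by blast
    show "f p = g p"
      by (rule projective_unique[OF ds cone_block_subset[OF B(1)] f[unfolded B(2) B(3)[rule_format]] g[unfolded B(2) B(3)[rule_format]] p])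
  qed (use h k in auto)
  ultimately show ?thesis using that by blast
qed

section \<open>Maps to the toric variety and to its blowups\<close>

lemma connected_block_subset: "connected_block \<Gamma> B \<Longrightarrow> B \<subseteq> {1..n}"
  unfolding connected_block_def V by blast

lemma toric_projection_exists:
  assumes M: "block_generated M a"
  shows "\<exists>\<pi>. morphism M (weyl_toric_variety n) \<pi> \<and> (\<forall>d\<in>D. \<pi> (a d) = toric_torus n d)"
proof -
  have dM: "dspace M a D" using M unfolding block_generated_def by blast
  show ?thesis
  proof (rule toric_universal[OF dM D_cover])
    fix p i j assume p: "p \<in> points M" and ij: "i \<in> {1..n}" "j \<in> {1..n}"
    have "connected_block (graph_cone \<Gamma>) {0, i, j}"
      by (rule connected_block_cone) (use ij V in auto)
    then obtain i' j' where g: "block_generator M a D {0, i, j} p i' j'"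
      using M p unfolding block_generated_def by blast
    show "(\<exists>u. germ M a D p (\<lambda>d. d i / d j) u) \<or> (\<exists>u. germ M a D p (\<lambda>d. d j / d i) u)"
      by (rule block_generator_total[OF dM D_cover g ij])
  qed
qed

lemma torus_not_in_center:
  assumes "connected_block \<Gamma> B" "d \<in> D"
  shows "toric_torus n d \<notin> block_closure n B"
proof -
  have B: "B \<subseteq> {1..n}" by (rule connected_block_subset[OF assms(1)])
  then have "0 \<notin> B" by auto
  then have "connected_block (graph_cone \<Gamma>) B" using connected_block_cone_iff assms(1) by blast
  then obtain i j where "i \<in> B" "j \<in> B" "d i \<noteq> d j" using D_separated[OF assms(2)] by blast
  moreover have "d \<in> torus_cover n" using assms(2) D_cover by blast
  ultimately show ?thesis using torus_not_in_block_closure[OF _ _ _ _ B] by blast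
qed

lemma closedin_block_closure: "closedin (zariski (weyl_toric_variety n)) (block_closure n B)"
  unfolding block_closure_def by (rule closedin_closure_of)

lemma blowup_lift_exists:
  assumes M: "block_generated M a" and B: "connected_block \<Gamma> B"
  shows "\<exists>\<psi>. morphism M (blowup (weyl_toric_variety n) (block_closure n B)) \<psi> \<and>
    (\<forall>d\<in>D. \<psi> (a d) = blowup_lift (weyl_toric_variety n) (block_closure n B) (toric_torus n d))"
proof -
  let ?X = "weyl_toric_variety n" and ?Z = "block_closure n B"
  have dM: "dspace M a D" using M unfolding block_generated_def by blast
  have sub: "B \<subseteq> {1..n}" by (rule connected_block_subset[OF B])
  then have "0 \<notin> B" by auto
  then have cB: "connected_block (graph_cone \<Gamma>) B" using connected_block_cone_iff B by blast
  obtain \<pi> where pi: "morphism M ?X \<pi>" "\<forall>d\<in>D. \<pi> (a d) = toric_torus n d" using toric_projection_exists[OF M] by blast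
  have gen: "\<exists>f. local_generator M a D ?X ?Z (toric_torus n) \<pi> p f" if p: "p \<in> points M" for p
  proof -
    obtain i j where g: "block_generator M a D B p i j" using M cB p unfolding block_generated_def by blast
    show ?thesis by (rule blowup_local_generator[OF dM D_cover pi sub p g])
  qed
  have "\<exists>\<psi>. morphism M (blowup ?X ?Z) \<psi> \<and> (\<forall>p\<in>points M. fst (\<psi> p) = \<pi> p) \<and>
     (\<forall>p\<in>points M. \<pi> p \<notin> ?Z \<longrightarrow> \<psi> p = blowup_lift ?X ?Z (\<pi> p))"
    by (rule blowup_universal[OF dM sheafy_toric closedin_block_closure pi(1) bspec[OF pi(2)] torus_not_in_center[OF B] gen])
  then obtain \<psi> where psi: "morphism M (blowup ?X ?Z) \<psi>" "\<forall>p\<in>points M. \<pi> p \<notin> ?Z \<longrightarrow> \<psi> p = blowup_lift ?X ?Z (\<pi> p)"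
    by (elim exE conjE) (rule that)
  have "\<psi> (a d) = blowup_lift ?X ?Z (toric_torus n d)" if d: "d \<in> D" for d
  proof -
    have "a d \<in> points M" using dM d unfolding dspace_def by blast
    moreover have "\<pi> (a d) = toric_torus n d" using pi(2) d by blast
    ultimately show ?thesis using psi(2) torus_not_in_center[OF B d] by force
  qed
  then show ?thesis using psi(1) by (intro exI[of _ \<psi>]) simp
qed

text \<open>Blocks containing 0 are controlled by the map to the toric variety alone; the other
  connected blocks of the cone are connected in \<Gamma> and are controlled by their
  blowups.\<close>

lemma block_generatedI:
  assumes M: "dspace M a D"
    and pi: "morphism M (weyl_toric_variety n) \<pi>" "\<forall>d\<in>D. \<pi> (a d) = toric_torus n d"
    and psi: "\<And>B. connected_block \<Gamma> B \<Longrightarrow>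
      \<exists>\<psi>. morphism M (blowup (weyl_toric_variety n) (block_closure n B)) \<psi> \<and>
        (\<forall>d\<in>D. \<psi> (a d) = blowup_lift (weyl_toric_variety n) (block_closure n B) (toric_torus n d))"
  shows "block_generated M a"
  unfolding block_generated_def
proof (intro conjI M allI impI)
  fix B p assume B: "connected_block (graph_cone \<Gamma>) B" and p: "p \<in> points M"
  have ns: "B \<noteq> {0}" using B unfolding connected_block_def by auto
  show "\<exists>i j. block_generator M a D B p i j"
  proof (cases "0 \<in> B")
    case True
    show ?thesis by (rule toric_block_generator[OF M D_cover pi cone_block_subset[OF B] True ns p])
  next
    case False
    then have cB: "connected_block \<Gamma> B" using B connected_block_cone_iff by blast
    have ne: "B \<noteq> {}" using B connected_induced_nonempty unfolding connected_block_def by blast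
    obtain \<psi> where "morphism M (blowup (weyl_toric_variety n) (block_closure n B)) \<psi>"
      "\<forall>d\<in>D. \<psi> (a d) = blowup_lift (weyl_toric_variety n) (block_closure n B) (toric_torus n d)"
      using psi[OF cB] by blast
    then show ?thesis by (rule blowup_block_generator[OF M D_cover connected_block_subset[OF cB] ne _ _ p])
  qed
qed

text \<open>Common end of the two cases of the toric model, with \<open>Y\<close> either the toric
  variety itself or the closure in the product of blowups.\<close>

lemma toric_core_isomorphic:
  fixes Y :: "'a fspace"
  assumes Y: "block_generated Y e"
    and univ: "\<And>M a. block_generated (M :: ((nat \<Rightarrow> complex) set option \<Rightarrow> (nat \<Rightarrow> complex) set) fspace) a \<Longrightarrow>
      \<exists>f. morphism M Y f \<and> (\<forall>d\<in>D. f (a d) = e d)"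
    and uniq: "\<And>p h k. p \<in> points Y \<Longrightarrow> morphism Y Y h \<Longrightarrow> \<forall>d\<in>D. h (e d) = e d \<Longrightarrow>
      morphism Y Y k \<Longrightarrow> \<forall>d\<in>D. k (e d) = e d \<Longrightarrow> h p = k p"
  shows "isomorphic_varieties Y (hyperplane_model n (graph_cone \<Gamma>))"
proof -
  let ?H = "hyperplane_model n (graph_cone \<Gamma>)"
  obtain b where b: "block_generated ?H b"
    and bY: "\<And>M :: 'a fspace. \<And>a. block_generated M a \<Longrightarrow> \<exists>f. morphism M ?H f \<and> (\<forall>d\<in>D. f (a d) = b d)"
    and bu: "\<And>p h k. p \<in> points ?H \<Longrightarrow> morphism ?H ?H h \<Longrightarrow> \<forall>d\<in>D. h (b d) = b d \<Longrightarrow>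
      morphism ?H ?H k \<Longrightarrow> \<forall>d\<in>D. k (b d) = b d \<Longrightarrow> h p = k p"
    by (rule hyperplane_terminal, rule that)
  obtain f where f: "morphism Y ?H f" "\<forall>d\<in>D. f (e d) = b d" using bY[OF Y] by blast
  obtain g where g: "morphism ?H Y g" "\<forall>d\<in>D. g (b d) = e d" using univ[OF b] by blast
  show ?thesis
  proof (rule isomorphic_terminal[where a=e and b=b and D=D, OF _ _ f g])
    show "dspace Y e D" "dspace ?H b D" using Y b unfolding block_generated_def by blast+
  qed (rule uniq bu; assumption)+
qed

lemma blowup_unique:
  assumes M: "dspace M a D"
    and h: "morphism M (blowup (weyl_toric_variety n) Z) h" "\<forall>d\<in>D. h (a d) = blowup_lift (weyl_toric_variety n) Z (toric_torus n d)"
    and k: "morphism M (blowup (weyl_toric_variety n) Z) k" "\<forall>d\<in>D. k (a d) = blowup_lift (weyl_toric_variety n) Z (toric_torus n d)"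
    and p: "p \<in> points M"
  shows "h p = k p"
proof (rule morphism_blowup_unique[OF M sheafy_toric h k p])
  \<comment> \<open>Both blowdowns are given by \<open>toric_torus\<close> on \<open>D\<close>, so
    uniqueness of maps to the toric variety supplies the common base point.\<close>
  have "(fst \<circ> h) p = (fst \<circ> k) p"
    by (rule toric_unique[OF M D_cover morphism_compose[OF h(1) morphism_blowdown[OF sheafy_toric]] _
        morphism_compose[OF k(1) morphism_blowdown[OF sheafy_toric]] _ p])
      (use h(2) k(2) in \<open>auto simp: blowup_lift_def\<close>)
  then show "fst (h p) = fst (k p)" by simp
qed

lemma models_isomorphic: "isomorphic_varieties (toric_model n \<Gamma>) (hyperplane_model n (graph_cone \<Gamma>))"
proof (cases "toric_building_set n \<Gamma> = {}")
  case True
  let ?X = "weyl_toric_variety n"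
  have none: "\<not> connected_block \<Gamma> B" for B
    using True unfolding toric_building_set_blocks[OF V] by blast
  have dX: "dspace ?X (toric_torus n) D" by (rule dspace_toric[OF D_cover D_generic])
  have 1: "isomorphic_varieties ?X (hyperplane_model n (graph_cone \<Gamma>))"
  proof (rule toric_core_isomorphic)
    show "block_generated ?X (toric_torus n)"
      by (rule block_generatedI[OF dX morphism_id]) (use none in auto)
  qed (use toric_projection_exists toric_unique[OF dX D_cover] in auto)
  have model: "toric_model n \<Gamma> = transport Inl ?X" unfolding toric_model_def Let_def using True by simp
  have 2: "isomorphic_varieties ?X (toric_model n \<Gamma>)"
    unfolding model by (rule isomorphic_transport[OF sheafy_toric]) simp
  show ?thesis by (rule isomorphic_trans[OF isomorphic_sym[OF 2] 1])
next
  case False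
  let ?X = "weyl_toric_variety n" and ?G = "toric_building_set n \<Gamma>"
  define Z where "Z = layer_closure n"
  define X where "X G = blowup ?X (Z G)" for G
  define \<epsilon> where "\<epsilon> G d = blowup_lift ?X (Z G) (toric_torus n d)" for G d
  have XG: "X G = blowup ?X (Z G)" for G by (simp add: X_def)
  let ?P = "variety_product ?G X" and ?e = "product_point ?G \<epsilon>"
  let ?Y = "closure_model ?P ?e D"
  have G: "\<exists>B. connected_block \<Gamma> B \<and> Z G = block_closure n B" if "G \<in> ?G" for G
    using that unfolding toric_building_set_blocks[OF V] Z_def by (auto simp: layer_closure_block)
  have fG: "finite ?G"
  proof -
    have "{B. connected_block \<Gamma> B} \<subseteq> Pow {1..n}" using connected_block_subset by blast
    then have "finite {B. connected_block \<Gamma> B}" by (rule finite_subset) simp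
    then show ?thesis unfolding toric_building_set_blocks[OF V] by simp
  qed
  have cZ: "closedin (zariski ?X) (Z G)" for G unfolding Z_def layer_closure_def by (rule closedin_closure_of)
  have X: "sheafy (X G)" for G unfolding X_def by (rule sheafy_blowup[OF sheafy_toric])
  define Q where "Q = points ?X - (\<Union>G\<in>?G. Z G)"
  have Q: "openin (zariski ?X) Q" unfolding Q_def
    by (intro openin_diff openin_topspace closedin_Union) (use fG cZ in auto)
  have DQ: "toric_torus n d \<in> Q" if d: "d \<in> D" for d
  proof -
    have "toric_torus n d \<notin> Z G" if g: "G \<in> ?G" for G
      using G[OF g] torus_not_in_center[OF _ d] by force
    then show ?thesis unfolding Q_def using toric_torus_point D_cover d by blast
  qed
  have ext: "\<exists>\<psi>. morphism (subvariety ?X Q) (X G) \<psi> \<and> (\<forall>p\<in>Q. \<psi> p = blowup_lift ?X (Z G) p)" if "G \<in> ?G" for G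
    unfolding X_def
    by (rule blowup_lift_extends(2)[OF D_cover D_generic Q DQ cZ]) (use that in \<open>auto simp: Q_def\<close>)
  have dQ: "dspace (subvariety ?X Q) (toric_torus n) D"
    by (rule blowup_lift_extends(1)[OF D_cover D_generic Q DQ closedin_empty]) simp_all
  have pQ: "points (subvariety ?X Q) = Q" unfolding points_subvariety using openin_subset[OF Q] by blast
  have pt: "\<epsilon> G d \<in> points (X G)" if g: "G \<in> ?G" and d: "d \<in> D" for G d
  proof -
    obtain \<psi> where psi: "morphism (subvariety ?X Q) (X G) \<psi>" "\<forall>p\<in>Q. \<psi> p = blowup_lift ?X (Z G) p"
      using ext[OF g] by blast
    have "\<psi> (toric_torus n d) \<in> points (X G)" by (rule morphism_points[OF psi(1)]) (use DQ[OF d] pQ in simp)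
    then show ?thesis using psi(2) DQ[OF d] unfolding \<epsilon>_def by simp
  qed
  \<comment> \<open>The model is defined by lifting all points off the centres. The lift is a
    morphism on \<open>Q\<close>, where the family is dense, so it maps \<open>Q\<close> into the
    closure of the image of the family.\<close>
  have closure: "zariski ?P closure_of ((\<lambda>x. \<lambda>G\<in>?G. blowup_lift ?X (Z G) x) ` Q) = zariski ?P closure_of (?e ` D)"
  proof (rule antisym)
    obtain F where F: "\<And>G. G \<in> ?G \<Longrightarrow> morphism (subvariety ?X Q) (X G) (F G)"
      "\<And>G p. G \<in> ?G \<Longrightarrow> p \<in> Q \<Longrightarrow> F G p = blowup_lift ?X (Z G) p" using ext by metis
    have eq: "(\<lambda>G\<in>?G. F G p) = (\<lambda>G\<in>?G. blowup_lift ?X (Z G) p)" if "p \<in> Q" for p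
      by (rule restrict_ext) (rule F(2)[OF _ that])
    have m: "morphism (subvariety ?X Q) ?Y (\<lambda>p. \<lambda>G\<in>?G. F G p)"
    proof (rule morphism_into_closure_model[OF dQ morphism_pairing[OF fG dspace_sheafy[OF dQ] F(1)]])
      show "(\<lambda>G\<in>?G. F G (toric_torus n d)) = ?e d" if "d \<in> D" for d
        unfolding eq[OF DQ[OF that]] product_point_def \<epsilon>_def ..
    qed
    have "(\<lambda>x. \<lambda>G\<in>?G. blowup_lift ?X (Z G) x) ` Q \<subseteq> zariski ?P closure_of (?e ` D)"
    proof (rule image_subsetI)
      fix p assume p: "p \<in> Q"
      have "(\<lambda>G\<in>?G. F G p) \<in> points ?Y" by (rule morphism_points[OF m]) (use p pQ in simp)
      then show "(\<lambda>G\<in>?G. blowup_lift ?X (Z G) p) \<in> zariski ?P closure_of (?e ` D)"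
        unfolding eq[OF p] closure_model_def points_subvariety by blast
    qed
    then show "zariski ?P closure_of ((\<lambda>x. \<lambda>G\<in>?G. blowup_lift ?X (Z G) x) ` Q) \<subseteq> zariski ?P closure_of (?e ` D)"
      by (rule closure_of_minimal) (rule closedin_closure_of)
    have "?e ` D \<subseteq> (\<lambda>x. \<lambda>G\<in>?G. blowup_lift ?X (Z G) x) ` Q"
    proof (rule image_subsetI)
      fix d assume d: "d \<in> D"
      have "?e d = (\<lambda>x. \<lambda>G\<in>?G. blowup_lift ?X (Z G) x) (toric_torus n d)" unfolding product_point_def \<epsilon>_def ..
      then show "?e d \<in> (\<lambda>x. \<lambda>G\<in>?G. blowup_lift ?X (Z G) x) ` Q" using DQ[OF d] by (rule image_eqI)
    qed
    then show "zariski ?P closure_of (?e ` D) \<subseteq> zariski ?P closure_of ((\<lambda>x. \<lambda>G\<in>?G. blowup_lift ?X (Z G) x) ` Q)"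
      by (rule closure_of_mono)
  qed
  have model: "toric_model n \<Gamma> = transport Inr ?Y"
    unfolding toric_model_def Let_def if_not_P[OF False] closure_model_def Z_def[symmetric] X_def[abs_def, symmetric]
      Q_def[symmetric] closure ..
  have dY: "dspace ?Y ?e D" by (rule dspace_product_closure[OF X pt])
  have proj: "morphism ?Y (X G) (\<lambda>p. p G)" "\<forall>d\<in>D. ?e d G = \<epsilon> G d" if "G \<in> ?G" for G
    by (rule product_closure_projection[OF X that]) (use that in \<open>simp add: product_point_def\<close>)
  have 1: "isomorphic_varieties ?Y (hyperplane_model n (graph_cone \<Gamma>))"
  proof (rule toric_core_isomorphic)
    \<comment> \<open>Blowing down any one factor gives the map to the toric variety; here the
      building set being nonempty enters.\<close>
    obtain G where g: "G \<in> ?G" using False by blast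
    show "block_generated ?Y ?e"
    proof (rule block_generatedI[OF dY])
      show "morphism ?Y ?X (fst \<circ> (\<lambda>p. p G))"
        by (rule morphism_compose[OF proj(1)[OF g]], subst XG) (rule morphism_blowdown[OF sheafy_toric])
      show "\<forall>d\<in>D. (fst \<circ> (\<lambda>p. p G)) (?e d) = toric_torus n d"
        using proj(2)[OF g] unfolding \<epsilon>_def blowup_lift_def by simp
      fix B assume B: "connected_block \<Gamma> B"
      have k: "torus_block n B \<in> ?G" unfolding toric_building_set_blocks[OF V] using B by blast
      have Zk: "Z (torus_block n B) = block_closure n B" unfolding Z_def by (rule layer_closure_block)
      show "\<exists>\<psi>. morphism ?Y (blowup ?X (block_closure n B)) \<psi> \<and>
          (\<forall>d\<in>D. \<psi> (?e d) = blowup_lift ?X (block_closure n B) (toric_torus n d))"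
        using proj[OF k] unfolding XG Zk \<epsilon>_def by (intro exI[of _ "\<lambda>p. p (torus_block n B)"] conjI)
    qed
    show "\<exists>f. morphism M ?Y f \<and> (\<forall>d\<in>D. f (a d) = ?e d)" if M: "block_generated M a"
      for M :: "((nat \<Rightarrow> complex) set option \<Rightarrow> (nat \<Rightarrow> complex) set) fspace" and a
    proof (rule product_closure_universal[OF fG])
      show "dspace M a D" using M unfolding block_generated_def by blast
      fix G assume "G \<in> ?G"
      from G[OF this] obtain B where B: "connected_block \<Gamma> B" "Z G = block_closure n B" by blast
      show "\<exists>f. morphism M (X G) f \<and> (\<forall>d\<in>D. f (a d) = \<epsilon> G d)"
        unfolding XG \<epsilon>_def B(2) by (rule blowup_lift_exists[OF M B(1)])
    qed
    show "h p = k p" if p: "p \<in> points ?Y" and h: "morphism ?Y ?Y h" "\<forall>d\<in>D. h (?e d) = ?e d"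
      and k: "morphism ?Y ?Y k" "\<forall>d\<in>D. k (?e d) = ?e d" for p h k
    proof (rule product_closure_unique[where X=X and I="?G" and \<epsilon>=\<epsilon> and D=D and e="?e", OF X p h k])
      fix G f g assume f: "morphism ?Y (X G) f" "\<forall>d\<in>D. f (?e d) = \<epsilon> G d" and g: "morphism ?Y (X G) g" "\<forall>d\<in>D. g (?e d) = \<epsilon> G d"
      show "f p = g p"
      proof (rule blowup_unique[OF dY _ _ _ _ p])
        show "morphism ?Y (blowup ?X (Z G)) f" "morphism ?Y (blowup ?X (Z G)) g"
          using f(1) g(1) by (simp_all only: XG)
        show "\<forall>d\<in>D. f (?e d) = blowup_lift ?X (Z G) (toric_torus n d)"
          "\<forall>d\<in>D. g (?e d) = blowup_lift ?X (Z G) (toric_torus n d)"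
          using f(2) g(2) by (simp_all only: \<epsilon>_def)
      qed
    qed
  qed
  have 2: "isomorphic_varieties ?Y (toric_model n \<Gamma>)"
    unfolding model by (rule isomorphic_transport[OF dspace_sheafy[OF dY]]) simp
  show ?thesis by (rule isomorphic_trans[OF isomorphic_sym[OF 2] 1])
qed

end

theorem theorem4p1:
  fixes n :: nat and \<Gamma> :: "nat pair_pre_digraph"
  assumes "n \<ge> 2" and "pair_graph \<Gamma>" and "pverts \<Gamma> = {1..n}"
  shows "isomorphic_varieties (toric_model n \<Gamma>) (hyperplane_model n (graph_cone \<Gamma>))"
proof -
  interpret graph_on n \<Gamma> by (rule graph_on.intro) (rule assms)+
  show ?thesis by (rule models_isomorphic)
qed

end
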